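(* Let $d=4$ and $\theta<0$. (1) There exist stochastic processes $(\widetilde Y_r)_{r\ge0}$ and $(\widetilde G_r)_{r\ge0}$ with values in $\mathscr{C}^\theta$, with continuous sample paths, such that for all $r\ge0$ and $\phi\in\mathscr{S}$: $\mathbb{P}(\widetilde Y_r(\phi)=Y_r(\phi))=1$ and $\mathbb{P}(\widetilde G_r(\phi)=G_r(\phi))=1$. (2) For every $\epsilon>0$ there exist stochastic processes $(\widetilde Y_{r,\epsilon})_{r\ge0}$ and $(\widetilde G_{r,\epsilon})_{r\ge0}$ with values in $\mathscr{C}^\theta$, with continuous sample paths, such that for all $r\ge0$ and $\phi\in\mathscr{S}$: $\mathbb{P}(\widetilde Y_{r,\epsilon}(\phi)=Y_{r,\epsilon}(\phi))=1$ and $\mathbb{P}(\widetilde G_{r,\epsilon}(\phi)=G_{r,\epsilon}(\phi))=1$. (3) For every $U\ge0$ and $\sigma>0$, $$\lim_{\epsilon\to0}\mathbb{P}\Big(\sup_{r\in[0,U]}\|\widetilde Y_{r,\epsilon}-\widetilde Y_r\|_\theta>\sigma\Big)=\lim_{\epsilon\to0}\mathbb{P}\Big(\sup_{r\in[0,U]}\|\widetilde G_{r,\epsilon}-\widetilde G_r\|_\theta>\sigma\Big)=0.$$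
   Context: Notation. $\mathbb{T}^4=\mathbb{R}^4/\mathbb{Z}^4$, $\mathscr{S}=C^\infty(\mathbb{T}^4,\mathbb{R})$, and $\mathscr{S}'$ is the space of distributions. Convolution is $(f*g)(x)=\int f(x-y)g(y)\,dy$. Fix a dyadic partition of unity: non-negative radial $\rho_{-1},\rho_0\in C_c^\infty(\mathbb{R}^4)$ with $\operatorname{supp}\rho_{-1}\subset\{|y|\le4/3\}$, $\operatorname{supp}\rho_0\subset\{3/4\le|y|\le8/3\}$, and $\rho_{-1}+\sum_{q\ge0}\rho_0(2^{-q}\cdot)=1$. Put $\rho_q=\rho_0(2^{-q}\cdot)$, $K_q(x)=\sum_{m}\rho_q(m)\cos(2\pi\langle x,m\rangle)$ and $\Delta_qf=K_q*f$ for $q\ge-1$. $\|f\|_\alpha=\sup_{q\ge-1}2^{\alpha q}\|\Delta_qf\|_{L^\infty}$ and $\mathscr{C}^\alpha=\{f\in\mathscr{S}':\lim_{q\to\infty}2^{\alpha q}\|\Delta_qf\|_{L^\infty}=0\}$. $\eta_r(x)=\sum_{k\in\mathbb{Z}^4}\cos(2\pi\langle x,k\rangle)e^{-r|2\pi k|^4}$ for $r>0$. $\zeta\in C_c^\infty(\mathbb{R}^4)$ is even with $\zeta(0)=1$, and $\zeta_\epsilon(x)=\sum_k\zeta(\epsilon k)\cos(2\pi\langle x,k\rangle)$. Probability. $(\Omega,\mathcal F,\mathbb P)$ is complete and $\xi$ is a space-time white noise on $\mathbb{R}_+\times\mathbb{T}^4$ (isonormal Gaussian process on $L^2(\mathbb{R}_+\times\mathbb{T}^4)$).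 Multiple integrals against $\xi$ are multiple Wiener–Itô integrals. For $r\ge0$ and $\phi\in L^2(\mathbb{T}^4)$: $$Y_r(\phi)=\int_{([0,r]\times\mathbb{T}^4)^2}\Big(\int_{\mathbb{T}^4}\phi(x)\prod_{m=1}^2\eta_{r-q_m}(x-y_m)\,dx\Big)\,\xi(dq_1,dy_1)\,\xi(dq_2,dy_2),$$ $$G_r(\phi)=\int_{([0,r]\times\mathbb{T}^4)^3}\Big(\int_{\mathbb{T}^4}\phi(x)\prod_{m=1}^3\eta_{r-q_m}(x-y_m)\,dx\Big)\,\xi(dq_1,dy_1)\,\xi(dq_2,dy_2)\,\xi(dq_3,dy_3).$$ $Y_{r,\epsilon}(\phi)$ and $G_{r,\epsilon}(\phi)$ are defined by the same formulas with each $\eta_{r-q_m}$ replaced by $\zeta_\epsilon*\eta_{r-q_m}$. *)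

theory Defs
  imports "HOL-Analysis.Analysis" "HOL-Probability.Probability"
begin

definition Z4 :: "(real^4) set" where
  "Z4 = {k. \<forall>i. k $ i \<in> \<int>}"

text \<open>Fundamental domain of the torus T^4 = R^4/Z^4; functions on T^4 are Z^4-periodic functions on R^4.\<close>
definition cube :: "(real^4) set" where
  "cube = {x. \<forall>i. 0 \<le> x $ i \<and> x $ i < 1}"

definition periodic4 :: "(real^4 \<Rightarrow> real) \<Rightarrow> bool" where
  "periodic4 f \<longleftrightarrow> (\<forall>x k. k \<in> Z4 \<longrightarrow> f (x + k) = f x)"

fun pderivs :: "4 list \<Rightarrow> (real^4 \<Rightarrow> real) \<Rightarrow> real^4 \<Rightarrow> real" where
  "pderivs [] f = f"
| "pderivs (i # is) f = (\<lambda>x. deriv (\<lambda>t. pderivs is f (x + t *\<^sub>R axis i 1)) 0)"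

definition smooth4 :: "(real^4 \<Rightarrow> real) \<Rightarrow> bool" where
  "smooth4 f \<longleftrightarrow> (\<forall>is. continuous_on UNIV (pderivs is f) \<and>
      (\<forall>i x. (\<lambda>t. pderivs is f (x + t *\<^sub>R axis i 1)) differentiable (at 0)))"

definition TestF :: "(real^4 \<Rightarrow> real) set" where
  "TestF = {\<phi>. smooth4 \<phi> \<and> periodic4 \<phi>}"

definition supn :: "(real^4 \<Rightarrow> real) \<Rightarrow> real" where
  "supn f = (SUP x. \<bar>f x\<bar>)"

text \<open>Distributions S': continuous linear functionals on S (represented as functionals,
  only their values on S matter).\<close>
definition Distrib :: "((real^4 \<Rightarrow> real) \<Rightarrow> real) \<Rightarrow> bool" where
  "Distrib T \<longleftrightarrow>
     (\<forall>\<phi> \<psi> a b. \<phi> \<in> TestF \<longrightarrow> \<psi> \<in> TestF \<longrightarrow>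
        T (\<lambda>x. a * \<phi> x + b * \<psi> x) = a * T \<phi> + b * T \<psi>) \<and>
     (\<exists>C N. \<forall>\<phi>\<in>TestF. \<bar>T \<phi>\<bar> \<le> C * (\<Sum>is\<in>{is. length is \<le> N}. supn (pderivs is \<phi>)))"

definition convT :: "(real^4 \<Rightarrow> real) \<Rightarrow> (real^4 \<Rightarrow> real) \<Rightarrow> real^4 \<Rightarrow> real" where
  "convT f g x = (LINT y:cube|lborel. f (x - y) * g y)"

definition radial :: "(real^4 \<Rightarrow> real) \<Rightarrow> bool" where
  "radial f \<longleftrightarrow> (\<forall>x y. norm x = norm y \<longrightarrow> f x = f y)"

definition dyadic_partition :: "(real^4 \<Rightarrow> real) \<Rightarrow> (real^4 \<Rightarrow> real) \<Rightarrow> bool" where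
  "dyadic_partition \<rho>m \<rho>0 \<longleftrightarrow>
     (\<forall>y. 0 \<le> \<rho>m y \<and> 0 \<le> \<rho>0 y) \<and> radial \<rho>m \<and> radial \<rho>0 \<and> smooth4 \<rho>m \<and> smooth4 \<rho>0 \<and>
     (\<forall>y. \<rho>m y \<noteq> 0 \<longrightarrow> norm y \<le> 4/3) \<and>
     (\<forall>y. \<rho>0 y \<noteq> 0 \<longrightarrow> 3/4 \<le> norm y \<and> norm y \<le> 8/3) \<and>
     (\<forall>y. \<rho>m y + (\<Sum>q. \<rho>0 ((2::real) powr (- real q) *\<^sub>R y)) = 1)"

definition rhoq :: "(real^4 \<Rightarrow> real) \<Rightarrow> (real^4 \<Rightarrow> real) \<Rightarrow> int \<Rightarrow> real^4 \<Rightarrow> real" where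
  "rhoq \<rho>m \<rho>0 q y = (if q = -1 then \<rho>m y else \<rho>0 ((2::real) powr (- real_of_int q) *\<^sub>R y))"

definition Kq :: "(real^4 \<Rightarrow> real) \<Rightarrow> (real^4 \<Rightarrow> real) \<Rightarrow> int \<Rightarrow> real^4 \<Rightarrow> real" where
  "Kq \<rho>m \<rho>0 q x = infsum (\<lambda>m. rhoq \<rho>m \<rho>0 q m * cos (2 * pi * (x \<bullet> m))) Z4"

definition Deltaq :: "(real^4 \<Rightarrow> real) \<Rightarrow> (real^4 \<Rightarrow> real) \<Rightarrow> int \<Rightarrow> ((real^4 \<Rightarrow> real) \<Rightarrow> real) \<Rightarrow> real^4 \<Rightarrow> real" where
  "Deltaq \<rho>m \<rho>0 q f x = f (\<lambda>y. Kq \<rho>m \<rho>0 q (x - y))"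

definition Cnorm :: "(real^4 \<Rightarrow> real) \<Rightarrow> (real^4 \<Rightarrow> real) \<Rightarrow> real \<Rightarrow> ((real^4 \<Rightarrow> real) \<Rightarrow> real) \<Rightarrow> real" where
  "Cnorm \<rho>m \<rho>0 \<alpha> f = (SUP q\<in>{-1..}. (2::real) powr (\<alpha> * real_of_int q) * supn (Deltaq \<rho>m \<rho>0 q f))"

definition Calpha :: "(real^4 \<Rightarrow> real) \<Rightarrow> (real^4 \<Rightarrow> real) \<Rightarrow> real \<Rightarrow> ((real^4 \<Rightarrow> real) \<Rightarrow> real) set" where
  "Calpha \<rho>m \<rho>0 \<alpha> = {f. Distrib f \<and>
      (\<lambda>q::nat. (2::real) powr (\<alpha> * real q) * supn (Deltaq \<rho>m \<rho>0 (int q) f)) \<longlonglongrightarrow> 0}"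

definition eta :: "real \<Rightarrow> real^4 \<Rightarrow> real" where
  "eta r x = infsum (\<lambda>k. cos (2 * pi * (x \<bullet> k)) * exp (- r * (2 * pi * norm k) ^ 4)) Z4"

definition cutoff :: "(real^4 \<Rightarrow> real) \<Rightarrow> bool" where
  "cutoff \<zeta> \<longleftrightarrow> smooth4 \<zeta> \<and> (\<exists>R. \<forall>x. \<zeta> x \<noteq> 0 \<longrightarrow> norm x \<le> R) \<and>
      (\<forall>x. \<zeta> (- x) = \<zeta> x) \<and> \<zeta> 0 = 1"

definition zeta_eps :: "(real^4 \<Rightarrow> real) \<Rightarrow> real \<Rightarrow> real^4 \<Rightarrow> real" where
  "zeta_eps \<zeta> \<epsilon> x = infsum (\<lambda>k. \<zeta> (\<epsilon> *\<^sub>R k) * cos (2 * pi * (x \<bullet> k))) Z4"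

definition eta_eps :: "(real^4 \<Rightarrow> real) \<Rightarrow> real \<Rightarrow> real \<Rightarrow> real^4 \<Rightarrow> real" where
  "eta_eps \<zeta> \<epsilon> r = convT (zeta_eps \<zeta> \<epsilon>) (eta r)"

definition ST :: "(real \<times> (real^4)) measure" where
  "ST = restrict_space (lborel \<Otimes>\<^sub>M lborel) ({0..} \<times> cube)"

definition L2 :: "'a measure \<Rightarrow> ('a \<Rightarrow> real) \<Rightarrow> bool" where
  "L2 N f \<longleftrightarrow> f \<in> borel_measurable N \<and> integrable N (\<lambda>z. (f z)^2)"

text \<open>Isonormal Gaussian process on L^2(R_+ x T^4): a (a.s.) linear map h |-> W h with
  W h ~ N(0, ||h||^2) (equivalently, a centred Gaussian family with covariance the L^2 inner product).\<close>
definition isonormal :: "'w measure \<Rightarrow> ((real \<times> (real^4) \<Rightarrow> real) \<Rightarrow> 'w \<Rightarrow> real) \<Rightarrow> bool" where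
  "isonormal M W \<longleftrightarrow>
     (\<forall>h. L2 ST h \<longrightarrow> W h \<in> borel_measurable M \<and>
        (\<forall>t. char (distr M borel (W h)) t = complex_of_real (exp (- (t^2 * (\<integral>z. (h z)^2 \<partial>ST)) / 2)))) \<and>
     (\<forall>h g a b. L2 ST h \<longrightarrow> L2 ST g \<longrightarrow>
        (AE \<omega> in M. W (\<lambda>z. a * h z + b * g z) \<omega> = a * W h \<omega> + b * W g \<omega>))"

definition STn :: "nat \<Rightarrow> (nat \<Rightarrow> real \<times> (real^4)) measure" where
  "STn n = PiM {..<n} (\<lambda>_. ST)"

text \<open>Multiple Wiener-Ito integral of order n w.r.t. W: the (a.s. unique) linear map on
  L^2((R_+ x T^4)^n) with E[I(f)^2] <= n! ||f||^2 and I(1_A1 x ... x 1_An) = prod W(1_Ai)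
  for pairwise disjoint sets A_i of finite measure.\<close>
definition wiener_integral :: "'w measure \<Rightarrow> ((real \<times> (real^4) \<Rightarrow> real) \<Rightarrow> 'w \<Rightarrow> real) \<Rightarrow> nat \<Rightarrow>
    (((nat \<Rightarrow> real \<times> (real^4)) \<Rightarrow> real) \<Rightarrow> 'w \<Rightarrow> real) \<Rightarrow> bool" where
  "wiener_integral M W n I \<longleftrightarrow>
     (\<forall>f. L2 (STn n) f \<longrightarrow> I f \<in> borel_measurable M \<and> integrable M (\<lambda>\<omega>. (I f \<omega>)^2) \<and>
        (\<integral>\<omega>. (I f \<omega>)^2 \<partial>M) \<le> fact n * (\<integral>z. (f z)^2 \<partial>STn n)) \<and>
     (\<forall>f g a b. L2 (STn n) f \<longrightarrow> L2 (STn n) g \<longrightarrow>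
        (AE \<omega> in M. I (\<lambda>z. a * f z + b * g z) \<omega> = a * I f \<omega> + b * I g \<omega>)) \<and>
     (\<forall>A. (\<forall>i<n. A i \<in> sets ST \<and> emeasure ST (A i) < \<infinity>) \<longrightarrow> disjoint_family_on A {..<n} \<longrightarrow>
        (AE \<omega> in M. I (\<lambda>z. \<Prod>i<n. indicator (A i) (z i)) \<omega> = (\<Prod>i<n. W (indicator (A i)) \<omega>)))"

text \<open>Kernel of Y_r(phi) (n = 2) and G_r(phi) (n = 3), with heat kernel family E.\<close>
definition kern :: "nat \<Rightarrow> (real \<Rightarrow> real^4 \<Rightarrow> real) \<Rightarrow> real \<Rightarrow> (real^4 \<Rightarrow> real) \<Rightarrow>
    (nat \<Rightarrow> real \<times> (real^4)) \<Rightarrow> real" where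
  "kern n E r \<phi> z = indicator {z. \<forall>m<n. fst (z m) \<in> {0..r}} z *
      (LINT x:cube|lborel. \<phi> x * (\<Prod>m<n. E (r - fst (z m)) (x - snd (z m))))"

definition cproc :: "'w measure \<Rightarrow> (real^4 \<Rightarrow> real) \<Rightarrow> (real^4 \<Rightarrow> real) \<Rightarrow> real \<Rightarrow>
    (real \<Rightarrow> 'w \<Rightarrow> (real^4 \<Rightarrow> real) \<Rightarrow> real) \<Rightarrow> bool" where
  "cproc M \<rho>m \<rho>0 \<theta> X \<longleftrightarrow>
     (\<forall>r\<ge>0. \<forall>\<omega>\<in>space M. X r \<omega> \<in> Calpha \<rho>m \<rho>0 \<theta>) \<and>
     (\<forall>r\<ge>0. \<forall>\<phi>\<in>TestF. (\<lambda>\<omega>. X r \<omega> \<phi>) \<in> borel_measurable M) \<and>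
     (\<forall>\<omega>\<in>space M. \<forall>r\<ge>0. \<forall>e>0. \<exists>\<delta>>0. \<forall>s\<ge>0. \<bar>s - r\<bar> < \<delta> \<longrightarrow>
        Cnorm \<rho>m \<rho>0 \<theta> (\<lambda>\<phi>. X s \<omega> \<phi> - X r \<omega> \<phi>) < e)"

end

theory Submission
  imports Defs "HOL-Analysis.Analysis" "HOL-Probability.Probability"
begin

text \<open>
  Expanding the kernel of $Y_r(\phi)$ or $G_r(\phi)$ in Fourier modes turns its $L^2$ norm, by Parseval, into a
  lattice sum over $k_1, \dots, k_n$ with weights $\prod_m |k_m|^{-4}$ and $|\hat\phi(k_1 + \dots + k_n)|^2$; in
  dimension four such a sum diverges only logarithmically for a single block $\Delta_q$. Giving up $\beta$ powers of
  each frequency one gains a factor $|r - s|^\beta$ for time increments, and a small constant when the symbol $1$ is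
  replaced by $\zeta(\epsilon \cdot)$. Wiener-Ito integrals of order $n$ are hypercontractive (approximate the kernel by
  off-diagonal step functions and apply the Bonami inequality to polynomials in independent Gaussians), so all moments
  of the increments are controlled. A single random variable, a weighted sum over dyadic times, blocks, modes
  and grid points of high powers of increments, then has finite expectation and bounds the Hoelder norm in time with values in
  $\mathscr{C}^\theta$. The version of the process is the distribution whose modes are the limits along dyadic times, set to zero where
  that sum is infinite; applied to the difference of two kernels the same sum gives convergence in probability.
\<close>

section \<open>Fourier analysis on the torus\<close>

text \<open>The hypotheses on the noise are weak in form: \<open>isonormal\<close> gives the law of
  single variables and linearity up to null sets, \<open>wiener_integral\<close> an upper bound for
  second moments and the values on products of disjoint sets. Joint Gaussianity is therefore
  recovered from characteristic functions of linear combinations, and every integral is reached from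
  step functions off the diagonals. The kernels are singular at lag zero; truncating their Fourier
  series makes them bounded and continuous off a null set, and Parseval controls the truncation
  error. One small parameter \<beta> pays for everything. Per frequency, time regularity |r -
  s|^\<beta> costs 4 \<beta> powers in the variance, and a multiplier error of size |k|^\<beta>
  costs 2 \<beta> after squaring, so the weights are |k|^-(4 - 6 \<beta>). Summing over frequencies
  with given total loses (2 n - 1) 6 \<beta>, and the variance of a block of radius R grows at most
  like R^(12 n \<beta>), which \<theta> < 0 absorbs. The moment order 2 m has to be large because
  the gain must beat the number of dyadic times, modes and grid points.\<close>

definition cubeM :: "(real^4) measure" where
  "cubeM = restrict_space lborel cube"

definition ek :: "real^4 \<Rightarrow> real^4 \<Rightarrow> complex" where
  "ek k y = cis (2 * pi * (k \<bullet> y))"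

lemma cube_sets [measurable]: "cube \<in> sets borel"
  unfolding cube_def by measurable

lemma emeasure_cube: "emeasure lborel cube = 1"
proof (rule antisym)
  have "cube \<subseteq> cbox 0 1"
    by (auto simp: cube_def mem_box_cart less_imp_le)
  then have "emeasure lborel cube \<le> emeasure lborel (cbox (0::real^4) 1)"
    by (intro emeasure_mono) auto
  also have "\<dots> = 1"
    by (subst emeasure_lborel_cbox) (auto simp: Basis_vec_def inner_axis intro!: prod.neutral)
  finally show "emeasure lborel cube \<le> 1" .
  have "1 = emeasure lborel (box (0::real^4) 1)"
    by (subst emeasure_lborel_box) (auto simp: Basis_vec_def inner_axis intro!: prod.neutral)
  also have "\<dots> \<le> emeasure lborel cube"
    by (intro emeasure_mono) (auto simp: cube_def mem_box_cart less_imp_le)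
  finally show "1 \<le> emeasure lborel cube" .
qed

lemma space_cubeM [simp]: "space cubeM = cube"
  by (simp add: cubeM_def space_restrict_space)

lemma prob_space_cubeM: "prob_space cubeM"
  by (intro prob_spaceI) (simp add: cubeM_def emeasure_restrict_space space_restrict_space emeasure_cube)

interpretation cubeM: prob_space cubeM by (rule prob_space_cubeM)

lemma set_integral_cube:
  fixes f :: "real^4 \<Rightarrow> 'b::{banach, second_countable_topology}"
  shows "(LINT x:cube|lborel. f x) = (LINT x|cubeM. f x)"
  by (simp add: cubeM_def integral_restrict_space set_lebesgue_integral_def)

lemma measurable_cubeM [measurable (raw)]: "f \<in> borel \<rightarrow>\<^sub>M N \<Longrightarrow> f \<in> cubeM \<rightarrow>\<^sub>M N"
  unfolding cubeM_def by (intro measurable_restrict_space1) simp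

lemma integrable_cubeM_bounded:
  fixes f :: "real^4 \<Rightarrow> 'b::{banach, second_countable_topology}"
  assumes "f \<in> borel_measurable borel" "\<And>x. norm (f x) \<le> B"
  shows "integrable cubeM f"
  by (intro cubeM.integrable_const_bound[where B=B]) (use assms in auto)

text \<open>After the change of variables the shifted cube splits into a piece \<open>C1\<close> of
  the cube and a piece that is \<open>C2\<close> moved by one full period; periodicity brings the
  latter back. Shifts along one axis by at most one period suffice for characters and for difference
  quotients.\<close>

lemma integral_cube_shift:
  fixes f :: "real^4 \<Rightarrow> 'b::{banach, second_countable_topology}"
  assumes [measurable]: "f \<in> borel_measurable borel" and B: "\<And>x. norm (f x) \<le> B"
    and per: "\<And>x. f (x + axis i 1) = f x" and h: "0 \<le> h" "h \<le> 1"
  shows "(LINT x|cubeM. f (x + h *\<^sub>R axis i 1)) = (LINT x|cubeM. f x)"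
proof -
  define v where "v = h *\<^sub>R (axis i 1 :: real^4)"
  define C1 where "C1 = {x\<in>cube. h \<le> x $ i}"
  define C2 where "C2 = {x\<in>cube. x $ i < h}"
  have [measurable]: "C1 \<in> sets borel" "C2 \<in> sets borel"
    unfolding C1_def C2_def by measurable
  have sub: "C1 \<subseteq> cube" "C2 \<subseteq> cube" by (auto simp: C1_def C2_def)
  have fin: "emeasure lborel C1 < \<infinity>" "emeasure lborel C2 < \<infinity>"
    using emeasure_mono[OF sub(1), of lborel] emeasure_mono[OF sub(2), of lborel]
    by (auto simp: emeasure_cube top_unique less_top[symmetric])
  have int: "integrable lborel (\<lambda>x. indicator C x *\<^sub>R f x)" if [measurable]: "C \<in> sets borel" and "emeasure lborel C < \<infinity>" for C
    by (rule integrableI_bounded_set[where A=C and B=B]) (use that B in \<open>auto simp: indicator_def\<close>)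
  have tr: "(LINT x|lborel. g (x + w)) = (LINT x|lborel. g x)" if [measurable]: "g \<in> borel_measurable borel"
    for g :: "real^4 \<Rightarrow> 'b" and w
    by (subst (2) lborel_distr_plus[of w, symmetric]) (simp add: integral_distr add.commute)
  have trI: "integrable lborel (\<lambda>x. g (x + w))" if "integrable lborel g"
    for g :: "real^4 \<Rightarrow> 'b" and w
  proof -
    have "integrable (distr lborel borel ((+) w)) g" using that by (simp add: lborel_distr_plus)
    then have "integrable lborel (\<lambda>x. g (w + x))" by (subst (asm) integrable_distr_eq) (use that in auto)
    then show ?thesis by (simp add: add.commute)
  qed
  have split: "indicator cube (x - v) *\<^sub>R f x = indicator C1 x *\<^sub>R f x + indicator C2 (x - axis i 1) *\<^sub>R f (x - axis i 1)" for x
  proof -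
    have pf: "f (x - axis i 1) = f x" using per[of "x - axis i 1"] by simp
    have ax: "(axis i (1::real)) $ j = (if j = i then 1 else 0)" for j by (simp add: axis_def)
    have ci: "w \<in> cube \<longleftrightarrow> (\<forall>j. j \<noteq> i \<longrightarrow> 0 \<le> w $ j \<and> w $ j < 1) \<and> 0 \<le> w $ i \<and> w $ i < 1" for w
      unfolding cube_def mem_Collect_eq by metis
    have A: "x - v \<in> cube \<longleftrightarrow> (\<forall>j. j \<noteq> i \<longrightarrow> 0 \<le> x $ j \<and> x $ j < 1) \<and> h \<le> x $ i \<and> x $ i < 1 + h"
      unfolding ci v_def by (auto simp: ax)
    have Bq: "x \<in> C1 \<longleftrightarrow> (\<forall>j. j \<noteq> i \<longrightarrow> 0 \<le> x $ j \<and> x $ j < 1) \<and> h \<le> x $ i \<and> x $ i < 1"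
      unfolding C1_def mem_Collect_eq ci using h by auto
    have C: "x - axis i 1 \<in> C2 \<longleftrightarrow> (\<forall>j. j \<noteq> i \<longrightarrow> 0 \<le> x $ j \<and> x $ j < 1) \<and> 1 \<le> x $ i \<and> x $ i < 1 + h"
      unfolding C2_def mem_Collect_eq ci using h by (auto simp: ax)
    have "x - v \<in> cube \<longleftrightarrow> x \<in> C1 \<or> x - axis i 1 \<in> C2" "\<not> (x \<in> C1 \<and> x - axis i 1 \<in> C2)"
      unfolding A Bq C using h by argo+
    then show ?thesis using pf by (cases "x \<in> C1"; cases "x - axis i 1 \<in> C2") simp_all
  qed
  have "(LINT x|cubeM. f (x + h *\<^sub>R axis i 1)) = (LINT x|lborel. indicator cube (x + v - v) *\<^sub>R f (x + v))"
    by (simp add: cubeM_def integral_restrict_space v_def)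
  also have "\<dots> = (LINT x|lborel. indicator cube (x - v) *\<^sub>R f x)"
    by (rule tr[where g="\<lambda>x. indicator cube (x - v) *\<^sub>R f x"]) measurable
  also have "\<dots> = (LINT x|lborel. indicator C1 x *\<^sub>R f x + indicator C2 (x - axis i 1) *\<^sub>R f (x - axis i 1))"
    by (simp only: split)
  also have "\<dots> = (LINT x|lborel. indicator C1 x *\<^sub>R f x) + (LINT x|lborel. indicator C2 (x - axis i 1) *\<^sub>R f (x - axis i 1))"
    using trI[OF int[of C2], of "- axis i 1"] fin by (intro Bochner_Integration.integral_add int fin) auto
  also have "(LINT x|lborel. indicator C2 (x - axis i 1) *\<^sub>R f (x - axis i 1)) = (LINT x|lborel. indicator C2 x *\<^sub>R f x)"
    using tr[where g="\<lambda>x. indicator C2 x *\<^sub>R f x" and w="- axis i 1"] by simp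
  also have "(LINT x|lborel. indicator C1 x *\<^sub>R f x) + (LINT x|lborel. indicator C2 x *\<^sub>R f x)
     = (LINT x|lborel. indicator C1 x *\<^sub>R f x + indicator C2 x *\<^sub>R f x)"
    by (intro Bochner_Integration.integral_add[symmetric] int fin) auto
  also have "\<dots> = (LINT x|lborel. indicator cube x *\<^sub>R f x)"
    by (intro Bochner_Integration.integral_cong) (auto simp: C1_def C2_def indicator_def)
  finally show ?thesis by (simp add: cubeM_def integral_restrict_space)
qed

lemma ek_measurable [measurable]: "ek k \<in> borel_measurable borel"
  unfolding ek_def cis_conv_exp by measurable

lemma norm_ek [simp]: "norm (ek k x) = 1"
  by (simp add: ek_def)

lemma ek_add: "ek k (x + y) = ek k x * ek k y"
  by (simp add: ek_def inner_add_right ring_distribs cis_mult)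

lemma ek_add_left: "ek (k + l) x = ek k x * ek l x"
  by (simp add: ek_def inner_add_left ring_distribs cis_mult)

lemma ek_0 [simp]: "ek 0 x = 1" by (simp add: ek_def)

lemma cnj_ek: "cnj (ek k x) = ek (- k) x"
  by (simp add: ek_def cis_cnj)

lemma ek_minus_right: "ek k (- x) = ek (- k) x"
  by (simp add: ek_def)

lemma ek_sum: "ek (\<Sum>m\<in>S. k m) x = (\<Prod>m\<in>S. ek (k m) x)"
  by (induction S rule: infinite_finite_induct) (auto simp: ek_add_left)

lemma ek_axis: "ek k (h *\<^sub>R axis i 1) = cis (2 * pi * h * k $ i)"
  by (simp add: ek_def inner_axis mult_ac)

lemma ek_period: assumes "k \<in> Z4" "l \<in> Z4" shows "ek k l = 1"
proof -
  have "k \<bullet> l = (\<Sum>i\<in>UNIV. k $ i * l $ i)" by (simp add: inner_vec_def)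
  also have "\<dots> \<in> \<int>" using assms by (auto simp: Z4_def intro!: Ints_sum)
  finally show ?thesis by (simp add: ek_def cis_multiple_2pi)
qed

lemma axis_Z4: "axis i 1 \<in> Z4" by (auto simp: Z4_def axis_def)

lemma Z4_simps [simp]: "0 \<in> Z4" "k \<in> Z4 \<Longrightarrow> - k \<in> Z4"
    "k \<in> Z4 \<Longrightarrow> l \<in> Z4 \<Longrightarrow> k + l \<in> Z4" "k \<in> Z4 \<Longrightarrow> l \<in> Z4 \<Longrightarrow> k - l \<in> Z4"
  by (auto simp: Z4_def)

lemma Z4_sum: "(\<And>m. m \<in> S \<Longrightarrow> k m \<in> Z4) \<Longrightarrow> (\<Sum>m\<in>S. k m) \<in> Z4"
  by (induction S rule: infinite_finite_induct) auto

lemma ek_periodic: "k \<in> Z4 \<Longrightarrow> l \<in> Z4 \<Longrightarrow> ek k (x + l) = ek k x"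
  by (simp add: ek_add ek_period)

text \<open>For nonzero k some coordinate shift multiplies the character by -1; translation
  invariance then makes the integral equal to its own negative.\<close>

lemma integral_ek:
  assumes k: "k \<in> Z4"
  shows "(LINT x|cubeM. ek k x) = (if k = 0 then 1 else 0)"
proof (cases "k = 0")
  case True
  then show ?thesis using cubeM.prob_space by simp
next
  case False
  then obtain i where i: "k $ i \<noteq> 0" by (auto simp: vec_eq_iff)
  then have "1 \<le> \<bar>k $ i\<bar>" using k by (auto simp: Z4_def intro!: Ints_nonzero_abs_ge1)
  \<comment> \<open>Half a period in direction i. Integrality gives |k_i| \<ge> 1, so the shift
    stays in the range allowed by \<open>integral_cube_shift\<close>.\<close>
  define h where "h = 1 / (2 * \<bar>k $ i\<bar>)"
  have h: "0 \<le> h" "h \<le> 1" using \<open>1 \<le> \<bar>k $ i\<bar>\<close> by (auto simp: h_def divide_simps)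
  have ekh: "ek k (h *\<^sub>R axis i 1) = -1"
    unfolding ek_axis h_def using i by (cases "k $ i > 0") (auto simp: field_simps abs_if cis.ctr complex_eq_iff)
  have "(LINT x|cubeM. ek k x) = (LINT x|cubeM. ek k (x + h *\<^sub>R axis i 1))"
    using integral_cube_shift[of "ek k" 1 i h] h k axis_Z4 by (simp add: ek_periodic)
  also have "\<dots> = - (LINT x|cubeM. ek k x)" by (simp add: ek_add ekh)
  finally show ?thesis using False by simp
qed

section \<open>Test functions and the decay of their Fourier coefficients\<close>

lemma testf_smooth: "\<phi> \<in> TestF \<Longrightarrow> smooth4 \<phi>" by (simp add: TestF_def)

lemma continuous_pderivs: "\<phi> \<in> TestF \<Longrightarrow> continuous_on UNIV (pderivs is \<phi>)"
  by (auto simp: TestF_def smooth4_def)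

lemma continuous_testf: "\<phi> \<in> TestF \<Longrightarrow> continuous_on UNIV \<phi>"
  using continuous_pderivs[of \<phi> "[]"] by simp

lemma periodic_pderivs: "\<phi> \<in> TestF \<Longrightarrow> periodic4 (pderivs is \<phi>)"
proof (induction "is")
  case Nil
  then show ?case by (simp add: TestF_def)
next
  case (Cons i "is")
  have "pderivs is \<phi> (x + k + t *\<^sub>R axis i 1) = pderivs is \<phi> (x + t *\<^sub>R axis i 1)" if "k \<in> Z4" for x k t
  proof -
    have "x + k + t *\<^sub>R axis i 1 = (x + t *\<^sub>R axis i 1) + k" by (simp add: algebra_simps)
    then show ?thesis using Cons that unfolding periodic4_def by (metis (no_types))
  qed
  then show ?case by (simp add: periodic4_def)
qed

lemma cube_reduce: "\<exists>k\<in>Z4. x - k \<in> cube"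
  by (rule bexI[of _ "\<chi> i. of_int \<lfloor>x $ i\<rfloor>"]) (auto simp: cube_def Z4_def, linarith)

lemma periodic_bounded:
  assumes "continuous_on UNIV f" "periodic4 f"
  shows "bdd_above (range (\<lambda>x. \<bar>f x\<bar>))"
proof -
  have "compact (f ` cbox 0 1)"
    by (intro compact_continuous_image continuous_on_subset[OF assms(1)]) auto
  then obtain B where B: "\<And>x. x \<in> cbox 0 1 \<Longrightarrow> \<bar>f x\<bar> \<le> B"
    by (metis bounded_iff compact_imp_bounded imageI real_norm_def)
  have "\<bar>f x\<bar> \<le> B" for x
  proof -
    obtain k where k: "k \<in> Z4" "x - k \<in> cube" using cube_reduce by blast
    have "f x = f (x - k)" using assms(2) k(1) unfolding periodic4_def by (metis diff_add_cancel)
    moreover have "x - k \<in> cbox 0 1" using k(2) by (auto simp: cube_def mem_box_cart less_imp_le)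
    ultimately show ?thesis using B by metis
  qed
  then show ?thesis by (auto intro!: bdd_aboveI)
qed

lemma le_supn: "bdd_above (range (\<lambda>x. \<bar>f x\<bar>)) \<Longrightarrow> \<bar>f x\<bar> \<le> supn f"
  unfolding supn_def by (rule cSUP_upper) auto

lemma pderivs_le_supn: "\<phi> \<in> TestF \<Longrightarrow> \<bar>pderivs is \<phi> x\<bar> \<le> supn (pderivs is \<phi>)"
  by (intro le_supn periodic_bounded continuous_pderivs periodic_pderivs)

lemma supn_pderivs_nonneg: "\<phi> \<in> TestF \<Longrightarrow> 0 \<le> supn (pderivs is \<phi>)"
  using pderivs_le_supn[of \<phi> "is" 0] by linarith

text \<open>\<open>smooth4\<close> speaks of differentiability at t = 0 only, but from every base
  point; recentring gives the derivative along the whole line, as the mean value theorem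
  requires.\<close>

lemma pderivs_has_derivative:
  assumes "smooth4 \<phi>"
  shows "((\<lambda>t. pderivs is \<phi> (x + t *\<^sub>R axis i 1)) has_real_derivative pderivs (i # is) \<phi> (x + s *\<^sub>R axis i 1)) (at s)"
proof -
  let ?f = "\<lambda>t. pderivs is \<phi> (x + s *\<^sub>R axis i 1 + t *\<^sub>R axis i 1)"
  have "?f differentiable (at 0)" using assms unfolding smooth4_def by blast
  then have "(?f has_real_derivative deriv ?f 0) (at 0)"
    by (metis DERIV_deriv_iff_real_differentiable)
  then have "((\<lambda>t. pderivs is \<phi> (x + (t + s) *\<^sub>R axis i 1)) has_real_derivative pderivs (i # is) \<phi> (x + s *\<^sub>R axis i 1)) (at 0)"
    by (simp add: algebra_simps)
  then show ?thesis
    using DERIV_shift[of "\<lambda>t. pderivs is \<phi> (x + t *\<^sub>R axis i 1)" _ 0 s] by simp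
qed

lemma pderivs_difference_le:
  assumes "\<phi> \<in> TestF" "0 < h"
  shows "\<bar>pderivs is \<phi> (x + h *\<^sub>R axis i 1) - pderivs is \<phi> x\<bar> \<le> h * supn (pderivs (i # is) \<phi>)"
proof -
  have "\<exists>z>0. z < h \<and> pderivs is \<phi> (x + h *\<^sub>R axis i 1) - pderivs is \<phi> (x + 0 *\<^sub>R axis i 1) = (h - 0) * pderivs (i # is) \<phi> (x + z *\<^sub>R axis i 1)"
    using pderivs_has_derivative[OF testf_smooth[OF assms(1)]] assms(2) by (intro MVT2) auto
  then obtain z where "pderivs is \<phi> (x + h *\<^sub>R axis i 1) - pderivs is \<phi> x = h * pderivs (i # is) \<phi> (x + z *\<^sub>R axis i 1)"
    by auto
  then show ?thesis using pderivs_le_supn[OF assms(1), of "i # is" "x + z *\<^sub>R axis i 1"] assms(2)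
    by (simp add: abs_mult)
qed

text \<open>The pairing is with \<open>ek k\<close> and not with its conjugate, so in the usual
  convention this is the coefficient at -k. Expanding the kernels produces exactly this
  pairing.\<close>

definition fourier :: "(real^4 \<Rightarrow> real) \<Rightarrow> real^4 \<Rightarrow> complex" where
  "fourier \<phi> k = (LINT x|cubeM. complex_of_real (\<phi> x) * ek k x)"

lemma borel_pderivs: "\<phi> \<in> TestF \<Longrightarrow> pderivs is \<phi> \<in> borel_measurable borel"
  by (intro borel_measurable_continuous_onI continuous_pderivs)

lemma borel_testf: "\<phi> \<in> TestF \<Longrightarrow> \<phi> \<in> borel_measurable borel"
  using borel_pderivs[of \<phi> "[]"] by simp

text \<open>Integration by parts through difference quotients: translation invariance turns a shift
  of the function into a phase, whose difference quotient tends to the stated factor, while the mean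
  value bound by \<open>supn\<close> of the next derivative justifies dominated convergence.\<close>

lemma fourier_pderivs:
  assumes \<phi>: "\<phi> \<in> TestF" and k: "k \<in> Z4"
  shows "fourier (pderivs (i # is) \<phi>) k = - (2 * pi * \<i> * k $ i) * fourier (pderivs is \<phi>) k"
proof -
  define g where "g = pderivs is \<phi>"
  define g' where "g' = pderivs (i # is) \<phi>"
  define e where "e = (axis i 1 :: real^4)"
  \<comment> \<open>Positive steps of length at most one, as \<open>integral_cube_shift\<close>
    demands.\<close>
  define h where "h n = 1 / real (Suc n)" for n
  have [measurable]: "g \<in> borel_measurable borel" "g' \<in> borel_measurable borel"
    unfolding g_def g'_def by (intro borel_pderivs \<phi>)+
  have h: "0 < h n" "h n \<le> 1" for n by (auto simp: h_def divide_simps)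
  have hlim: "h \<longlonglongrightarrow> 0" unfolding h_def by (rule LIMSEQ_Suc, rule lim_1_over_n)
  have hlim': "filterlim h (at 0) sequentially"
    using hlim h(1) by (auto simp: filterlim_at less_imp_neq[symmetric] intro!: always_eventually)
  have gper: "g (x + l) = g x" if "l \<in> Z4" for x l
    using periodic_pderivs[OF \<phi>] that unfolding periodic4_def g_def by blast
  have conv: "(\<lambda>n. (g (x + h n *\<^sub>R e) - g x) / h n) \<longlonglongrightarrow> g' x" for x
  proof -
    have "((\<lambda>t. g (x + t *\<^sub>R e)) has_real_derivative g' x) (at 0)"
      using pderivs_has_derivative[OF testf_smooth[OF \<phi>], of "is" x i 0] by (simp add: g_def g'_def e_def)
    then have "((\<lambda>t. (g (x + t *\<^sub>R e) - g x) / t) \<longlongrightarrow> g' x) (at 0)"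
      by (simp add: has_field_derivative_iff)
    from filterlim_compose[OF this hlim'] show ?thesis .
  qed
  have shift: "(LINT x|cubeM. complex_of_real (g (x + t *\<^sub>R e)) * ek k x) = cis (- (2 * pi * t * k $ i)) * fourier g k"
    if "0 \<le> t" "t \<le> 1" for t
  proof -
    have "(LINT x|cubeM. complex_of_real (g (x + t *\<^sub>R e)) * ek k x)
       = (LINT x|cubeM. cis (- (2 * pi * t * k $ i)) * (complex_of_real (g (x + t *\<^sub>R e)) * ek k (x + t *\<^sub>R e)))"
      by (intro Bochner_Integration.integral_cong) (auto simp: ek_add ek_axis e_def cis_mult)
    also have "\<dots> = cis (- (2 * pi * t * k $ i)) * (LINT x|cubeM. (complex_of_real (g (x + t *\<^sub>R e)) * ek k (x + t *\<^sub>R e)))"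
      by (rule integral_mult_right_zero)
    also have "(LINT x|cubeM. (complex_of_real (g (x + t *\<^sub>R e)) * ek k (x + t *\<^sub>R e))) = fourier g k"
      unfolding fourier_def e_def using that k
      by (intro integral_cube_shift[where f="\<lambda>x. complex_of_real (g x) * ek k x" and B="supn g"])
        (auto simp: norm_mult gper[OF axis_Z4] axis_Z4 ek_periodic pderivs_le_supn[OF \<phi>, of "is", folded g_def])
    finally show ?thesis .
  qed
  have "(\<lambda>n. LINT x|cubeM. complex_of_real ((g (x + h n *\<^sub>R e) - g x) / h n) * ek k x) \<longlonglongrightarrow> fourier g' k"
    unfolding fourier_def
  proof (rule integral_dominated_convergence[where w="\<lambda>_. supn g'"])
    show "AE x in cubeM. (\<lambda>i. complex_of_real ((g (x + h i *\<^sub>R e) - g x) / h i) * ek k x) \<longlonglongrightarrow> complex_of_real (g' x) * ek k x"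
      by (intro AE_I2 tendsto_intros conv)
    show "AE x in cubeM. norm (complex_of_real ((g (x + h n *\<^sub>R e) - g x) / h n) * ek k x) \<le> supn g'" for n
    proof (rule AE_I2)
      fix x
      have "\<bar>g (x + h n *\<^sub>R e) - g x\<bar> \<le> h n * supn g'"
        using pderivs_difference_le[OF \<phi>] h by (simp add: g_def g'_def e_def)
      then show "norm (complex_of_real ((g (x + h n *\<^sub>R e) - g x) / h n) * ek k x) \<le> supn g'"
        using h[of n] by (simp only: norm_mult norm_ek norm_of_real abs_divide) (simp add: divide_simps mult.commute)
    qed
  qed auto
  moreover have "(LINT x|cubeM. complex_of_real ((g (x + h n *\<^sub>R e) - g x) / h n) * ek k x)
     = fourier g k * ((cis (- (2 * pi * h n * k $ i)) - 1) / h n)" for n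
  proof -
    have 1: "integrable cubeM (\<lambda>x. complex_of_real (g (x + t *\<^sub>R e)) * ek k x)" for t
      by (rule integrable_cubeM_bounded[where B="supn g"]) (auto simp: norm_mult pderivs_le_supn[OF \<phi>, of "is", folded g_def])
    have "(LINT x|cubeM. complex_of_real ((g (x + h n *\<^sub>R e) - g x) / h n) * ek k x)
      = (LINT x|cubeM. (complex_of_real (g (x + h n *\<^sub>R e)) * ek k x - complex_of_real (g x) * ek k x) / h n)"
      by (intro Bochner_Integration.integral_cong) (auto simp: algebra_simps diff_divide_distrib)
    also have "\<dots> = ((LINT x|cubeM. complex_of_real (g (x + h n *\<^sub>R e)) * ek k x) - fourier g k) / h n"
      using 1[of "h n"] 1[of 0] by (simp add: fourier_def)
    finally show ?thesis using shift[of "h n"] h[of n] by (simp add: algebra_simps diff_divide_distrib)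
  qed
  ultimately have A: "(\<lambda>n. fourier g k * ((cis (- (2 * pi * h n * k $ i)) - 1) / h n)) \<longlonglongrightarrow> fourier g' k" by (simp only:)
  define c where "c = - (2 * pi * \<i> * k $ i)"
  have "((\<lambda>z::complex. exp (c * z)) has_field_derivative c) (at 0)"
    by (auto intro!: derivative_eq_intros)
  then have D: "((\<lambda>z. (exp (c * z) - 1) / z) \<longlongrightarrow> c) (at 0)"
    by (simp add: has_field_derivative_iff)
  have "filterlim (\<lambda>n. complex_of_real (h n)) (at 0) sequentially"
    using tendsto_of_real[OF hlim, where 'a=complex] h(1)
    by (auto simp: filterlim_at less_imp_neq[symmetric] intro!: always_eventually)
  from filterlim_compose[OF D this]
  have "(\<lambda>n. fourier g k * ((exp (c * h n) - 1) / h n)) \<longlonglongrightarrow> fourier g k * c"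
    by (intro tendsto_intros)
  moreover have "exp (c * h n) = cis (- (2 * pi * h n * k $ i))" for n
    by (simp add: cis_conv_exp c_def mult_ac)
  ultimately have "(\<lambda>n. fourier g k * ((cis (- (2 * pi * h n * k $ i)) - 1) / h n)) \<longlonglongrightarrow> fourier g k * c"
    by simp
  from LIMSEQ_unique[OF A this] show ?thesis by (simp add: g_def g'_def c_def mult.commute)
qed

text \<open>The usual Japanese bracket up to constants. It equals the norm at nonzero lattice points
  and 1 at the origin, so negative powers are harmless and every power is monotone in the
  exponent.\<close>

definition bracket :: "real^4 \<Rightarrow> real" where "bracket k = max 1 (norm k)"

lemma bracket_ge_1 [simp]: "1 \<le> bracket k" by (simp add: bracket_def)
lemma bracket_pos [simp]: "0 < bracket k" using bracket_ge_1[of k] by linarith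
lemma bracket_nonneg [simp]: "0 \<le> bracket k" using bracket_ge_1[of k] by linarith
lemma norm_fourier_le:
  assumes "\<And>x. \<bar>\<phi> x\<bar> \<le> B"
  shows "norm (fourier \<phi> k) \<le> B"
proof -
  have "norm (fourier \<phi> k) \<le> (LINT x|cubeM. norm (complex_of_real (\<phi> x) * ek k x))"
    unfolding fourier_def by (rule integral_norm_bound)
  also have "\<dots> \<le> B"
  proof (cases "integrable cubeM (\<lambda>x. norm (complex_of_real (\<phi> x) * ek k x))")
    case True
    then have "(LINT x|cubeM. norm (complex_of_real (\<phi> x) * ek k x)) \<le> (LINT x|cubeM. B)"
      by (intro integral_mono) (auto simp: norm_mult assms)
    then show ?thesis using cubeM.prob_space by simp
  next
    case False
    then show ?thesis using assms[of 0] by (simp add: not_integrable_integral_eq)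
  qed
  finally show ?thesis .
qed

text \<open>Differentiate N times along the coordinate in which k is largest: each derivative yields
  a factor 2 pi |k_i|, which already dominates the norm of k because 4 \<le> 2 pi. That coordinate
  depends on k, hence the sum over all index lists.\<close>

lemma fourier_decay:
  assumes \<phi>: "\<phi> \<in> TestF" and k: "k \<in> Z4"
  shows "norm (fourier \<phi> k) * bracket k ^ N \<le> (\<Sum>is\<in>{is. length is \<le> N}. supn (pderivs is \<phi>))"
proof -
  have "(MAX j. \<bar>k $ j\<bar>) \<in> range (\<lambda>j. \<bar>k $ j\<bar>)" by (rule Max_in) auto
  then obtain i where "(MAX j. \<bar>k $ j\<bar>) = \<bar>k $ i\<bar>" by (rule imageE) blast
  then have i: "\<bar>k $ j\<bar> \<le> \<bar>k $ i\<bar>" for j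
    using Max_ge[of "range (\<lambda>j. \<bar>k $ j\<bar>)" "\<bar>k $ j\<bar>"] by auto
  have "norm k \<le> (\<Sum>j\<in>UNIV. \<bar>k $ j\<bar>)" by (rule norm_le_l1_cart)
  also have "\<dots> \<le> (\<Sum>j\<in>(UNIV::4 set). \<bar>k $ i\<bar>)" by (intro sum_mono i)
  also have "\<dots> \<le> 2 * pi * \<bar>k $ i\<bar>" using pi_ge_two by (simp add: mult_right_mono)
  finally have nk: "norm k \<le> 2 * pi * \<bar>k $ i\<bar>" .
  have it: "fourier (pderivs (replicate n i) \<phi>) k = (- (2 * pi * \<i> * k $ i)) ^ n * fourier \<phi> k" for n
    by (induction n) (use fourier_pderivs[OF \<phi> k] in auto)
  have fin: "finite {is::4 list. length is \<le> N}"
    using finite_lists_length_le[of "UNIV::4 set" N] by simp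
  have mem: "supn (pderivs is \<phi>) \<le> (\<Sum>is\<in>{is. length is \<le> N}. supn (pderivs is \<phi>))" if "length is \<le> N" for "is"
    by (rule member_le_sum[OF _ _ fin]) (use that supn_pderivs_nonneg[OF \<phi>] in auto)
  show ?thesis
  proof (cases "norm k \<le> 1")
    case True
    then have "norm (fourier \<phi> k) * bracket k ^ N = norm (fourier \<phi> k)" by (simp add: bracket_def max_def)
    also have "\<dots> \<le> supn (pderivs [] \<phi>)"
      by (rule norm_fourier_le) (use pderivs_le_supn[OF \<phi>, of "[]"] in auto)
    also have "\<dots> \<le> (\<Sum>is\<in>{is. length is \<le> N}. supn (pderivs is \<phi>))" by (rule mem) simp
    finally show ?thesis .
  next
    case False
    then have "norm (fourier \<phi> k) * bracket k ^ N \<le> norm (fourier \<phi> k) * (2 * pi * \<bar>k $ i\<bar>) ^ N"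
      using nk by (intro mult_left_mono power_mono) (auto simp: bracket_def)
    also have "\<dots> = norm (fourier (pderivs (replicate N i) \<phi>) k)"
      unfolding it by (simp add: norm_mult norm_power power_mult_distrib mult_ac)
    also have "\<dots> \<le> supn (pderivs (replicate N i) \<phi>)"
      by (rule norm_fourier_le) (use pderivs_le_supn[OF \<phi>] in auto)
    also have "\<dots> \<le> (\<Sum>is\<in>{is. length is \<le> N}. supn (pderivs is \<phi>))" by (rule mem) simp
    finally show ?thesis .
  qed
qed

section \<open>Gaussian hypercontractivity\<close>

lemma real_distribution_std_normal: "real_distribution std_normal_distribution"
  by (rule real_dist_normal_dist)

text \<open>Normalised by its total mass c, the weight g is a probability density under which X has
  the characteristic function of the standard normal law; Levy's uniqueness theorem identifies the
  law.\<close>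

lemma weighted_std_normal:
  fixes X g :: "'w \<Rightarrow> real"
  assumes "prob_space M" and [measurable]: "X \<in> borel_measurable M" "g \<in> borel_measurable M" "A \<in> sets borel"
    and g: "\<And>\<omega>. 0 \<le> g \<omega>" "\<And>\<omega>. g \<omega> \<le> B"
    and ch: "\<And>s. (LINT \<omega>|M. g \<omega> *\<^sub>R iexp (s * X \<omega>)) = complex_of_real (c * exp (- (s^2) / 2))"
  shows "(LINT \<omega>|M. g \<omega> * indicator A (X \<omega>)) = c * measure std_normal_distribution A"
proof -
  interpret prob_space M by fact
  have ig: "integrable M g"
    by (rule integrable_const_bound[where B=B]) (use g in \<open>auto simp: abs_of_nonneg\<close>)
  have "complex_of_real (LINT \<omega>|M. g \<omega>) = complex_of_real c"
    using ch[of 0] by (simp add: scaleR_conv_of_real)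
  then have cE: "(LINT \<omega>|M. g \<omega>) = c" by (simp only: of_real_eq_iff)
  then have c0: "0 \<le> c" using g Bochner_Integration.integral_nonneg[where M=M and f=g] by simp
  \<comment> \<open>With total mass zero there is nothing to normalise: g vanishes almost everywhere
    and both sides are zero.\<close>
  show ?thesis
  proof (cases "c = 0")
    case True
    then have "AE \<omega> in M. g \<omega> = 0"
      using integral_nonneg_eq_0_iff_AE[OF ig] g cE by simp
    then have "(LINT \<omega>|M. g \<omega> * indicator A (X \<omega>)) = (LINT \<omega>|M. 0)"
      by (intro integral_cong_AE) auto
    then show ?thesis using True by simp
  next
    case False
    with c0 have c: "0 < c" by simp
    define N where "N = density M (\<lambda>\<omega>. ennreal (g \<omega> / c))"
    have "emeasure N (space N) = (\<integral>\<^sup>+\<omega>. ennreal (g \<omega> / c) \<partial>M)"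
      by (simp add: N_def emeasure_density cong: nn_integral_cong)
    also have "\<dots> = ennreal (LINT \<omega>|M. g \<omega> / c)"
      using g c ig by (intro nn_integral_eq_integral) auto
    also have "\<dots> = 1" using cE c by simp
    finally interpret N: prob_space N by (rule prob_spaceI)
    have XN [measurable]: "X \<in> borel_measurable N" by (simp add: N_def)
    have "real_distribution (distr N borel X)"
      by (rule N.real_distribution_distr) measurable
    moreover have "char (distr N borel X) = char std_normal_distribution"
    proof
      fix s
      have "char (distr N borel X) s = (LINT \<omega>|N. iexp (s * X \<omega>))"
        by (simp add: char_def integral_distr)
      also have "\<dots> = (LINT \<omega>|M. (g \<omega> / c) *\<^sub>R iexp (s * X \<omega>))"
        unfolding N_def using g c by (subst integral_density) auto
      also have "\<dots> = (LINT \<omega>|M. (1 / c) *\<^sub>R (g \<omega> *\<^sub>R iexp (s * X \<omega>)))" by simp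
      also have "\<dots> = (1 / c) *\<^sub>R (LINT \<omega>|M. g \<omega> *\<^sub>R iexp (s * X \<omega>))" by (rule integral_scaleR_right)
      also have "\<dots> = complex_of_real (exp (- (s^2) / 2))" using c unfolding ch by (simp add: scaleR_conv_of_real)
      also have "\<dots> = char std_normal_distribution s" by (simp add: char_std_normal_distribution)
      finally show "char (distr N borel X) s = char std_normal_distribution s" .
    qed
    ultimately have "distr N borel X = std_normal_distribution"
      using real_distribution_std_normal Levy_uniqueness by blast
    then have "measure std_normal_distribution A = measure (distr N borel X) A" by simp
    also have "\<dots> = measure N (X -` A \<inter> space N)" by (rule measure_distr) auto
    also have "\<dots> = (LINT \<omega>|N. indicator A (X \<omega>))"
    proof -
      have "(LINT \<omega>|N. indicator A (X \<omega>)) = (LINT \<omega>|N. indicator (X -` A \<inter> space N) \<omega> :: real)"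
        by (intro Bochner_Integration.integral_cong) (auto simp: indicator_def)
      then show ?thesis by (simp add: Int_absorb2)
    qed
    also have "\<dots> = (LINT \<omega>|M. (g \<omega> / c) *\<^sub>R indicator A (X \<omega>))"
      unfolding N_def using g c by (subst integral_density) auto
    also have "\<dots> = (LINT \<omega>|M. (1 / c) * (g \<omega> * indicator A (X \<omega>)))" by simp
    also have "\<dots> = (1 / c) * (LINT \<omega>|M. g \<omega> * indicator A (X \<omega>))" by (rule integral_mult_right_zero)
    finally show ?thesis using c by simp
  qed
qed

text \<open>The weight $g$ absorbs the indicators of the coordinates already treated; this makes the statement inductive.\<close>

lemma weighted_joint_std_normal:
  fixes X :: "nat \<Rightarrow> 'w \<Rightarrow> real"
  assumes M: "prob_space M" and X [measurable]: "\<And>i. i < N \<Longrightarrow> X i \<in> borel_measurable M"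
    and A: "\<And>i. i < N \<Longrightarrow> A i \<in> sets borel"
    and gm: "g \<in> borel_measurable M"
    and g: "\<And>\<omega>. 0 \<le> g \<omega>" "\<And>\<omega>. g \<omega> \<le> B"
    and ch: "\<And>t. (LINT \<omega>|M. g \<omega> *\<^sub>R iexp (\<Sum>i<N. t i * X i \<omega>)) = complex_of_real (c * exp (- (\<Sum>i<N. (t i)^2) / 2))"
  shows "(LINT \<omega>|M. g \<omega> * (\<Prod>i<N. indicator (A i) (X i \<omega>))) = c * (\<Prod>i<N. measure std_normal_distribution (A i))"
  using X A gm g ch
proof (induction N arbitrary: g B c)
  case 0
  from "0.prems"(6)[of "\<lambda>_. 0"] have "complex_of_real (LINT \<omega>|M. g \<omega>) = complex_of_real c"
    by (simp add: scaleR_conv_of_real)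
  then have "(LINT \<omega>|M. g \<omega>) = c" by (simp only: of_real_eq_iff)
  then show ?case by simp
next
  case (Suc N)
  interpret prob_space M by fact
  have [measurable]: "g \<in> borel_measurable M" "X N \<in> borel_measurable M" "\<And>i. i < N \<Longrightarrow> X i \<in> borel_measurable M"
    "A N \<in> sets borel" using Suc.prems by auto
  note g = Suc.prems(4,5)
  let ?\<gamma> = "measure std_normal_distribution (A N)"
  define g' where "g' = (\<lambda>\<omega>. g \<omega> * indicator (A N) (X N \<omega>))"
  have [measurable]: "g' \<in> borel_measurable M" unfolding g'_def by measurable
  have g': "0 \<le> g' \<omega>" "g' \<omega> \<le> B" for \<omega> using g[of \<omega>] by (auto simp: g'_def indicator_def intro: order_trans)
  have bdd: "integrable M h" if [measurable]: "h \<in> borel_measurable M" and "\<And>\<omega>. norm (h \<omega>) \<le> C"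
    for h :: "'w \<Rightarrow> 'z::{banach,second_countable_topology}" and C
    by (rule integrable_const_bound[where B=C]) (use that in auto)
  \<comment> \<open>The one-variable lemma needs nonnegative weights, so the trigonometric functions
    of the remaining combination \<open>Z\<close> are entered as 1 + cos and 1 + sin. Subtracting
    the case of weight g recovers the real and imaginary parts of the characteristic function under
    the new weight \<open>g'\<close>.\<close>
  have ch': "(LINT \<omega>|M. g' \<omega> *\<^sub>R iexp (\<Sum>i<N. t i * X i \<omega>)) = complex_of_real ((c * ?\<gamma>) * exp (- (\<Sum>i<N. (t i)^2) / 2))" for t
  proof -
    define Z where "Z = (\<lambda>\<omega>. \<Sum>i<N. t i * X i \<omega>)"
    define T where "T = exp (- (\<Sum>i<N. (t i)^2) / 2)"
    have [measurable]: "Z \<in> borel_measurable M" unfolding Z_def by measurable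
    have S1: "(\<Sum>i<Suc N. (u(N := s)) i * X i \<omega>) = (\<Sum>i<N. u i * X i \<omega>) + s * X N \<omega>"
      and S2: "(\<Sum>i<Suc N. ((u(N := s)) i)^2) = (\<Sum>i<N. (u i)^2) + s^2" for u s \<omega>
      by (auto intro!: sum.cong)
    have E: "exp (- (a + b) / 2) = exp (- a / 2) * exp (- b / 2)" for a b :: real
      by (simp add: exp_add[symmetric] add_divide_distrib)
    have c1: "(LINT \<omega>|M. g \<omega> *\<^sub>R iexp (s * X N \<omega>)) = complex_of_real (c * exp (- (s^2) / 2))" for s
      using Suc.prems(6)[of "(\<lambda>_. 0)(N := s)"] unfolding S1 S2 by simp
    have c2: "(LINT \<omega>|M. g \<omega> *\<^sub>R iexp (Z \<omega> + s * X N \<omega>)) = complex_of_real (c * T * exp (- (s^2) / 2))" for s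
      using Suc.prems(6)[of "t(N := s)"] unfolding S1 S2 E Z_def T_def by (simp only: mult.assoc)
    \<comment> \<open>Reversing the sign of all t leaves the Gaussian right-hand side unchanged;
      this is why the sine part will cancel.\<close>
    have c3: "(LINT \<omega>|M. g \<omega> *\<^sub>R iexp (- Z \<omega> + s * X N \<omega>)) = complex_of_real (c * T * exp (- (s^2) / 2))" for s
    proof -
      have "(\<Sum>i<N. - t i * X i \<omega>) = - Z \<omega>" "(\<Sum>i<N. (- t i)^2) = (\<Sum>i<N. (t i)^2)" for \<omega>
        by (simp_all add: Z_def sum_negf)
      then show ?thesis
        using Suc.prems(6)[of "(\<lambda>i. - t i)(N := s)"] unfolding S1 S2 E T_def by (simp only: mult.assoc)
    qed
    have n1: "norm (g \<omega> *\<^sub>R iexp y) \<le> B" for \<omega> y using g[of \<omega>] by simp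
    have gI: "integrable M (\<lambda>\<omega>. g \<omega> *\<^sub>R iexp (y \<omega>))" if [measurable]: "y \<in> borel_measurable M" for y
      by (rule bdd[OF _ n1]) measurable
    have ip: "iexp (z + x) = iexp z * iexp x" for z x
      by (simp add: exp_add ring_distribs)
    have "iexp z + iexp (- z) = 2 * complex_of_real (cos z)" "iexp z - iexp (- z) = 2 * \<i> * complex_of_real (sin z)" for z
      unfolding cis_conv_exp[symmetric] by (simp_all add: complex_eq_iff)
    then have cosE: "complex_of_real (cos z) * iexp x = (iexp (z + x) + iexp (- z + x)) / 2"
      and sinE: "complex_of_real (sin z) * iexp x = (iexp (z + x) - iexp (- z + x)) / (2 * \<i>)" for z x
      unfolding ip distrib_right[symmetric] left_diff_distrib[symmetric] by simp_all
    have int_cos: "(LINT \<omega>|M. G1 \<omega> + (G2 \<omega> + G3 \<omega>) / 2) = (LINT \<omega>|M. G1 \<omega>) + ((LINT \<omega>|M. G2 \<omega>) + (LINT \<omega>|M. G3 \<omega>)) / 2"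
      and int_sin: "(LINT \<omega>|M. G1 \<omega> + (G2 \<omega> - G3 \<omega>) / (2 * \<i>)) = (LINT \<omega>|M. G1 \<omega>) + ((LINT \<omega>|M. G2 \<omega>) - (LINT \<omega>|M. G3 \<omega>)) / (2 * \<i>)"
      if "integrable M G1" "integrable M G2" "integrable M G3" for G1 G2 G3 :: "'w \<Rightarrow> complex"
      using that by simp_all
    have e1: "(LINT \<omega>|M. g \<omega> * indicator (A N) (X N \<omega>)) = c * ?\<gamma>"
      by (rule weighted_std_normal[OF M _ _ _ g c1]) measurable
    have e2: "(LINT \<omega>|M. (g \<omega> * (1 + cos (Z \<omega>))) * indicator (A N) (X N \<omega>)) = c * (1 + T) * ?\<gamma>"
    proof (rule weighted_std_normal[OF M, where B="B * 2"])
      fix s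
      have "(LINT \<omega>|M. (g \<omega> * (1 + cos (Z \<omega>))) *\<^sub>R iexp (s * X N \<omega>))
        = (LINT \<omega>|M. g \<omega> *\<^sub>R iexp (s * X N \<omega>) + (g \<omega> *\<^sub>R iexp (Z \<omega> + s * X N \<omega>) + g \<omega> *\<^sub>R iexp (- Z \<omega> + s * X N \<omega>)) / 2)"
      proof (rule Bochner_Integration.integral_cong[OF refl])
        fix \<omega>
        have "(g \<omega> * (1 + cos (Z \<omega>))) *\<^sub>R iexp (s * X N \<omega>) = g \<omega> *\<^sub>R iexp (s * X N \<omega>) + complex_of_real (g \<omega>) * (complex_of_real (cos (Z \<omega>)) * iexp (s * X N \<omega>))"
          by (simp add: scaleR_conv_of_real algebra_simps del: cos_of_real)
        then show "(g \<omega> * (1 + cos (Z \<omega>))) *\<^sub>R iexp (s * X N \<omega>) = g \<omega> *\<^sub>R iexp (s * X N \<omega>) + (g \<omega> *\<^sub>R iexp (Z \<omega> + s * X N \<omega>) + g \<omega> *\<^sub>R iexp (- Z \<omega> + s * X N \<omega>)) / 2"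
          unfolding cosE by (simp add: scaleR_conv_of_real algebra_simps add_divide_distrib)
      qed
      also have "\<dots> = complex_of_real (c * exp (- (s^2) / 2)) + (complex_of_real (c * T * exp (- (s^2) / 2)) + complex_of_real (c * T * exp (- (s^2) / 2))) / 2"
        by (subst int_cos, (rule gI, measurable)+, simp only: c1 c2 c3)
      also have "\<dots> = complex_of_real (c * (1 + T) * exp (- (s^2) / 2))" by (simp add: algebra_simps)
      finally show "(LINT \<omega>|M. (g \<omega> * (1 + cos (Z \<omega>))) *\<^sub>R iexp (s * X N \<omega>)) = complex_of_real (c * (1 + T) * exp (- (s^2) / 2))" .
    next
      fix \<omega>
      have cb: "0 \<le> 1 + cos (Z \<omega>)" "1 + cos (Z \<omega>) \<le> 2"
        using cos_ge_minus_one[of "Z \<omega>"] cos_le_one[of "Z \<omega>"] by linarith+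
      then show "0 \<le> g \<omega> * (1 + cos (Z \<omega>))" using g(1)[of \<omega>] by simp
      show "g \<omega> * (1 + cos (Z \<omega>)) \<le> B * 2" by (rule mult_mono) (use cb g(1)[of \<omega>] g(2)[of \<omega>] in linarith)+
    qed measurable
    have e3: "(LINT \<omega>|M. (g \<omega> * (1 + sin (Z \<omega>))) * indicator (A N) (X N \<omega>)) = c * ?\<gamma>"
    proof (rule weighted_std_normal[OF M, where B="B * 2"])
      fix s
      have "(LINT \<omega>|M. (g \<omega> * (1 + sin (Z \<omega>))) *\<^sub>R iexp (s * X N \<omega>))
        = (LINT \<omega>|M. g \<omega> *\<^sub>R iexp (s * X N \<omega>) + (g \<omega> *\<^sub>R iexp (Z \<omega> + s * X N \<omega>) - g \<omega> *\<^sub>R iexp (- Z \<omega> + s * X N \<omega>)) / (2 * \<i>))"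
      proof (rule Bochner_Integration.integral_cong[OF refl])
        fix \<omega>
        have "(g \<omega> * (1 + sin (Z \<omega>))) *\<^sub>R iexp (s * X N \<omega>) = g \<omega> *\<^sub>R iexp (s * X N \<omega>) + complex_of_real (g \<omega>) * (complex_of_real (sin (Z \<omega>)) * iexp (s * X N \<omega>))"
          by (simp add: scaleR_conv_of_real algebra_simps del: sin_of_real)
        then show "(g \<omega> * (1 + sin (Z \<omega>))) *\<^sub>R iexp (s * X N \<omega>) = g \<omega> *\<^sub>R iexp (s * X N \<omega>) + (g \<omega> *\<^sub>R iexp (Z \<omega> + s * X N \<omega>) - g \<omega> *\<^sub>R iexp (- Z \<omega> + s * X N \<omega>)) / (2 * \<i>)"
          unfolding sinE by (simp add: scaleR_conv_of_real algebra_simps diff_divide_distrib)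
      qed
      also have "\<dots> = complex_of_real (c * exp (- (s^2) / 2)) + (complex_of_real (c * T * exp (- (s^2) / 2)) - complex_of_real (c * T * exp (- (s^2) / 2))) / (2 * \<i>)"
        by (subst int_sin, (rule gI, measurable)+, simp only: c1 c2 c3)
      finally show "(LINT \<omega>|M. (g \<omega> * (1 + sin (Z \<omega>))) *\<^sub>R iexp (s * X N \<omega>)) = complex_of_real (c * exp (- (s^2) / 2))" by simp
    next
      fix \<omega>
      have cb: "0 \<le> 1 + sin (Z \<omega>)" "1 + sin (Z \<omega>) \<le> 2"
        using sin_ge_minus_one[of "Z \<omega>"] sin_le_one[of "Z \<omega>"] by linarith+
      then show "0 \<le> g \<omega> * (1 + sin (Z \<omega>))" using g(1)[of \<omega>] by simp
      show "g \<omega> * (1 + sin (Z \<omega>)) \<le> B * 2" by (rule mult_mono) (use cb g(1)[of \<omega>] g(2)[of \<omega>] in linarith)+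
    qed measurable
    have i1: "integrable M (\<lambda>\<omega>. g' \<omega> * f (Z \<omega>))" if "f = cos \<or> f = sin" for f :: "real \<Rightarrow> real"
      by (rule bdd) (use that g' in \<open>auto simp: abs_mult intro!: mult_le_one order_trans[OF mult_left_le]\<close>)
    have i2: "integrable M g'" by (rule bdd) (use g' in auto)
    have e2': "(LINT \<omega>|M. g' \<omega> * cos (Z \<omega>)) = c * ?\<gamma> * T"
    proof -
      have "(LINT \<omega>|M. (g \<omega> * (1 + cos (Z \<omega>))) * indicator (A N) (X N \<omega>)) = (LINT \<omega>|M. g' \<omega> + g' \<omega> * cos (Z \<omega>))"
        by (intro Bochner_Integration.integral_cong) (auto simp: g'_def algebra_simps)
      also have "\<dots> = (LINT \<omega>|M. g' \<omega>) + (LINT \<omega>|M. g' \<omega> * cos (Z \<omega>))"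
        using i1 i2 by simp
      finally show ?thesis using e1 e2 by (simp add: g'_def algebra_simps)
    qed
    have e3': "(LINT \<omega>|M. g' \<omega> * sin (Z \<omega>)) = 0"
    proof -
      have "(LINT \<omega>|M. (g \<omega> * (1 + sin (Z \<omega>))) * indicator (A N) (X N \<omega>)) = (LINT \<omega>|M. g' \<omega> + g' \<omega> * sin (Z \<omega>))"
        by (intro Bochner_Integration.integral_cong) (auto simp: g'_def algebra_simps)
      also have "\<dots> = (LINT \<omega>|M. g' \<omega>) + (LINT \<omega>|M. g' \<omega> * sin (Z \<omega>))"
        using i1 i2 by simp
      finally show ?thesis using e1 e3 by (simp add: g'_def algebra_simps)
    qed
    have "(LINT \<omega>|M. g' \<omega> *\<^sub>R iexp (Z \<omega>)) = (LINT \<omega>|M. complex_of_real (g' \<omega> * cos (Z \<omega>)) + \<i> * complex_of_real (g' \<omega> * sin (Z \<omega>)))"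
      by (intro Bochner_Integration.integral_cong refl) (simp add: scaleR_conv_of_real algebra_simps cis_conv_exp[symmetric] complex_eq_iff)
    also have "\<dots> = complex_of_real (c * ?\<gamma> * T)"
      using i1 by (subst Bochner_Integration.integral_add) (auto simp: e2' e3' simp del: of_real_mult)
    finally show ?thesis by (simp add: Z_def T_def)
  qed
  have "(LINT \<omega>|M. g \<omega> * (\<Prod>i<Suc N. indicator (A i) (X i \<omega>))) = (LINT \<omega>|M. g' \<omega> * (\<Prod>i<N. indicator (A i) (X i \<omega>)))"
    by (intro Bochner_Integration.integral_cong) (auto simp: g'_def)
  also have "\<dots> = (c * ?\<gamma>) * (\<Prod>i<N. measure std_normal_distribution (A i))"
    by (rule Suc.IH[OF _ _ _ g' ch']) (use Suc.prems in auto)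
  finally show ?case by simp
qed

text \<open>With weight and constant 1 the preceding lemma gives the mass of every rectangle, and
  rectangles determine the product measure. Independence and normality thus come out together from
  the characteristic functions of linear combinations.\<close>

lemma distr_joint_std_normal:
  fixes X :: "nat \<Rightarrow> 'w \<Rightarrow> real"
  assumes M: "prob_space M" and X [measurable]: "\<And>i. i < N \<Longrightarrow> X i \<in> borel_measurable M"
    and ch: "\<And>t. (LINT \<omega>|M. iexp (\<Sum>i<N. t i * X i \<omega>)) = complex_of_real (exp (- (\<Sum>i<N. (t i)^2) / 2))"
  shows "distr M (\<Pi>\<^sub>M i\<in>{..<N}. std_normal_distribution) (\<lambda>\<omega>. \<lambda>i\<in>{..<N}. X i \<omega>) = (\<Pi>\<^sub>M i\<in>{..<N}. std_normal_distribution)"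
proof -
  interpret prob_space M by fact
  interpret SN: prob_space std_normal_distribution
    by (rule prob_space_normal_density) simp
  interpret P: product_sigma_finite "\<lambda>_::nat. std_normal_distribution" by standard
  have XM: "(\<lambda>\<omega>. \<lambda>i\<in>{..<N}. X i \<omega>) \<in> M \<rightarrow>\<^sub>M (\<Pi>\<^sub>M i\<in>{..<N}. std_normal_distribution)"
    by (rule measurable_restrict) simp
  show ?thesis
  proof (rule P.PiM_eqI)
    fix A :: "nat \<Rightarrow> real set"
    assume "\<And>i. i \<in> {..<N} \<Longrightarrow> A i \<in> sets std_normal_distribution"
    then have A[measurable]: "\<And>i. i < N \<Longrightarrow> A i \<in> sets borel" by simp
    define S where "S = {\<omega>\<in>space M. \<forall>i\<in>{..<N}. X i \<omega> \<in> A i}"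
    have Sm: "S \<in> sets M" unfolding S_def
      by (intro sets.sets_Collect_finite_All measurable_sets_Collect[OF X, of _ "\<lambda>x. x \<in> A _"]) (use A in auto)
    have "emeasure (distr M (\<Pi>\<^sub>M i\<in>{..<N}. std_normal_distribution) (\<lambda>\<omega>. \<lambda>i\<in>{..<N}. X i \<omega>)) (Pi\<^sub>E {..<N} A)
      = emeasure M ((\<lambda>\<omega>. \<lambda>i\<in>{..<N}. X i \<omega>) -` (Pi\<^sub>E {..<N} A) \<inter> space M)"
      by (rule emeasure_distr) (rule XM, intro sets_PiM_I_finite, simp_all add: A)
    also have "(\<lambda>\<omega>. \<lambda>i\<in>{..<N}. X i \<omega>) -` (Pi\<^sub>E {..<N} A) \<inter> space M = S"
      unfolding S_def by (auto simp: restrict_def PiE_def Pi_def extensional_def)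
    also have "emeasure M S = ennreal (LINT \<omega>|M. indicator S \<omega>)"
      using Sm by (simp add: emeasure_eq_measure)
    also have "(LINT \<omega>|M. indicator S \<omega>) = (LINT \<omega>|M. 1 * (\<Prod>i<N. indicator (A i) (X i \<omega>) :: real))"
    proof (intro Bochner_Integration.integral_cong refl)
      fix \<omega> assume w: "\<omega> \<in> space M"
      show "indicator S \<omega> = 1 * (\<Prod>i<N. indicator (A i) (X i \<omega>) :: real)"
      proof (cases "\<omega> \<in> S")
        case True
        then have "indicator (A i) (X i \<omega>) = (1::real)" if "i < N" for i using that by (simp add: S_def)
        then show ?thesis using True by simp
      next
        case False
        then obtain i where "i < N" "X i \<omega> \<notin> A i" using w by (auto simp: S_def)
        then have "(\<Prod>i<N. indicator (A i) (X i \<omega>) :: real) = 0" by (intro prod_zero) (auto intro!: bexI[of _ i])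
        then show ?thesis using False by simp
      qed
    qed
    also have "\<dots> = 1 * (\<Prod>i<N. measure std_normal_distribution (A i))"
      by (rule weighted_joint_std_normal[OF M, where B=1]) (use ch in auto)
    finally have E: "emeasure (distr M (\<Pi>\<^sub>M i\<in>{..<N}. std_normal_distribution) (\<lambda>\<omega>. \<lambda>i\<in>{..<N}. X i \<omega>)) (Pi\<^sub>E {..<N} A)
       = ennreal (1 * (\<Prod>i<N. measure std_normal_distribution (A i)))" .
    show "emeasure (distr M (\<Pi>\<^sub>M i\<in>{..<N}. std_normal_distribution) (\<lambda>\<omega>. \<lambda>i\<in>{..<N}. X i \<omega>)) (Pi\<^sub>E {..<N} A)
       = (\<Prod>i\<in>{..<N}. emeasure std_normal_distribution (A i))"
      unfolding E by (simp add: SN.emeasure_eq_measure prod_ennreal)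
  qed auto
qed

text \<open>Off-diagonal step functions of order $d$ integrate to polynomials of this kind in independent Gaussians.\<close>

fun mlin_poly :: "nat \<Rightarrow> nat \<Rightarrow> ((nat \<Rightarrow> real) \<Rightarrow> real) set" where
  "mlin_poly 0 d = {\<lambda>x. c | c. True}"
| "mlin_poly (Suc N) 0 = mlin_poly N 0"
| "mlin_poly (Suc N) (Suc d) = {\<lambda>x. A x + x N * B x | A B. A \<in> mlin_poly N (Suc d) \<and> B \<in> mlin_poly N d}"

lemma mlin_poly_SucI: "A \<in> mlin_poly N (Suc d) \<Longrightarrow> B \<in> mlin_poly N d \<Longrightarrow> (\<lambda>x. A x + x N * B x) \<in> mlin_poly (Suc N) (Suc d)"
  by auto

lemma mlin_poly_const: "(\<lambda>x. c) \<in> mlin_poly N d"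
proof (induction N arbitrary: d c)
  case (Suc N)
  then show ?case using mlin_poly_SucI[OF Suc[of c] Suc[of 0]] Suc by (cases d) (simp_all del: mlin_poly.simps(3))
qed auto

lemma mlin_poly_0: "F \<in> mlin_poly N 0 \<Longrightarrow> \<exists>c. F = (\<lambda>_. c)"
  by (induction N) auto

lemma mlin_poly_add: "F \<in> mlin_poly N d \<Longrightarrow> G \<in> mlin_poly N d \<Longrightarrow> (\<lambda>x. F x + G x) \<in> mlin_poly N d"
proof (induction N d arbitrary: F G rule: mlin_poly.induct)
  case (3 N d)
  from "3.prems" obtain A B A' B' where *: "F = (\<lambda>x. A x + x N * B x)" "G = (\<lambda>x. A' x + x N * B' x)"
    "A \<in> mlin_poly N (Suc d)" "B \<in> mlin_poly N d" "A' \<in> mlin_poly N (Suc d)" "B' \<in> mlin_poly N d" by auto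
  have "(\<lambda>x. F x + G x) = (\<lambda>x. (\<lambda>x. A x + A' x) x + x N * (\<lambda>x. B x + B' x) x)"
    by (simp add: * algebra_simps)
  with "3.IH"(1)[OF *(3,5)] "3.IH"(2)[OF *(4,6)] show ?case by auto
qed auto

lemma mlin_poly_scale: "F \<in> mlin_poly N d \<Longrightarrow> (\<lambda>x. c * F x) \<in> mlin_poly N d"
proof (induction N d arbitrary: F rule: mlin_poly.induct)
  case (3 N d)
  from "3.prems" obtain A B where *: "F = (\<lambda>x. A x + x N * B x)"
    "A \<in> mlin_poly N (Suc d)" "B \<in> mlin_poly N d" by auto
  have "(\<lambda>x. c * F x) = (\<lambda>x. (\<lambda>x. c * A x) x + x N * (\<lambda>x. c * B x) x)"
    by (simp add: * algebra_simps)
  with "3.IH"(1)[OF *(2)] "3.IH"(2)[OF *(3)] show ?case by auto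
qed auto

lemma mlin_poly_sum: "finite S \<Longrightarrow> (\<And>i. i \<in> S \<Longrightarrow> F i \<in> mlin_poly N d) \<Longrightarrow> (\<lambda>x. \<Sum>i\<in>S. F i x) \<in> mlin_poly N d"
  by (induction S rule: finite_induct) (auto intro: mlin_poly_const mlin_poly_add)

lemma mlin_poly_prod: "S \<subseteq> {..<N} \<Longrightarrow> card S \<le> d \<Longrightarrow> (\<lambda>x. \<Prod>i\<in>S. x i) \<in> mlin_poly N d"
proof (induction N arbitrary: S d)
  case (Suc N)
  have fS: "finite S" using Suc.prems(1) finite_subset by blast
  show ?case
  proof (cases d)
    case 0
    then have "S = {}" using Suc.prems fS by auto
    then show ?thesis using mlin_poly_const by simp
  next
    case (Suc d')
    show ?thesis
    proof (cases "N \<in> S")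
      case True
      have "(\<lambda>x::nat \<Rightarrow> real. \<Prod>i\<in>S. x i) = (\<lambda>x. (\<lambda>x. 0) x + x N * (\<lambda>x. \<Prod>i\<in>S - {N}. x i) x)"
        using True fS by (simp add: prod.remove)
      moreover have "(\<lambda>x::nat \<Rightarrow> real. \<Prod>i\<in>S - {N}. x i) \<in> mlin_poly N d'"
        using Suc.prems Suc True fS by (intro Suc.IH) (auto simp: less_Suc_eq card_Diff_singleton)
      ultimately show ?thesis using mlin_poly_SucI[OF mlin_poly_const[of 0]] Suc by (simp del: mlin_poly.simps)
    next
      case False
      have "(\<lambda>x::nat \<Rightarrow> real. \<Prod>i\<in>S. x i) = (\<lambda>x. (\<lambda>x. \<Prod>i\<in>S. x i) x + x N * (\<lambda>x. 0) x)"
        by simp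
      moreover have "(\<lambda>x::nat \<Rightarrow> real. \<Prod>i\<in>S. x i) \<in> mlin_poly N d"
        using Suc.prems False by (intro Suc.IH) (auto simp: less_Suc_eq)
      ultimately show ?thesis using mlin_poly_SucI[OF _ mlin_poly_const[of 0]] Suc by (simp del: mlin_poly.simps)
    qed
  qed
qed (auto)

lemma mlin_poly_upd: "F \<in> mlin_poly N d \<Longrightarrow> N \<le> i \<Longrightarrow> F (x(i := t)) = F x"
proof (induction N d arbitrary: F rule: mlin_poly.induct)
  case (3 N d)
  from "3.prems" obtain A B where *: "F = (\<lambda>x. A x + x N * B x)"
    "A \<in> mlin_poly N (Suc d)" "B \<in> mlin_poly N d" by auto
  have "N \<le> i" "(x(i := t)) N = x N" using "3.prems" by auto
  then show ?case unfolding *(1) using "3.IH"(1)[OF *(2)] "3.IH"(2)[OF *(3)] by (simp only:)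
qed auto

lemma mlin_poly_measurable: "F \<in> mlin_poly N d \<Longrightarrow> N \<le> K \<Longrightarrow> F \<in> borel_measurable (\<Pi>\<^sub>M i\<in>{..<K}. std_normal_distribution)"
proof (induction N d arbitrary: F rule: mlin_poly.induct)
  case (3 N d)
  from "3.prems" obtain A B where *: "F = (\<lambda>x. A x + x N * B x)"
    "A \<in> mlin_poly N (Suc d)" "B \<in> mlin_poly N d" by auto
  have [measurable]: "A \<in> borel_measurable (\<Pi>\<^sub>M i\<in>{..<K}. std_normal_distribution)"
    "B \<in> borel_measurable (\<Pi>\<^sub>M i\<in>{..<K}. std_normal_distribution)"
    using "3.IH"(1)[OF *(2)] "3.IH"(2)[OF *(3)] "3.prems" by auto
  have [measurable]: "(\<lambda>x. x N) \<in> borel_measurable (\<Pi>\<^sub>M i\<in>{..<K}. std_normal_distribution)"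
    using measurable_component_singleton[of N "{..<K}" "\<lambda>_. std_normal_distribution"] "3.prems" by simp
  show ?case unfolding * by measurable
qed auto

section \<open>Moments of polynomials in independent Gaussians\<close>

definition nmom :: "nat \<Rightarrow> real" where
  "nmom j = fact (2 * j) / (2 ^ j * fact j)"

text \<open>\<open>nmom j\<close> is the moment of order 2 j of the standard normal law. The sharp
  hypercontractive constant would be 2 m - 1; any number will do that is at least 1 and bounds every
  coefficient of the averaged binomial expansion, and the sum of these coefficients plus 1 is such a
  number.\<close>

definition Kbon :: "nat \<Rightarrow> real" where
  "Kbon m = 1 + (\<Sum>j\<le>m. real ((2 * m) choose (2 * j)) * nmom j)"

lemma nmom_nonneg [simp]: "0 \<le> nmom j" by (simp add: nmom_def)
lemma nmom_0 [simp]: "nmom 0 = 1" by (simp add: nmom_def)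

lemma Kbon_ge_1: "1 \<le> Kbon m"
  unfolding Kbon_def by (simp add: sum_nonneg)

text \<open>Compares, coefficient by coefficient, the Gaussian average over t of (a + t b)^(2 m)
  with (a^2 + K b^2)^m. At j = 0 there is equality, so the loss K falls on b alone.\<close>

lemma Kbon_coeff:
  assumes "j \<le> m" shows "real ((2 * m) choose (2 * j)) * nmom j \<le> real (m choose j) * Kbon m ^ j"
proof (cases "j = 0")
  case False
  have "real ((2 * m) choose (2 * j)) * nmom j \<le> (\<Sum>j\<le>m. real ((2 * m) choose (2 * j)) * nmom j)"
    by (rule member_le_sum) (use assms in auto)
  also have "\<dots> \<le> Kbon m" by (simp add: Kbon_def)
  also have "\<dots> = Kbon m ^ 1" by simp
  also have "\<dots> \<le> Kbon m ^ j" using Kbon_ge_1 False by (intro power_increasing) auto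
  also have "\<dots> = 1 * Kbon m ^ j" by simp
  also have "\<dots> \<le> real (m choose j) * Kbon m ^ j"
    using assms Kbon_ge_1[of m] by (intro mult_right_mono) (auto simp: Suc_le_eq)
  finally show ?thesis .
qed simp

lemma sum_even_only:
  fixes g :: "nat \<Rightarrow> real"
  assumes "\<And>i. odd i \<Longrightarrow> g i = 0"
  shows "(\<Sum>i\<le>2 * m. g i) = (\<Sum>j\<le>m. g (2 * j))"
  by (induction m) (use assms in auto)

text \<open>Odd Gaussian moments vanish, so only powers of a^2 and b^2 survive. These are the two
  nonnegative quantities to which Hoelder will be applied.\<close>

lemma std_normal_poly:
  shows "(\<integral>\<^sup>+t. ennreal ((a + t * b) ^ (2 * m)) \<partial>std_normal_distribution)
     = ennreal (\<Sum>j\<le>m. real ((2 * m) choose (2 * j)) * nmom j * (a^2) ^ (m - j) * (b^2) ^ j)"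
proof -
  define c where "c i = real ((2 * m) choose i) * a ^ (2 * m - i) * b ^ i" for i
  have exp: "(a + t * b) ^ (2 * m) = (\<Sum>i\<le>2 * m. c i * t ^ i)" for t
  proof -
    have "(a + t * b) ^ (2 * m) = (t * b + a) ^ (2 * m)" by (simp add: add.commute)
    also have "\<dots> = (\<Sum>i\<le>2 * m. c i * t ^ i)"
      unfolding binomial_ring c_def by (simp add: power_mult_distrib mult_ac)
    finally show ?thesis .
  qed
  have I: "integrable std_normal_distribution (\<lambda>t. c i * t ^ i)" for i
    by (intro integrable_mult_right integrable_std_normal_distribution_moment)
  have "(\<integral>\<^sup>+t. ennreal ((a + t * b) ^ (2 * m)) \<partial>std_normal_distribution) = ennreal (LINT t|std_normal_distribution. (a + t * b) ^ (2 * m))"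
    proof (rule nn_integral_eq_integral)
    show "integrable std_normal_distribution (\<lambda>t. (a + t * b) ^ (2 * m))"
      unfolding exp by (intro Bochner_Integration.integrable_sum I)
  qed simp
  also have "(LINT t|std_normal_distribution. (a + t * b) ^ (2 * m)) = (\<Sum>i\<le>2 * m. c i * (LINT t|std_normal_distribution. t ^ i))"
    unfolding exp using I by (subst Bochner_Integration.integral_sum) auto
  also have "\<dots> = (\<Sum>j\<le>m. c (2 * j) * (LINT t|std_normal_distribution. t ^ (2 * j)))"
    by (intro sum_even_only) (simp add: integral_std_normal_distribution_moment_odd)
  also have "\<dots> = (\<Sum>j\<le>m. real ((2 * m) choose (2 * j)) * nmom j * (a^2) ^ (m - j) * (b^2) ^ j)"
  proof (intro sum.cong refl)
    fix j assume "j \<in> {..m}"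
    then have "2 * m - 2 * j = 2 * (m - j)" by auto
    moreover have "(LINT t|std_normal_distribution. t ^ (2 * j)) = nmom j"
      using std_normal_distribution_even_moments[of j] by (simp add: nmom_def)
    ultimately show "c (2 * j) * (LINT t|std_normal_distribution. t ^ (2 * j)) = real ((2 * m) choose (2 * j)) * nmom j * (a^2) ^ (m - j) * (b^2) ^ j"
      by (simp add: c_def mult_ac flip: power_mult)
  qed
  finally show ?thesis .
qed

text \<open>The weighted inequality between geometric and arithmetic mean with weights (m - j)/m and
  j/m; degenerate cases are split off before real powers are used.\<close>

lemma young_nat:
  fixes x y :: real
  assumes "0 \<le> x" "0 \<le> y" "j \<le> m" "0 < m"
  shows "x ^ (m - j) * y ^ j \<le> (real (m - j) / real m) * x ^ m + (real j / real m) * y ^ m"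
proof (cases "j = 0 \<or> j = m \<or> x = 0 \<or> y = 0")
  case True
  then show ?thesis using assms by (auto simp: power_0_left)
next
  case False
  then have pos: "0 < x" "0 < y" using assms by auto
  have "(x ^ m) powr (real (m - j) / real m) * (y ^ m) powr (real j / real m) \<le> (real (m - j) / real m) * x ^ m + (real j / real m) * y ^ m"
  proof (rule Youngs_inequality_0)
    show "real (m - j) / real m + real j / real m = 1"
      using assms by (simp add: add_divide_distrib[symmetric] of_nat_diff)
  qed (use pos in auto)
  moreover have "(u ^ m) powr (real i / real m) = u ^ i" if "0 < u" for u :: real and i
  proof -
    have "(u ^ m) powr (real i / real m) = (u powr real m) powr (real i / real m)"
      by (simp only: powr_realpow[OF that])
    also have "\<dots> = u powr real i" using assms by (simp add: powr_powr)
    also have "\<dots> = u ^ i" by (rule powr_realpow[OF that])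
    finally show ?thesis .
  qed
  ultimately show ?thesis using pos by simp
qed

text \<open>Hoelder's inequality with exponents m/(m - j) and m/j, obtained pointwise from Young's
  inequality after rescaling by s and t. Working with strictly positive bounds in place of the norms
  avoids division by zero.\<close>

lemma holder_from_bounds:
  fixes f g :: "'a \<Rightarrow> real"
  assumes [measurable]: "f \<in> borel_measurable M" "g \<in> borel_measurable M"
    and nn: "\<And>x. 0 \<le> f x" "\<And>x. 0 \<le> g x"
    and "(\<integral>\<^sup>+x. ennreal (f x ^ m) \<partial>M) \<le> ennreal (s ^ m)" "(\<integral>\<^sup>+x. ennreal (g x ^ m) \<partial>M) \<le> ennreal (t ^ m)"
    and "0 < s" "0 < t" "j \<le> m" "0 < m"
  shows "(\<integral>\<^sup>+x. ennreal (f x ^ (m - j) * g x ^ j) \<partial>M) \<le> ennreal (s ^ (m - j) * t ^ j)"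
proof -
  let ?a = "real (m - j) / real m" and ?b = "real j / real m"
  let ?c = "s ^ (m - j) * t ^ j"
  have c: "0 \<le> ?c" using assms by simp
  have "f x ^ (m - j) * g x ^ j \<le> ?c * (?a / s ^ m * f x ^ m + ?b / t ^ m * g x ^ m)" for x
  proof -
    have "f x ^ (m - j) * g x ^ j = ?c * ((f x / s) ^ (m - j) * (g x / t) ^ j)"
      using assms by (simp add: power_divide)
    also have "\<dots> \<le> ?c * (?a * (f x / s) ^ m + ?b * (g x / t) ^ m)"
      using assms by (intro mult_left_mono young_nat c) auto
    finally show ?thesis by (simp add: power_divide)
  qed
  then have le: "f x ^ (m - j) * g x ^ j \<le> (?c * ?a / s ^ m) * f x ^ m + (?c * ?b / t ^ m) * g x ^ m" for x
    by (simp only: distrib_left times_divide_eq_left times_divide_eq_right mult.assoc)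
  have "ennreal (f x ^ (m - j) * g x ^ j) \<le> ennreal (?c * ?a / s ^ m) * ennreal (f x ^ m) + ennreal (?c * ?b / t ^ m) * ennreal (g x ^ m)" for x
  proof -
    have p: "0 \<le> ?c * ?a / s ^ m" "0 \<le> f x ^ m" "0 \<le> ?c * ?b / t ^ m" "0 \<le> g x ^ m" using assms c by auto
    show ?thesis
      unfolding ennreal_mult[OF p(1,2), symmetric] ennreal_mult[OF p(3,4), symmetric]
        ennreal_plus[OF mult_nonneg_nonneg[OF p(1,2)] mult_nonneg_nonneg[OF p(3,4)], symmetric]
      by (rule ennreal_leI[OF le])
  qed
  then have "(\<integral>\<^sup>+x. ennreal (f x ^ (m - j) * g x ^ j) \<partial>M) \<le> (\<integral>\<^sup>+x. ennreal (?c * ?a / s ^ m) * ennreal (f x ^ m) + ennreal (?c * ?b / t ^ m) * ennreal (g x ^ m) \<partial>M)"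
    by (intro nn_integral_mono)
  also have "\<dots> = ennreal (?c * ?a / s ^ m) * (\<integral>\<^sup>+x. ennreal (f x ^ m) \<partial>M) + ennreal (?c * ?b / t ^ m) * (\<integral>\<^sup>+x. ennreal (g x ^ m) \<partial>M)"
    by (subst nn_integral_add) (auto simp: nn_integral_cmult)
  also have "\<dots> \<le> ennreal (?c * ?a / s ^ m) * ennreal (s ^ m) + ennreal (?c * ?b / t ^ m) * ennreal (t ^ m)"
    by (intro add_mono mult_left_mono assms) auto
  also have "\<dots> = ennreal (?c * ?a / s ^ m * s ^ m + ?c * ?b / t ^ m * t ^ m)"
    using assms c by (simp add: ennreal_mult[symmetric] ennreal_plus[symmetric] del: ennreal_plus)
  also have "?c * ?a / s ^ m * s ^ m + ?c * ?b / t ^ m * t ^ m = ?c * (?a + ?b)"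
  proof -
    have "?c * ?a / s ^ m * s ^ m = ?c * ?a" "?c * ?b / t ^ m * t ^ m = ?c * ?b" using assms by simp_all
    then show ?thesis by (simp only: distrib_left)
  qed
  also have "?a + ?b = 1" using assms by (simp add: add_divide_distrib[symmetric] of_nat_diff)
  finally show ?thesis by simp
qed

lemma bonami_const:
  assumes "prob_space P" "(\<integral>\<^sup>+x. ennreal (a^2) \<partial>P) < ennreal c"
  shows "(\<integral>\<^sup>+x. ennreal (a ^ (2 * m)) \<partial>P) \<le> ennreal ((Kbon m ^ d * c) ^ m)"
proof -
  interpret prob_space P by fact
  have "ennreal (a^2) < ennreal c" using assms by (simp add: emeasure_space_1)
  then have c: "a^2 < c" by (metis ennreal_less_iff zero_le_power2)
  have "a ^ (2 * m) = (a^2) ^ m" by (simp add: power_mult)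
  also have "\<dots> \<le> (1 * c) ^ m" using c by (intro power_mono) auto
  also have "\<dots> \<le> (Kbon m ^ d * c) ^ m"
    using c one_le_power[OF Kbon_ge_1[of m], of d] zero_le_power2[of a]
    by (intro power_mono mult_right_mono) (linarith | simp)+
  finally show ?thesis by (simp add: emeasure_space_1 ennreal_leI)
qed

text \<open>Induction on the number of variables. Write F = A + x_N B and integrate out x_N: second
  moments add, and the mixed terms in the moment of order 2 m are bounded by Hoelder and the
  induction hypotheses. B has lower degree, so the factor K that comes with each power of b raises
  K^d to the constant K^(d+1) of A, and the binomial theorem reassembles the m-th power of a +
  b.\<close>

lemma bonami:
  assumes "F \<in> mlin_poly N d" "0 < m"
    and "(\<integral>\<^sup>+x. ennreal ((F x)^2) \<partial>(\<Pi>\<^sub>M i\<in>{..<N}. std_normal_distribution)) < ennreal c"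
  shows "(\<integral>\<^sup>+x. ennreal ((F x) ^ (2 * m)) \<partial>(\<Pi>\<^sub>M i\<in>{..<N}. std_normal_distribution)) \<le> ennreal ((Kbon m ^ d * c) ^ m)"
proof -
  interpret SN: prob_space std_normal_distribution
    by (rule prob_space_normal_density) simp
  interpret P: product_sigma_finite "\<lambda>_::nat. std_normal_distribution" by standard
  have pr: "prob_space (\<Pi>\<^sub>M i\<in>{..<N}. std_normal_distribution)" for N :: nat
    by (rule prob_space_PiM) (rule SN.prob_space_axioms)
  show ?thesis using assms
  proof (induction N d arbitrary: F c rule: mlin_poly.induct)
    case (1 d)
    from 1 obtain a where "F = (\<lambda>_. a)" by auto
    show ?case using "1.prems"(3) unfolding \<open>F = (\<lambda>_. a)\<close> by (rule bonami_const[OF pr])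
  next
    case (2 N)
    then obtain a where "F = (\<lambda>_. a)" using mlin_poly_0 by blast
    show ?case using "2.prems"(3) unfolding \<open>F = (\<lambda>_. a)\<close> by (rule bonami_const[OF pr])
  next
    case (3 N d)
    let ?P = "\<Pi>\<^sub>M i\<in>{..<N}. std_normal_distribution"
    from "3.prems" obtain A B where *: "F = (\<lambda>x. A x + x N * B x)"
      "A \<in> mlin_poly N (Suc d)" "B \<in> mlin_poly N d" by auto
    have [measurable]: "A \<in> borel_measurable ?P" "B \<in> borel_measurable ?P"
      using mlin_poly_measurable[OF *(2)] mlin_poly_measurable[OF *(3)] by auto
    have Fm [measurable]: "F \<in> borel_measurable (\<Pi>\<^sub>M i\<in>{..<Suc N}. std_normal_distribution)"
      using mlin_poly_measurable[OF "3.prems"(1)] by simp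
    have ins: "(\<integral>\<^sup>+x. ennreal ((F x) ^ (2 * k)) \<partial>(\<Pi>\<^sub>M i\<in>{..<Suc N}. std_normal_distribution))
      = (\<integral>\<^sup>+x. ennreal (\<Sum>j\<le>k. real ((2 * k) choose (2 * j)) * nmom j * ((A x)^2) ^ (k - j) * ((B x)^2) ^ j) \<partial>?P)" for k
    proof -
      have "(\<integral>\<^sup>+x. ennreal ((F x) ^ (2 * k)) \<partial>(\<Pi>\<^sub>M i\<in>insert N {..<N}. std_normal_distribution))
        = (\<integral>\<^sup>+x. \<integral>\<^sup>+t. ennreal ((F (x(N := t))) ^ (2 * k)) \<partial>std_normal_distribution \<partial>?P)"
        using Fm by (intro P.product_nn_integral_insert) (auto simp: lessThan_Suc)
      also have "\<dots> = (\<integral>\<^sup>+x. \<integral>\<^sup>+t. ennreal ((A x + t * B x) ^ (2 * k)) \<partial>std_normal_distribution \<partial>?P)"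
        by (simp add: *(1) mlin_poly_upd[OF *(2)] mlin_poly_upd[OF *(3)])
      finally show ?thesis by (simp only: std_normal_poly lessThan_Suc)
    qed
    define \<alpha> where "\<alpha> = (\<integral>\<^sup>+x. ennreal ((A x)^2) \<partial>?P)"
    define \<beta> where "\<beta> = (\<integral>\<^sup>+x. ennreal ((B x)^2) \<partial>?P)"
    \<comment> \<open>The case k = 1 of \<open>ins\<close>: A and x_N B are orthogonal.\<close>
    have "\<alpha> + \<beta> = (\<integral>\<^sup>+x. ennreal ((F x) ^ (2 * 1)) \<partial>(\<Pi>\<^sub>M i\<in>{..<Suc N}. std_normal_distribution))"
      unfolding ins \<alpha>_def \<beta>_def by (subst nn_integral_add[symmetric]) (auto simp: nmom_def)
    also have "\<dots> < ennreal c" using "3.prems"(3) by simp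
    finally have ab: "\<alpha> + \<beta> < ennreal c" .
    then have fin: "\<alpha> < \<infinity>" "\<beta> < \<infinity>"
      by (auto simp: less_top[symmetric] top_unique)
    define a0 where "a0 = enn2real \<alpha>"
    define b0 where "b0 = enn2real \<beta>"
    have a0: "\<alpha> = ennreal a0" "0 \<le> a0" and b0: "\<beta> = ennreal b0" "0 \<le> b0"
      using fin by (auto simp: a0_def b0_def less_top)
    have "a0 + b0 < c" using ab unfolding a0(1) b0(1) ennreal_plus[OF a0(2) b0(2), symmetric]
      using a0(2) b0(2) by (simp add: ennreal_less_iff del: ennreal_plus)
    \<comment> \<open>Half of the slack goes to each of A and B: both strict hypotheses of the
      induction hold, a and b are positive as Hoelder needs, and a + b = c exactly.\<close>
    define \<eta> where "\<eta> = (c - a0 - b0) / 2"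
    have eta: "0 < \<eta>" using \<open>a0 + b0 < c\<close> by (simp add: \<eta>_def)
    define a where "a = a0 + \<eta>"
    define b where "b = b0 + \<eta>"
    have abc: "a + b = c" by (simp add: a_def b_def \<eta>_def field_simps)
    have pos: "0 < a" "0 < b" using a0 b0 eta by (auto simp: a_def b_def)
    let ?K = "Kbon m"
    have K: "1 \<le> ?K" by (rule Kbon_ge_1)
    have IA: "(\<integral>\<^sup>+x. ennreal (((A x)^2) ^ m) \<partial>?P) \<le> ennreal ((?K ^ Suc d * a) ^ m)"
      using "3.IH"(1)[OF *(2) "3.prems"(2), of a] a0 eta
      by (simp add: \<alpha>_def[symmetric] a_def ennreal_less_iff power_mult[symmetric])
    have IB: "(\<integral>\<^sup>+x. ennreal (((B x)^2) ^ m) \<partial>?P) \<le> ennreal ((?K ^ d * b) ^ m)"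
      using "3.IH"(2)[OF *(3) "3.prems"(2), of b] b0 eta
      by (simp add: \<beta>_def[symmetric] b_def ennreal_less_iff power_mult[symmetric])
    have "(\<integral>\<^sup>+x. ennreal ((F x) ^ (2 * m)) \<partial>(\<Pi>\<^sub>M i\<in>{..<Suc N}. std_normal_distribution))
      = (\<integral>\<^sup>+x. (\<Sum>j\<le>m. ennreal (real ((2 * m) choose (2 * j)) * nmom j) * ennreal (((A x)^2) ^ (m - j) * ((B x)^2) ^ j)) \<partial>?P)"
      unfolding ins
    proof (intro nn_integral_cong)
      fix x
      have nn: "0 \<le> real ((2 * m) choose (2 * j)) * nmom j" "0 \<le> ((A x)^2) ^ (m - j) * ((B x)^2) ^ j" for j
        by simp_all
      show "ennreal (\<Sum>j\<le>m. real ((2 * m) choose (2 * j)) * nmom j * ((A x)^2) ^ (m - j) * ((B x)^2) ^ j)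
        = (\<Sum>j\<le>m. ennreal (real ((2 * m) choose (2 * j)) * nmom j) * ennreal (((A x)^2) ^ (m - j) * ((B x)^2) ^ j))"
        unfolding ennreal_mult[OF nn, symmetric] mult.assoc
        by (rule sum_ennreal[symmetric]) (simp add: mult.assoc)
    qed
    also have "\<dots> = (\<Sum>j\<le>m. ennreal (real ((2 * m) choose (2 * j)) * nmom j) * (\<integral>\<^sup>+x. ennreal (((A x)^2) ^ (m - j) * ((B x)^2) ^ j) \<partial>?P))"
      by (subst nn_integral_sum) (auto simp: nn_integral_cmult)
    also have "\<dots> \<le> (\<Sum>j\<le>m. ennreal (real (m choose j) * ?K ^ j) * ennreal ((?K ^ Suc d * a) ^ (m - j) * (?K ^ d * b) ^ j))"
    proof (intro sum_mono mult_mono)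
      fix j assume j: "j \<in> {..m}"
      then show "ennreal (real ((2 * m) choose (2 * j)) * nmom j) \<le> ennreal (real (m choose j) * ?K ^ j)"
        by (intro ennreal_leI Kbon_coeff) auto
      show "(\<integral>\<^sup>+x. ennreal (((A x)^2) ^ (m - j) * ((B x)^2) ^ j) \<partial>?P) \<le> ennreal ((?K ^ Suc d * a) ^ (m - j) * (?K ^ d * b) ^ j)"
        using IA IB pos K j "3.prems"(2) by (intro holder_from_bounds) auto
    qed auto
    also have "\<dots> = ennreal (\<Sum>j\<le>m. real (m choose j) * ?K ^ j * ((?K ^ Suc d * a) ^ (m - j) * (?K ^ d * b) ^ j))"
    proof -
      have nn: "0 \<le> real (m choose j) * ?K ^ j" "0 \<le> (?K ^ Suc d * a) ^ (m - j) * (?K ^ d * b) ^ j" for j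
        using pos K by simp_all
      show ?thesis
        unfolding ennreal_mult[OF nn, symmetric] by (rule sum_ennreal) (intro mult_nonneg_nonneg nn)
    qed
    also have "(\<Sum>j\<le>m. real (m choose j) * ?K ^ j * ((?K ^ Suc d * a) ^ (m - j) * (?K ^ d * b) ^ j))
       = (\<Sum>j\<le>m. real (m choose j) * (?K ^ Suc d * b) ^ j * (?K ^ Suc d * a) ^ (m - j))"
      by (intro sum.cong refl) (simp add: power_mult_distrib mult_ac)
    also have "\<dots> = (?K ^ Suc d * b + ?K ^ Suc d * a) ^ m" by (rule binomial_ring[symmetric])
    also have "?K ^ Suc d * b + ?K ^ Suc d * a = ?K ^ Suc d * c" unfolding abc[symmetric] by (simp add: algebra_simps)
    finally show ?case .
  qed
qed

section \<open>Space-time and multiple integrals\<close>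

lemma L2_I: "f \<in> borel_measurable N \<Longrightarrow> integrable N (\<lambda>z. (f z)^2) \<Longrightarrow> L2 N f"
  by (simp add: L2_def)

lemma L2_measurable: "L2 N f \<Longrightarrow> f \<in> borel_measurable N"
  by (simp add: L2_def)

lemma L2_integrable: "L2 N f \<Longrightarrow> integrable N (\<lambda>z. (f z)^2)"
  by (simp add: L2_def)

lemma L2_lincomb:
  assumes "L2 N f" "L2 N g" shows "L2 N (\<lambda>z. a * f z + b * g z)"
proof (rule L2_I)
  note [measurable] = assms[THEN L2_measurable]
  show "(\<lambda>z. a * f z + b * g z) \<in> borel_measurable N" by measurable
  have le: "(a * x + b * y)^2 \<le> 2 * a^2 * x^2 + 2 * b^2 * y^2" for x y
    using sum_squares_bound[of "a * x" "b * y"] by (simp add: power2_eq_square algebra_simps)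
  show "integrable N (\<lambda>z. (a * f z + b * g z)^2)"
  proof (rule Bochner_Integration.integrable_bound)
    show "integrable N (\<lambda>z. 2 * a^2 * (f z)^2 + 2 * b^2 * (g z)^2)"
      by (intro Bochner_Integration.integrable_add integrable_mult_right L2_integrable assms)
    show "AE z in N. norm ((a * f z + b * g z)^2) \<le> norm (2 * a^2 * (f z)^2 + 2 * b^2 * (g z)^2)"
      using le by (intro AE_I2) (simp add: abs_of_nonneg)
  qed measurable
qed

lemma L2_diff: "L2 N f \<Longrightarrow> L2 N g \<Longrightarrow> L2 N (\<lambda>z. f z - g z)"
  using L2_lincomb[of N f g 1 "-1"] by simp

lemma L2_zero: "L2 N (\<lambda>z. 0)"
  by (simp add: L2_def)

lemma L2_sum: "(\<And>i. i \<in> S \<Longrightarrow> L2 N (f i)) \<Longrightarrow> L2 N (\<lambda>z. \<Sum>i\<in>S. a i * f i z)"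
proof (induction S rule: infinite_finite_induct)
  case (insert x F)
  then show ?case using L2_lincomb[of N "f x" "\<lambda>z. \<Sum>i\<in>F. a i * f i z" "a x" 1] by simp
qed (auto simp: L2_zero)

text \<open>Shared by \<open>W\<close> and \<open>I\<close>, which are linear up to null sets that
  depend on the arguments; hence an induction over finite sums, each step with its own null
  set.\<close>

lemma AE_linear_sum:
  fixes T :: "('a \<Rightarrow> real) \<Rightarrow> 'w \<Rightarrow> real"
  assumes lin: "\<And>f g a b. L2 N f \<Longrightarrow> L2 N g \<Longrightarrow> (AE \<omega> in M. T (\<lambda>z. a * f z + b * g z) \<omega> = a * T f \<omega> + b * T g \<omega>)"
    and L: "\<And>i. i \<in> S \<Longrightarrow> L2 N (f i)" and S: "finite S"
  shows "AE \<omega> in M. T (\<lambda>z. \<Sum>i\<in>S. a i * f i z) \<omega> = (\<Sum>i\<in>S. a i * T (f i) \<omega>)"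
  using S L
proof (induction S rule: finite_induct)
  case empty
  show ?case using lin[OF L2_zero L2_zero, of 0 0] by simp
next
  case (insert x F)
  have "AE \<omega> in M. T (\<lambda>z. a x * f x z + 1 * (\<Sum>i\<in>F. a i * f i z)) \<omega> = a x * T (f x) \<omega> + 1 * T (\<lambda>z. \<Sum>i\<in>F. a i * f i z) \<omega>"
    by (rule lin) (use insert in \<open>auto intro!: L2_sum\<close>)
  moreover have "AE \<omega> in M. T (\<lambda>z. \<Sum>i\<in>F. a i * f i z) \<omega> = (\<Sum>i\<in>F. a i * T (f i) \<omega>)"
    using insert by auto
  ultimately show ?case
  proof eventually_elim
    case (elim \<omega>)
    have "(\<lambda>z. \<Sum>i\<in>insert x F. a i * f i z) = (\<lambda>z. a x * f x z + 1 * (\<Sum>i\<in>F. a i * f i z))"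
      using insert by simp
    with elim insert show ?case by simp
  qed
qed

lemma ST_eq: "ST = restrict_space lborel ({0..} \<times> cube)"
  by (simp add: ST_def lborel_prod)

lemma ST_region [measurable]: "{0..} \<times> cube \<in> sets (borel :: (real \<times> (real^4)) measure)"
  by (intro borel_Times) auto

lemma space_ST: "space ST = {0..} \<times> cube"
  by (simp add: ST_eq space_restrict_space)

lemma measurable_ST [measurable (raw)]: "f \<in> borel \<rightarrow>\<^sub>M N \<Longrightarrow> f \<in> ST \<rightarrow>\<^sub>M N"
  unfolding ST_eq by (intro measurable_restrict_space1) simp

lemma sigma_finite_ST: "sigma_finite_measure ST"
  unfolding ST_eq by (intro sigma_finite_measure_restrict_space) (auto simp: lborel.sigma_finite_measure_axioms)

interpretation STn: product_sigma_finite "\<lambda>_::nat. ST"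
  by standard (rule sigma_finite_measure.sigma_finite_countable[OF sigma_finite_ST])

lemma emeasure_ST: "A \<in> sets borel \<Longrightarrow> A \<subseteq> {0..} \<times> cube \<Longrightarrow> emeasure ST A = emeasure lborel A"
  unfolding ST_eq by (intro emeasure_restrict_space) auto

lemma sets_ST_I: "A \<in> sets borel \<Longrightarrow> A \<subseteq> {0..} \<times> cube \<Longrightarrow> A \<in> sets ST"
  unfolding ST_eq by (auto simp: sets_restrict_space_iff)

lemma emeasure_ST_slab:
  assumes "A \<in> sets borel" "A \<subseteq> {0..}"
  shows "emeasure ST (A \<times> cube) = emeasure lborel A"
proof -
  have "emeasure ST (A \<times> cube) = emeasure (lborel \<Otimes>\<^sub>M lborel) (A \<times> cube)"
    using assms by (subst emeasure_ST) (auto simp: lborel_prod intro!: borel_Times)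
  also have "\<dots> = emeasure lborel A * emeasure lborel cube"
    using assms by (intro lborel.emeasure_pair_measure_Times) auto
  finally show ?thesis by (simp add: emeasure_cube)
qed

text \<open>Fubini in coordinate i: a measurable exceptional set is null as soon as all its sections
  in that coordinate are null.\<close>

lemma AE_STn_insert:
  assumes P [measurable]: "Measurable.pred (STn n) P" and i: "i < n"
    and ae: "\<And>x. x \<in> space (PiM ({..<n} - {i}) (\<lambda>_. ST)) \<Longrightarrow> AE y in ST. P (x(i := y))"
  shows "AE z in STn n. P z"
proof -
  have eq: "insert i ({..<n} - {i}) = {..<n}" using i by auto
  have m: "(\<lambda>z. indicator {z. \<not> P z} z :: ennreal) \<in> borel_measurable (PiM (insert i ({..<n} - {i})) (\<lambda>_. ST))"
    unfolding eq using P by (simp add: STn_def)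
  have "(\<integral>\<^sup>+z. indicator {z. \<not> P z} z \<partial>STn n) = (\<integral>\<^sup>+x. (\<integral>\<^sup>+y. indicator {z. \<not> P z} (x(i := y)) \<partial>ST) \<partial>PiM ({..<n} - {i}) (\<lambda>_. ST))"
    using STn.product_nn_integral_insert[OF _ _ m] unfolding eq STn_def by simp
  also have "\<dots> = (\<integral>\<^sup>+x. 0 \<partial>PiM ({..<n} - {i}) (\<lambda>_. ST))"
  proof (rule nn_integral_cong)
    fix x assume "x \<in> space (PiM ({..<n} - {i}) (\<lambda>_. ST))"
    from ae[OF this] have "(\<integral>\<^sup>+y. indicator {z. \<not> P z} (x(i := y)) \<partial>ST) = (\<integral>\<^sup>+y. 0 \<partial>ST)"
      by (intro nn_integral_cong_AE) (auto elim!: eventually_mono)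
    then show "(\<integral>\<^sup>+y. indicator {z. \<not> P z} (x(i := y)) \<partial>ST) = 0" by simp
  qed
  finally have "(\<integral>\<^sup>+z. indicator {z. \<not> P z} z \<partial>STn n) = 0" by simp
  then have "AE z in STn n. (indicator {z. \<not> P z} z :: ennreal) = 0"
    by (subst (asm) nn_integral_0_iff_AE) measurable
  then show ?thesis by (auto elim!: eventually_mono simp: indicator_def split: if_splits)
qed

lemma measurable_component_STn [measurable]: "i < n \<Longrightarrow> (\<lambda>z. z i) \<in> STn n \<rightarrow>\<^sub>M ST"
  unfolding STn_def by (rule measurable_component_singleton) simp

lemma measurable_time_STn [measurable]: "i < n \<Longrightarrow> (\<lambda>z. fst (z i)) \<in> borel_measurable (STn n)"
  by (rule measurable_compose[OF measurable_component_STn measurable_ST])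
    (auto intro!: borel_measurable_continuous_onI continuous_on_fst continuous_on_id)

lemma AE_ST_time: "AE y in ST. fst y \<noteq> t"
proof (rule AE_I)
  let ?A = "({t} \<inter> {0..}) \<times> cube"
  show "{y\<in>space ST. \<not> fst y \<noteq> t} \<subseteq> ?A" by (auto simp: space_ST)
  show "emeasure ST ?A = 0"
    by (subst emeasure_ST_slab) (auto intro: emeasure_lborel_countable countable_subset[of _ "{t}"])
  show "?A \<in> sets ST" by (intro sets_ST_I borel_Times) auto
qed

lemma AE_STn_time: assumes "i < n" shows "AE z in STn n. fst (z i) \<noteq> t"
proof (rule AE_STn_insert[OF _ assms])
  have [measurable]: "(\<lambda>z. fst (z i)) \<in> borel_measurable (STn n)" by (rule measurable_time_STn[OF assms])
  show "Measurable.pred (STn n) (\<lambda>z. fst (z i) \<noteq> t)" by measurable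
qed (use AE_ST_time in simp)

text \<open>The diagonals are null already because of the time coordinate. This is what lets step
  functions supported on tuples of distinct cells approximate every kernel.\<close>

lemma AE_STn_distinct:
  assumes "i < n" "j < n" "i \<noteq> j" shows "AE z in STn n. fst (z i) \<noteq> fst (z j)"
proof (rule AE_STn_insert[OF _ assms(1)])
  have [measurable]: "(\<lambda>z. fst (z i)) \<in> borel_measurable (STn n)" "(\<lambda>z. fst (z j)) \<in> borel_measurable (STn n)"
    by (rule measurable_time_STn[OF assms(1)] measurable_time_STn[OF assms(2)])+
  have "Measurable.pred (STn n) (\<lambda>z. fst (z i) - fst (z j) \<noteq> 0)" by measurable
  then show "Measurable.pred (STn n) (\<lambda>z. fst (z i) \<noteq> fst (z j))" by simp
qed (use AE_ST_time assms in simp)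

definition slab :: "nat \<Rightarrow> nat \<Rightarrow> (nat \<Rightarrow> real \<times> (real^4)) set" where
  "slab n U = {z\<in>space (STn n). \<forall>i<n. fst (z i) < real U}"

lemma slab_eq: "slab n U = Pi\<^sub>E {..<n} (\<lambda>_. {0..<real U} \<times> cube)"
proof (rule set_eqI)
  fix z
  show "z \<in> slab n U \<longleftrightarrow> z \<in> Pi\<^sub>E {..<n} (\<lambda>_. {0..<real U} \<times> cube)"
    unfolding slab_def STn_def space_PiM space_ST mem_Collect_eq PiE_iff mem_Times_iff
    by (simp only: lessThan_iff Ball_def atLeast_iff atLeastLessThan_iff) blast
qed

lemma slab_factor: "{0..<real U} \<times> cube \<in> sets ST"
  by (intro sets_ST_I borel_Times) auto

lemma slab_sets [measurable]: "slab n U \<in> sets (STn n)"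
  unfolding slab_eq STn_def by (intro sets_PiM_I_finite slab_factor) auto

lemma emeasure_slab: "emeasure (STn n) (slab n U) = ennreal (real U ^ n)"
proof -
  have "emeasure (STn n) (slab n U) = (\<Prod>i<n. emeasure ST ({0..<real U} \<times> cube))"
    unfolding STn_def slab_eq by (rule STn.emeasure_PiM) (auto simp: slab_factor)
  also have "\<dots> = ennreal (real U ^ n)"
    by (subst emeasure_ST_slab) (auto simp: ennreal_power)
  finally show ?thesis .
qed

lemma integrable_slab: "integrable (STn n) (\<lambda>z. c * indicator (slab n U) z :: real)"
  using emeasure_slab[of n U] slab_sets[of n U]
  by (intro integrable_mult_right) (simp add: integrable_indicator_iff)

text \<open>Fatou's lemma in the form in which moment bounds pass to almost sure limits: the bounds
  may move with the index as long as they converge.\<close>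

lemma nn_integral_fatou_le:
  fixes u :: "nat \<Rightarrow> 'a \<Rightarrow> ennreal"
  assumes [measurable]: "\<And>k. u k \<in> borel_measurable M"
    and lim: "AE x in M. (\<lambda>k. u k x) \<longlonglongrightarrow> v x"
    and le: "eventually (\<lambda>k. (\<integral>\<^sup>+x. u k x \<partial>M) \<le> C k) sequentially" and C: "C \<longlonglongrightarrow> D"
  shows "(\<integral>\<^sup>+x. v x \<partial>M) \<le> D"
proof -
  have "(\<integral>\<^sup>+x. v x \<partial>M) = (\<integral>\<^sup>+x. liminf (\<lambda>k. u k x) \<partial>M)"
    using lim by (intro nn_integral_cong_AE) (auto elim!: eventually_mono dest: lim_imp_Liminf[rotated])
  also have "\<dots> \<le> liminf (\<lambda>k. \<integral>\<^sup>+x. u k x \<partial>M)"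
    by (rule nn_integral_liminf) simp
  also have "\<dots> \<le> liminf C" by (rule Liminf_mono[OF le])
  also have "\<dots> = D" using C by (intro lim_imp_Liminf) auto
  finally show ?thesis .
qed

section \<open>Grid cells in space-time\<close>

definition grid_floor :: "nat \<Rightarrow> real \<times> (real^4) \<Rightarrow> real \<times> (real^4)" where
  "grid_floor N z = (of_int \<lfloor>real N * fst z\<rfloor> / real N, \<chi> i. of_int \<lfloor>real N * snd z $ i\<rfloor> / real N)"

lemma floor_div_tendsto: "(\<lambda>N. of_int \<lfloor>real (Suc N) * x\<rfloor> / real (Suc N)) \<longlonglongrightarrow> x"
proof (rule tendsto_sandwich)
  show "eventually (\<lambda>N. x - 1 / real (Suc N) \<le> of_int \<lfloor>real (Suc N) * x\<rfloor> / real (Suc N)) sequentially"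
  proof (intro always_eventually allI)
    fix N
    have "real (Suc N) * x - 1 \<le> of_int \<lfloor>real (Suc N) * x\<rfloor>" by linarith
    then have "(real (Suc N) * x - 1) / real (Suc N) \<le> of_int \<lfloor>real (Suc N) * x\<rfloor> / real (Suc N)"
      by (intro divide_right_mono) auto
    then show "x - 1 / real (Suc N) \<le> of_int \<lfloor>real (Suc N) * x\<rfloor> / real (Suc N)"
      by (simp add: diff_divide_distrib del: of_nat_Suc)
  qed
  show "eventually (\<lambda>N. of_int \<lfloor>real (Suc N) * x\<rfloor> / real (Suc N) \<le> x) sequentially"
  proof (intro always_eventually allI)
    fix N
    have "of_int \<lfloor>real (Suc N) * x\<rfloor> \<le> real (Suc N) * x" by (rule of_int_floor_le)
    then have "of_int \<lfloor>real (Suc N) * x\<rfloor> / real (Suc N) \<le> real (Suc N) * x / real (Suc N)"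
      by (intro divide_right_mono) auto
    then show "of_int \<lfloor>real (Suc N) * x\<rfloor> / real (Suc N) \<le> x" by (simp del: of_nat_Suc)
  qed
  have "(\<lambda>N. x - 1 / real (Suc N)) \<longlonglongrightarrow> x - 0"
    by (intro tendsto_intros LIMSEQ_Suc[OF lim_1_over_n])
  then show "(\<lambda>N. x - 1 / real (Suc N)) \<longlonglongrightarrow> x" by simp
qed simp

lemma grid_floor_tendsto: "(\<lambda>N. grid_floor (Suc N) z) \<longlonglongrightarrow> z"
proof -
  have "(\<lambda>N. grid_floor (Suc N) z) \<longlonglongrightarrow> (fst z, \<chi> i. snd z $ i)"
    unfolding grid_floor_def by (intro tendsto_Pair tendsto_vec_lambda floor_div_tendsto)
  then show ?thesis by simp
qed

lemma grid_floor_measurable [measurable]: "grid_floor N \<in> borel_measurable borel"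
proof -
  have [measurable]: "fst \<in> borel \<rightarrow>\<^sub>M (borel::real measure)" "(\<lambda>z. snd z $ i) \<in> borel_measurable (borel :: (real \<times> (real^4)) measure)" for i
    by (auto intro!: borel_measurable_continuous_onI continuous_on_fst continuous_on_id continuous_intros)
  have "(\<lambda>z::real \<times> (real^4). \<chi> i. of_int \<lfloor>real N * snd z $ i\<rfloor> / real N) \<in> borel_measurable borel"
    by (subst borel_measurable_euclidean_space) (auto simp: Basis_vec_def inner_axis)
  then show ?thesis unfolding grid_floor_def by measurable
qed

definition gridset :: "nat \<Rightarrow> nat \<Rightarrow> (real \<times> (real^4)) set" where
  "gridset N U = grid_floor N ` ({0..<real U} \<times> cube)"

lemma finite_gridset: "finite (gridset N U)"
proof -
  let ?S = "{0..\<lfloor>real N * real U\<rfloor>} \<times> Pi\<^sub>E (UNIV::4 set) (\<lambda>_. {0..int N})"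
  have "gridset N U \<subseteq> (\<lambda>(a, b). (of_int a / real N, \<chi> i. of_int (b i) / real N)) ` ?S"
  proof
    fix c assume "c \<in> gridset N U"
    then obtain q y where c: "c = grid_floor N (q, y)" "0 \<le> q" "q < real U" "y \<in> cube" by (auto simp: gridset_def)
    have "(\<lfloor>real N * q\<rfloor>, \<lambda>i. \<lfloor>real N * y $ i\<rfloor>) \<in> ?S"
    proof -
      have "\<lfloor>real N * q\<rfloor> \<le> \<lfloor>real N * real U\<rfloor>" using c by (intro floor_mono mult_left_mono) auto
      moreover have "\<lfloor>real N * y $ i\<rfloor> \<le> int N" for i
      proof -
        have "real N * y $ i \<le> real N * 1" using c by (intro mult_left_mono) (auto simp: cube_def less_imp_le)
        then have "\<lfloor>real N * y $ i\<rfloor> \<le> \<lfloor>real N * 1\<rfloor>" by (rule floor_mono)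
        then show ?thesis by simp
      qed
      ultimately show ?thesis using c by (auto simp: cube_def PiE_iff)
    qed
    then show "c \<in> (\<lambda>(a, b). (of_int a / real N, \<chi> i. of_int (b i) / real N)) ` ?S"
      by (rule rev_image_eqI) (simp add: c grid_floor_def)
  qed
  moreover have "finite ?S" by (intro finite_cartesian_product finite_PiE) auto
  ultimately show ?thesis by (metis finite_imageI finite_subset)
qed

definition gbox :: "nat \<Rightarrow> real \<times> (real^4) \<Rightarrow> (real \<times> (real^4)) set" where
  "gbox N c = {z\<in>{0..} \<times> cube. grid_floor N z = c}"

lemma gbox_borel [measurable]: "gbox N c \<in> sets borel"
proof -
  have "gbox N c = grid_floor N -` {c} \<inter> ({0..} \<times> cube)" by (auto simp: gbox_def)
  also have "\<dots> \<in> sets borel"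
    by (intro sets.Int ST_region measurable_sets_borel[OF grid_floor_measurable]) auto
  finally show ?thesis .
qed

lemma gbox_ST [measurable]: "gbox N c \<in> sets ST"
  by (intro sets_ST_I) (auto simp: gbox_def)

lemma gbox_disjoint: "c \<noteq> c' \<Longrightarrow> gbox N c \<inter> gbox N c' = {}"
  by (auto simp: gbox_def)

lemma floor_cell:
  assumes "N > 0" "of_int k / real N < x" "x < of_int k / real N + 1 / real N"
  shows "\<lfloor>real N * x\<rfloor> = k"
  using assms by (intro floor_unique) (auto simp: field_simps)

text \<open>A cell has time length 1/N \<le> 1, so it ends before time U + 1; this crude bound
  serves to show that cells have finite mass.\<close>

lemma gbox_slab:
  assumes "N > 0" "c \<in> gridset N U"
  shows "gbox N c \<subseteq> {0..<real (U + 1)} \<times> cube"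
proof
  fix z assume z: "z \<in> gbox N c"
  from assms obtain w where w: "c = grid_floor N w" "fst w < real U" by (auto simp: gridset_def)
  have "\<lfloor>real N * fst z\<rfloor> = \<lfloor>real N * fst w\<rfloor>" using z w assms by (auto simp: gbox_def grid_floor_def)
  then have "real N * fst z < real N * fst w + 1" by linarith
  also have "\<dots> \<le> real N * (fst w + 1)" using assms by (simp add: algebra_simps)
  finally have "fst z < fst w + 1" using assms by simp
  then show "z \<in> {0..<real (U + 1)} \<times> cube" using z w by (auto simp: gbox_def mem_Times_iff)
qed

lemma emeasure_gbox_finite:
  assumes "N > 0" "c \<in> gridset N U" shows "emeasure ST (gbox N c) < \<infinity>"
proof -
  have "emeasure ST (gbox N c) \<le> emeasure ST ({0..<real (U + 1)} \<times> cube)"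
    by (intro emeasure_mono gbox_slab assms slab_factor)
  also have "\<dots> = ennreal (real (U + 1))" by (subst emeasure_ST_slab) auto
  also have "\<dots> < \<infinity>" by simp
  finally show ?thesis .
qed

text \<open>The Gaussian variable of a cell is divided by the square root of its mass. The side of
  the cube is a multiple of the mesh, so a corner inside the cube leaves room for a full open
  cell.\<close>

lemma emeasure_gbox_pos:
  assumes "N > 0" "c \<in> gridset N U" shows "0 < emeasure ST (gbox N c)"
proof -
  from assms obtain q y where w: "c = grid_floor N (q, y)" "0 \<le> q" "y \<in> cube" by (auto simp: gridset_def)
  have q0: "0 \<le> fst c" using w by (simp add: grid_floor_def)
  have y0: "0 \<le> snd c $ i" "snd c $ i + 1 / real N \<le> 1" for i
  proof -
    show "0 \<le> snd c $ i" using w by (simp add: grid_floor_def cube_def)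
    have "real N * y $ i < real N * 1" using w assms by (intro mult_strict_left_mono) (auto simp: cube_def)
    then have "\<lfloor>real N * y $ i\<rfloor> < int N" by (simp add: floor_less_iff)
    then have "real_of_int (\<lfloor>real N * y $ i\<rfloor> + 1) \<le> real_of_int (int N)" by (intro of_int_le_iff[THEN iffD2]) simp
    then show "snd c $ i + 1 / real N \<le> 1" using assms w by (simp add: grid_floor_def field_simps)
  qed
  let ?v = "(\<chi> i. 1 / real N) :: real^4"
  have "{fst c<..<fst c + 1 / real N} \<times> box (snd c) (snd c + ?v) \<subseteq> gbox N c"
  proof
    fix z assume z: "z \<in> {fst c<..<fst c + 1 / real N} \<times> box (snd c) (snd c + ?v)"
    then have zq: "fst c < fst z" "fst z < fst c + 1 / real N" and
      zy: "\<And>i. snd c $ i < snd z $ i" "\<And>i. snd z $ i < snd c $ i + 1 / real N"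
      by (auto simp: mem_box_cart mem_Times_iff)
    have "\<lfloor>real N * fst z\<rfloor> = \<lfloor>real N * q\<rfloor>"
      using zq w assms by (intro floor_cell) (auto simp: grid_floor_def)
    moreover have "\<lfloor>real N * snd z $ i\<rfloor> = \<lfloor>real N * y $ i\<rfloor>" for i
      using zy[of i] w assms by (intro floor_cell) (auto simp: grid_floor_def)
    ultimately have "grid_floor N z = c" by (simp add: w grid_floor_def)
    moreover have "z \<in> {0..} \<times> cube"
    proof -
      have "0 \<le> snd z $ i \<and> snd z $ i < 1" for i using zy[of i] y0[of i] by linarith
      then show ?thesis using zq q0 by (auto simp: mem_Times_iff cube_def)
    qed
    ultimately show "z \<in> gbox N c" by (simp add: gbox_def)
  qed
  then have "emeasure lborel ({fst c<..<fst c + 1 / real N} \<times> box (snd c) (snd c + ?v)) \<le> emeasure lborel (gbox N c)"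
    by (intro emeasure_mono) auto
  also have "\<dots> = emeasure ST (gbox N c)" by (rule emeasure_ST[symmetric]) (auto simp: gbox_def)
  finally have le: "emeasure lborel ({fst c<..<fst c + 1 / real N} \<times> box (snd c) (snd c + ?v)) \<le> emeasure ST (gbox N c)" .
  have "emeasure lborel ({fst c<..<fst c + 1 / real N} \<times> box (snd c) (snd c + ?v))
    = emeasure lborel {fst c<..<fst c + 1 / real N} * emeasure lborel (box (snd c) (snd c + ?v))"
    unfolding lborel_prod[symmetric] by (intro lborel.emeasure_pair_measure_Times) auto
  also have "\<dots> \<noteq> 0"
  proof -
    have "emeasure lborel (box (snd c) (snd c + ?v)) = ennreal (\<Prod>b\<in>Basis. ?v \<bullet> b)"
      using assms by (subst emeasure_lborel_box) (auto simp: Basis_vec_def inner_axis inner_add_left)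
    moreover have "(\<Prod>b\<in>Basis. ?v \<bullet> b) > 0" using assms by (intro prod_pos) (auto simp: Basis_vec_def inner_axis)
    ultimately show ?thesis using assms by (auto simp: ennreal_eq_0_iff)
  qed
  finally show ?thesis using le by (metis not_gr_zero le_zero_eq)
qed

section \<open>Hypercontractivity of multiple integrals\<close>

locale wiener_chaos = prob_space M for M :: "'w measure" +
  fixes W :: "(real \<times> (real^4) \<Rightarrow> real) \<Rightarrow> 'w \<Rightarrow> real"
    and n :: nat
    and I :: "((nat \<Rightarrow> real \<times> (real^4)) \<Rightarrow> real) \<Rightarrow> 'w \<Rightarrow> real"
  assumes iso: "isonormal M W" and wi: "wiener_integral M W n I"
begin

lemma I_measurable: "L2 (STn n) f \<Longrightarrow> I f \<in> borel_measurable M"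
  and I_sq_integrable: "L2 (STn n) f \<Longrightarrow> integrable M (\<lambda>\<omega>. (I f \<omega>)^2)"
  and I_bound: "L2 (STn n) f \<Longrightarrow> (\<integral>\<omega>. (I f \<omega>)^2 \<partial>M) \<le> fact n * (\<integral>z. (f z)^2 \<partial>STn n)"
  and I_lin: "L2 (STn n) f \<Longrightarrow> L2 (STn n) g \<Longrightarrow> AE \<omega> in M. I (\<lambda>z. a * f z + b * g z) \<omega> = a * I f \<omega> + b * I g \<omega>"
  and I_prod: "(\<And>i. i < n \<Longrightarrow> A i \<in> sets ST \<and> emeasure ST (A i) < \<infinity>) \<Longrightarrow> disjoint_family_on A {..<n} \<Longrightarrow>
        (AE \<omega> in M. I (\<lambda>z. \<Prod>i<n. indicator (A i) (z i)) \<omega> = (\<Prod>i<n. W (indicator (A i)) \<omega>))"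
  using wi unfolding wiener_integral_def by blast+

lemma I_diff: "L2 (STn n) f \<Longrightarrow> L2 (STn n) g \<Longrightarrow> AE \<omega> in M. I (\<lambda>z. f z - g z) \<omega> = I f \<omega> - I g \<omega>"
  using I_lin[of f g 1 "-1"] by simp

lemma I_sum: "(\<And>i. i \<in> S \<Longrightarrow> L2 (STn n) (f i)) \<Longrightarrow> finite S \<Longrightarrow>
    AE \<omega> in M. I (\<lambda>z. \<Sum>i\<in>S. a i * f i z) \<omega> = (\<Sum>i\<in>S. a i * I (f i) \<omega>)"
  by (rule AE_linear_sum[where N="STn n"]) (use I_lin in auto)

text \<open>The strict inequality makes the property stable under $L^2$ limits of $f$.\<close>

definition hypercontr :: "((nat \<Rightarrow> real \<times> (real^4)) \<Rightarrow> real) \<Rightarrow> bool" where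
  "hypercontr f \<longleftrightarrow> L2 (STn n) f \<and> (\<forall>m>0. \<forall>c. fact n * (\<integral>z. (f z)^2 \<partial>STn n) < c \<longrightarrow>
     (\<integral>\<^sup>+\<omega>. ennreal ((I f \<omega>) ^ (2 * m)) \<partial>M) \<le> ennreal ((Kbon m ^ n * c) ^ m))"

text \<open>Along a subsequence the integrals converge almost surely, and Fatou transfers the moment
  bound. The room left by the strict inequality lets \<open>u k\<close> satisfy the hypothesis with
  the same c for all large k.\<close>

lemma hypercontr_closed:
  assumes h: "\<And>k. hypercontr (u k)" and f: "L2 (STn n) f"
    and lim: "(\<lambda>k. \<integral>z. (u k z - f z)^2 \<partial>STn n) \<longlonglongrightarrow> 0"
  shows "hypercontr f"
  unfolding hypercontr_def
proof (intro conjI f allI impI)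
  fix m :: nat and c :: real
  assume m: "0 < m" and c: "fact n * (\<integral>z. (f z)^2 \<partial>STn n) < c"
  have u: "L2 (STn n) (u k)" for k using h by (simp add: hypercontr_def)
  note [measurable] = I_measurable[OF u] I_measurable[OF f] L2_measurable[OF u] L2_measurable[OF f]
  let ?E = "\<lambda>k. \<integral>z. (u k z - f z)^2 \<partial>STn n"
  define S where "S = (\<integral>z. (f z)^2 \<partial>STn n)"
  have S0: "0 \<le> S" unfolding S_def by simp
  define p where "p = (fact n :: real)"
  have p0: "0 < p" by (simp add: p_def)
  \<comment> \<open>Chosen so that (1 + \<delta>) p S is still below c; the 1 in the denominator
    covers S = 0.\<close>
  define \<delta> where "\<delta> = (c - p * S) / (2 * (p * S + 1))"
  have pS: "0 \<le> p * S" using S0 p0 by simp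
  have d: "0 < \<delta>" using c pS by (simp add: \<delta>_def S_def[symmetric] p_def[symmetric])
  have dS: "p * ((1 + \<delta>) * S) < c"
  proof -
    have "\<delta> * (p * S) \<le> \<delta> * (p * S + 1)" using d by simp
    also have "\<dots> = (c - p * S) / 2"
    proof -
      have "x / (2 * T) * T = x / 2" if "0 < T" for x T :: real using that by simp
      from this[of "p * S + 1"] show ?thesis using pS unfolding \<delta>_def by simp
    qed
    also have "\<dots> < c - p * S"
    proof -
      have h: "x / 2 < x" if "0 < x" for x :: real using that by simp
      show ?thesis by (rule h) (use c in \<open>simp only: S_def p_def diff_gt_0_iff_gt\<close>)
    qed
    finally have "\<delta> * (p * S) + p * S < c" by linarith
    then show ?thesis by (simp add: algebra_simps)
  qed
  \<comment> \<open>Young's inequality with parameter \<delta> compares the squared norms of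
    \<open>u k\<close> and f up to a multiple of their squared distance.\<close>
  have ub: "(\<integral>z. (u k z)^2 \<partial>STn n) \<le> (1 + \<delta>) * S + (1 + 1 / \<delta>) * ?E k" for k
  proof -
    have le: "(a + b)^2 \<le> (1 + \<delta>) * a^2 + (1 + 1 / \<delta>) * b^2" for a b :: real
    proof -
      have "0 \<le> (\<delta> * a - b)^2 / \<delta>" using d by simp
      also have "(\<delta> * a - b)^2 / \<delta> = \<delta> * a^2 - 2 * a * b + b^2 / \<delta>" using d by (simp add: power2_eq_square field_simps)
      finally show ?thesis by (simp add: power2_eq_square algebra_simps)
    qed
    have "(\<integral>z. (u k z)^2 \<partial>STn n) \<le> (\<integral>z. (1 + \<delta>) * (f z)^2 + (1 + 1 / \<delta>) * (u k z - f z)^2 \<partial>STn n)"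
    proof (rule integral_mono)
      show "integrable (STn n) (\<lambda>z. (1 + \<delta>) * (f z)^2 + (1 + 1 / \<delta>) * (u k z - f z)^2)"
        by (intro Bochner_Integration.integrable_add integrable_mult_right L2_integrable f L2_diff u)
      show "(u k z)^2 \<le> (1 + \<delta>) * (f z)^2 + (1 + 1 / \<delta>) * (u k z - f z)^2" for z
        using le[of "f z" "u k z - f z"] by simp
    qed (rule L2_integrable[OF u])
    also have "\<dots> = (1 + \<delta>) * S + (1 + 1 / \<delta>) * ?E k"
      unfolding S_def by (subst Bochner_Integration.integral_add)
        (auto intro!: integrable_mult_right L2_integrable f L2_diff u)
    finally show ?thesis .
  qed
  have "(\<lambda>k. p * ((1 + \<delta>) * S + (1 + 1 / \<delta>) * ?E k)) \<longlonglongrightarrow> p * ((1 + \<delta>) * S + (1 + 1 / \<delta>) * 0)"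
    by (intro tendsto_intros lim)
  then have "eventually (\<lambda>k. p * ((1 + \<delta>) * S + (1 + 1 / \<delta>) * ?E k) < c) sequentially"
    using dS by (intro order_tendstoD(2)) auto
  then have ev: "eventually (\<lambda>k. (\<integral>\<^sup>+\<omega>. ennreal ((I (u k) \<omega>) ^ (2 * m)) \<partial>M) \<le> ennreal ((Kbon m ^ n * c) ^ m)) sequentially"
  proof eventually_elim
    case (elim k)
    have "fact n * (\<integral>z. (u k z)^2 \<partial>STn n) < c"
      using mult_left_mono[OF ub[of k], of p] elim p0 unfolding p_def by linarith
    then show ?case using h[of k] m by (simp add: hypercontr_def)
  qed
  define D where "D k \<omega> = I (u k) \<omega> - I f \<omega>" for k \<omega>
  have Dae: "AE \<omega> in M. (I (\<lambda>z. u k z - f z) \<omega>)^2 = (D k \<omega>)^2" for k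
    using I_diff[OF u f, of k] unfolding D_def by eventually_elim simp
  have [measurable]: "D k \<in> borel_measurable M" for k unfolding D_def by measurable
  have Im: "I (\<lambda>z. u k z - f z) \<in> borel_measurable M" for k by (rule I_measurable[OF L2_diff[OF u f]])
  have Dint: "integrable M (\<lambda>\<omega>. (D k \<omega>)^2)" for k
    using I_sq_integrable[OF L2_diff[OF u f], of k] Im[of k] Dae[of k]
    by (subst integrable_cong_AE[where g="\<lambda>\<omega>. (I (\<lambda>z. u k z - f z) \<omega>)^2"]) (auto elim: eventually_mono)
  have Dle: "(\<integral>\<omega>. norm ((D k \<omega>)^2) \<partial>M) \<le> p * ?E k" for k
  proof -
    have "(\<integral>\<omega>. norm ((D k \<omega>)^2) \<partial>M) = (\<integral>\<omega>. (I (\<lambda>z. u k z - f z) \<omega>)^2 \<partial>M)"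
      using Im[of k] Dae[of k] by (intro integral_cong_AE) (auto elim: eventually_mono)
    then show ?thesis using I_bound[OF L2_diff[OF u f], of k] by (simp add: p_def)
  qed
  \<comment> \<open>The second-moment bound turns L^2 convergence of the kernels into L^2
    convergence of the integrals.\<close>
  have D0: "(\<lambda>k. \<integral>\<omega>. norm ((D k \<omega>)^2) \<partial>M) \<longlonglongrightarrow> 0"
  proof (rule tendsto_sandwich[OF _ _ tendsto_const])
    show "(\<lambda>k. p * ?E k) \<longlonglongrightarrow> 0" using tendsto_mult_left[OF lim, of p] by simp
  qed (use Dle in auto)
  obtain r where r: "strict_mono r" "AE \<omega> in M. (\<lambda>k. (D (r k) \<omega>)^2) \<longlonglongrightarrow> 0"
    using tendsto_L1_AE_subseq[OF Dint D0] by blast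
  show "(\<integral>\<^sup>+\<omega>. ennreal ((I f \<omega>) ^ (2 * m)) \<partial>M) \<le> ennreal ((Kbon m ^ n * c) ^ m)"
  proof (rule nn_integral_fatou_le[where u="\<lambda>k \<omega>. ennreal ((I (u (r k)) \<omega>) ^ (2 * m))"])
    show "AE \<omega> in M. (\<lambda>k. ennreal ((I (u (r k)) \<omega>) ^ (2 * m))) \<longlonglongrightarrow> ennreal ((I f \<omega>) ^ (2 * m))"
      using r(2)
    proof eventually_elim
      case (elim \<omega>)
      then have "(\<lambda>k. sqrt ((D (r k) \<omega>)^2)) \<longlonglongrightarrow> sqrt 0" by (rule tendsto_real_sqrt)
      then have "(\<lambda>k. D (r k) \<omega>) \<longlonglongrightarrow> 0" by (simp add: tendsto_rabs_zero_iff)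
      then have "(\<lambda>k. D (r k) \<omega> + I f \<omega>) \<longlonglongrightarrow> 0 + I f \<omega>" by (intro tendsto_intros)
      then have "(\<lambda>k. I (u (r k)) \<omega>) \<longlonglongrightarrow> I f \<omega>" by (simp add: D_def)
      then show ?case by (intro tendsto_ennrealI tendsto_power)
    qed
    show "eventually (\<lambda>k. (\<integral>\<^sup>+\<omega>. ennreal ((I (u (r k)) \<omega>) ^ (2 * m)) \<partial>M) \<le> ennreal ((Kbon m ^ n * c) ^ m)) sequentially"
      using eventually_subseq[OF r(1) ev] .
  qed simp_all
qed

lemma W_sum:
  assumes "finite S" "\<And>i. i \<in> S \<Longrightarrow> L2 ST (h i)"
  shows "AE \<omega> in M. W (\<lambda>z. \<Sum>i\<in>S. a i * h i z) \<omega> = (\<Sum>i\<in>S. a i * W (h i) \<omega>)"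
  by (rule AE_linear_sum[where N=ST]) (use iso assms in \<open>auto simp: isonormal_def\<close>)

lemma W_measurable: "L2 ST h \<Longrightarrow> W h \<in> borel_measurable M"
  using iso by (simp add: isonormal_def)

lemma L2_indicator: "A \<in> sets ST \<Longrightarrow> emeasure ST A < \<infinity> \<Longrightarrow> L2 ST (indicator A)"
proof (rule L2_I)
  assume A: "A \<in> sets ST" "emeasure ST A < \<infinity>"
  have "(\<lambda>z. (indicator A z :: real)^2) = indicator A" by (auto simp: indicator_def)
  then show "integrable ST (\<lambda>z. (indicator A z :: real)^2)" using A by (simp only: integrable_real_indicator)
qed auto

lemma W_char:
  assumes "L2 ST h"
  shows "(LINT \<omega>|M. iexp (W h \<omega>)) = complex_of_real (exp (- (\<integral>z. (h z)^2 \<partial>ST) / 2))"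
proof -
  have [measurable]: "W h \<in> borel_measurable M" by (rule W_measurable[OF assms])
  have "char (distr M borel (W h)) 1 = complex_of_real (exp (- (1^2 * (\<integral>z. (h z)^2 \<partial>ST)) / 2))"
    using iso assms unfolding isonormal_def by blast
  moreover have "char (distr M borel (W h)) 1 = (LINT \<omega>|M. iexp (W h \<omega>))"
    by (simp add: char_def integral_distr)
  ultimately show ?thesis by simp
qed

text \<open>On disjoint boxes the squared norm of a combination of indicators is the sum of the
  squares, so every linear combination of the normalised variables has the characteristic function
  of independent standard normals. Linearity of \<open>W\<close> is invoked for one combination at a
  time, hence its null sets cause no trouble.\<close>

lemma joint_normal_boxes:
  fixes B :: "nat \<Rightarrow> (real \<times> (real^4)) set"
  assumes B: "\<And>j. j < K \<Longrightarrow> B j \<in> sets ST" "\<And>j. j < K \<Longrightarrow> emeasure ST (B j) < \<infinity>" "\<And>j. j < K \<Longrightarrow> 0 < emeasure ST (B j)"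
    and disj: "\<And>i j. i < K \<Longrightarrow> j < K \<Longrightarrow> i \<noteq> j \<Longrightarrow> B i \<inter> B j = {}"
  shows "distr M (\<Pi>\<^sub>M i\<in>{..<K}. std_normal_distribution) (\<lambda>\<omega>. \<lambda>i\<in>{..<K}. W (indicator (B i)) \<omega> / sqrt (measure ST (B i)))
     = (\<Pi>\<^sub>M i\<in>{..<K}. std_normal_distribution)"
proof (rule distr_joint_std_normal)
  have L: "L2 ST (indicator (B j))" if "j < K" for j using B that by (intro L2_indicator)
  define s where "s j = sqrt (measure ST (B j))" for j
  have mp: "0 < measure ST (B j)" if "j < K" for j
    using B[OF that] by (simp add: measure_def enn2real_positive_iff)
  show "prob_space M" by (rule prob_space_axioms)
  show "(\<lambda>\<omega>. W (indicator (B i)) \<omega> / sqrt (measure ST (B i))) \<in> borel_measurable M" if "i < K" for i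
    using W_measurable[OF L[OF that]] by measurable
  fix t :: "nat \<Rightarrow> real"
  let ?h = "\<lambda>z. \<Sum>i\<in>{..<K}. (t i / s i) * indicator (B i) z"
  have Lh: "L2 ST ?h" by (rule L2_sum) (use L in auto)
  have "AE \<omega> in M. W ?h \<omega> = (\<Sum>i\<in>{..<K}. (t i / s i) * W (indicator (B i)) \<omega>)"
    by (rule W_sum) (use L in auto)
  then have "(LINT \<omega>|M. iexp (\<Sum>i<K. t i * (W (indicator (B i)) \<omega> / sqrt (measure ST (B i))))) = (LINT \<omega>|M. iexp (W ?h \<omega>))"
  proof (intro integral_cong_AE)
    have [measurable]: "W ?h \<in> borel_measurable M" by (rule W_measurable[OF Lh])
    have [measurable]: "(\<lambda>\<omega>. \<Sum>i<K. t i * (W (indicator (B i)) \<omega> / sqrt (measure ST (B i)))) \<in> borel_measurable M"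
      by (intro borel_measurable_sum borel_measurable_times borel_measurable_divide W_measurable L) auto
    show "(\<lambda>\<omega>. iexp (W ?h \<omega>)) \<in> borel_measurable M"
      "(\<lambda>\<omega>. iexp (\<Sum>i<K. t i * (W (indicator (B i)) \<omega> / sqrt (measure ST (B i))))) \<in> borel_measurable M"
      by measurable
  qed (auto simp: s_def elim!: eventually_mono)
  also have "\<dots> = complex_of_real (exp (- (\<integral>z. (?h z)^2 \<partial>ST) / 2))" by (rule W_char[OF Lh])
  also have "(\<integral>z. (?h z)^2 \<partial>ST) = (\<integral>z. (\<Sum>i\<in>{..<K}. (t i / s i)^2 * indicator (B i) z) \<partial>ST)"
  proof (intro Bochner_Integration.integral_cong refl)
    fix z
    show "(?h z)^2 = (\<Sum>i\<in>{..<K}. (t i / s i)^2 * indicator (B i) z)"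
    proof (cases "\<exists>j<K. z \<in> B j")
      case True
      then obtain j where j: "j < K" "z \<in> B j" by auto
      have ind: "indicator (B i) z = (if i = j then 1 else 0 :: real)" if "i < K" for i
        using disj[OF that j(1)] j that by (auto simp: indicator_def)
      have "(\<Sum>i\<in>{..<K}. g i * indicator (B i) z) = (g j :: real)" for g
      proof -
        have "(\<Sum>i\<in>{..<K}. g i * indicator (B i) z) = (\<Sum>i\<in>{..<K}. if i = j then g i else 0)"
          by (intro sum.cong refl) (simp add: ind)
        then show ?thesis using j by simp
      qed
      then show ?thesis by (simp only:)
    next
      case False
      then have "indicator (B i) z = (0::real)" if "i < K" for i using that by auto
      then show ?thesis by simp
    qed
  qed
  also have "\<dots> = (\<Sum>i\<in>{..<K}. (t i / s i)^2 * measure ST (B i))"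
    using B by (subst Bochner_Integration.integral_sum) (auto intro!: integrable_mult_right simp: integrable_indicator_iff measure_def[symmetric])
  also have "\<dots> = (\<Sum>i<K. (t i)^2)"
    using mp by (intro sum.cong refl) (auto simp: s_def power_divide less_imp_le dest!: mp[THEN less_imp_neq])
  finally show "(LINT \<omega>|M. iexp (\<Sum>i<K. t i * (W (indicator (B i)) \<omega> / sqrt (measure ST (B i))))) = complex_of_real (exp (- (\<Sum>i<K. (t i)^2) / 2))" .
qed

lemma L2_prod_indicator:
  assumes "\<And>i. i < n \<Longrightarrow> A i \<in> sets ST" "\<And>i. i < n \<Longrightarrow> emeasure ST (A i) < \<infinity>"
  shows "L2 (STn n) (\<lambda>z. \<Prod>i<n. indicator (A i) (z i))"
proof (rule L2_I)
  have "integrable (STn n) (\<lambda>z. \<Prod>i\<in>{..<n}. indicator (A i) (z i) :: real)"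
    unfolding STn_def by (rule STn.product_integrable_prod) (use assms in \<open>auto simp: integrable_indicator_iff\<close>)
  moreover have "(\<lambda>z. (\<Prod>i<n. indicator (A i) (z i) :: real)^2) = (\<lambda>z. \<Prod>i<n. indicator (A i) (z i))"
    by (auto simp: power2_eq_square prod.distrib[symmetric] indicator_def intro!: prod.cong)
  ultimately show "integrable (STn n) (\<lambda>z. (\<Prod>i<n. indicator (A i) (z i) :: real)^2)"
    "(\<lambda>z. \<Prod>i<n. indicator (A i) (z i) :: real) \<in> borel_measurable (STn n)" by (simp_all only: borel_measurable_integrable)
qed

text \<open>Injective tuples make the sets in each product disjoint, so the integral is almost
  surely a multilinear polynomial \<open>F\<close> in the independent vector \<open>X\<close>.
  \<open>I_bound\<close> supplies its second moment and \<open>bonami\<close> the higher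
  ones.\<close>

lemma hypercontr_step:
  assumes N: "0 < N" and T: "T \<subseteq> {c \<in> Pi\<^sub>E {..<n} (\<lambda>_. gridset N U). inj_on c {..<n}}"
  shows "hypercontr (\<lambda>z. \<Sum>c\<in>T. a c * (\<Prod>i<n. indicator (gbox N (c i)) (z i)))" (is "hypercontr ?f")
proof -
  let ?G = "gridset N U"
  have finT: "finite T"
    by (rule finite_subset[OF T]) (auto intro!: finite_subset[OF _ finite_PiE[of "{..<n}" "\<lambda>_. ?G"]] finite_gridset)
  have cG: "c i \<in> ?G" if "c \<in> T" "i < n" for c i using T that by auto
  have inj: "inj_on c {..<n}" if "c \<in> T" for c using T that by auto
  obtain g where g: "bij_betw g {..<card ?G} ?G"
    using ex_bij_betw_nat_finite[OF finite_gridset[of N U]] by (auto simp: atLeast0LessThan)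
  define K where "K = card ?G"
  \<comment> \<open>\<open>h\<close> numbers the cells by inverting the enumeration
    \<open>g\<close>: coordinate h c of the Gaussian vector belongs to cell c.\<close>
  define h where "h = the_inv_into {..<K} g"
  have gK: "g j \<in> ?G" if "j < K" for j using g that by (auto simp: K_def bij_betw_def)
  have gi: "i = j" if "g i = g j" "i < K" "j < K" for i j
    using g that by (auto simp: K_def bij_betw_def inj_on_def)
  have h: "h c < K" "g (h c) = c" if "c \<in> ?G" for c
    using bij_betw_the_inv_into[OF g] f_the_inv_into_f_bij_betw[OF g] that
    by (auto simp: h_def K_def bij_betw_def)
  have hi: "c = c'" if "h c = h c'" "c \<in> ?G" "c' \<in> ?G" for c c' using h that by metis
  have L: "L2 (STn n) (\<lambda>z. \<Prod>i<n. indicator (gbox N (c i)) (z i))" if "c \<in> T" for c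
    by (rule L2_prod_indicator[OF gbox_ST emeasure_gbox_finite[OF N cG[OF that]]])
  have Lf: "L2 (STn n) ?f" by (rule L2_sum) (rule L)
  define s where "s c = sqrt (measure ST (gbox N c))" for c
  have sp: "0 < s c" if "c \<in> ?G" for c
    using emeasure_gbox_pos[OF N that] emeasure_gbox_finite[OF N that]
    by (simp add: s_def measure_def enn2real_positive_iff)
  define X where "X \<omega> = (\<lambda>j\<in>{..<K}. W (indicator (gbox N (g j))) \<omega> / sqrt (measure ST (gbox N (g j))))" for \<omega>
  define P where "P = (\<Pi>\<^sub>M i\<in>{..<K}. std_normal_distribution)"
  have dX: "distr M P X = P"
    unfolding X_def P_def
    by (rule joint_normal_boxes) (auto intro!: emeasure_gbox_finite[OF N gK, unfolded infinity_ennreal_def] emeasure_gbox_pos[OF N gK] gbox_disjoint dest: gi)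
  have XW: "s c * X \<omega> (h c) = W (indicator (gbox N c)) \<omega>" if "c \<in> ?G" for c \<omega>
    using sp[OF that] h[OF that] by (simp add: X_def s_def)
  have Xm: "X \<in> M \<rightarrow>\<^sub>M P"
    unfolding X_def P_def
  proof (rule measurable_restrict)
    fix j assume "j \<in> {..<K}"
    then have "L2 ST (indicator (gbox N (g j)))"
      by (intro L2_indicator gbox_ST emeasure_gbox_finite[OF N, where U=U]) (auto intro: gK)
    from W_measurable[OF this] show "(\<lambda>\<omega>. W (indicator (gbox N (g j))) \<omega> / sqrt (measure ST (gbox N (g j)))) \<in> M \<rightarrow>\<^sub>M std_normal_distribution"
      by simp
  qed
  \<comment> \<open>\<open>X\<close> is normalised, so the standard deviations of the cells move
    into the coefficients.\<close>
  define F where "F x = (\<Sum>c\<in>T. (a c * (\<Prod>i<n. s (c i))) * (\<Prod>j\<in>(\<lambda>i. h (c i)) ` {..<n}. x j))" for x :: "nat \<Rightarrow> real"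
  have F: "F \<in> mlin_poly K n"
    unfolding F_def[abs_def]
  proof (intro mlin_poly_sum finT mlin_poly_scale mlin_poly_prod)
    show "(\<lambda>i. h (c i)) ` {..<n} \<subseteq> {..<K}" if "c \<in> T" for c using h(1)[OF cG[OF that]] by auto
    show "card ((\<lambda>i. h (c i)) ` {..<n}) \<le> n" for c using card_image_le[of "{..<n}" "\<lambda>i. h (c i)"] by simp
  qed
  have [measurable]: "F \<in> borel_measurable P" unfolding P_def by (rule mlin_poly_measurable[OF F]) simp
  have FX: "AE \<omega> in M. I ?f \<omega> = F (X \<omega>)"
  proof -
    have "AE \<omega> in M. I ?f \<omega> = (\<Sum>c\<in>T. a c * I (\<lambda>z. \<Prod>i<n. indicator (gbox N (c i)) (z i)) \<omega>)"
      by (rule I_sum[OF L finT])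
    moreover have "AE \<omega> in M. \<forall>c\<in>T. I (\<lambda>z. \<Prod>i<n. indicator (gbox N (c i)) (z i)) \<omega> = (\<Prod>i<n. W (indicator (gbox N (c i))) \<omega>)"
    proof (rule AE_finite_allI[OF finT])
      fix c assume c: "c \<in> T"
      show "AE \<omega> in M. I (\<lambda>z. \<Prod>i<n. indicator (gbox N (c i)) (z i)) \<omega> = (\<Prod>i<n. W (indicator (gbox N (c i))) \<omega>)"
      proof (rule I_prod)
        show "disjoint_family_on (\<lambda>i. gbox N (c i)) {..<n}"
          using inj[OF c] by (auto simp: disjoint_family_on_def inj_on_def gbox_def)
      qed (use emeasure_gbox_finite[OF N cG[OF c]] in auto)
    qed
    ultimately show ?thesis
    proof eventually_elim
      case (elim \<omega>)
      have "(\<Prod>i<n. W (indicator (gbox N (c i))) \<omega>) = (\<Prod>i<n. s (c i)) * (\<Prod>j\<in>(\<lambda>i. h (c i)) ` {..<n}. X \<omega> j)" if c: "c \<in> T" for c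
      proof -
        have "inj_on (\<lambda>i. h (c i)) {..<n}"
          using inj[OF c] hi cG[OF c] by (auto simp: inj_on_def)
        then have "(\<Prod>j\<in>(\<lambda>i. h (c i)) ` {..<n}. X \<omega> j) = (\<Prod>i<n. X \<omega> (h (c i)))"
          by (simp add: prod.reindex)
        then show ?thesis using XW[OF cG[OF c]] by (simp add: prod.distrib[symmetric])
      qed
      then show ?case using elim by (simp add: F_def mult.assoc)
    qed
  qed
  \<comment> \<open>Moments of the integral are moments of \<open>F\<close> under the product law;
    used with exponents 2 and 2 m.\<close>
  have tr: "(\<integral>\<^sup>+\<omega>. ennreal ((I ?f \<omega>) ^ k) \<partial>M) = (\<integral>\<^sup>+x. ennreal ((F x) ^ k) \<partial>P)" for k
  proof -
    have "(\<integral>\<^sup>+\<omega>. ennreal ((I ?f \<omega>) ^ k) \<partial>M) = (\<integral>\<^sup>+\<omega>. ennreal ((F (X \<omega>)) ^ k) \<partial>M)"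
      using FX by (intro nn_integral_cong_AE) (auto elim: eventually_mono)
    also have "\<dots> = (\<integral>\<^sup>+x. ennreal ((F x) ^ k) \<partial>distr M P X)"
      using Xm by (subst nn_integral_distr) auto
    finally show ?thesis unfolding dX .
  qed
  show ?thesis
    unfolding hypercontr_def
  proof (intro conjI Lf allI impI)
    fix m :: nat and c :: real
    assume m: "0 < m" and c: "fact n * (\<integral>z. (?f z)^2 \<partial>STn n) < c"
    have "(\<integral>\<^sup>+x. ennreal ((F x)^2) \<partial>P) = ennreal (\<integral>\<omega>. (I ?f \<omega>)^2 \<partial>M)"
      unfolding tr[symmetric] by (rule nn_integral_eq_integral[OF I_sq_integrable[OF Lf]]) simp
    also have "\<dots> < ennreal c"
    proof (rule ennreal_lessI)
      show lt: "(\<integral>\<omega>. (I ?f \<omega>)^2 \<partial>M) < c" by (rule le_less_trans[OF I_bound[OF Lf] c])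
      show "0 < c" by (rule le_less_trans[OF _ lt]) simp
    qed
    finally show "(\<integral>\<^sup>+\<omega>. ennreal ((I ?f \<omega>) ^ (2 * m)) \<partial>M) \<le> ennreal ((Kbon m ^ n * c) ^ m)"
      unfolding tr P_def by (rule bonami[OF F m])
  qed
qed

lemma L2_bounded_slab:
  fixes f :: "(nat \<Rightarrow> real \<times> (real^4)) \<Rightarrow> real"
  assumes [measurable]: "f \<in> borel_measurable (STn n)" and le: "\<And>z. z \<in> space (STn n) \<Longrightarrow> \<bar>f z\<bar> \<le> Bd * indicator (slab n U) z"
  shows "L2 (STn n) f"
proof (rule L2_I)
  show "integrable (STn n) (\<lambda>z. (f z)^2)"
  proof (rule Bochner_Integration.integrable_bound[OF integrable_slab[of n "Bd^2" U]])
    show "AE z in STn n. norm ((f z)^2) \<le> norm (Bd^2 * indicator (slab n U) z :: real)"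
    proof (rule AE_I2)
      fix z assume "z \<in> space (STn n)"
      from le[OF this] have "\<bar>f z\<bar>^2 \<le> (Bd * indicator (slab n U) z)^2" by (intro power_mono) auto
      then show "norm ((f z)^2) \<le> norm (Bd^2 * indicator (slab n U) z :: real)"
        by (auto simp: indicator_def)
    qed
  qed measurable
qed simp

text \<open>Sample f at the lower corners of the cells and drop tuples with a repeated cell. Almost
  every point has distinct times, hence distinct cells on fine grids, so these step functions
  converge almost everywhere; a common bound on a slab of finite measure gives L^2
  convergence.\<close>

lemma hypercontr_ae_continuous:
  assumes fm [measurable]: "f \<in> borel_measurable (STn n)" and le: "\<And>z. \<bar>f z\<bar> \<le> Bd"
    and supp: "\<And>z. z \<in> space (STn n) \<Longrightarrow> z \<notin> slab n U \<Longrightarrow> f z = 0"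
    and lim: "AE z in STn n. (\<lambda>N. f (\<lambda>i\<in>{..<n}. grid_floor (Suc N) (z i))) \<longlonglongrightarrow> f z"
  shows "hypercontr f"
proof -
  define T where "T N = {c \<in> Pi\<^sub>E {..<n} (\<lambda>_. gridset (Suc N) U). inj_on c {..<n}}" for N
  define u where "u N z = (\<Sum>c\<in>T N. f c * (\<Prod>i<n. indicator (gbox (Suc N) (c i)) (z i)))" for N z
  define R where "R N z = (\<lambda>i\<in>{..<n}. grid_floor (Suc N) (z i))" for N and z :: "nat \<Rightarrow> real \<times> (real^4)"
  have finT: "finite (T N)" for N
    unfolding T_def by (auto intro!: finite_subset[OF _ finite_PiE[of "{..<n}" "\<lambda>_. gridset (Suc N) U"]] finite_gridset)
  have hu: "hypercontr (u N)" for N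
    unfolding u_def[abs_def] by (rule hypercontr_step[where U=U]) (auto simp: T_def)
  have spz: "z i \<in> {0..} \<times> cube" if "z \<in> space (STn n)" "i < n" for z i
    using that unfolding STn_def space_PiM space_ST by auto
  \<comment> \<open>A point lies in exactly one product of cells, so at most one term of the sum is
    nonzero.\<close>
  have uz: "u N z = (if R N z \<in> T N then f (R N z) else 0)" if z: "z \<in> space (STn n)" for N z
  proof -
    have "(\<Prod>i<n. indicator (gbox (Suc N) (c i)) (z i)) = (if c = R N z then 1 else 0 :: real)" if c: "c \<in> T N" for c
    proof (cases "c = R N z")
      case True
      then have "indicator (gbox (Suc N) (c i)) (z i) = (1::real)" if "i < n" for i
        using spz[OF z that] that by (simp add: gbox_def R_def)
      then show ?thesis using True by simp
    next
      case False
      have "c \<in> extensional {..<n}" "R N z \<in> extensional {..<n}" using c by (auto simp: T_def PiE_iff R_def)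
      then obtain i where "i < n" "c i \<noteq> R N z i" using False extensionalityI by blast
      then have "indicator (gbox (Suc N) (c i)) (z i) = (0::real)" by (auto simp: R_def gbox_def)
      then have "(\<Prod>i<n. indicator (gbox (Suc N) (c i)) (z i)) = (0::real)"
        using \<open>i < n\<close> by (intro prod_zero) auto
      then show ?thesis using False by simp
    qed
    then have "u N z = (\<Sum>c\<in>T N. if c = R N z then f c else 0)"
      unfolding u_def by (intro sum.cong) auto
    then show ?thesis using finT by simp
  qed
  have ubd: "\<bar>u N z\<bar> \<le> Bd * indicator (slab n (U + 1)) z" if z: "z \<in> space (STn n)" for N z
  proof (cases "R N z \<in> T N")
    case True
    have "fst (z i) < real (U + 1)" if "i < n" for i
    proof -
      have "grid_floor (Suc N) (z i) \<in> gridset (Suc N) U" using True that by (auto simp: T_def R_def)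
      from gbox_slab[OF _ this] have "z i \<in> {0..<real (U + 1)} \<times> cube"
        using spz[OF z that] by (auto simp: gbox_def)
      then show ?thesis by (simp add: mem_Times_iff)
    qed
    then have "z \<in> slab n (U + 1)" using z by (simp add: slab_def)
    then show ?thesis using uz[OF z] True le by simp
  next
    case False
    have "0 \<le> Bd" using le[of z] by linarith
    then show ?thesis using uz[OF z] False by simp
  qed
  have fbd: "\<bar>f z\<bar> \<le> Bd * indicator (slab n (U + 1)) z" if z: "z \<in> space (STn n)" for z
  proof (cases "z \<in> slab n U")
    case True
    then have "z \<in> slab n (U + 1)" by (fastforce simp: slab_def)
    then show ?thesis using le by simp
  next
    case False
    have "0 \<le> Bd" using le[of z] by linarith
    then show ?thesis using supp[OF z False] by simp
  qed
  have Lf: "L2 (STn n) f" by (rule L2_bounded_slab[OF fm fbd])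
  have um [measurable]: "u N \<in> borel_measurable (STn n)" for N
    using hu[of N] by (auto simp: hypercontr_def intro: L2_measurable)
  have dist: "AE z in STn n. \<forall>i<n. \<forall>j<n. i \<noteq> j \<longrightarrow> fst (z i) \<noteq> fst (z j)"
  proof -
    have "AE z in STn n. \<forall>p\<in>{(i,j). i < n \<and> j < n \<and> i \<noteq> j}. fst (z (fst p)) \<noteq> fst (z (snd p))"
    proof (rule AE_finite_allI)
      show "finite {(i, j). i < n \<and> j < n \<and> i \<noteq> j}" by (rule finite_subset[of _ "{..<n} \<times> {..<n}"]) auto
    qed (use AE_STn_distinct in auto)
    then show ?thesis by eventually_elim auto
  qed
  have conv: "AE z in STn n. (\<lambda>N. u N z) \<longlonglongrightarrow> f z"
    using lim dist AE_space
  proof eventually_elim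
    case (elim z)
    note z = elim(3)
    have lim: "(\<lambda>N. f (R N z)) \<longlonglongrightarrow> f z" using elim(1) by (simp add: R_def)
    show ?case
    proof (cases "z \<in> slab n U")
      case False
      have "(\<lambda>N. f (R N z)) \<longlonglongrightarrow> 0" using lim supp[OF z False] by simp
      then have "(\<lambda>N. u N z) \<longlonglongrightarrow> 0"
        by (intro Lim_null_comparison[where g="\<lambda>N. \<bar>f (R N z)\<bar>" and f="\<lambda>N. u N z"])
          (use uz[OF z] in \<open>auto simp: tendsto_rabs_zero_iff\<close>)
      then show ?thesis using supp[OF z False] by simp
    next
      case True
      have "eventually (\<lambda>N. grid_floor (Suc N) (z i) \<noteq> grid_floor (Suc N) (z j)) sequentially" if "i < n" "j < n" "i \<noteq> j" for i j
      proof -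
        have "z i \<noteq> z j" using elim(2) that by metis
        then show ?thesis
          using tendsto_imp_eventually_ne[OF tendsto_diff[OF grid_floor_tendsto[of "z i"] grid_floor_tendsto[of "z j"]], of 0]
          by (auto elim: eventually_mono)
      qed
      then have "eventually (\<lambda>N. \<forall>i\<in>{..<n}. \<forall>j\<in>{..<n}. i \<noteq> j \<longrightarrow> grid_floor (Suc N) (z i) \<noteq> grid_floor (Suc N) (z j)) sequentially"
        by (intro eventually_ball_finite ballI) auto
      then have "eventually (\<lambda>N. R N z \<in> T N) sequentially"
      proof eventually_elim
        case (elim N)
        have "grid_floor (Suc N) (z i) \<in> gridset (Suc N) U" if "i < n" for i
          using True spz[OF z that] that by (auto simp: gridset_def slab_def mem_Times_iff)
        then show ?case using elim by (auto simp: T_def R_def inj_on_def)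
      qed
      then have "eventually (\<lambda>N. u N z = f (R N z)) sequentially"
        by eventually_elim (simp add: uz[OF z])
      then show ?thesis using lim by (simp add: tendsto_cong)
    qed
  qed
  have "(\<lambda>N. \<integral>z. (u N z - f z)^2 \<partial>STn n) \<longlonglongrightarrow> (\<integral>z. 0 \<partial>STn n)"
  proof (rule integral_dominated_convergence[where w="\<lambda>z. (2 * Bd)^2 * indicator (slab n (U + 1)) z"])
    show "AE z in STn n. (\<lambda>N. (u N z - f z)^2) \<longlonglongrightarrow> 0"
      using conv
    proof eventually_elim
      case (elim z)
      then have "(\<lambda>N. (u N z - f z)^2) \<longlonglongrightarrow> (f z - f z)^2" by (intro tendsto_intros)
      then show ?case by simp
    qed
    show "AE z in STn n. norm ((u N z - f z)^2) \<le> (2 * Bd)^2 * indicator (slab n (U + 1)) z" for N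
    proof (rule AE_I2)
      fix z assume z: "z \<in> space (STn n)"
      have "\<bar>u N z - f z\<bar> \<le> 2 * Bd * indicator (slab n (U + 1)) z"
        using ubd[OF z, of N] fbd[OF z] by linarith
      then have "\<bar>u N z - f z\<bar>^2 \<le> (2 * Bd * indicator (slab n (U + 1)) z)^2" by (intro power_mono) auto
      then show "norm ((u N z - f z)^2) \<le> (2 * Bd)^2 * indicator (slab n (U + 1)) z"
        by (auto simp: indicator_def)
    qed
  qed (rule integrable_slab borel_measurable_const | intro borel_measurable_power borel_measurable_diff um fm)+
  then show ?thesis using hypercontr_closed[OF hu Lf] by simp
qed

end

section \<open>Lattice sums\<close>

text \<open>Encoding an integer by absolute value and sign bounds the sum by twice a convergent
  series. All lattice bounds are stated uniformly over finite sets, the form in which Parseval sums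
  are later controlled.\<close>

lemma lattice_line_sum:
  assumes "0 < \<delta>"
  obtains D where "\<And>S. finite S \<Longrightarrow> S \<subseteq> \<int> \<Longrightarrow> (\<Sum>x\<in>S. (max 1 \<bar>x\<bar>) powr - (1 + \<delta>)) \<le> (D::real)"
proof -
  let ?u = "\<lambda>x::real. (max 1 \<bar>x\<bar>) powr - (1 + \<delta>)"
  have "summable (\<lambda>n. real n powr - (1 + \<delta>))" using assms by (subst summable_real_powr_iff) auto
  then have sm: "summable (\<lambda>n. ?u (real n))"
    by (rule summable_cong[THEN iffD1, rotated]) (auto intro!: eventually_mono[OF eventually_ge_at_top[of 1]] simp: max_def)
  show ?thesis
  proof (rule that)
    fix S :: "real set" assume S: "finite S" "S \<subseteq> \<int>"
    have "inj_on (\<lambda>x. (nat \<lfloor>\<bar>x\<bar>\<rfloor>, 0 \<le> x)) S"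
    proof (rule inj_onI)
      fix x y assume xy: "x \<in> S" "y \<in> S" "(nat \<lfloor>\<bar>x\<bar>\<rfloor>, 0 \<le> x) = (nat \<lfloor>\<bar>y\<bar>\<rfloor>, 0 \<le> y)"
      then obtain a b where ab: "x = of_int a" "y = of_int b" using S(2) by (metis Ints_cases subsetD)
      then have "\<lfloor>\<bar>x\<bar>\<rfloor> = \<bar>a\<bar>" "\<lfloor>\<bar>y\<bar>\<rfloor> = \<bar>b\<bar>" by (simp_all add: floor_of_int flip: of_int_abs)
      then have "\<bar>a\<bar> = \<bar>b\<bar>" "0 \<le> a \<longleftrightarrow> 0 \<le> b" using xy(3) ab by auto
      then show "x = y" using ab by auto
    qed
    define T where "T = (\<lambda>x. (nat \<lfloor>\<bar>x\<bar>\<rfloor>, 0 \<le> x)) ` S"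
    have val: "?u x = ?u (real (nat \<lfloor>\<bar>x\<bar>\<rfloor>))" if "x \<in> S" for x
    proof -
      obtain a where "x = of_int a" using S(2) \<open>x \<in> S\<close> by (metis Ints_cases subsetD)
      then show ?thesis by (simp flip: of_int_abs)
    qed
    have "(\<Sum>x\<in>S. ?u x) = (\<Sum>x\<in>S. ?u (real (fst (nat \<lfloor>\<bar>x\<bar>\<rfloor>, 0 \<le> x))))"
      by (intro sum.cong refl) (use val in auto)
    also have "\<dots> = (\<Sum>p\<in>T. ?u (real (fst p)))"
      unfolding T_def using \<open>inj_on _ S\<close> by (simp add: sum.reindex)
    also have "\<dots> \<le> (\<Sum>p\<in>(fst ` T) \<times> (UNIV::bool set). ?u (real (fst p)))"
      using S by (intro sum_mono2) (auto simp: T_def image_iff)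
    also have "\<dots> = (\<Sum>j\<in>fst ` T. \<Sum>b\<in>(UNIV::bool set). ?u (real j))"
      by (subst sum.cartesian_product) (simp add: case_prod_unfold)
    also have "\<dots> = 2 * (\<Sum>j\<in>fst ` T. ?u (real j))" by (simp add: sum_distrib_left)
    also have "\<dots> \<le> 2 * (\<Sum>j. ?u (real j))"
      using S by (intro mult_left_mono sum_le_suminf sm) (auto simp: T_def)
    finally show "(\<Sum>x\<in>S. ?u x) \<le> 2 * (\<Sum>j. ?u (real j))" .
  qed
qed

text \<open>Each coordinate is at most \<open>bracket k\<close>, so a quarter of the exponent can be
  given to each of the four coordinates; the sum factors into four line sums of exponent 1 +
  \<delta>/4.\<close>

lemma lattice_sum:
  assumes "0 < \<delta>"
  obtains C where "0 < C" "\<And>F. finite F \<Longrightarrow> F \<subseteq> Z4 \<Longrightarrow> (\<Sum>k\<in>F. bracket k powr - (4 + \<delta>)) \<le> C"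
proof -
  obtain D where D: "\<And>S. finite S \<Longrightarrow> S \<subseteq> \<int> \<Longrightarrow> (\<Sum>x\<in>S. (max 1 \<bar>x\<bar>) powr - (1 + \<delta> / 4)) \<le> (D::real)"
    using lattice_line_sum[of "\<delta> / 4"] assms by auto
  let ?u = "\<lambda>x::real. (max 1 \<bar>x\<bar>) powr - (1 + \<delta> / 4)"
  show ?thesis
  proof (rule that)
    show "0 < \<bar>D\<bar> ^ 4 + 1" by (simp add: add_nonneg_pos)
    fix F assume F: "finite F" "F \<subseteq> Z4"
    define S where "S = (\<lambda>(k, i). k $ i) ` (F \<times> (UNIV::4 set))"
    have S: "finite S" "S \<subseteq> \<int>" using F by (auto simp: S_def Z4_def)
    have "(\<Sum>k\<in>F. bracket k powr - (4 + \<delta>)) \<le> (\<Sum>k\<in>F. \<Prod>i\<in>(UNIV::4 set). ?u (k $ i))"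
    proof (rule sum_mono)
      fix k assume "k \<in> F"
      have "bracket k powr - (4 + \<delta>) = (bracket k powr - (1 + \<delta> / 4)) ^ 4"
      proof -
        have "(bracket k powr - (1 + \<delta> / 4)) ^ 4 = bracket k powr (- (1 + \<delta> / 4) * real 4)"
          using less_imp_neq[OF bracket_pos[of k]] by (subst powr_power) auto
        also have "- (1 + \<delta> / 4) * real 4 = - (4 + \<delta>)" by simp
        finally show ?thesis by simp
      qed
      also have "\<dots> = (\<Prod>i\<in>(UNIV::4 set). bracket k powr - (1 + \<delta> / 4))" by simp
      also have "\<dots> \<le> (\<Prod>i\<in>(UNIV::4 set). ?u (k $ i))"
      proof (rule prod_mono, rule conjI)
        fix i
        have "max 1 \<bar>k $ i\<bar> \<le> bracket k" using component_le_norm_cart[of k i] by (auto simp: bracket_def)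
        then show "bracket k powr - (1 + \<delta> / 4) \<le> ?u (k $ i)"
          using assms by (intro powr_mono2') auto
      qed simp
      finally show "bracket k powr - (4 + \<delta>) \<le> (\<Prod>i\<in>(UNIV::4 set). ?u (k $ i))" .
    qed
    also have "\<dots> = (\<Sum>b\<in>(\<lambda>k. \<lambda>i. k $ i) ` F. \<Prod>i\<in>(UNIV::4 set). ?u (b i))"
      by (subst sum.reindex) (auto simp: inj_on_def vec_eq_iff fun_eq_iff)
    also have "\<dots> \<le> (\<Sum>b\<in>Pi\<^sub>E (UNIV::4 set) (\<lambda>_. S). \<Prod>i\<in>(UNIV::4 set). ?u (b i))"
      using S by (intro sum_mono2 finite_PiE prod_nonneg) (auto simp: S_def image_iff)
    also have "\<dots> = (\<Prod>i\<in>(UNIV::4 set). \<Sum>x\<in>S. ?u x)"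
      using S by (subst prod_sum_PiE) auto
    also have "\<dots> = (\<Sum>x\<in>S. ?u x) ^ 4" by simp
    also have "\<dots> \<le> \<bar>D\<bar> ^ 4"
      using D[OF S] by (intro power_mono sum_nonneg) auto
    finally show "(\<Sum>k\<in>F. bracket k powr - (4 + \<delta>)) \<le> \<bar>D\<bar> ^ 4 + 1" by simp
  qed
qed

text \<open>The largest frequency k_j is at least the n-th part of the sum K. Of its decay 4 -
  \<delta>, a part 4 - \<delta>' becomes decay in K, and the remaining 2 \<delta> (n - 1) is handed
  out to the other n - 1 factors, whose exponents rise from 4 - \<delta> to the summable 4 +
  \<delta>. This is the origin of the loss \<delta>' = (2 n - 1) \<delta>.\<close>

lemma lattice_conv:
  assumes n: "1 \<le> n" and \<delta>: "0 < \<delta>" "(2 * real n - 1) * \<delta> \<le> 4"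
  obtains C where "0 < C" "\<And>F g. finite F \<Longrightarrow> F \<subseteq> Pi\<^sub>E {..<n} (\<lambda>_. Z4) \<Longrightarrow> (\<And>K. 0 \<le> g K) \<Longrightarrow>
     (\<Sum>k\<in>F. (\<Prod>m<n. bracket (k m) powr - (4 - \<delta>)) * g (\<Sum>m<n. k m))
       \<le> C * (\<Sum>K\<in>(\<lambda>k. \<Sum>m<n. k m) ` F. g K * bracket K powr - (4 - (2 * real n - 1) * \<delta>))"
proof -
  obtain C0 where C0: "0 < C0" "\<And>F. finite F \<Longrightarrow> F \<subseteq> Z4 \<Longrightarrow> (\<Sum>k\<in>F. bracket k powr - (4 + \<delta>)) \<le> C0"
    using lattice_sum[OF \<delta>(1)] by blast
  define \<delta>' where "\<delta>' = (2 * real n - 1) * \<delta>"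
  have d': "\<delta>' = \<delta> + 2 * \<delta> * real (n - 1)" using n by (simp add: \<delta>'_def of_nat_diff algebra_simps)
  let ?w = "\<lambda>K. bracket K powr - (4 - \<delta>')"
  let ?v = "\<lambda>l. bracket l powr - (4 + \<delta>)"
  show ?thesis
  proof (rule that)
    show "0 < real n * (real n ^ 4 * C0 ^ (n - 1))" using n C0 by simp
    fix F :: "(nat \<Rightarrow> real^4) set" and g :: "real^4 \<Rightarrow> real"
    assume F: "finite F" "F \<subseteq> Pi\<^sub>E {..<n} (\<lambda>_. Z4)" and g: "\<And>K. 0 \<le> g K"
    let ?s = "\<lambda>k. \<Sum>m<n. k m"
    \<comment> \<open>The index of the largest frequency varies with k, so the bound sums over all
      candidates j; the additional terms are nonnegative.\<close>
    have pt: "(\<Prod>m<n. bracket (k m) powr - (4 - \<delta>)) \<le> (\<Sum>j<n. real n ^ 4 * ?w (?s k) * (\<Prod>m\<in>{..<n} - {j}. ?v (k m)))" for k :: "nat \<Rightarrow> real^4"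
    proof -
      have "(MAX m\<in>{..<n}. bracket (k m)) \<in> (\<lambda>m. bracket (k m)) ` {..<n}" using n by (intro Max_in) (auto simp: lessThan_empty_iff)
      then obtain j where j: "j < n" "(MAX m\<in>{..<n}. bracket (k m)) = bracket (k j)" by auto
      have jm: "bracket (k m) \<le> bracket (k j)" if "m < n" for m
        unfolding j(2)[symmetric] using that by (intro Max_ge) auto
      have "norm (?s k) \<le> (\<Sum>m<n. norm (k m))" by (rule norm_sum)
      also have "\<dots> \<le> (\<Sum>m<n. bracket (k j))" by (intro sum_mono) (use jm in \<open>force simp: bracket_def\<close>)
      finally have "norm (?s k) \<le> real n * bracket (k j)" by simp
      moreover have "1 \<le> real n * bracket (k j)"
        using mult_mono[of 1 "real n" 1 "bracket (k j)"] n by simp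
      ultimately have brK: "bracket (?s k) \<le> real n * bracket (k j)" by (simp add: bracket_def)
      \<comment> \<open>n^4 comes from comparing k_j with K / n under an exponent of absolute value
        at most 4; \<delta>' \<le> 4 keeps the power monotone in the right direction.\<close>
      have e1: "bracket (k j) powr - (4 - \<delta>') \<le> real n ^ 4 * ?w (?s k)"
      proof -
        have "bracket (k j) powr - (4 - \<delta>') \<le> (bracket (?s k) / real n) powr - (4 - \<delta>')"
          using brK n \<delta> by (intro powr_mono2') (auto simp: \<delta>'_def field_simps)
        also have "\<dots> = real n powr (4 - \<delta>') * ?w (?s k)"
        proof -
          have pd: "(x / y) powr - s = y powr s * x powr - s" if "0 < x" "0 < y" for x y s :: real
            using that by (simp add: powr_divide powr_minus field_simps)
          show ?thesis by (rule pd) (use n in auto)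
        qed
        also have "\<dots> \<le> real n powr 4 * ?w (?s k)"
        proof (intro mult_right_mono powr_mono)
          have "0 \<le> 2 * \<delta> * real (n - 1)" using \<delta> by simp
          then show "4 - \<delta>' \<le> 4" using d' \<delta> by linarith
        qed (use n in auto)
        finally show ?thesis using n by (simp add: powr_numeral)
      qed
      have "bracket (k j) powr - (4 - \<delta>) = bracket (k j) powr - (4 - \<delta>') * bracket (k j) powr (- (2 * \<delta> * real (n - 1)))"
        by (simp add: powr_add[symmetric] d')
      also have "bracket (k j) powr (- (2 * \<delta> * real (n - 1))) = (bracket (k j) powr - (2 * \<delta>)) ^ (n - 1)"
        using less_imp_neq[OF bracket_pos[of "k j"]] by (subst powr_power) (auto simp: mult_ac)
      also have "\<dots> = (\<Prod>m\<in>{..<n} - {j}. bracket (k j) powr - (2 * \<delta>))" using j by simp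
      also have "bracket (k j) powr - (4 - \<delta>') * \<dots> \<le> (real n ^ 4 * ?w (?s k)) * (\<Prod>m\<in>{..<n} - {j}. bracket (k m) powr - (2 * \<delta>))"
        using jm \<delta> by (intro mult_mono e1 prod_mono conjI powr_mono2' prod_nonneg) auto
      finally have e2: "bracket (k j) powr - (4 - \<delta>) \<le> (real n ^ 4 * ?w (?s k)) * (\<Prod>m\<in>{..<n} - {j}. bracket (k m) powr - (2 * \<delta>))" .
      have "(\<Prod>m<n. bracket (k m) powr - (4 - \<delta>)) = bracket (k j) powr - (4 - \<delta>) * (\<Prod>m\<in>{..<n} - {j}. bracket (k m) powr - (4 - \<delta>))"
        using j by (subst prod.remove[of _ j]) auto
      also have "\<dots> \<le> (real n ^ 4 * ?w (?s k)) * (\<Prod>m\<in>{..<n} - {j}. bracket (k m) powr - (2 * \<delta>)) * (\<Prod>m\<in>{..<n} - {j}. bracket (k m) powr - (4 - \<delta>))"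
        by (intro mult_right_mono e2 prod_nonneg) auto
      also have "\<dots> = real n ^ 4 * ?w (?s k) * (\<Prod>m\<in>{..<n} - {j}. ?v (k m))"
        by (simp add: mult.assoc prod.distrib[symmetric] powr_add[symmetric] algebra_simps)
      also have "\<dots> \<le> (\<Sum>j<n. real n ^ 4 * ?w (?s k) * (\<Prod>m\<in>{..<n} - {j}. ?v (k m)))"
        using j by (intro member_le_sum[where f="\<lambda>j. real n ^ 4 * ?w (?s k) * (\<Prod>m\<in>{..<n} - {j}. ?v (k m))"] mult_nonneg_nonneg prod_nonneg) auto
      finally show ?thesis .
    qed
    define L where "L = (\<lambda>(k, m). k m) ` (F \<times> {..<n})"
    have L: "finite L" "L \<subseteq> Z4" using F by (auto simp: L_def)
    have one: "(\<Sum>k\<in>F. g (?s k) * ?w (?s k) * (\<Prod>m\<in>{..<n} - {j}. ?v (k m))) \<le> (\<Sum>K\<in>?s ` F. g K * ?w K) * C0 ^ (n - 1)" if j: "j < n" for j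
    proof -
      let ?J = "{..<n} - {j}"
      let ?h = "\<lambda>k. (?s k, restrict k ?J)"
      \<comment> \<open>The total K and the frequencies other than the j-th determine the j-th. For
        fixed j the sum over tuples is therefore at most a product of independent sums.\<close>
      have inj: "inj_on ?h F"
      proof (rule inj_onI)
        fix k l assume kl: "k \<in> F" "l \<in> F" "?h k = ?h l"
        have J: "k m = l m" if "m \<in> ?J" for m using kl(3) that by (metis prod.inject restrict_apply')
        have "?s k = k j + (\<Sum>m\<in>?J. k m)" "?s l = l j + (\<Sum>m\<in>?J. l m)" using j by (auto simp: sum.remove)
        moreover have "(\<Sum>m\<in>?J. k m) = (\<Sum>m\<in>?J. l m)" by (intro sum.cong refl J)
        moreover have "?s k = ?s l" using kl(3) by simp
        ultimately have "k j = l j" by (metis add_right_imp_eq)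
        then have "k m = l m" if "m < n" for m using J that by (cases "m = j") auto
        then show "k = l" using subsetD[OF F(2) kl(1)] subsetD[OF F(2) kl(2)] by (metis PiE_ext lessThan_iff)
      qed
      let ?f = "\<lambda>p. g (fst p) * ?w (fst p) * (\<Prod>m\<in>?J. ?v (snd p m))"
      have "(\<Sum>k\<in>F. g (?s k) * ?w (?s k) * (\<Prod>m\<in>?J. ?v (k m))) = (\<Sum>k\<in>F. ?f (?h k))"
        by (intro sum.cong refl) simp
      also have "\<dots> = (\<Sum>p\<in>?h ` F. ?f p)" using inj by (simp add: sum.reindex)
      also have "\<dots> \<le> (\<Sum>p\<in>?s ` F \<times> Pi\<^sub>E ?J (\<lambda>_. L). ?f p)"
      proof (rule sum_mono2)
        have Lm: "k m \<in> L" if "k \<in> F" "m < n" for k m using that by (force simp: L_def)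
        have r: "restrict k ?J \<in> Pi\<^sub>E ?J (\<lambda>_. L)" if "k \<in> F" for k
          unfolding restrict_PiE_iff using Lm[OF that] by auto
        show "?h ` F \<subseteq> ?s ` F \<times> Pi\<^sub>E ?J (\<lambda>_. L)"
          by (intro image_subsetI SigmaI imageI r)
        show "finite (?s ` F \<times> Pi\<^sub>E ?J (\<lambda>_. L))"
          using F L by (intro finite_cartesian_product finite_PiE) auto
      qed (auto intro!: mult_nonneg_nonneg prod_nonneg g)
      also have "\<dots> = (\<Sum>K\<in>?s ` F. \<Sum>l\<in>Pi\<^sub>E ?J (\<lambda>_. L). g K * ?w K * (\<Prod>m\<in>?J. ?v (l m)))"
        by (subst sum.cartesian_product) (simp add: case_prod_unfold)
      also have "\<dots> = (\<Sum>K\<in>?s ` F. g K * ?w K) * (\<Sum>l\<in>Pi\<^sub>E ?J (\<lambda>_. L). (\<Prod>m\<in>?J. ?v (l m)))"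
        by (rule sum_product[symmetric])
      also have "(\<Sum>l\<in>Pi\<^sub>E ?J (\<lambda>_. L). (\<Prod>m\<in>?J. ?v (l m))) = (\<Prod>m\<in>?J. \<Sum>x\<in>L. ?v x)"
        using L by (subst prod_sum_PiE) auto
      also have "\<dots> = (\<Sum>x\<in>L. ?v x) ^ (n - 1)" using j by simp
      also have "(\<Sum>K\<in>?s ` F. g K * ?w K) * \<dots> \<le> (\<Sum>K\<in>?s ` F. g K * ?w K) * C0 ^ (n - 1)"
        using C0(2)[OF L] g by (intro mult_left_mono power_mono sum_nonneg mult_nonneg_nonneg) auto
      finally show ?thesis .
    qed
    have "(\<Sum>k\<in>F. (\<Prod>m<n. bracket (k m) powr - (4 - \<delta>)) * g (?s k))
      \<le> (\<Sum>k\<in>F. (\<Sum>j<n. real n ^ 4 * ?w (?s k) * (\<Prod>m\<in>{..<n} - {j}. ?v (k m))) * g (?s k))"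
      by (intro sum_mono mult_right_mono pt g)
    also have "\<dots> = (\<Sum>j<n. real n ^ 4 * (\<Sum>k\<in>F. g (?s k) * ?w (?s k) * (\<Prod>m\<in>{..<n} - {j}. ?v (k m))))"
      unfolding sum_distrib_right sum_distrib_left by (subst sum.swap) (simp add: mult_ac)
    also have "\<dots> \<le> (\<Sum>j<n. real n ^ 4 * ((\<Sum>K\<in>?s ` F. g K * ?w K) * C0 ^ (n - 1)))"
      by (intro sum_mono mult_left_mono one) auto
    also have "\<dots> = real n * (real n ^ 4 * C0 ^ (n - 1)) * (\<Sum>K\<in>?s ` F. g K * ?w K)" by simp
    finally show "(\<Sum>k\<in>F. (\<Prod>m<n. bracket (k m) powr - (4 - \<delta>)) * g (?s k))
       \<le> real n * (real n ^ 4 * C0 ^ (n - 1)) * (\<Sum>K\<in>?s ` F. g K * bracket K powr - (4 - (2 * real n - 1) * \<delta>))"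
      unfolding \<delta>'_def .
  qed
qed

section \<open>Heat kernels with Fourier symbols\<close>

text \<open>Eigenvalue of the squared Laplacian on the torus at frequency k.\<close>

definition aK :: "real^4 \<Rightarrow> real" where "aK k = (2 * pi * norm k) ^ 4"

definition ZB :: "nat \<Rightarrow> (real^4) set" where
  "ZB j = {k\<in>Z4. \<forall>i. \<bar>k $ i\<bar> \<le> real j}"

text \<open>Partial sum, over a symmetric cube of frequencies, of the kernel with multiplier b. At r
  = 0 it also represents the mollifier \<open>zeta_eps\<close>, whose multiplier has bounded
  support.\<close>

definition etat :: "(real^4 \<Rightarrow> real) \<Rightarrow> nat \<Rightarrow> real \<Rightarrow> real^4 \<Rightarrow> real" where
  "etat b j r x = (\<Sum>k\<in>ZB j. b k * exp (- r * aK k) * cos (2 * pi * (x \<bullet> k)))"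

text \<open>What frequency k of the kernel at time r becomes as a function of the noise variable (q,
  y): y enters through x - y, hence the character at -k. The time cutoff is part of the mode, so
  modes for different r live on one space.\<close>

definition uk :: "real \<Rightarrow> real^4 \<Rightarrow> real \<times> (real^4) \<Rightarrow> complex" where
  "uk r k z = complex_of_real (indicator {0..r} (fst z) * exp (- (r - fst z) * aK k)) * ek (- k) (snd z)"

lemma aK_nonneg [simp]: "0 \<le> aK k" by (simp add: aK_def)
lemma aK_minus [simp]: "aK (- k) = aK k" by (simp add: aK_def)
lemma aK_0 [simp]: "aK 0 = 0" by (simp add: aK_def)

lemma finite_ZB [simp]: "finite (ZB j)"
proof -
  have "ZB j \<subseteq> (\<lambda>b. \<chi> i. of_int (b i)) ` Pi\<^sub>E (UNIV::4 set) (\<lambda>_. {- int j..int j})"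
  proof
    fix k assume k: "k \<in> ZB j"
    have "\<lfloor>k $ i\<rfloor> \<in> {- int j..int j}" for i
    proof -
      obtain a where a: "k $ i = of_int a" using k unfolding ZB_def Z4_def by (metis (no_types, lifting) Ints_cases mem_Collect_eq)
      have "\<bar>k $ i\<bar> \<le> real j" using k by (simp add: ZB_def)
      then have "\<bar>a\<bar> \<le> int j" unfolding a by linarith
      then show ?thesis using a by auto
    qed
    moreover have "k = (\<chi> i. of_int \<lfloor>k $ i\<rfloor>)"
      using k by (auto simp: ZB_def Z4_def vec_eq_iff)
    ultimately show "k \<in> (\<lambda>b. \<chi> i. of_int (b i)) ` Pi\<^sub>E (UNIV::4 set) (\<lambda>_. {- int j..int j})"
      by (intro rev_image_eqI[of "\<lambda>i. \<lfloor>k $ i\<rfloor>"]) auto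
  qed
  then show ?thesis by (rule finite_subset) (auto intro!: finite_PiE)
qed

lemma ZB_Z4: "ZB j \<subseteq> Z4" by (auto simp: ZB_def)

lemma ZB_minus [simp]: "- k \<in> ZB j \<longleftrightarrow> k \<in> ZB j"
  using Z4_simps(2)[of k] Z4_simps(2)[of "- k"] by (auto simp: ZB_def)

lemma ZB_mono: "i \<le> j \<Longrightarrow> ZB i \<subseteq> ZB j"
  by (auto simp: ZB_def) (meson of_nat_mono order_trans)

lemma ZB_exhaust: assumes "k \<in> Z4" shows "\<exists>j. k \<in> ZB j"
proof
  have "\<bar>k $ i\<bar> \<le> real (nat \<lceil>norm k\<rceil>)" for i
    using component_le_norm_cart[of k i] by linarith
  then show "k \<in> ZB (nat \<lceil>norm k\<rceil>)" using assms by (simp add: ZB_def)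
qed

text \<open>Turns unordered sums over the lattice into limits of sequences, to which dominated
  convergence and measurability of limits apply.\<close>

lemma ZB_filterlim: "filterlim ZB (finite_subsets_at_top Z4) sequentially"
  unfolding filterlim_finite_subsets_at_top
proof (intro allI impI)
  fix X assume X: "finite X \<and> X \<subseteq> Z4"
  then have "\<exists>f. \<forall>k\<in>X. k \<in> ZB (f k)" using ZB_exhaust by (intro bchoice) auto
  then obtain f where f: "\<And>k. k \<in> X \<Longrightarrow> k \<in> ZB (f k)" by blast
  have "X \<subseteq> ZB j" if "Max (insert 0 (f ` X)) \<le> j" for j
  proof
    fix k assume "k \<in> X"
    then have "f k \<le> j" using that X by (intro order_trans[OF Max_ge that]) auto
    then show "k \<in> ZB j" using f[OF \<open>k \<in> X\<close>] ZB_mono by blast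
  qed
  then show "\<forall>\<^sub>F j in sequentially. finite (ZB j) \<and> X \<subseteq> ZB j \<and> ZB j \<subseteq> Z4"
    using ZB_Z4 by (intro eventually_mono[OF eventually_ge_at_top[of "Max (insert 0 (f ` X))"]]) auto
qed

lemma sum_ZB_minus: "(\<Sum>k\<in>ZB j. f (- k)) = (\<Sum>k\<in>ZB j. f k)"
  by (rule sum.reindex_bij_witness[of _ uminus uminus]) auto

text \<open>Cubes are symmetric and b is even, so pairing k with -k turns cosines into characters,
  which factor under addition.\<close>

lemma etat_ek:
  assumes "\<And>k. b (- k) = b k"
  shows "complex_of_real (etat b j r x) = (\<Sum>k\<in>ZB j. complex_of_real (b k * exp (- r * aK k)) * ek k x)"
proof -
  let ?c = "\<lambda>k. complex_of_real (b k * exp (- r * aK k))"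
  have "(\<Sum>k\<in>ZB j. ?c k * ek k x) = ((\<Sum>k\<in>ZB j. ?c k * ek k x) + (\<Sum>k\<in>ZB j. ?c (- k) * ek (- k) x)) / 2"
    using sum_ZB_minus[of "\<lambda>k. ?c k * ek k x"] by simp
  also have "\<dots> = (\<Sum>k\<in>ZB j. ?c k * ((ek k x + ek (- k) x) / 2))"
    by (simp add: assms sum.distrib[symmetric] distrib_left sum_divide_distrib add_divide_distrib)
  also have "\<dots> = (\<Sum>k\<in>ZB j. ?c k * complex_of_real (cos (2 * pi * (x \<bullet> k))))"
    by (intro sum.cong refl arg_cong2[where f="(*)"]) (simp add: ek_def complex_eq_iff inner_commute)
  finally show ?thesis by (simp add: etat_def)
qed

lemma etat_continuous: "continuous_on UNIV (etat b j r)"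
  unfolding etat_def[abs_def] by (intro continuous_intros)

lemma etat_borel [measurable]: "etat b j r \<in> borel_measurable borel"
  by (intro borel_measurable_continuous_onI etat_continuous)

lemma etat_bound: "\<bar>etat b j r x\<bar> \<le> (\<Sum>k\<in>ZB j. \<bar>b k\<bar> * exp (- r * aK k))"
  unfolding etat_def by (rule order_trans[OF sum_abs sum_mono]) (auto simp: abs_mult intro!: mult_left_le)

text \<open>Expanding the product leaves, as a function of x, the character of the total frequency;
  integration against \<phi> gives its Fourier coefficient there. The truncated kernel is thus a
  finite combination of tensor products of the modes \<open>uk\<close>.\<close>

lemma kern_etat:
  assumes b: "\<And>k. b (- k) = b k" and [measurable]: "\<phi> \<in> borel_measurable borel" and \<phi>: "\<And>x. \<bar>\<phi> x\<bar> \<le> Bp"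
  shows "complex_of_real (kern n (etat b j) r \<phi> z)
    = (\<Sum>\<kappa>\<in>Pi\<^sub>E {..<n} (\<lambda>_. ZB j). fourier \<phi> (\<Sum>m<n. \<kappa> m) * (\<Prod>m<n. b (\<kappa> m)) * (\<Prod>m<n. uk r (\<kappa> m) (z m)))"
proof -
  let ?ind = "indicator {z. \<forall>m<n. fst (z m) \<in> {0..r}} z :: real"
  let ?w = "\<lambda>\<kappa> m. complex_of_real (b (\<kappa> m) * exp (- (r - fst (z m)) * aK (\<kappa> m))) * ek (- \<kappa> m) (snd (z m))"
  let ?P = "Pi\<^sub>E {..<n} (\<lambda>_. ZB j)"
  have ind: "?ind = (\<Prod>m<n. indicator {0..r} (fst (z m)))"
  proof (cases "\<forall>m<n. fst (z m) \<in> {0..r}")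
    case True
    then show ?thesis by simp
  next
    case False
    then obtain m where "m < n" "fst (z m) \<notin> {0..r}" by blast
    then have "(\<Prod>m<n. indicator {0..r} (fst (z m))) = (0::real)" by (intro prod_zero bexI[of _ m]) auto
    then show ?thesis using False by auto
  qed
  have fin: "finite ?P" by (intro finite_PiE) auto
  have prod: "complex_of_real (\<Prod>m<n. etat b j (r - fst (z m)) (x - snd (z m))) = (\<Sum>\<kappa>\<in>?P. (\<Prod>m<n. ?w \<kappa> m) * ek (\<Sum>m<n. \<kappa> m) x)" for x
  proof -
    have "complex_of_real (\<Prod>m<n. etat b j (r - fst (z m)) (x - snd (z m)))
      = (\<Prod>m<n. \<Sum>k\<in>ZB j. complex_of_real (b k * exp (- (r - fst (z m)) * aK k)) * ek k (x - snd (z m)))"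
      unfolding of_real_prod etat_ek[of b, OF b] ..
    also have "\<dots> = (\<Sum>\<kappa>\<in>?P. \<Prod>m<n. complex_of_real (b (\<kappa> m) * exp (- (r - fst (z m)) * aK (\<kappa> m))) * ek (\<kappa> m) (x - snd (z m)))"
      by (subst prod_sum_PiE) auto
    also have "\<dots> = (\<Sum>\<kappa>\<in>?P. (\<Prod>m<n. ?w \<kappa> m) * ek (\<Sum>m<n. \<kappa> m) x)"
    proof (intro sum.cong refl)
      fix \<kappa> :: "nat \<Rightarrow> real^4"
      have "ek (\<kappa> m) (x - snd (z m)) = ek (- \<kappa> m) (snd (z m)) * ek (\<kappa> m) x" for m
        using ek_add[of "\<kappa> m" "- snd (z m)" x] by (simp add: ek_minus_right)
      then show "(\<Prod>m<n. complex_of_real (b (\<kappa> m) * exp (- (r - fst (z m)) * aK (\<kappa> m))) * ek (\<kappa> m) (x - snd (z m))) = (\<Prod>m<n. ?w \<kappa> m) * ek (\<Sum>m<n. \<kappa> m) x"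
        by (simp add: ek_sum prod.distrib mult.assoc)
    qed
    finally show ?thesis .
  qed
  have int: "integrable cubeM (\<lambda>x. complex_of_real (\<phi> x) * ek K x)" for K
    by (rule integrable_cubeM_bounded[where B=Bp]) (auto simp: norm_mult \<phi>)
  have "complex_of_real (LINT x:cube|lborel. \<phi> x * (\<Prod>m<n. etat b j (r - fst (z m)) (x - snd (z m))))
    = (LINT x|cubeM. complex_of_real (\<phi> x * (\<Prod>m<n. etat b j (r - fst (z m)) (x - snd (z m)))))"
    unfolding set_integral_cube integral_complex_of_real ..
  also have "\<dots> = (LINT x|cubeM. (\<Sum>\<kappa>\<in>?P. (\<Prod>m<n. ?w \<kappa> m) * (complex_of_real (\<phi> x) * ek (\<Sum>m<n. \<kappa> m) x)))"
    by (intro Bochner_Integration.integral_cong refl) (simp only: of_real_mult prod sum_distrib_left mult_ac)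
  also have "\<dots> = (\<Sum>\<kappa>\<in>?P. (\<Prod>m<n. ?w \<kappa> m) * fourier \<phi> (\<Sum>m<n. \<kappa> m))"
    by (subst Bochner_Integration.integral_sum) (auto simp: fourier_def intro!: integrable_mult_right int)
  finally have "complex_of_real (kern n (etat b j) r \<phi> z)
    = complex_of_real (\<Prod>m<n. indicator {0..r} (fst (z m))) * (\<Sum>\<kappa>\<in>?P. (\<Prod>m<n. ?w \<kappa> m) * fourier \<phi> (\<Sum>m<n. \<kappa> m))"
    unfolding kern_def of_real_mult ind by (simp only:)
  also have "\<dots> = (\<Sum>\<kappa>\<in>?P. fourier \<phi> (\<Sum>m<n. \<kappa> m) * (\<Prod>m<n. b (\<kappa> m)) * (\<Prod>m<n. uk r (\<kappa> m) (z m)))"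
    unfolding sum_distrib_left
  proof (intro sum.cong refl)
    fix \<kappa> :: "nat \<Rightarrow> real^4"
    have "complex_of_real (\<Prod>m<n. indicator {0..r} (fst (z m))) * (\<Prod>m<n. ?w \<kappa> m) = complex_of_real (\<Prod>m<n. b (\<kappa> m)) * (\<Prod>m<n. uk r (\<kappa> m) (z m))"
      unfolding of_real_prod prod.distrib[symmetric] uk_def by (intro prod.cong refl) (simp add: mult_ac)
    then show "complex_of_real (\<Prod>m<n. indicator {0..r} (fst (z m))) * ((\<Prod>m<n. ?w \<kappa> m) * fourier \<phi> (\<Sum>m<n. \<kappa> m))
      = fourier \<phi> (\<Sum>m<n. \<kappa> m) * (\<Prod>m<n. b (\<kappa> m)) * (\<Prod>m<n. uk r (\<kappa> m) (z m))"
      by (simp only: mult_ac)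
  qed
  finally show ?thesis .
qed

lemma norm_uk_le: "norm (uk r k z) \<le> 1"
  by (auto simp: uk_def norm_mult indicator_def intro!: mult_nonpos_nonneg)

lemma uk_borel [measurable]: "uk r k \<in> borel_measurable borel"
proof -
  have [measurable]: "fst \<in> borel \<rightarrow>\<^sub>M (borel::real measure)" "snd \<in> borel \<rightarrow>\<^sub>M (borel :: (real^4) measure)"
    by (auto intro!: borel_measurable_continuous_onI continuous_on_fst continuous_on_snd continuous_on_id)
  show ?thesis unfolding uk_def[abs_def] by measurable
qed

section \<open>Covariances in time and Parseval\<close>

lemma integral_ST_product:
  fixes T :: "real \<Rightarrow> complex" and Y :: "real^4 \<Rightarrow> complex"
  assumes [measurable]: "T \<in> borel_measurable borel" "Y \<in> borel_measurable borel"
    and T: "\<And>q. norm (T q) \<le> indicator {0..r} q * BT" and Y: "\<And>y. norm (Y y) \<le> BY"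
  shows "integrable ST (\<lambda>z. T (fst z) * Y (snd z))"
    and "(LINT z|ST. T (fst z) * Y (snd z)) = (LINT q|lborel. T q) * (LINT y|cubeM. Y y)"
proof -
  have B0: "0 \<le> BY" using norm_ge_zero[of "Y 0"] Y[of 0] by linarith
  have [measurable]: "fst \<in> borel \<rightarrow>\<^sub>M (borel::real measure)" "snd \<in> borel \<rightarrow>\<^sub>M (borel :: (real^4) measure)"
    by (auto intro!: borel_measurable_continuous_onI continuous_on_fst continuous_on_snd continuous_on_id)
  have fm [measurable]: "(\<lambda>z. T (fst z) * Y (snd z)) \<in> borel_measurable borel" by measurable
  let ?g = "\<lambda>z. indicator ({0..} \<times> cube) z *\<^sub>R (T (fst z) * Y (snd z))"
  have fin: "emeasure lborel ({0..r} \<times> cube) < \<infinity>"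
  proof -
    have "emeasure lborel ({0..r} \<times> cube) = emeasure lborel {0..r} * emeasure lborel cube"
      unfolding lborel_prod[symmetric] by (intro lborel.emeasure_pair_measure_Times) auto
    then show ?thesis by (cases "0 \<le> r") (simp_all add: emeasure_cube)
  qed
  have gi: "integrable lborel ?g"
  proof (rule integrableI_bounded_set[where A="{0..r} \<times> cube" and B="\<bar>BT\<bar> * BY"])
    show "{0..r} \<times> cube \<in> sets lborel" by (simp add: borel_Times)
    have T': "norm (T q) \<le> \<bar>BT\<bar>" for q
      using T[of q] by (cases "q \<in> {0..r}") auto
    have "norm (T q * Y y) \<le> \<bar>BT\<bar> * BY" for q y
      unfolding norm_mult using T'[of q] Y[of y] by (intro mult_mono) auto
    then show "AE z\<in>{0..r} \<times> cube in lborel. norm (?g z) \<le> \<bar>BT\<bar> * BY"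
      by (intro AE_I2) (auto simp: indicator_def)
    have T0: "T q = 0" if "\<not> q \<le> r" for q using T[of q] that by simp
    have "?g z = 0" if "z \<notin> {0..r} \<times> cube" for z
      using that T0[of "fst z"] by (cases "fst z \<le> r") (auto simp: indicator_def mem_Times_iff)
    then show "AE z in lborel. z \<notin> {0..r} \<times> cube \<longrightarrow> ?g z = 0"
      by (intro AE_I2 impI)
  qed (use fin in auto)
  then show "integrable ST (\<lambda>z. T (fst z) * Y (snd z))"
    unfolding ST_eq by (subst integrable_restrict_space) auto
  have "(LINT z|ST. T (fst z) * Y (snd z)) = (LINT z|lborel. ?g z)"
    unfolding ST_eq by (subst integral_restrict_space) auto
  also have "\<dots> = (LINT z|(lborel \<Otimes>\<^sub>M lborel). ?g z)" unfolding lborel_prod ..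
  also have "\<dots> = (LINT q|lborel. LINT y|lborel. ?g (q, y))"
    using gi by (intro lborel_pair.integral_fst'[symmetric]) (simp add: lborel_prod)
  also have "\<dots> = (LINT q|lborel. T q * (LINT y|cubeM. Y y))"
  proof (intro Bochner_Integration.integral_cong refl)
    fix q
    have g: "?g (q, y) = T q * (indicator cube y *\<^sub>R Y y)" for y
      using T[of q] by (auto simp: indicator_def split: if_splits)
    have c: "(LINT y|cubeM. Y y) = (LINT y|lborel. indicator cube y *\<^sub>R Y y)"
      by (simp add: cubeM_def integral_restrict_space)
    show "(LINT y|lborel. ?g (q, y)) = T q * (LINT y|cubeM. Y y)"
      unfolding g c by (rule integral_mult_right_zero)
  qed
  also have "\<dots> = (LINT q|lborel. T q) * (LINT y|cubeM. Y y)" by simp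
  finally show "(LINT z|ST. T (fst z) * Y (snd z)) = (LINT q|lborel. T q) * (LINT y|cubeM. Y y)" .
qed

text \<open>Covariance at times r and s of an Ornstein-Uhlenbeck process with rate a started at
  zero. With a = \<open>aK k\<close> it is the inner product of \<open>uk r k\<close> and
  \<open>uk s k\<close>.\<close>

definition Hk :: "real \<Rightarrow> real \<Rightarrow> real \<Rightarrow> real" where
  "Hk a r s = (LINT q|lborel. indicator {0..r} q * exp (- (r - q) * a) * (indicator {0..s} q * exp (- (s - q) * a)))"

lemma Hk_commute: "Hk a r s = Hk a s r"
  unfolding Hk_def by (intro Bochner_Integration.integral_cong) (auto simp: mult_ac)

lemma integral_uk:
  assumes k: "k \<in> Z4" "l \<in> Z4"
  shows "integrable ST (\<lambda>z. uk r k z * cnj (uk s l z))"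
    and "(LINT z|ST. uk r k z * cnj (uk s l z)) = (if k = l then complex_of_real (Hk (aK k) r s) else 0)"
proof -
  let ?T = "\<lambda>q. complex_of_real (indicator {0..r} q * exp (- (r - q) * aK k) * (indicator {0..s} q * exp (- (s - q) * aK l)))"
  let ?Y = "\<lambda>y. ek (l - k) y"
  have eq: "uk r k z * cnj (uk s l z) = ?T (fst z) * ?Y (snd z)" for z
    using ek_add_left[of "- k" l "snd z"] by (simp add: uk_def cnj_ek mult_ac)
  have T: "norm (?T q) \<le> indicator {0..r} q * 1" for q
    unfolding norm_of_real by (auto simp: indicator_def abs_mult intro!: mult_le_one mult_nonpos_nonneg)
  have m: "?T \<in> borel_measurable borel" by measurable
  note * = integral_ST_product[where T="?T" and Y="?Y" and r=r and BT=1 and BY=1, OF m ek_measurable T]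
  show "integrable ST (\<lambda>z. uk r k z * cnj (uk s l z))" unfolding eq by (rule *(1)) simp
  have "(LINT z|ST. uk r k z * cnj (uk s l z)) = (LINT q|lborel. ?T q) * (LINT y|cubeM. ?Y y)"
    unfolding eq by (rule *(2)) simp
  also have "(LINT y|cubeM. ?Y y) = (if k = l then 1 else 0)"
    using integral_ek[of "l - k"] k by simp
  also have "(LINT q|lborel. ?T q) = complex_of_real (LINT q|lborel. indicator {0..r} q * exp (- (r - q) * aK k) * (indicator {0..s} q * exp (- (s - q) * aK l)))"
    by (rule integral_complex_of_real)
  finally show "(LINT z|ST. uk r k z * cnj (uk s l z)) = (if k = l then complex_of_real (Hk (aK k) r s) else 0)"
    by (auto simp: Hk_def)
qed

definition Pk :: "nat \<Rightarrow> real \<Rightarrow> (nat \<Rightarrow> real^4) \<Rightarrow> (nat \<Rightarrow> real \<times> (real^4)) \<Rightarrow> complex" where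
  "Pk n r \<kappa> z = (\<Prod>m<n. uk r (\<kappa> m) (z m))"

lemma integral_Pk:
  assumes \<kappa>: "\<kappa> \<in> Pi\<^sub>E {..<n} (\<lambda>_. Z4)" "\<mu> \<in> Pi\<^sub>E {..<n} (\<lambda>_. Z4)"
  shows "integrable (STn n) (\<lambda>z. Pk n r \<kappa> z * cnj (Pk n s \<mu> z))"
    and "(LINT z|STn n. Pk n r \<kappa> z * cnj (Pk n s \<mu> z)) = (if \<kappa> = \<mu> then complex_of_real (\<Prod>m<n. Hk (aK (\<kappa> m)) r s) else 0)"
proof -
  have eq: "Pk n r \<kappa> z * cnj (Pk n s \<mu> z) = (\<Prod>m\<in>{..<n}. uk r (\<kappa> m) (z m) * cnj (uk s (\<mu> m) (z m)))" for z
    by (simp add: Pk_def prod.distrib)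
  have Z: "\<kappa> m \<in> Z4" "\<mu> m \<in> Z4" if "m < n" for m using \<kappa> that by auto
  show "integrable (STn n) (\<lambda>z. Pk n r \<kappa> z * cnj (Pk n s \<mu> z))"
    unfolding eq STn_def by (rule STn.product_integrable_prod) (auto intro!: integral_uk Z)
  have "(LINT z|STn n. Pk n r \<kappa> z * cnj (Pk n s \<mu> z)) = (\<Prod>m\<in>{..<n}. LINT z|ST. uk r (\<kappa> m) z * cnj (uk s (\<mu> m) z))"
    unfolding eq STn_def by (rule STn.product_integral_prod) (auto intro!: integral_uk Z)
  also have "\<dots> = (\<Prod>m<n. if \<kappa> m = \<mu> m then complex_of_real (Hk (aK (\<kappa> m)) r s) else 0)"
    using Z by (intro prod.cong refl integral_uk) auto
  also have "\<dots> = (if \<kappa> = \<mu> then complex_of_real (\<Prod>m<n. Hk (aK (\<kappa> m)) r s) else 0)"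
  proof (cases "\<kappa> = \<mu>")
    case False
    then obtain m where "m < n" "\<kappa> m \<noteq> \<mu> m" using \<kappa> by (metis PiE_ext lessThan_iff)
    then have "(\<Prod>m<n. if \<kappa> m = \<mu> m then complex_of_real (Hk (aK (\<kappa> m)) r s) else 0) = 0"
      by (intro prod_zero) auto
    then show ?thesis using False by simp
  qed simp
  finally show "(LINT z|STn n. Pk n r \<kappa> z * cnj (Pk n s \<mu> z)) = (if \<kappa> = \<mu> then complex_of_real (\<Prod>m<n. Hk (aK (\<kappa> m)) r s) else 0)" .
qed

text \<open>The squared L^2 norm of \<open>Pk n r \<kappa> - Pk n s \<kappa>\<close>, multiplied
  out.\<close>

definition Dk :: "nat \<Rightarrow> real \<Rightarrow> real \<Rightarrow> (nat \<Rightarrow> real^4) \<Rightarrow> real" where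
  "Dk n r s \<kappa> = (\<Prod>m<n. Hk (aK (\<kappa> m)) r r) - 2 * (\<Prod>m<n. Hk (aK (\<kappa> m)) r s) + (\<Prod>m<n. Hk (aK (\<kappa> m)) s s)"

text \<open>Tensor modes with different frequency tuples are orthogonal through their space
  variables, whatever the times. Increments in time keep this orthogonality, and only diagonal terms
  remain.\<close>

lemma parseval_Pk:
  fixes c :: "(nat \<Rightarrow> real^4) \<Rightarrow> complex" and r s :: real
  assumes F: "finite F" "F \<subseteq> Pi\<^sub>E {..<n} (\<lambda>_. Z4)"
  defines "S \<equiv> \<lambda>z. \<Sum>\<kappa>\<in>F. c \<kappa> * (Pk n r \<kappa> z - Pk n s \<kappa> z)"
  shows "integrable (STn n) (\<lambda>z. (norm (S z))^2)"
    and "(LINT z|STn n. (norm (S z))^2) = (\<Sum>\<kappa>\<in>F. (norm (c \<kappa>))^2 * Dk n r s \<kappa>)"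
proof -
  let ?G = "\<lambda>\<kappa> z. Pk n r \<kappa> z - Pk n s \<kappa> z"
  have Z: "\<kappa> \<in> Pi\<^sub>E {..<n} (\<lambda>_. Z4)" if "\<kappa> \<in> F" for \<kappa> using F that by auto
  have G: "integrable (STn n) (\<lambda>z. ?G \<kappa> z * cnj (?G \<mu> z))"
    "(LINT z|STn n. ?G \<kappa> z * cnj (?G \<mu> z)) = (if \<kappa> = \<mu> then complex_of_real (Dk n r s \<kappa>) else 0)"
    if "\<kappa> \<in> F" "\<mu> \<in> F" for \<kappa> \<mu>
  proof -
    note I = integral_Pk[OF Z[OF that(1)] Z[OF that(2)]]
    have eq: "?G \<kappa> z * cnj (?G \<mu> z) = Pk n r \<kappa> z * cnj (Pk n r \<mu> z) - Pk n r \<kappa> z * cnj (Pk n s \<mu> z)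
        - (Pk n s \<kappa> z * cnj (Pk n r \<mu> z) - Pk n s \<kappa> z * cnj (Pk n s \<mu> z))" for z
      by (simp add: algebra_simps)
    show "integrable (STn n) (\<lambda>z. ?G \<kappa> z * cnj (?G \<mu> z))"
      unfolding eq by (intro Bochner_Integration.integrable_diff I)
    have "(LINT z|STn n. ?G \<kappa> z * cnj (?G \<mu> z)) =
       (LINT z|STn n. Pk n r \<kappa> z * cnj (Pk n r \<mu> z)) - (LINT z|STn n. Pk n r \<kappa> z * cnj (Pk n s \<mu> z))
       - ((LINT z|STn n. Pk n s \<kappa> z * cnj (Pk n r \<mu> z)) - (LINT z|STn n. Pk n s \<kappa> z * cnj (Pk n s \<mu> z)))"
      unfolding eq by (simp only: Bochner_Integration.integral_diff I Bochner_Integration.integrable_diff)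
    also have "\<dots> = (if \<kappa> = \<mu> then complex_of_real (Dk n r s \<kappa>) else 0)"
      unfolding I(2) by (simp add: Dk_def Hk_commute[of _ s r])
    finally show "(LINT z|STn n. ?G \<kappa> z * cnj (?G \<mu> z)) = (if \<kappa> = \<mu> then complex_of_real (Dk n r s \<kappa>) else 0)" .
  qed
  have sq: "complex_of_real ((norm (S z))^2) = (\<Sum>\<kappa>\<in>F. \<Sum>\<mu>\<in>F. (c \<kappa> * cnj (c \<mu>)) * (?G \<kappa> z * cnj (?G \<mu> z)))" for z
  proof -
    have "complex_of_real ((norm (S z))^2) = S z * cnj (S z)" by (rule complex_norm_square)
    also have "\<dots> = (\<Sum>\<kappa>\<in>F. \<Sum>\<mu>\<in>F. (c \<kappa> * ?G \<kappa> z) * cnj (c \<mu> * ?G \<mu> z))"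
      unfolding S_def cnj_sum sum_product ..
    finally show ?thesis by (simp only: complex_cnj_mult mult_ac)
  qed
  have int: "integrable (STn n) (\<lambda>z. complex_of_real ((norm (S z))^2))"
    unfolding sq by (intro Bochner_Integration.integrable_sum integrable_mult_right G)
  from integrable_Re[OF this] show "integrable (STn n) (\<lambda>z. (norm (S z))^2)" by simp
  have "complex_of_real (LINT z|STn n. (norm (S z))^2) = (LINT z|STn n. complex_of_real ((norm (S z))^2))"
    by (rule integral_complex_of_real[symmetric])
  also have "\<dots> = (\<Sum>\<kappa>\<in>F. \<Sum>\<mu>\<in>F. (c \<kappa> * cnj (c \<mu>)) * (LINT z|STn n. ?G \<kappa> z * cnj (?G \<mu> z)))"
    unfolding sq
    by (subst Bochner_Integration.integral_sum, intro Bochner_Integration.integrable_sum integrable_mult_right G, assumption+)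
      (intro sum.cong refl, subst Bochner_Integration.integral_sum, intro integrable_mult_right G, assumption+, simp)
  also have "\<dots> = (\<Sum>\<kappa>\<in>F. \<Sum>\<mu>\<in>F. if \<kappa> = \<mu> then (c \<kappa> * cnj (c \<kappa>)) * complex_of_real (Dk n r s \<kappa>) else 0)"
    by (intro sum.cong refl) (subst G(2), assumption+, simp)
  also have "\<dots> = (\<Sum>\<kappa>\<in>F. (c \<kappa> * cnj (c \<kappa>)) * complex_of_real (Dk n r s \<kappa>))"
    using F by simp
  also have "\<dots> = complex_of_real (\<Sum>\<kappa>\<in>F. (norm (c \<kappa>))^2 * Dk n r s \<kappa>)"
    by (simp only: of_real_sum of_real_mult complex_norm_square)
  finally show "(LINT z|STn n. (norm (S z))^2) = (\<Sum>\<kappa>\<in>F. (norm (c \<kappa>))^2 * Dk n r s \<kappa>)"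
    by (simp only: of_real_eq_iff)
qed

lemma Z4_norm_ge_1: assumes "k \<in> Z4" "k \<noteq> 0" shows "1 \<le> norm k"
proof -
  obtain i where i: "k $ i \<noteq> 0" using assms(2) by (auto simp: vec_eq_iff)
  then have "1 \<le> \<bar>k $ i\<bar>" using assms(1) by (auto simp: Z4_def intro!: Ints_nonzero_abs_ge1)
  then show ?thesis using component_le_norm_cart[of k i] by linarith
qed

lemma aK_ge: assumes "k \<in> Z4" "k \<noteq> 0" shows "bracket k ^ 4 \<le> aK k"
proof -
  have "bracket k = norm k" using Z4_norm_ge_1[OF assms] by (simp add: bracket_def)
  also have "\<dots> \<le> 2 * pi * norm k" using pi_ge_two mult_right_mono[of 1 "2 * pi" "norm k"] by simp
  finally show ?thesis unfolding aK_def by (intro power_mono) auto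
qed

text \<open>For t \<ge> 0, the integral of exp(-2 a u) over u in [0, t], that is the variance of a
  mode at time t; the zero mode grows linearly.\<close>

definition Ek :: "real \<Rightarrow> real \<Rightarrow> real" where
  "Ek a t = (if a = 0 then t else (1 - exp (- 2 * t * a)) / (2 * a))"

lemma Hk_eq:
  assumes "0 \<le> a" "0 \<le> s" "s \<le> r"
  shows "Hk a r s = exp (- (r - s) * a) * Ek a s"
proof -
  have eq: "indicator {0..r} q * exp (- (r - q) * a) * (indicator {0..s} q * exp (- (s - q) * a))
     = exp (- (r - s) * a) * (exp (- 2 * (s - q) * a) * indicator {0..s} q)" for q
  proof -
    have "exp (- (r - q) * a) * exp (- (s - q) * a) = exp (- (r - s) * a) * exp (- 2 * (s - q) * a)"
      unfolding exp_add[symmetric] by (simp add: algebra_simps)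
    then show ?thesis using assms by (auto simp: indicator_def mult_ac)
  qed
  have "(LINT q|lborel. exp (- 2 * (s - q) * a) * indicator {0..s} q) = Ek a s"
  proof (cases "a = 0")
    case True
    then show ?thesis using assms by (simp add: Ek_def)
  next
    case False
    have "(LINT q|lborel. exp (- 2 * (s - q) * a) * indicator {0..s} q)
       = exp (- 2 * (s - s) * a) / (2 * a) - exp (- 2 * (s - 0) * a) / (2 * a)"
      using False assms
      by (intro integral_FTC_Icc_real) (auto intro!: derivative_eq_intros continuous_intros)
    then show ?thesis using False by (simp add: Ek_def diff_divide_distrib)
  qed
  then show ?thesis unfolding Hk_def eq by simp
qed

lemma exp_ge_1_minus: "1 - exp (- x) \<le> (x::real)"
  using exp_ge_add_one_self[of "- x"] by simp

lemma Ek_bounds: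
  assumes "0 \<le> a" "0 \<le> t"
  shows "0 \<le> Ek a t" "Ek a t \<le> t" "a \<noteq> 0 \<Longrightarrow> Ek a t \<le> 1 / (2 * a)"
proof -
  show "0 \<le> Ek a t" using assms by (auto simp: Ek_def)
  show "Ek a t \<le> t"
    using exp_ge_1_minus[of "2 * t * a"] assms by (auto simp: Ek_def divide_simps mult_ac)
  show "a \<noteq> 0 \<Longrightarrow> Ek a t \<le> 1 / (2 * a)"
    using assms by (auto simp: Ek_def divide_simps)
qed

text \<open>By the semigroup law the variance gained between s and r is exp(-2 s a) times the
  variance at time r - s.\<close>

lemma Ek_diff:
  assumes "0 \<le> a" "0 \<le> s" "s \<le> r"
  shows "Ek a s \<le> Ek a r" "Ek a r - Ek a s \<le> Ek a (r - s)"
proof -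
  have "Ek a r - Ek a s = exp (- 2 * s * a) * Ek a (r - s)"
  proof (cases "a = 0")
    case False
    have "exp (- 2 * r * a) = exp (- 2 * s * a) * exp (- 2 * (r - s) * a)"
      unfolding exp_add[symmetric] by (simp add: algebra_simps)
    then show ?thesis using False by (simp add: Ek_def diff_divide_distrib right_diff_distrib)
  qed (simp add: Ek_def)
  moreover have "0 \<le> exp (- 2 * s * a) * Ek a (r - s)" "exp (- 2 * s * a) * Ek a (r - s) \<le> Ek a (r - s)"
    using Ek_bounds(1)[of a "r - s"] assms by (auto intro!: mult_left_le_one_le)
  ultimately show "Ek a s \<le> Ek a r" "Ek a r - Ek a s \<le> Ek a (r - s)" by linarith+
qed

text \<open>Two bounds for one quantity, one small in time and one small in frequency;
  \<open>le_powr_interpolate\<close> takes their weighted geometric mean.\<close>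

lemma exp_defect:
  assumes "0 \<le> a" "0 \<le> \<tau>" "0 \<le> s"
  shows "(1 - exp (- \<tau> * a)) * Ek a s \<le> \<tau>" "a \<noteq> 0 \<Longrightarrow> (1 - exp (- \<tau> * a)) * Ek a s \<le> 1 / (2 * a)"
proof -
  have e: "0 \<le> 1 - exp (- \<tau> * a)" "1 - exp (- \<tau> * a) \<le> 1" "1 - exp (- \<tau> * a) \<le> \<tau> * a"
    using assms exp_ge_1_minus[of "\<tau> * a"] by auto
  show 2: "(1 - exp (- \<tau> * a)) * Ek a s \<le> 1 / (2 * a)" if "a \<noteq> 0"
    using mult_mono[OF e(2) Ek_bounds(3)[OF assms(1,3) that]] Ek_bounds(1)[OF assms(1,3)] by simp
  show "(1 - exp (- \<tau> * a)) * Ek a s \<le> \<tau>"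
  proof (cases "a = 0")
    case False
    then have "(1 - exp (- \<tau> * a)) * Ek a s \<le> (\<tau> * a) * (1 / (2 * a))"
      using e assms by (intro mult_mono Ek_bounds) auto
    also have "\<dots> \<le> \<tau>" using False assms by simp
    finally show ?thesis .
  qed (use assms in simp)
qed

lemma le_powr_interpolate:
  fixes x t w :: real
  assumes "0 \<le> x" "x \<le> t" "x \<le> w" "0 \<le> \<beta>" "\<beta> \<le> 1"
  shows "x \<le> t powr \<beta> * w powr (1 - \<beta>)"
proof (cases "x = 0")
  case False
  then have "x = x powr \<beta> * x powr (1 - \<beta>)" using assms by (simp add: powr_add[symmetric])
  also have "\<dots> \<le> t powr \<beta> * w powr (1 - \<beta>)"
    using assms by (intro mult_mono powr_mono2) auto
  finally show ?thesis .
qed simp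

text \<open>Variances and defects are bounded both by a time and by a multiple of |k|^-4.
  Interpolating with weights \<beta> and 1 - \<beta> trades |r - s|^\<beta> for 4 \<beta> powers of
  frequency. The factor U covers the zero mode, for which only the bound by time is
  available.\<close>

lemma Hk_estimates:
  assumes k: "k \<in> Z4" and s: "0 \<le> s" "s \<le> r" "r \<le> U" and U: "1 \<le> U" and \<beta>: "0 \<le> \<beta>" "\<beta> \<le> 1"
  defines "w \<equiv> U * bracket k powr - (4 - 4 * \<beta>)" and "a \<equiv> aK k"
  shows "0 \<le> Hk a r s" "Hk a r s \<le> Hk a r r" "Hk a r s \<le> Hk a s s"
    "Hk a r r \<le> w" "Hk a s s \<le> w"
    "Hk a r r - Hk a r s \<le> 2 * (r - s) powr \<beta> * w" "Hk a s s - Hk a r s \<le> (r - s) powr \<beta> * w"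
proof -
  have a0: "0 \<le> a" by (simp add: a_def)
  have H: "Hk a r r = Ek a r" "Hk a s s = Ek a s" "Hk a r s = exp (- (r - s) * a) * Ek a s"
    using Hk_eq[OF a0, of r r] Hk_eq[OF a0, of s s] Hk_eq[OF a0, of s r] s by auto
  define v where "v = U * bracket k powr - 4"
  have br4: "bracket k powr - 4 = 1 / bracket k ^ 4"
    using powr_realpow[of "bracket k" 4] by (simp add: powr_minus_divide)
  have v: "x \<le> v" if "0 \<le> x" "x \<le> U" "a \<noteq> 0 \<Longrightarrow> x \<le> 1 / (2 * a)" for x
  proof (cases "k = 0")
    case True
    then show ?thesis using that by (simp add: v_def bracket_def)
  next
    case False
    have "1 \<le> bracket k ^ 4" by (rule one_le_power) simp
    then have a: "bracket k ^ 4 \<le> a" "0 < a" using aK_ge[OF k False] unfolding a_def by linarith+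
    have "x \<le> 1 / (2 * a)" using that(3) a by simp
    also have "\<dots> \<le> 1 / bracket k ^ 4" using a \<open>1 \<le> bracket k ^ 4\<close> by (intro frac_le) linarith+
    also have "\<dots> \<le> U * (1 / bracket k ^ 4)" using U mult_right_mono[of 1 U "1 / bracket k ^ 4"] by simp
    finally show ?thesis by (simp only: v_def br4)
  qed
  have v0: "0 \<le> v" using U by (simp add: v_def)
  have vw: "v \<le> w" unfolding v_def w_def using U \<beta> by (intro mult_left_mono powr_mono) auto
  have vpow: "v powr (1 - \<beta>) \<le> w"
  proof -
    have "v powr (1 - \<beta>) = U powr (1 - \<beta>) * bracket k powr - (4 - 4 * \<beta>)"
      unfolding v_def using U by (simp add: powr_mult powr_powr algebra_simps)
    also have "\<dots> \<le> U powr 1 * bracket k powr - (4 - 4 * \<beta>)"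
      using U \<beta> by (intro mult_right_mono powr_mono) auto
    finally show ?thesis using U by (simp add: w_def)
  qed
  have ip: "x \<le> (r - s) powr \<beta> * w" if "0 \<le> x" "x \<le> r - s" "a \<noteq> 0 \<Longrightarrow> x \<le> 1 / (2 * a)" for x
  proof -
    have "x \<le> v" using that s by (intro v) auto
    then have "x \<le> (r - s) powr \<beta> * v powr (1 - \<beta>)" using that \<beta> by (intro le_powr_interpolate) auto
    also have "\<dots> \<le> (r - s) powr \<beta> * w" by (intro mult_left_mono vpow) simp
    finally show ?thesis .
  qed
  have Es: "0 \<le> Ek a s" using Ek_bounds(1)[OF a0 s(1)] .
  show "0 \<le> Hk a r s" unfolding H using Es by simp
  have c: "exp (- (r - s) * a) \<le> 1" using a0 s by (simp add: mult_nonpos_nonneg)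
  show le: "Hk a r s \<le> Hk a s s" unfolding H using Es c by (intro mult_left_le_one_le) auto
  then show "Hk a r s \<le> Hk a r r" using Ek_diff(1)[OF a0 s(1,2)] unfolding H by linarith
  show "Hk a r r \<le> w" using v[of "Ek a r"] vw Ek_bounds[OF a0, of r] s unfolding H by linarith
  show "Hk a s s \<le> w" using v[of "Ek a s"] vw Ek_bounds[OF a0, of s] s unfolding H by linarith
  have d: "Hk a s s - Hk a r s = (1 - exp (- (r - s) * a)) * Ek a s" unfolding H by (simp add: algebra_simps)
  show 2: "Hk a s s - Hk a r s \<le> (r - s) powr \<beta> * w"
    unfolding d using exp_defect[OF a0, of "r - s" s] s c Es by (intro ip) auto
  have "Ek a (r - s) \<le> (r - s) powr \<beta> * w"
    using Ek_bounds[OF a0, of "r - s"] s by (intro ip) auto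
  then show "Hk a r r - Hk a r s \<le> 2 * (r - s) powr \<beta> * w"
    using 2 Ek_diff(2)[OF a0 s(1,2)] unfolding H by linarith
qed

text \<open>Replace one factor at a time; each of the n replacements costs c times the product of
  the upper bounds.\<close>

lemma prod_diff_le:
  fixes x y w :: "nat \<Rightarrow> real"
  assumes "\<And>m. m < n \<Longrightarrow> 0 \<le> y m" "\<And>m. m < n \<Longrightarrow> y m \<le> x m" "\<And>m. m < n \<Longrightarrow> x m \<le> w m"
    "\<And>m. m < n \<Longrightarrow> x m - y m \<le> c * w m" "0 \<le> c"
  shows "(\<Prod>m<n. x m) - (\<Prod>m<n. y m) \<le> real n * c * (\<Prod>m<n. w m)"
  using assms(1-4)
proof (induction n)
  case (Suc n)
  have IH: "(\<Prod>m<n. x m) - (\<Prod>m<n. y m) \<le> real n * c * (\<Prod>m<n. w m)" using Suc by auto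
  have nn: "0 \<le> y m" "0 \<le> x m" "0 \<le> w m" if "m < Suc n" for m
    using Suc.prems(1-3)[OF that] by linarith+
  have W: "0 \<le> (\<Prod>m<n. w m)" using nn by (intro prod_nonneg) auto
  have xw: "(\<Prod>m<n. x m) \<le> (\<Prod>m<n. w m)" using Suc.prems nn by (intro prod_mono) auto
  have y0: "0 \<le> (\<Prod>m<n. x m)" using nn by (intro prod_nonneg) auto
  have "(\<Prod>m<Suc n. x m) - (\<Prod>m<Suc n. y m) = (\<Prod>m<n. x m) * (x n - y n) + ((\<Prod>m<n. x m) - (\<Prod>m<n. y m)) * y n"
    by (simp add: algebra_simps)
  also have "\<dots> \<le> (\<Prod>m<n. w m) * (c * w n) + (real n * c * (\<Prod>m<n. w m)) * w n"
  proof (intro add_mono mult_mono)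
    show "x n - y n \<le> c * w n" "y n \<le> w n" "0 \<le> x n - y n" "0 \<le> y n"
      using Suc.prems(1-4)[of n] by auto
    show "0 \<le> real n * c * (\<Prod>m<n. w m)" using W assms(5) by simp
  qed (use xw y0 IH W in auto)
  also have "\<dots> = real (Suc n) * c * (\<Prod>m<Suc n. w m)" by (simp add: algebra_simps)
  finally show ?case .
qed simp

text \<open>Each of the two variance products in \<open>Dk\<close> is paired with one copy of the
  covariance product; the one-mode constants 2 and 1 add up to 3.\<close>

lemma Dk_bound:
  assumes \<kappa>: "\<And>m. m < n \<Longrightarrow> \<kappa> m \<in> Z4" and s: "0 \<le> s" "s \<le> r" "r \<le> U" and U: "1 \<le> U" and \<beta>: "0 \<le> \<beta>" "\<beta> \<le> 1"
  shows "Dk n r s \<kappa> \<le> 3 * real n * U ^ n * (r - s) powr \<beta> * (\<Prod>m<n. bracket (\<kappa> m) powr - (4 - 4 * \<beta>))"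
proof -
  let ?w = "\<lambda>m. U * bracket (\<kappa> m) powr - (4 - 4 * \<beta>)"
  note est = Hk_estimates[OF \<kappa> s U \<beta>]
  have "(\<Prod>m<n. Hk (aK (\<kappa> m)) r r) - (\<Prod>m<n. Hk (aK (\<kappa> m)) r s) \<le> real n * (2 * (r - s) powr \<beta>) * (\<Prod>m<n. ?w m)"
    by (rule prod_diff_le) (use est in auto)
  moreover have "(\<Prod>m<n. Hk (aK (\<kappa> m)) s s) - (\<Prod>m<n. Hk (aK (\<kappa> m)) r s) \<le> real n * ((r - s) powr \<beta>) * (\<Prod>m<n. ?w m)"
    by (rule prod_diff_le) (use est in auto)
  ultimately have "Dk n r s \<kappa> \<le> 3 * real n * (r - s) powr \<beta> * (\<Prod>m<n. ?w m)"
    unfolding Dk_def by (simp add: algebra_simps)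
  also have "(\<Prod>m<n. ?w m) = U ^ n * (\<Prod>m<n. bracket (\<kappa> m) powr - (4 - 4 * \<beta>))"
    by (simp add: prod.distrib)
  finally show ?thesis by (simp add: mult_ac)
qed

text \<open>The value at time $0$ is the junk value of the divergent series defining the kernel; \<open>kern\<close> only uses it on a null set.\<close>

definition fourier_symbol :: "(real^4 \<Rightarrow> real) \<Rightarrow> (real \<Rightarrow> real^4 \<Rightarrow> real) \<Rightarrow> bool" where
  "fourier_symbol b E \<longleftrightarrow> (\<forall>k. b (- k) = b k) \<and> (\<exists>B. \<forall>k. \<bar>b k\<bar> \<le> B) \<and>
     (\<forall>r>0. \<forall>x. (\<lambda>j. etat b j r x) \<longlonglongrightarrow> E r x) \<and> (\<forall>x. E 0 x = 0)"

lemma reprD: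
  assumes "fourier_symbol b E"
  shows "b (- k) = b k" "\<exists>B. \<forall>k. \<bar>b k\<bar> \<le> B" "0 < r \<Longrightarrow> (\<lambda>j. etat b j r x) \<longlonglongrightarrow> E r x" "E 0 x = 0"
  using assms by (auto simp: fourier_symbol_def)

text \<open>The quadratic Taylor term of the exponential gives decay |k|^-8, more than the |k|^-5
  that suffices for summation in dimension four. The summand 1 covers k = 0.\<close>

lemma exp_aK_le:
  assumes k: "k \<in> Z4" and s: "0 < s"
  shows "exp (- s * aK k) \<le> (1 + 2 / s^2) * bracket k powr - (4 + 1)"
proof (cases "k = 0")
  case True
  then show ?thesis by (simp add: bracket_def)
next
  case False
  define t where "t = bracket k ^ 4"
  have t1: "1 \<le> t" unfolding t_def by (rule one_le_power) simp
  have at: "t \<le> aK k" using aK_ge[OF k False] by (simp add: t_def)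
  have st: "0 < s * t" using s t1 by simp
  have "exp (- s * aK k) \<le> exp (- (s * t))" using at s by simp
  also have "\<dots> = 1 / exp (s * t)" by (simp add: exp_minus divide_inverse)
  also have "\<dots> \<le> 1 / ((s * t)^2 / 2)"
  proof (rule frac_le)
    show "(s * t)^2 / 2 \<le> exp (s * t)" using exp_lower_Taylor_quadratic[of "s * t"] st by linarith
  qed (use st in auto)
  also have "\<dots> = 2 / s^2 * (1 / t^2)" by (simp add: power_mult_distrib)
  also have "\<dots> \<le> (1 + 2 / s^2) * bracket k powr - (4 + 1)"
  proof (intro mult_mono)
    have "bracket k powr 5 \<le> bracket k powr 8" by (intro powr_mono) auto
    also have "\<dots> = t^2" using powr_realpow[of "bracket k" 8] by (simp add: t_def power_mult[symmetric])
    finally have "bracket k powr 5 \<le> t^2" .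
    then have "1 / t^2 \<le> 1 / bracket k powr 5" by (intro frac_le) auto
    then show "1 / t^2 \<le> bracket k powr - (4 + 1)" by (simp add: powr_minus_divide)
  qed auto
  finally show ?thesis .
qed

lemma etat_bounded:
  assumes b: "\<And>k. \<bar>b k\<bar> \<le> B" and s: "0 < s"
  shows "\<exists>M. \<forall>j x. \<bar>etat b j s x\<bar> \<le> M"
proof -
  obtain C where C: "\<And>F. finite F \<Longrightarrow> F \<subseteq> Z4 \<Longrightarrow> (\<Sum>k\<in>F. bracket k powr - (4 + 1)) \<le> C"
    using lattice_sum[OF zero_less_one] by blast
  have B0: "0 \<le> B" using b[of 0] by linarith
  show ?thesis
  proof (intro exI allI)
    fix j x
    have "\<bar>etat b j s x\<bar> \<le> (\<Sum>k\<in>ZB j. \<bar>b k\<bar> * exp (- s * aK k))" by (rule etat_bound)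
    also have "\<dots> \<le> (\<Sum>k\<in>ZB j. B * ((1 + 2 / s^2) * bracket k powr - (4 + 1)))"
      using ZB_Z4 by (intro sum_mono mult_mono b exp_aK_le s B0) auto
    also have "\<dots> = B * (1 + 2 / s^2) * (\<Sum>k\<in>ZB j. bracket k powr - (4 + 1))"
      by (simp add: sum_distrib_left mult.assoc)
    also have "\<dots> \<le> B * (1 + 2 / s^2) * C"
      using B0 by (intro mult_left_mono C ZB_Z4 finite_ZB) auto
    finally show "\<bar>etat b j s x\<bar> \<le> B * (1 + 2 / s^2) * C" .
  qed
qed

text \<open>When no time equals r, all lags in the support are positive and the truncated factors
  are bounded uniformly in the truncation, so dominated convergence applies in x. The excluded z
  form a null set.\<close>

lemma kern_limit:
  assumes R: "fourier_symbol b E" and [measurable]: "\<phi> \<in> borel_measurable borel" and \<phi>: "\<And>x. \<bar>\<phi> x\<bar> \<le> Bp"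
    and z: "\<And>m. m < n \<Longrightarrow> fst (z m) \<noteq> r"
  shows "(\<lambda>j. kern n (etat b j) r \<phi> z) \<longlonglongrightarrow> kern n E r \<phi> z"
proof (cases "\<forall>m<n. fst (z m) \<in> {0..r}")
  case False
  then have ind0: "indicator {z. \<forall>m<n. fst (z m) \<in> {0..r}} z = (0::real)" by (intro indicator_simps(2)) blast
  show ?thesis unfolding kern_def ind0 by simp
next
  case True
  have pos: "0 < r - fst (z m)" if "m < n" for m
  proof -
    have "fst (z m) \<le> r" using True that by simp
    then show ?thesis using z[OF that] by simp
  qed
  obtain B where B: "\<And>k. \<bar>b k\<bar> \<le> B" using reprD(2)[OF R] by auto
  have "\<forall>m\<in>{..<n}. \<exists>M. \<forall>j x. \<bar>etat b j (r - fst (z m)) x\<bar> \<le> M"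
  proof
    fix m assume "m \<in> {..<n}"
    then have "0 < r - fst (z m)" using pos by simp
    then show "\<exists>M. \<forall>j x. \<bar>etat b j (r - fst (z m)) x\<bar> \<le> M" by (rule etat_bounded[of b, OF B])
  qed
  from bchoice[OF this] obtain M where M': "\<forall>m\<in>{..<n}. \<forall>j x. \<bar>etat b j (r - fst (z m)) x\<bar> \<le> M m" by (rule exE)
  have M: "\<bar>etat b j (r - fst (z m)) x\<bar> \<le> M m" if "m < n" for m j x
    using bspec[OF M', of m] that by simp
  let ?u = "\<lambda>j x. \<phi> x * (\<Prod>m<n. etat b j (r - fst (z m)) (x - snd (z m)))"
  let ?v = "\<lambda>x. \<phi> x * (\<Prod>m<n. E (r - fst (z m)) (x - snd (z m)))"
  have lim: "(\<lambda>j. ?u j x) \<longlonglongrightarrow> ?v x" for x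
    by (intro tendsto_mult tendsto_const tendsto_prod reprD(3)[OF R]) (use pos in auto)
  have um [measurable]: "?u j \<in> borel_measurable borel" for j by measurable
  have vm: "?v \<in> borel_measurable borel" by (rule borel_measurable_LIMSEQ_real[OF lim um])
  have "(\<lambda>j. LINT x|cubeM. ?u j x) \<longlonglongrightarrow> (LINT x|cubeM. ?v x)"
  proof (rule integral_dominated_convergence[where w="\<lambda>_. Bp * (\<Prod>m<n. M m)"])
    show "AE x in cubeM. norm (?u j x) \<le> Bp * (\<Prod>m<n. M m)" for j
    proof (rule AE_I2)
      fix x
      have "0 \<le> Bp" using \<phi>[of 0] by linarith
      then show "norm (?u j x) \<le> Bp * (\<Prod>m<n. M m)"
        unfolding real_norm_def abs_mult abs_prod by (intro mult_mono \<phi> prod_mono conjI M prod_nonneg) auto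
    qed
  qed (auto intro!: measurable_cubeM vm um AE_I2 lim)
  moreover have ind1: "indicator {z. \<forall>m<n. fst (z m) \<in> {0..r}} z = (1::real)" using True by (intro indicator_simps(1)) blast
  ultimately show ?thesis unfolding kern_def set_integral_cube ind1 mult_1_left by (simp only:)
qed

text \<open>One factor is taken at lag zero, where kernels with a symbol have the value 0. This
  settles the points excluded from \<open>kern_limit\<close>, so later identities can hold for every
  z.\<close>

lemma kern_at_time:
  assumes "fourier_symbol b E" "m < n" "fst (z m) = r"
  shows "kern n E r \<phi> z = 0"
proof -
  have "(\<Prod>m<n. E (r - fst (z m)) (x - snd (z m))) = 0" for x
    using assms reprD(4)[OF assms(1)] by (intro prod_zero bexI[of _ m]) auto
  then show ?thesis unfolding kern_def by (simp only: mult_zero_right) (simp add: set_lebesgue_integral_def)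
qed

lemma kern_time_0:
  assumes "fourier_symbol b E" "1 \<le> n" shows "kern n E 0 \<phi> z = 0"
proof (cases "fst (z 0) = 0")
  case True
  then show ?thesis using kern_at_time[OF assms(1), of 0 n z 0] assms by simp
next
  case False
  then have "indicator {z. \<forall>m<n. fst (z m) \<in> {0..0}} z = (0::real)"
    using assms(2) by (auto simp: indicator_def intro!: exI[of _ 0])
  then show ?thesis by (simp add: kern_def)
qed

lemma kern_zero: "1 \<le> n \<Longrightarrow> kern n (\<lambda>_ _. 0) r \<phi> z = 0"
  by (simp add: kern_def)

lemma Pk_measurable [measurable]: "Pk n r \<kappa> \<in> borel_measurable (STn n)"
  unfolding Pk_def[abs_def]
  by (intro borel_measurable_prod measurable_compose[OF measurable_component_STn]) auto

lemma norm_Pk_le: "norm (Pk n r \<kappa> z) \<le> 1"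
  unfolding Pk_def prod_norm[symmetric] by (intro prod_le_1 conjI norm_uk_le norm_ge_zero)

lemma kern_etat_measurable:
  assumes "fourier_symbol b E" "\<phi> \<in> borel_measurable borel" "\<And>x. \<bar>\<phi> x\<bar> \<le> Bp"
  shows "kern n (etat b j) r \<phi> \<in> borel_measurable (STn n)"
proof -
  have "kern n (etat b j) r \<phi> = (\<lambda>z. Re (\<Sum>\<kappa>\<in>Pi\<^sub>E {..<n} (\<lambda>_. ZB j). fourier \<phi> (\<Sum>m<n. \<kappa> m) * (\<Prod>m<n. b (\<kappa> m)) * Pk n r \<kappa> z))"
  proof
    fix z
    from arg_cong[OF kern_etat[where b=b and \<phi>=\<phi> and Bp=Bp and n=n and j=j and r=r and z=z, OF reprD(1)[OF assms(1)] assms(2,3)], of Re]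
    show "kern n (etat b j) r \<phi> z = Re (\<Sum>\<kappa>\<in>Pi\<^sub>E {..<n} (\<lambda>_. ZB j). fourier \<phi> (\<Sum>m<n. \<kappa> m) * (\<Prod>m<n. b (\<kappa> m)) * Pk n r \<kappa> z)"
      by (simp only: Re_complex_of_real Pk_def)
  qed
  also have "\<dots> \<in> borel_measurable (STn n)" by measurable
  finally show ?thesis .
qed

text \<open>Truncated kernels are measurable by their finite expansion. Where some time equals r
  they are replaced by zero, the value of the full kernel, so convergence holds at every
  point.\<close>

lemma kern_measurable:
  assumes R: "fourier_symbol b E" and \<phi>: "\<phi> \<in> borel_measurable borel" "\<And>x. \<bar>\<phi> x\<bar> \<le> Bp"
  shows "kern n E r \<phi> \<in> borel_measurable (STn n)"
proof (rule borel_measurable_LIMSEQ_real)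
  let ?A = "{z\<in>space (STn n). \<exists>m\<in>{..<n}. fst (z m) = r}"
  have A: "?A \<in> sets (STn n)"
  proof (rule sets.sets_Collect_finite_Ex)
    fix m assume "m \<in> {..<n}"
    then have [measurable]: "(\<lambda>z. fst (z m)) \<in> borel_measurable (STn n)" by (intro measurable_time_STn) auto
    show "{z\<in>space (STn n). fst (z m) = r} \<in> sets (STn n)" by measurable
  qed auto
  show "(\<lambda>z. if z \<in> ?A then 0 else kern n (etat b j) r \<phi> z) \<in> borel_measurable (STn n)" for j
    using kern_etat_measurable[OF R \<phi>, of n j r] A by measurable
  show "(\<lambda>j. if z \<in> ?A then 0 else kern n (etat b j) r \<phi> z) \<longlonglongrightarrow> kern n E r \<phi> z" if "z \<in> space (STn n)" for z
  proof (cases "z \<in> ?A")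
    case True
    then show ?thesis using kern_at_time[OF R] by auto
  next
    case False
    then have "(\<lambda>j. kern n (etat b j) r \<phi> z) \<longlonglongrightarrow> kern n E r \<phi> z"
      using that by (intro kern_limit[OF R \<phi>]) auto
    then show ?thesis using False by (simp only: if_False)
  qed
qed

text \<open>With $E' = 0$ and $s = 0$ this is the kernel itself, so one bound serves for existence, time continuity and convergence.\<close>

definition kern_incr :: "nat \<Rightarrow> (real \<Rightarrow> real^4 \<Rightarrow> real) \<Rightarrow> (real \<Rightarrow> real^4 \<Rightarrow> real) \<Rightarrow> real \<Rightarrow> real \<Rightarrow> (real^4 \<Rightarrow> real)
    \<Rightarrow> (nat \<Rightarrow> real \<times> (real^4)) \<Rightarrow> real" where
  "kern_incr n E E' r s \<phi> z = (kern n E r \<phi> z - kern n E' r \<phi> z) - (kern n E s \<phi> z - kern n E' s \<phi> z)"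

text \<open>Coefficient of the tensor mode \<kappa> in the difference of the two kernels; time
  enters only through \<open>Pk\<close>.\<close>

definition ck :: "nat \<Rightarrow> (real^4 \<Rightarrow> real) \<Rightarrow> (real^4 \<Rightarrow> real) \<Rightarrow> (real^4 \<Rightarrow> real) \<Rightarrow> (nat \<Rightarrow> real^4) \<Rightarrow> complex" where
  "ck n b b' \<phi> \<kappa> = fourier \<phi> (\<Sum>m<n. \<kappa> m) * ((\<Prod>m<n. b (\<kappa> m)) - (\<Prod>m<n. b' (\<kappa> m)))"

definition Bx :: "nat \<Rightarrow> nat \<Rightarrow> (nat \<Rightarrow> real^4) set" where
  "Bx n j = Pi\<^sub>E {..<n} (\<lambda>_. ZB j)"

lemma finite_Bx [simp]: "finite (Bx n j)" unfolding Bx_def by (intro finite_PiE) auto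
lemma Bx_Z4: "Bx n j \<subseteq> Pi\<^sub>E {..<n} (\<lambda>_. Z4)" unfolding Bx_def using ZB_Z4 by (intro PiE_mono) auto
lemma Bx_mono: "i \<le> j \<Longrightarrow> Bx n i \<subseteq> Bx n j" unfolding Bx_def using ZB_mono by (intro PiE_mono) auto

lemma kern_incr_etat:
  assumes "fourier_symbol b E" "fourier_symbol b' E'" "\<phi> \<in> borel_measurable borel" "\<And>x. \<bar>\<phi> x\<bar> \<le> Bp"
  shows "complex_of_real (kern_incr n (etat b j) (etat b' j) r s \<phi> z) = (\<Sum>\<kappa>\<in>Bx n j. ck n b b' \<phi> \<kappa> * (Pk n r \<kappa> z - Pk n s \<kappa> z))"
proof -
  note k = kern_etat[where b=b and \<phi>=\<phi> and Bp=Bp, OF reprD(1)[OF assms(1)] assms(3,4)]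
    kern_etat[where b=b' and \<phi>=\<phi> and Bp=Bp, OF reprD(1)[OF assms(2)] assms(3,4)]
  have alg: "a * p * x - a * p' * x - (a * p * y - a * p' * y) = a * (p - p') * (x - y)" for a p p' x y :: complex
    by (simp add: algebra_simps)
  show ?thesis
    unfolding kern_incr_def of_real_diff k Bx_def[symmetric] Pk_def[symmetric] ck_def sum_subtractf[symmetric]
    by (intro sum.cong refl) (rule alg)
qed

text \<open>The time cutoff jumps at q = r. Its other end q = 0 causes no jump along the grids,
  because rounding down keeps nonnegative times nonnegative.\<close>

lemma uk_grid_floor:
  assumes "0 \<le> fst z" "fst z \<noteq> r"
  shows "(\<lambda>N. uk r k (grid_floor (Suc N) z)) \<longlonglongrightarrow> uk r k z"
proof -
  have f: "(\<lambda>N. fst (grid_floor (Suc N) z)) \<longlonglongrightarrow> fst z" and g: "(\<lambda>N. snd (grid_floor (Suc N) z)) \<longlonglongrightarrow> snd z"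
    using grid_floor_tendsto[of z] by (auto intro: tendsto_fst tendsto_snd)
  have nn: "0 \<le> fst (grid_floor (Suc N) z)" for N using assms by (simp add: grid_floor_def)
  have "(\<lambda>N. indicator {0..r} (fst (grid_floor (Suc N) z)) :: real) \<longlonglongrightarrow> indicator {0..r} (fst z)"
  proof (cases "fst z < r")
    case True
    then have "eventually (\<lambda>N. fst (grid_floor (Suc N) z) < r) sequentially" by (rule order_tendstoD(2)[OF f])
    then have "eventually (\<lambda>N. indicator {0..r} (fst (grid_floor (Suc N) z)) = (indicator {0..r} (fst z) :: real)) sequentially"
      by eventually_elim (use nn True assms in \<open>auto simp: indicator_def\<close>)
    then show ?thesis by (rule tendsto_eventually)
  next
    case False
    then have "r < fst z" using assms by simp
    then have "eventually (\<lambda>N. r < fst (grid_floor (Suc N) z)) sequentially" by (rule order_tendstoD(1)[OF f])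
    then have "eventually (\<lambda>N. indicator {0..r} (fst (grid_floor (Suc N) z)) = (indicator {0..r} (fst z) :: real)) sequentially"
      by eventually_elim (use \<open>r < fst z\<close> in \<open>auto simp: indicator_def\<close>)
    then show ?thesis by (rule tendsto_eventually)
  qed
  moreover have "(\<lambda>N. ek (- k) (snd (grid_floor (Suc N) z))) \<longlonglongrightarrow> ek (- k) (snd z)"
    unfolding ek_def cis_conv_exp by (intro tendsto_intros g)
  ultimately show ?thesis unfolding uk_def by (intro tendsto_intros f)
qed

context wiener_chaos
begin

text \<open>A finite trigonometric sum is bounded, vanishes beyond a finite time, and converges
  along the grids unless some time equals r or s, so approximation by step functions
  applies.\<close>

lemma kern_incr_etat_hyp:
  assumes R: "fourier_symbol b E" "fourier_symbol b' E'" and \<phi>: "\<phi> \<in> borel_measurable borel" "\<And>x. \<bar>\<phi> x\<bar> \<le> Bp"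
    and n: "1 \<le> n"
  shows "hypercontr (kern_incr n (etat b j) (etat b' j) r s \<phi>)"
proof (rule hypercontr_ae_continuous)
  let ?V = "kern_incr n (etat b j) (etat b' j) r s \<phi>"
  have f: "?V z = Re (\<Sum>\<kappa>\<in>Bx n j. ck n b b' \<phi> \<kappa> * (Pk n r \<kappa> z - Pk n s \<kappa> z))" for z
    using kern_incr_etat[OF R \<phi>, of n j r s z] by (metis Re_complex_of_real)
  show "?V \<in> borel_measurable (STn n)" unfolding f[abs_def] by measurable
  show "\<bar>?V z\<bar> \<le> (\<Sum>\<kappa>\<in>Bx n j. norm (ck n b b' \<phi> \<kappa>) * 2)" for z
  proof -
    have "\<bar>?V z\<bar> \<le> norm (\<Sum>\<kappa>\<in>Bx n j. ck n b b' \<phi> \<kappa> * (Pk n r \<kappa> z - Pk n s \<kappa> z))"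
      unfolding f by (rule abs_Re_le_cmod)
    also have "\<dots> \<le> (\<Sum>\<kappa>\<in>Bx n j. norm (ck n b b' \<phi> \<kappa> * (Pk n r \<kappa> z - Pk n s \<kappa> z)))" by (rule norm_sum)
    also have "\<dots> \<le> (\<Sum>\<kappa>\<in>Bx n j. norm (ck n b b' \<phi> \<kappa>) * 2)"
      unfolding norm_mult
    proof (intro sum_mono mult_left_mono)
      show "norm (Pk n r \<kappa> z - Pk n s \<kappa> z) \<le> 2" for \<kappa>
        using norm_triangle_ineq4[of "Pk n r \<kappa> z" "Pk n s \<kappa> z"] norm_Pk_le[of n r \<kappa> z] norm_Pk_le[of n s \<kappa> z] by linarith
    qed simp
    finally show ?thesis .
  qed
  define U where "U = nat \<lceil>max r s\<rceil> + 1"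
  have U: "r < real U" "s < real U" unfolding U_def by linarith+
  show "?V z = 0" if mode_diff: "z \<in> space (STn n)" "z \<notin> slab n U" for z
  proof -
    obtain m where m: "m < n" "real U \<le> fst (z m)" using mode_diff by (auto simp: slab_def not_less)
    have "Pk n t \<kappa> z = 0" if "t < real U" for t \<kappa>
      unfolding Pk_def using m that by (intro prod_zero bexI[of _ m]) (auto simp: uk_def)
    then show ?thesis unfolding f using U by simp
  qed
  have "AE z in STn n. \<forall>m\<in>{..<n}. fst (z m) \<noteq> r \<and> fst (z m) \<noteq> s"
    by (rule AE_finite_allI) (auto intro: AE_STn_time)
  then show "AE z in STn n. (\<lambda>N. ?V (\<lambda>i\<in>{..<n}. grid_floor (Suc N) (z i))) \<longlonglongrightarrow> ?V z"
    using AE_space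
  proof eventually_elim
    case (elim z)
    have pos: "0 \<le> fst (z m)" if "m < n" for m
      using elim(2) that unfolding STn_def space_PiM space_ST by (auto simp: PiE_iff mem_Times_iff)
    have "(\<lambda>N. Pk n t \<kappa> (\<lambda>i\<in>{..<n}. grid_floor (Suc N) (z i))) \<longlonglongrightarrow> Pk n t \<kappa> z" if "\<And>m. m < n \<Longrightarrow> fst (z m) \<noteq> t" for t \<kappa>
      unfolding Pk_def using that pos by (intro tendsto_prod) (auto intro: uk_grid_floor)
    then show ?case unfolding f using elim(1) by (intro tendsto_intros) auto
  qed
qed

text \<open>Partial Parseval sums are increasing and bounded by Q, so the truncations are Cauchy in
  L^2; Fatou identifies their limit with the pointwise limit, which is the true kernel.
  Hypercontractivity survives by \<open>hypercontr_closed\<close>.\<close>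

lemma kern_incr_main:
  assumes R: "fourier_symbol b E" "fourier_symbol b' E'" and \<phi>: "\<phi> \<in> borel_measurable borel" "\<And>x. \<bar>\<phi> x\<bar> \<le> Bp"
    and n: "1 \<le> n"
    and Q: "\<And>F. finite F \<Longrightarrow> F \<subseteq> Pi\<^sub>E {..<n} (\<lambda>_. Z4) \<Longrightarrow> (\<Sum>\<kappa>\<in>F. (norm (ck n b b' \<phi> \<kappa>))^2 * Dk n r s \<kappa>) \<le> Q"
  shows "hypercontr (kern_incr n E E' r s \<phi>)" "(\<integral>z. (kern_incr n E E' r s \<phi> z)^2 \<partial>STn n) \<le> Q"
proof -
  let ?V = "kern_incr n E E' r s \<phi>"
  define V where "V j = kern_incr n (etat b j) (etat b' j) r s \<phi>" for j
  let ?t = "\<lambda>\<kappa>. (norm (ck n b b' \<phi> \<kappa>))^2 * Dk n r s \<kappa>"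
  define S where "S j = (\<Sum>\<kappa>\<in>Bx n j. ?t \<kappa>)" for j
  have hV: "hypercontr (V j)" for j unfolding V_def by (rule kern_incr_etat_hyp[OF R \<phi> n])
  then have LV: "L2 (STn n) (V j)" for j by (simp add: hypercontr_def)
  have Vm [measurable]: "V j \<in> borel_measurable (STn n)" for j by (rule L2_measurable[OF LV])
  have VVm [measurable]: "?V \<in> borel_measurable (STn n)"
    unfolding kern_incr_def[abs_def] using kern_measurable[OF R(1) \<phi>] kern_measurable[OF R(2) \<phi>] by measurable
  have Vf: "complex_of_real (V j z) = (\<Sum>\<kappa>\<in>Bx n j. ck n b b' \<phi> \<kappa> * (Pk n r \<kappa> z - Pk n s \<kappa> z))" for j z
    unfolding V_def by (rule kern_incr_etat[OF R \<phi>])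
  \<comment> \<open>Nonnegativity is read off from Parseval for a single tuple, where
    \<open>Dk\<close> is a squared norm.\<close>
  have D0: "0 \<le> Dk n r s \<kappa>" if "\<kappa> \<in> Pi\<^sub>E {..<n} (\<lambda>_. Z4)" for \<kappa>
  proof -
    have "(LINT z|STn n. (norm (Pk n r \<kappa> z - Pk n s \<kappa> z))^2) = Dk n r s \<kappa>"
      using parseval_Pk(2)[of "{\<kappa>}" n "\<lambda>_. 1" r s] that by simp
    moreover have "0 \<le> (LINT z|STn n. (norm (Pk n r \<kappa> z - Pk n s \<kappa> z))^2)" by simp
    ultimately show ?thesis by (simp only:)
  qed
  have par: "(\<integral>\<^sup>+z. ennreal ((V i z - V j z)^2) \<partial>STn n) = ennreal (S i - S j)" if "j \<le> i" for i j
  proof -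
    let ?F = "Bx n i - Bx n j"
    have F: "finite ?F" "?F \<subseteq> Pi\<^sub>E {..<n} (\<lambda>_. Z4)" using Bx_Z4 by auto
    have eq: "(V i z - V j z)^2 = (norm (\<Sum>\<kappa>\<in>?F. ck n b b' \<phi> \<kappa> * (Pk n r \<kappa> z - Pk n s \<kappa> z)))^2" for z
    proof -
      have "complex_of_real (V i z - V j z) = (\<Sum>\<kappa>\<in>?F. ck n b b' \<phi> \<kappa> * (Pk n r \<kappa> z - Pk n s \<kappa> z))"
        unfolding of_real_diff Vf by (rule sum_diff[symmetric]) (use Bx_mono[OF that] in auto)
      from arg_cong[OF this, of "\<lambda>w. (norm w)^2"] show ?thesis by (simp only: norm_of_real power2_abs)
    qed
    have "(\<integral>\<^sup>+z. ennreal ((V i z - V j z)^2) \<partial>STn n) = ennreal (\<integral>z. (V i z - V j z)^2 \<partial>STn n)"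
      by (intro nn_integral_eq_integral L2_integrable L2_diff LV) auto
    also have "(\<integral>z. (V i z - V j z)^2 \<partial>STn n) = (\<Sum>\<kappa>\<in>?F. ?t \<kappa>)"
      unfolding eq by (rule parseval_Pk(2)[OF F])
    also have "\<dots> = S i - S j" unfolding S_def by (rule sum_diff) (use Bx_mono[OF that] in auto)
    finally show ?thesis .
  qed
  have par0: "(\<integral>\<^sup>+z. ennreal ((V i z)^2) \<partial>STn n) = ennreal (S i)" for i
  proof -
    have "(\<integral>\<^sup>+z. ennreal ((V i z)^2) \<partial>STn n) = ennreal (\<integral>z. (V i z)^2 \<partial>STn n)"
      by (intro nn_integral_eq_integral L2_integrable LV) auto
    also have "(\<integral>z. (V i z)^2 \<partial>STn n) = (\<integral>z. (norm (\<Sum>\<kappa>\<in>Bx n i. ck n b b' \<phi> \<kappa> * (Pk n r \<kappa> z - Pk n s \<kappa> z)))^2 \<partial>STn n)"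
      by (simp only: Vf[symmetric] norm_of_real power2_abs)
    also have "\<dots> = S i" unfolding S_def by (rule parseval_Pk(2)) (use Bx_Z4 in auto)
    finally show ?thesis .
  qed
  have "incseq S" unfolding S_def incseq_def
    using Bx_mono Bx_Z4 D0 by (intro allI impI sum_mono2 mult_nonneg_nonneg) (auto simp: subset_iff)
  moreover have SQ: "S j \<le> Q" for j unfolding S_def by (rule Q) (use Bx_Z4 in auto)
  ultimately obtain L where L: "S \<longlonglongrightarrow> L" "\<And>i. S i \<le> L" using incseq_convergent[of S Q] by blast
  have LQ: "L \<le> Q" by (rule LIMSEQ_le_const2[OF L(1)]) (use SQ in auto)
  have conv: "AE z in STn n. (\<lambda>j. V j z) \<longlonglongrightarrow> ?V z"
  proof -
    have "AE z in STn n. \<forall>m\<in>{..<n}. fst (z m) \<noteq> r \<and> fst (z m) \<noteq> s"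
      by (rule AE_finite_allI) (auto intro: AE_STn_time)
    then show ?thesis
    proof eventually_elim
      case (elim z)
      then show ?case unfolding V_def kern_incr_def
        by (intro tendsto_diff kern_limit[OF R(1) \<phi>] kern_limit[OF R(2) \<phi>]) auto
    qed
  qed
  \<comment> \<open>Fatou in the first index with the second one fixed; L - S j is the tail of the
    Parseval sum.\<close>
  have fat: "(\<integral>\<^sup>+z. ennreal ((V j z - ?V z)^2) \<partial>STn n) \<le> ennreal (L - S j)" for j
  proof (rule nn_integral_fatou_le[where u="\<lambda>i z. ennreal ((V i z - V j z)^2)" and C="\<lambda>i. ennreal (S i - S j)"])
    show "AE z in STn n. (\<lambda>i. ennreal ((V i z - V j z)^2)) \<longlonglongrightarrow> ennreal ((V j z - ?V z)^2)"
      using conv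
    proof eventually_elim
      case (elim z)
      have "(\<lambda>i. (V i z - V j z)^2) \<longlonglongrightarrow> (?V z - V j z)^2" by (intro tendsto_intros elim)
      then show ?case by (intro tendsto_ennrealI) (simp add: power2_commute)
    qed
    show "eventually (\<lambda>i. (\<integral>\<^sup>+z. ennreal ((V i z - V j z)^2) \<partial>STn n) \<le> ennreal (S i - S j)) sequentially"
      using eventually_ge_at_top[of j] by eventually_elim (simp add: par)
    show "(\<lambda>i. ennreal (S i - S j)) \<longlonglongrightarrow> ennreal (L - S j)" by (intro tendsto_ennrealI tendsto_intros L)
  qed simp
  have LD: "integrable (STn n) (\<lambda>z. (V j z - ?V z)^2)" for j
    by (rule integrableI_bounded) (use fat[of j] in \<open>auto simp: less_top[symmetric] top_unique intro: le_less_trans\<close>)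
  \<comment> \<open>Square integrability of the limit follows from that of one truncation and of the
    difference just bounded.\<close>
  have "L2 (STn n) (\<lambda>z. V 0 z - (V 0 z - ?V z))"
    by (rule L2_diff[OF LV L2_I]) (use LD in auto)
  then have L2V: "L2 (STn n) ?V" by simp
  have Ible: "(\<integral>z. (V j z - ?V z)^2 \<partial>STn n) \<le> L - S j" for j
  proof -
    have "ennreal (\<integral>z. (V j z - ?V z)^2 \<partial>STn n) \<le> ennreal (L - S j)"
      using fat[of j] nn_integral_eq_integral[OF LD[of j]] by simp
    then show ?thesis using L(2)[of j] by (subst (asm) ennreal_le_iff) auto
  qed
  have "(\<lambda>j. \<integral>z. (V j z - ?V z)^2 \<partial>STn n) \<longlonglongrightarrow> 0"
  proof (rule tendsto_sandwich[OF _ _ tendsto_const])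
    show "(\<lambda>j. L - S j) \<longlonglongrightarrow> 0" using tendsto_diff[OF tendsto_const[of L] L(1)] by simp
  qed (use Ible in auto)
  then show "hypercontr ?V" by (rule hypercontr_closed[OF hV L2V])
  have "(\<integral>\<^sup>+z. ennreal ((?V z)^2) \<partial>STn n) \<le> ennreal L"
  proof (rule nn_integral_fatou_le[where u="\<lambda>i z. ennreal ((V i z)^2)" and C="\<lambda>i. ennreal (S i)"])
    show "AE z in STn n. (\<lambda>i. ennreal ((V i z)^2)) \<longlonglongrightarrow> ennreal ((?V z)^2)"
      using conv by eventually_elim (intro tendsto_ennrealI tendsto_intros)
  qed (use L(1) in \<open>auto simp: par0 intro: tendsto_ennrealI\<close>)
  then have "ennreal (\<integral>z. (?V z)^2 \<partial>STn n) \<le> ennreal L"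
    using nn_integral_eq_integral[OF L2_integrable[OF L2V]] by simp
  moreover have "0 \<le> L"
  proof (rule order_trans[OF _ L(2)[of 0]])
    show "0 \<le> S 0" unfolding S_def using D0[OF subsetD[OF Bx_Z4]] by (intro sum_nonneg mult_nonneg_nonneg) auto
  qed
  ultimately have "(\<integral>z. (?V z)^2 \<partial>STn n) \<le> L" by (simp add: ennreal_le_iff)
  then show "(\<integral>z. (?V z)^2 \<partial>STn n) \<le> Q" using LQ by linarith
qed

text \<open>Squaring the multiplier difference costs 2 \<beta> per frequency and
  \<open>Dk_bound\<close> costs 4 \<beta>, so \<open>lattice_conv\<close> is used with \<delta> = 6
  \<beta>. The constant is uniform: symbols, test function and times enter through B, G and r -
  s.\<close>

lemma kern_incr_bound:
  assumes n: "1 \<le> n" and \<beta>: "0 < \<beta>" "\<beta> \<le> 1" "(2 * real n - 1) * (6 * \<beta>) \<le> 4" and U: "1 \<le> U"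
  obtains C where "0 < C"
    "\<And>b b' E E' B \<phi> Bp r s G. fourier_symbol b E \<Longrightarrow> fourier_symbol b' E' \<Longrightarrow> \<phi> \<in> borel_measurable borel \<Longrightarrow> (\<And>x. \<bar>\<phi> x\<bar> \<le> Bp) \<Longrightarrow>
       (\<And>\<kappa>. \<kappa> \<in> Pi\<^sub>E {..<n} (\<lambda>_. Z4) \<Longrightarrow> \<bar>(\<Prod>m<n. b (\<kappa> m)) - (\<Prod>m<n. b' (\<kappa> m))\<bar> \<le> B * (\<Prod>m<n. bracket (\<kappa> m) powr \<beta>)) \<Longrightarrow>
       (\<And>F. finite F \<Longrightarrow> F \<subseteq> Z4 \<Longrightarrow> (\<Sum>K\<in>F. (norm (fourier \<phi> K))^2 * bracket K powr - (4 - (2 * real n - 1) * (6 * \<beta>))) \<le> G) \<Longrightarrow>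
       0 \<le> s \<Longrightarrow> s \<le> r \<Longrightarrow> r \<le> U \<Longrightarrow>
       hypercontr (kern_incr n E E' r s \<phi>) \<and> (\<integral>z. (kern_incr n E E' r s \<phi> z)^2 \<partial>STn n) \<le> C * B^2 * (r - s) powr \<beta> * G"
proof -
  obtain C0 where C0: "0 < C0" "\<And>F g. finite F \<Longrightarrow> F \<subseteq> Pi\<^sub>E {..<n} (\<lambda>_. Z4) \<Longrightarrow> (\<And>K. 0 \<le> g K) \<Longrightarrow>
     (\<Sum>k\<in>F. (\<Prod>m<n. bracket (k m) powr - (4 - 6 * \<beta>)) * g (\<Sum>m<n. k m))
       \<le> C0 * (\<Sum>K\<in>(\<lambda>k. \<Sum>m<n. k m) ` F. g K * bracket K powr - (4 - (2 * real n - 1) * (6 * \<beta>)))"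
    using lattice_conv[OF n mult_pos_pos[OF zero_less_numeral \<beta>(1)] \<beta>(3)] by blast
  let ?A = "3 * real n * U ^ n"
  have A0: "0 < ?A" using n U by simp
  show ?thesis
  proof (rule that)
    show "0 < ?A * C0" using A0 C0 by simp
    fix b b' E E' B Bp r s G and \<phi> :: "real^4 \<Rightarrow> real"
    assume R: "fourier_symbol b E" "fourier_symbol b' E'" and \<phi>: "\<phi> \<in> borel_measurable borel" "\<And>x. \<bar>\<phi> x\<bar> \<le> Bp"
      and B: "\<And>\<kappa>. \<kappa> \<in> Pi\<^sub>E {..<n} (\<lambda>_. Z4) \<Longrightarrow> \<bar>(\<Prod>m<n. b (\<kappa> m)) - (\<Prod>m<n. b' (\<kappa> m))\<bar> \<le> B * (\<Prod>m<n. bracket (\<kappa> m) powr \<beta>)"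
      and G: "\<And>F. finite F \<Longrightarrow> F \<subseteq> Z4 \<Longrightarrow> (\<Sum>K\<in>F. (norm (fourier \<phi> K))^2 * bracket K powr - (4 - (2 * real n - 1) * (6 * \<beta>))) \<le> G"
      and s: "0 \<le> s" "s \<le> r" "r \<le> U"
    have Q: "(\<Sum>\<kappa>\<in>F. (norm (ck n b b' \<phi> \<kappa>))^2 * Dk n r s \<kappa>) \<le> ?A * C0 * B^2 * (r - s) powr \<beta> * G"
      if F: "finite F" "F \<subseteq> Pi\<^sub>E {..<n} (\<lambda>_. Z4)" for F
    proof -
      let ?c = "B^2 * (?A * (r - s) powr \<beta>)"
      let ?g = "\<lambda>K. (norm (fourier \<phi> K))^2"
      have c0: "0 \<le> ?c" using A0 by simp
      have "(norm (ck n b b' \<phi> \<kappa>))^2 * Dk n r s \<kappa> \<le> ?c * ((\<Prod>m<n. bracket (\<kappa> m) powr - (4 - 6 * \<beta>)) * ?g (\<Sum>m<n. \<kappa> m))" if "\<kappa> \<in> F" for \<kappa>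
      proof -
        have \<kappa>: "\<kappa> \<in> Pi\<^sub>E {..<n} (\<lambda>_. Z4)" using that F by auto
        then have Z: "\<And>m. m < n \<Longrightarrow> \<kappa> m \<in> Z4" by auto
        let ?d = "(\<Prod>m<n. b (\<kappa> m)) - (\<Prod>m<n. b' (\<kappa> m))"
        have "\<bar>?d\<bar>^2 \<le> (B * (\<Prod>m<n. bracket (\<kappa> m) powr \<beta>))^2"
          by (intro power_mono B \<kappa>) simp
        then have d: "?d^2 \<le> B^2 * (\<Prod>m<n. bracket (\<kappa> m) powr \<beta>)^2" by (simp add: power_mult_distrib)
        have "(norm (ck n b b' \<phi> \<kappa>))^2 = ?g (\<Sum>m<n. \<kappa> m) * ?d^2"
          unfolding ck_def norm_mult power_mult_distrib of_real_diff[symmetric] norm_of_real by simp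
        then have "(norm (ck n b b' \<phi> \<kappa>))^2 * Dk n r s \<kappa> = ?g (\<Sum>m<n. \<kappa> m) * (?d^2 * Dk n r s \<kappa>)" by simp
        also have "\<dots> \<le> ?g (\<Sum>m<n. \<kappa> m) * (B^2 * (\<Prod>m<n. bracket (\<kappa> m) powr \<beta>)^2 * (?A * (r - s) powr \<beta> * (\<Prod>m<n. bracket (\<kappa> m) powr - (4 - 4 * \<beta>))))"
        proof (intro mult_left_mono)
          have "?d^2 * Dk n r s \<kappa> \<le> ?d^2 * (?A * (r - s) powr \<beta> * (\<Prod>m<n. bracket (\<kappa> m) powr - (4 - 4 * \<beta>)))"
            using Dk_bound[OF Z s U] \<beta> by (intro mult_left_mono) auto
          also have "\<dots> \<le> B^2 * (\<Prod>m<n. bracket (\<kappa> m) powr \<beta>)^2 * (?A * (r - s) powr \<beta> * (\<Prod>m<n. bracket (\<kappa> m) powr - (4 - 4 * \<beta>)))"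
            using U by (intro mult_right_mono d mult_nonneg_nonneg prod_nonneg) auto
          finally show "?d^2 * Dk n r s \<kappa> \<le> B^2 * (\<Prod>m<n. bracket (\<kappa> m) powr \<beta>)^2 * (?A * (r - s) powr \<beta> * (\<Prod>m<n. bracket (\<kappa> m) powr - (4 - 4 * \<beta>)))" .
        qed simp
        also have "\<dots> = ?c * (((\<Prod>m<n. bracket (\<kappa> m) powr \<beta>)^2 * (\<Prod>m<n. bracket (\<kappa> m) powr - (4 - 4 * \<beta>))) * ?g (\<Sum>m<n. \<kappa> m))"
          by (simp only: mult_ac)
        also have "(\<Prod>m<n. bracket (\<kappa> m) powr \<beta>)^2 * (\<Prod>m<n. bracket (\<kappa> m) powr - (4 - 4 * \<beta>)) = (\<Prod>m<n. bracket (\<kappa> m) powr - (4 - 6 * \<beta>))"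
          unfolding power2_eq_square prod.distrib[symmetric] powr_add[symmetric] by (simp add: algebra_simps)
        finally show ?thesis .
      qed
      then have "(\<Sum>\<kappa>\<in>F. (norm (ck n b b' \<phi> \<kappa>))^2 * Dk n r s \<kappa>) \<le> (\<Sum>\<kappa>\<in>F. ?c * ((\<Prod>m<n. bracket (\<kappa> m) powr - (4 - 6 * \<beta>)) * ?g (\<Sum>m<n. \<kappa> m)))"
        by (rule sum_mono)
      also have "\<dots> = ?c * (\<Sum>\<kappa>\<in>F. (\<Prod>m<n. bracket (\<kappa> m) powr - (4 - 6 * \<beta>)) * ?g (\<Sum>m<n. \<kappa> m))" by (rule sum_distrib_left[symmetric])
      also have "\<dots> \<le> ?c * (C0 * (\<Sum>K\<in>(\<lambda>k. \<Sum>m<n. k m) ` F. ?g K * bracket K powr - (4 - (2 * real n - 1) * (6 * \<beta>))))"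
        by (intro mult_left_mono C0 F c0) auto
      also have "\<dots> \<le> ?c * (C0 * G)"
        using F C0(1) by (intro mult_left_mono G c0) (auto intro!: Z4_sum)
      finally show ?thesis by (simp only: mult_ac)
    qed
    show "hypercontr (kern_incr n E E' r s \<phi>) \<and> (\<integral>z. (kern_incr n E E' r s \<phi> z)^2 \<partial>STn n) \<le> ?A * C0 * B^2 * (r - s) powr \<beta> * G"
      using kern_incr_main[OF R \<phi> n Q] by blast
  qed
qed

end

section \<open>Trigonometric polynomials and chaining\<close>

text \<open>A mode is a pair $(k, b)$ standing for the real ($b$ false) or imaginary part of the character of frequency $k$; the frequencies $k$ and $-k$ are both listed.\<close>

definition mode :: "(real^4) \<times> bool \<Rightarrow> real^4 \<Rightarrow> real" where
  "mode \<kappa> x = (if snd \<kappa> then Im (ek (fst \<kappa>) x) else Re (ek (fst \<kappa>) x))"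

definition mode_coeff :: "(real^4 \<Rightarrow> complex) \<Rightarrow> (real^4) \<times> bool \<Rightarrow> real" where
  "mode_coeff d \<kappa> = (if snd \<kappa> then Im (d (fst \<kappa>)) else Re (d (fst \<kappa>)))"

definition modes :: "nat \<Rightarrow> ((real^4) \<times> bool) set" where
  "modes N = ZB N \<times> UNIV"

text \<open>Each frequency contributes the real part of \<open>cnj (d k) * ek k x\<close>. With this
  conjugation d is the list of coefficients in the convention of \<open>fourier\<close>, as
  \<open>fourier_tpoly\<close> confirms.\<close>

definition tpoly :: "(real^4 \<Rightarrow> complex) \<Rightarrow> nat \<Rightarrow> real^4 \<Rightarrow> real" where
  "tpoly d N x = (\<Sum>\<kappa>\<in>modes N. mode_coeff d \<kappa> * mode \<kappa> x)"

definition herm :: "(real^4 \<Rightarrow> complex) \<Rightarrow> bool" where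
  "herm d \<longleftrightarrow> (\<forall>k. d (- k) = cnj (d k))"

lemma finite_modes [simp]: "finite (modes N)" by (simp add: modes_def)

lemma sum_modes: "(\<Sum>\<kappa>\<in>modes N. f \<kappa>) = (\<Sum>k\<in>ZB N. f (k, False) + f (k, True))"
proof -
  have "(\<Sum>\<kappa>\<in>modes N. f \<kappa>) = (\<Sum>(k, j)\<in>ZB N \<times> (UNIV::bool set). f (k, j))" by (simp add: modes_def)
  also have "\<dots> = (\<Sum>k\<in>ZB N. \<Sum>j\<in>(UNIV::bool set). f (k, j))" by (rule sum.cartesian_product[symmetric])
  finally show ?thesis by (simp add: UNIV_bool add.commute)
qed

lemma abs_mode_coeff_le: "\<bar>mode_coeff d \<kappa>\<bar> \<le> norm (d (fst \<kappa>))"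
  by (simp add: mode_coeff_def abs_Re_le_cmod abs_Im_le_cmod)

lemma abs_mode_le: "\<bar>mode \<kappa> x\<bar> \<le> 1"
  using abs_Re_le_cmod[of "ek (fst \<kappa>) x"] abs_Im_le_cmod[of "ek (fst \<kappa>) x"] by (simp add: mode_def)

lemma mode_borel [measurable]: "mode \<kappa> \<in> borel_measurable borel"
  unfolding mode_def[abs_def] by measurable

lemma tpoly_borel [measurable]: "tpoly d N \<in> borel_measurable borel"
  unfolding tpoly_def[abs_def] by measurable

lemma tpoly_bound: "\<bar>tpoly d N x\<bar> \<le> (\<Sum>\<kappa>\<in>modes N. \<bar>mode_coeff d \<kappa>\<bar>)"
  unfolding tpoly_def
  by (rule order_trans[OF sum_abs sum_mono]) (use abs_mode_le in \<open>auto simp: abs_mult intro!: mult_left_le\<close>)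

lemma tpoly_complex:
  assumes "herm d"
  shows "complex_of_real (tpoly d N x) = (\<Sum>k\<in>ZB N. cnj (d k) * ek k x)"
proof -
  define S where "S = (\<Sum>k\<in>ZB N. cnj (d k) * ek k x)"
  have "cnj S = (\<Sum>k\<in>ZB N. cnj (d (- k)) * ek (- k) x)"
    using assms by (simp add: S_def cnj_sum cnj_ek herm_def)
  also have "\<dots> = S" unfolding S_def by (rule sum_ZB_minus[of "\<lambda>k. cnj (d k) * ek k x"])
  finally have 1: "S = complex_of_real (Re S)" by (simp add: complex_eq_iff)
  have 2: "Re S = tpoly d N x"
    by (simp add: S_def tpoly_def sum_modes mode_coeff_def mode_def)
  have "complex_of_real (tpoly d N x) = S" using 1 unfolding 2 by (rule sym)
  then show ?thesis by (simp only: S_def)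
qed

lemma fourier_tpoly:
  assumes "herm d" "K \<in> Z4"
  shows "fourier (tpoly d N) K = (if K \<in> ZB N then d K else 0)"
proof -
  have "fourier (tpoly d N) K = (LINT x|cubeM. (\<Sum>k\<in>ZB N. cnj (d k) * ek (k + K) x))"
    unfolding fourier_def tpoly_complex[OF assms(1)] by (simp add: sum_distrib_right ek_add_left mult.assoc)
  also have "\<dots> = (\<Sum>k\<in>ZB N. LINT x|cubeM. cnj (d k) * ek (k + K) x)"
    by (intro Bochner_Integration.integral_sum integrable_mult_right integrable_cubeM_bounded[where B=1]) auto
  also have "\<dots> = (\<Sum>k\<in>ZB N. cnj (d k) * (if k + K = 0 then 1 else 0))"
    using assms(2) ZB_Z4 by (intro sum.cong refl) (auto simp: integral_ek subset_iff)
  also have "\<dots> = (\<Sum>k\<in>ZB N. if k = - K then cnj (d k) else 0)"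
    by (intro sum.cong refl) (simp add: eq_neg_iff_add_eq_0)
  also have "\<dots> = (if K \<in> ZB N then d K else 0)"
    using assms(1) by (simp add: herm_def)
  finally show ?thesis .
qed

lemma herm_fourier: "herm (fourier \<phi>)"
proof -
  have "fourier \<phi> (- k) = cnj (fourier \<phi> k)" for k
    unfolding fourier_def using Bochner_Integration.integral_cnj[of cubeM "\<lambda>x. complex_of_real (\<phi> x) * ek k x"] by (simp add: cnj_ek)
  then show ?thesis by (simp add: herm_def)
qed

text \<open>Euler's formulas in the convention of \<open>fourier\<close>. Writing a single mode as a
  trigonometric polynomial lets one moment estimate serve modes and blocks alike.\<close>

definition dmode :: "(real^4) \<times> bool \<Rightarrow> real^4 \<Rightarrow> complex" where
  "dmode \<kappa> K = (if snd \<kappa> then \<i> * ((if K = fst \<kappa> then 1 else 0) - (if K = - fst \<kappa> then 1 else 0)) / 2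
      else ((if K = fst \<kappa> then 1 else 0) + (if K = - fst \<kappa> then 1 else 0)) / 2)"

lemma herm_dmode: "herm (dmode \<kappa>)"
  unfolding herm_def
proof
  fix k
  have "(- k = fst \<kappa>) = (k = - fst \<kappa>)" "(- k = - fst \<kappa>) = (k = fst \<kappa>)" by (metis minus_minus) simp
  then show "dmode \<kappa> (- k) = cnj (dmode \<kappa> k)" unfolding dmode_def by (simp add: field_simps)
qed

lemma norm_dmode_le: "norm (dmode \<kappa> K) \<le> 1"
  unfolding dmode_def by (auto simp: norm_mult norm_divide)

lemma tpoly_dmode:
  assumes "\<kappa> \<in> modes N"
  shows "tpoly (dmode \<kappa>) N x = mode \<kappa> x"
proof -
  obtain k j where \<kappa>: "\<kappa> = (k, j)" by (cases \<kappa>)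
  have k: "k \<in> ZB N" "- k \<in> ZB N" using assms by (auto simp: modes_def \<kappa>)
  have ekm: "Re (ek (- k) x) = Re (ek k x)" "Im (ek (- k) x) = - Im (ek k x)" by (simp_all add: ek_def)
  have dl: "(\<Sum>k'\<in>ZB N. (if k' = l then 1 else 0) * f k') = (f l :: real)" if "l \<in> ZB N" for l f
    using that by (simp add: if_distrib[of "\<lambda>c. c * _"] sum.delta cong: if_cong)
  show ?thesis
  proof (cases j)
    case True
    have "tpoly (dmode \<kappa>) N x = (\<Sum>k'\<in>ZB N. ((if k' = k then 1 else 0) * Im (ek k' x) - (if k' = - k then 1 else 0) * Im (ek k' x)) / 2)"
      unfolding tpoly_def sum_modes by (intro sum.cong refl) (auto simp: mode_coeff_def dmode_def \<kappa> True mode_def)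
    also have "\<dots> = (Im (ek k x) - Im (ek (- k) x)) / 2"
      using dl[OF k(1), of "\<lambda>k'. Im (ek k' x)"] dl[OF k(2), of "\<lambda>k'. Im (ek k' x)"]
      by (simp only: sum_divide_distrib[symmetric] sum_subtractf)
    finally show ?thesis by (simp add: ekm mode_def \<kappa> True)
  next
    case False
    have "tpoly (dmode \<kappa>) N x = (\<Sum>k'\<in>ZB N. ((if k' = k then 1 else 0) * Re (ek k' x) + (if k' = - k then 1 else 0) * Re (ek k' x)) / 2)"
      unfolding tpoly_def sum_modes by (intro sum.cong refl) (auto simp: mode_coeff_def dmode_def \<kappa> False mode_def)
    also have "\<dots> = (Re (ek k x) + Re (ek (- k) x)) / 2"
      using dl[OF k(1), of "\<lambda>k'. Re (ek k' x)"] dl[OF k(2), of "\<lambda>k'. Re (ek k' x)"]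
      by (simp only: sum_divide_distrib[symmetric] sum.distrib)
    finally show ?thesis by (simp add: ekm mode_def \<kappa> False)
  qed
qed

lemma kern_etat_sum:
  assumes S: "finite S" and \<phi>: "\<And>i. i \<in> S \<Longrightarrow> \<phi> i \<in> borel_measurable borel" "\<And>i x. i \<in> S \<Longrightarrow> \<bar>\<phi> i x\<bar> \<le> Bp i"
    and b: "\<And>k. \<bar>b k\<bar> \<le> (B :: real)"
  shows "kern n (etat b j) r (\<lambda>x. \<Sum>i\<in>S. a i * \<phi> i x) z = (\<Sum>i\<in>S. a i * kern n (etat b j) r (\<phi> i) z)"
proof -
  let ?P = "\<lambda>x. \<Prod>m<n. etat b j (r - fst (z m)) (x - snd (z m))"
  define M where "M = (\<Prod>m<n. \<Sum>k\<in>ZB j. \<bar>b k\<bar> * exp (- (r - fst (z m)) * aK k))"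
  have P: "\<bar>?P x\<bar> \<le> M" for x
    unfolding M_def abs_prod by (intro prod_mono conjI etat_bound) auto
  have int: "integrable cubeM (\<lambda>x. \<phi> i x * ?P x)" if "i \<in> S" for i
  proof (rule integrable_cubeM_bounded)
    show "(\<lambda>x. \<phi> i x * ?P x) \<in> borel_measurable borel" using \<phi>(1)[OF that] by measurable
    have "0 \<le> Bp i" using \<phi>(2)[OF that, of 0] by linarith
    then show "norm (\<phi> i x * ?P x) \<le> Bp i * M" for x
      unfolding real_norm_def abs_mult by (intro mult_mono \<phi> that P) auto
  qed
  have "(LINT x|cubeM. (\<Sum>i\<in>S. a i * \<phi> i x) * ?P x) = (LINT x|cubeM. (\<Sum>i\<in>S. a i * (\<phi> i x * ?P x)))"
    by (simp add: sum_distrib_right mult.assoc)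
  also have "\<dots> = (\<Sum>i\<in>S. a i * (LINT x|cubeM. \<phi> i x * ?P x))"
    by (subst Bochner_Integration.integral_sum) (auto intro!: integrable_mult_right int)
  finally show ?thesis
    unfolding kern_def set_integral_cube by (simp add: sum_distrib_left mult_ac)
qed

text \<open>Linearity in the test function is clear for truncated kernels, which are bounded, and
  passes to the limit by \<open>kern_limit\<close>; where a time equals r both sides are
  zero.\<close>

lemma kern_sum:
  assumes R: "fourier_symbol b E" and S: "finite S" and \<phi>: "\<And>i. i \<in> S \<Longrightarrow> \<phi> i \<in> borel_measurable borel" "\<And>i x. i \<in> S \<Longrightarrow> \<bar>\<phi> i x\<bar> \<le> Bp i"
  shows "kern n E r (\<lambda>x. \<Sum>i\<in>S. a i * \<phi> i x) z = (\<Sum>i\<in>S. a i * kern n E r (\<phi> i) z)"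
proof (cases "\<exists>m<n. fst (z m) = r")
  case True
  then show ?thesis using kern_at_time[OF R] by auto
next
  case False
  then have z: "\<And>m. m < n \<Longrightarrow> fst (z m) \<noteq> r" by auto
  obtain B where B: "\<And>k. \<bar>b k\<bar> \<le> B" using reprD(2)[OF R] by auto
  have "(\<lambda>x. \<Sum>i\<in>S. a i * \<phi> i x) \<in> borel_measurable borel"
    by (intro borel_measurable_sum borel_measurable_times borel_measurable_const \<phi>)
  moreover have "\<bar>\<Sum>i\<in>S. a i * \<phi> i x\<bar> \<le> (\<Sum>i\<in>S. \<bar>a i\<bar> * Bp i)" for x
    by (rule order_trans[OF sum_abs sum_mono]) (auto simp: abs_mult intro!: mult_left_mono \<phi>)
  ultimately have "(\<lambda>j. kern n (etat b j) r (\<lambda>x. \<Sum>i\<in>S. a i * \<phi> i x) z) \<longlonglongrightarrow> kern n E r (\<lambda>x. \<Sum>i\<in>S. a i * \<phi> i x) z"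
    by (intro kern_limit[OF R]) (use z in auto)
  moreover have "(\<lambda>j. \<Sum>i\<in>S. a i * kern n (etat b j) r (\<phi> i) z) \<longlonglongrightarrow> (\<Sum>i\<in>S. a i * kern n E r (\<phi> i) z)"
    by (rule tendsto_sum, rule tendsto_mult[OF tendsto_const], rule kern_limit[OF R \<phi>(1) \<phi>(2) z]) auto
  moreover have "kern n (etat b j) r (\<lambda>x. \<Sum>i\<in>S. a i * \<phi> i x) z = (\<Sum>i\<in>S. a i * kern n (etat b j) r (\<phi> i) z)" for j
    by (rule kern_etat_sum[OF S \<phi>(1) \<phi>(2) B])
  ultimately show ?thesis by (simp only:) (rule LIMSEQ_unique)
qed

lemma kern_tpoly:
  assumes "fourier_symbol b E"
  shows "kern n E r (tpoly d N) z = (\<Sum>\<kappa>\<in>modes N. mode_coeff d \<kappa> * kern n E r (mode \<kappa>) z)"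
  unfolding tpoly_def[abs_def] by (rule kern_sum[OF assms, where Bp="\<lambda>_. 1"]) (auto simp: abs_mode_le)

section \<open>Dyadic chaining\<close>

definition dyad :: "nat \<Rightarrow> real \<Rightarrow> real" where
  "dyad l t = real (nat \<lfloor>t * 2 ^ l\<rfloor>) / 2 ^ l"

text \<open>The pathwise half of Kolmogorov's continuity criterion. Raising the level by one moves
  the rounded time by nothing or by one step of the finer grid, so successive differences are
  dominated by a geometric series with sum \<open>cg\<close>. All conclusions concern the limit
  along rounded times, so y enters through its dyadic values only.\<close>

lemma chaining:
  fixes y :: "real \<Rightarrow> real"
  assumes \<gamma>: "0 < \<gamma>" and K: "0 \<le> K" and y0: "y 0 = 0"
    and inc: "\<And>l j. j < U * 2 ^ l \<Longrightarrow> \<bar>y (real (Suc j) / 2 ^ l) - y (real j / 2 ^ l)\<bar> \<le> K * 2 powr (- \<gamma> * real l)"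
  defines "cg \<equiv> 1 / (1 - 2 powr - \<gamma>)"
  shows "\<And>t. 0 \<le> t \<Longrightarrow> t \<le> real U \<Longrightarrow> (\<lambda>l. y (dyad l t)) \<longlonglongrightarrow> lim (\<lambda>l. y (dyad l t))"
    and "\<And>t. 0 \<le> t \<Longrightarrow> t \<le> real U \<Longrightarrow> \<bar>lim (\<lambda>l. y (dyad l t))\<bar> \<le> (real U + cg) * K"
    and "\<And>s t l. 0 \<le> s \<Longrightarrow> s \<le> t \<Longrightarrow> t \<le> real U \<Longrightarrow> t - s \<le> 1 / 2 ^ l \<Longrightarrow>
        \<bar>lim (\<lambda>l. y (dyad l t)) - lim (\<lambda>l. y (dyad l s))\<bar> \<le> (1 + 2 * cg) * K * 2 powr (- \<gamma> * real l)"
proof -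
  let ?\<theta> = "2 powr - \<gamma> :: real"
  have \<theta>: "0 < ?\<theta>" "?\<theta> < 1" using \<gamma> powr_less_mono[of "- \<gamma>" 0 2] by auto
  have pw: "2 powr (- \<gamma> * real l) = ?\<theta> ^ l" for l
    by (simp add: powr_power mult.commute)
  have cg: "0 < cg" "summable (\<lambda>l. ?\<theta> ^ l)" "(\<Sum>l. ?\<theta> ^ l) = cg"
    using \<theta> by (auto simp: cg_def suminf_geometric summable_geometric)
  have step: "\<bar>y (dyad (Suc l) t) - y (dyad l t)\<bar> \<le> K * ?\<theta> ^ l" if t: "0 \<le> t" "t \<le> real U" for l t
  proof -
    define j where "j = nat \<lfloor>t * 2 ^ l\<rfloor>"
    have j: "real j \<le> t * 2 ^ l" "t * 2 ^ l < real j + 1" using t by (auto simp: j_def)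
    \<comment> \<open>Halving the mesh sends the integer part j to 2 j or 2 j + 1: stay, or one step
      to the right.\<close>
    have fl: "\<lfloor>t * 2 ^ Suc l\<rfloor> = 2 * int j \<or> \<lfloor>t * 2 ^ Suc l\<rfloor> = 2 * int j + 1"
    proof -
      have "real (2 * j) \<le> t * 2 ^ Suc l" "t * 2 ^ Suc l < real (2 * j) + 2" using j by auto
      then show ?thesis by linarith
    qed
    have d: "dyad l t = real (2 * j) / 2 ^ Suc l" by (simp add: dyad_def j_def)
    from fl show ?thesis
    proof
      assume "\<lfloor>t * 2 ^ Suc l\<rfloor> = 2 * int j"
      then have "dyad (Suc l) t = dyad l t" unfolding d by (simp add: dyad_def)
      then show ?thesis using K \<theta> by simp
    next
      assume f: "\<lfloor>t * 2 ^ Suc l\<rfloor> = 2 * int j + 1"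
      then have e: "dyad (Suc l) t = real (Suc (2 * j)) / 2 ^ Suc l"
        by (simp add: dyad_def nat_add_distrib)
      have "real_of_int (2 * int j + 1) \<le> t * 2 ^ Suc l" using f by linarith
      also have "\<dots> \<le> real U * 2 ^ Suc l" using t by (intro mult_right_mono) auto
      finally have "real (2 * j + 1) \<le> real (U * 2 ^ Suc l)" by simp
      then have "2 * j < U * 2 ^ Suc l" by linarith
      from inc[OF this] have "\<bar>y (dyad (Suc l) t) - y (dyad l t)\<bar> \<le> K * ?\<theta> ^ Suc l" unfolding e d pw .
      also have "\<dots> \<le> K * ?\<theta> ^ l" using K \<theta> by (intro mult_left_mono) (auto intro!: mult_left_le_one_le)
      finally show ?thesis .
    qed
  qed
  have *: "(\<lambda>l. y (dyad l t)) \<longlonglongrightarrow> lim (\<lambda>l. y (dyad l t)) \<and> \<bar>lim (\<lambda>l. y (dyad l t)) - y (dyad l t)\<bar> \<le> cg * K * ?\<theta> ^ l"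
    if t: "0 \<le> t" "t \<le> real U" for t l
  proof -
    let ?d = "\<lambda>i. y (dyad (Suc i) t) - y (dyad i t)"
    have tel: "(\<Sum>i<l. ?d i) = y (dyad l t) - y (dyad 0 t)" for l
      by (rule sum_lessThan_telescope[of "\<lambda>i. y (dyad i t)" l])
    have sK: "summable (\<lambda>i. K * ?\<theta> ^ i)" using cg(2) by (rule summable_mult)
    have sd: "summable ?d" by (rule summable_comparison_test'[OF sK, of 0]) (use step[OF t] in auto)
    have "(\<lambda>l. \<Sum>i<l. ?d i) \<longlonglongrightarrow> suminf ?d" using sd by (rule summable_LIMSEQ)
    then have "(\<lambda>l. y (dyad l t) - y (dyad 0 t)) \<longlonglongrightarrow> suminf ?d" unfolding tel .
    then have "(\<lambda>l. y (dyad l t) - y (dyad 0 t) + y (dyad 0 t)) \<longlonglongrightarrow> suminf ?d + y (dyad 0 t)" by (intro tendsto_intros)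
    then have conv: "(\<lambda>l. y (dyad l t)) \<longlonglongrightarrow> suminf ?d + y (dyad 0 t)" by simp
    then have L: "lim (\<lambda>l. y (dyad l t)) = suminf ?d + y (dyad 0 t)" by (rule limI)
    have "suminf ?d = (\<Sum>i. ?d (i + l)) + (\<Sum>i<l. ?d i)" by (rule suminf_split_initial_segment[OF sd])
    then have "lim (\<lambda>l. y (dyad l t)) - y (dyad l t) = (\<Sum>i. ?d (i + l))" using L unfolding tel by simp
    also have "\<bar>\<dots>\<bar> \<le> (\<Sum>i. \<bar>?d (i + l)\<bar>)"
      by (rule summable_rabs, rule summable_comparison_test'[OF summable_ignore_initial_segment[OF sK, of l], of 0]) (use step[OF t] in auto)
    also have "\<dots> \<le> (\<Sum>i. K * ?\<theta> ^ l * ?\<theta> ^ i)"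
    proof (rule suminf_le)
      show s2: "summable (\<lambda>i. K * ?\<theta> ^ l * ?\<theta> ^ i)" using cg(2) by (rule summable_mult)
      show le: "\<bar>?d (i + l)\<bar> \<le> K * ?\<theta> ^ l * ?\<theta> ^ i" for i using step[OF t, of "i + l"] by (simp add: power_add mult_ac)
      show "summable (\<lambda>i. \<bar>?d (i + l)\<bar>)" by (rule summable_comparison_test'[OF s2, of 0]) (use le in auto)
    qed
    also have "\<dots> = K * ?\<theta> ^ l * cg" using cg by (simp add: suminf_mult)
    finally show ?thesis using conv L by (simp add: mult_ac)
  qed
  show "(\<lambda>l. y (dyad l t)) \<longlonglongrightarrow> lim (\<lambda>l. y (dyad l t))" if "0 \<le> t" "t \<le> real U" for t using *[OF that] by blast
  show "\<bar>lim (\<lambda>l. y (dyad l t))\<bar> \<le> (real U + cg) * K" if t: "0 \<le> t" "t \<le> real U" for t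
  proof -
    \<comment> \<open>Walk from 0 to the integer part of t by unit steps, which are the increments
      of level 0; this gives the summand U in the constant.\<close>
    have "\<bar>y (real j)\<bar> \<le> real j * K" if "j \<le> U" for j using that
    proof (induction j)
      case (Suc j)
      then show ?case using inc[of j 0] by (simp add: algebra_simps)
    qed (simp add: y0)
    from this[of "nat \<lfloor>t\<rfloor>"] have "\<bar>y (dyad 0 t)\<bar> \<le> real (nat \<lfloor>t\<rfloor>) * K" using t by (simp add: dyad_def nat_le_iff floor_le_iff)
    also have "\<dots> \<le> real U * K" using t K by (intro mult_right_mono) linarith+
    finally have "\<bar>y (dyad 0 t)\<bar> \<le> real U * K" .
    moreover have "\<bar>lim (\<lambda>l. y (dyad l t)) - y (dyad 0 t)\<bar> \<le> cg * K" using *[OF t, of 0] by simp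
    ultimately show ?thesis unfolding distrib_right by linarith
  qed
  show "\<bar>lim (\<lambda>l. y (dyad l t)) - lim (\<lambda>l. y (dyad l s))\<bar> \<le> (1 + 2 * cg) * K * 2 powr (- \<gamma> * real l)"
    if st: "0 \<le> s" "s \<le> t" "t \<le> real U" "t - s \<le> 1 / 2 ^ l" for s t l
  proof -
    define i where "i = nat \<lfloor>s * 2 ^ l\<rfloor>"
    define j where "j = nat \<lfloor>t * 2 ^ l\<rfloor>"
    have i: "real i \<le> s * 2 ^ l" "s * 2 ^ l < real i + 1" using st by (auto simp: i_def)
    have j: "real j \<le> t * 2 ^ l" "t * 2 ^ l < real j + 1" using st by (auto simp: j_def)
    have "(t - s) * 2 ^ l \<le> 1 / 2 ^ l * 2 ^ l" using st by (intro mult_right_mono) auto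
    then have d: "t * 2 ^ l - s * 2 ^ l \<le> 1" by (simp add: algebra_simps)
    have ts: "s * 2 ^ l \<le> t * 2 ^ l" using st by (intro mult_right_mono) auto
    have "i \<le> j" using i j ts by linarith
    moreover have "j \<le> Suc i" using i j d by linarith
    \<comment> \<open>Times at most one mesh apart round to the same or to neighbouring grid
      points.\<close>
    ultimately consider "j = i" | "j = Suc i" by linarith
    then have "\<bar>y (dyad l t) - y (dyad l s)\<bar> \<le> K * ?\<theta> ^ l"
    proof cases
      case 1
      then show ?thesis using K \<theta> by (simp add: dyad_def i_def[symmetric] j_def[symmetric])
    next
      case 2
      have "t * 2 ^ l \<le> real U * 2 ^ l" using st by (intro mult_right_mono) auto
      then have "real j \<le> real U * 2 ^ l" using j by linarith
      then have "real j \<le> real (U * 2 ^ l)" by simp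
      then have "i < U * 2 ^ l" using 2 by linarith
      from inc[OF this] show ?thesis using 2 unfolding pw by (simp add: dyad_def i_def[symmetric] j_def[symmetric])
    qed
    moreover have "\<bar>lim (\<lambda>l. y (dyad l t)) - y (dyad l t)\<bar> \<le> cg * K * ?\<theta> ^ l" using *[of t l] st by auto
    moreover have "\<bar>lim (\<lambda>l. y (dyad l s)) - y (dyad l s)\<bar> \<le> cg * K * ?\<theta> ^ l" using *[of s l] st by auto
    ultimately have "\<bar>lim (\<lambda>l. y (dyad l t)) - lim (\<lambda>l. y (dyad l s))\<bar> \<le> K * ?\<theta> ^ l + 2 * (cg * K * ?\<theta> ^ l)" by linarith
    then show ?thesis unfolding pw by (simp add: algebra_simps)
  qed
qed

section \<open>Distributions with given Fourier modes\<close>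

definition shell :: "nat \<Rightarrow> ((real^4) \<times> bool) set" where
  "shell N = (case N of 0 \<Rightarrow> modes 0 | Suc M \<Rightarrow> modes (Suc M) - modes M)"

text \<open>Grouping by shells gives an ordinary series of finite sums, defined for every argument
  and measurable in a parameter. For polynomially growing A and a test function the double sum
  converges absolutely.\<close>

definition dist_of :: "((real^4) \<times> bool \<Rightarrow> real) \<Rightarrow> (real^4 \<Rightarrow> real) \<Rightarrow> real" where
  "dist_of A \<phi> = (\<Sum>N. \<Sum>\<kappa>\<in>shell N. mode_coeff (fourier \<phi>) \<kappa> * A \<kappa>)"

definition growth :: "((real^4) \<times> bool \<Rightarrow> real) \<Rightarrow> bool" where
  "growth A \<longleftrightarrow> (\<exists>C p. 0 \<le> C \<and> (\<forall>\<kappa>. fst \<kappa> \<in> Z4 \<longrightarrow> \<bar>A \<kappa>\<bar> \<le> C * bracket (fst \<kappa>) ^ p))"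

lemma finite_shell [simp]: "finite (shell N)"
  by (cases N) (auto simp: shell_def)

lemma modes_mono: "i \<le> j \<Longrightarrow> modes i \<subseteq> modes j"
  unfolding modes_def using ZB_mono by blast

lemma shell_Z4: "\<kappa> \<in> shell N \<Longrightarrow> fst \<kappa> \<in> Z4"
  by (cases N) (auto simp: shell_def modes_def dest: subsetD[OF ZB_Z4])

lemma sum_shell: "(\<Sum>i<Suc N. \<Sum>\<kappa>\<in>shell i. f \<kappa>) = (\<Sum>\<kappa>\<in>modes N. f \<kappa> :: real)"
proof (induction N)
  case (Suc N)
  have "(\<Sum>\<kappa>\<in>modes (Suc N). f \<kappa>) = (\<Sum>\<kappa>\<in>modes (Suc N) - modes N. f \<kappa>) + (\<Sum>\<kappa>\<in>modes N. f \<kappa>)"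
    by (rule sum.subset_diff) (use modes_mono[of N "Suc N"] in auto)
  then show ?case using Suc by (simp add: shell_def)
qed (simp add: shell_def)

lemma dist_summable:
  assumes bd: "\<And>F. finite F \<Longrightarrow> F \<subseteq> Z4 \<times> UNIV \<Longrightarrow> (\<Sum>\<kappa>\<in>F. \<bar>f \<kappa>\<bar>) \<le> (D::real)"
  shows "summable (\<lambda>N. \<Sum>\<kappa>\<in>shell N. f \<kappa>)" "\<bar>\<Sum>N. \<Sum>\<kappa>\<in>shell N. f \<kappa>\<bar> \<le> D"
proof -
  let ?g = "\<lambda>N. \<bar>\<Sum>\<kappa>\<in>shell N. f \<kappa>\<bar>"
  have D0: "0 \<le> D" using bd[of "{}"] by simp
  have part: "(\<Sum>i<M. ?g i) \<le> D" for M
  proof (cases M)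
    case (Suc N)
    have "(\<Sum>i<M. ?g i) \<le> (\<Sum>i<Suc N. \<Sum>\<kappa>\<in>shell i. \<bar>f \<kappa>\<bar>)" unfolding Suc by (intro sum_mono sum_abs)
    also have "\<dots> = (\<Sum>\<kappa>\<in>modes N. \<bar>f \<kappa>\<bar>)" by (rule sum_shell)
    also have "\<dots> \<le> D" using ZB_Z4 by (intro bd) (auto simp: modes_def)
    finally show ?thesis .
  qed (simp add: D0)
  have sg: "summable ?g" by (rule summableI_nonneg_bounded[OF _ part]) simp
  then show "summable (\<lambda>N. \<Sum>\<kappa>\<in>shell N. f \<kappa>)" by (rule summable_rabs_cancel)
  have "\<bar>\<Sum>N. \<Sum>\<kappa>\<in>shell N. f \<kappa>\<bar> \<le> suminf ?g" by (rule summable_rabs[OF sg])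
  also have "\<dots> \<le> D" by (rule suminf_le_const[OF sg part])
  finally show "\<bar>\<Sum>N. \<Sum>\<kappa>\<in>shell N. f \<kappa>\<bar> \<le> D" .
qed

text \<open>Of the p + 5 derivatives, p absorb the growth of A and 5 leave a summable power in
  dimension four. The constant does not depend on \<phi>, which makes the functional a
  distribution.\<close>

lemma mode_sum_bound:
  obtains Cl where "0 < Cl" "\<And>A C p \<phi> F. 0 \<le> C \<Longrightarrow> (\<And>\<kappa>. fst \<kappa> \<in> Z4 \<Longrightarrow> \<bar>A \<kappa>\<bar> \<le> C * bracket (fst \<kappa>) ^ p) \<Longrightarrow> \<phi> \<in> TestF \<Longrightarrow>
     finite F \<Longrightarrow> F \<subseteq> Z4 \<times> UNIV \<Longrightarrow>
     (\<Sum>\<kappa>\<in>F. \<bar>mode_coeff (fourier \<phi>) \<kappa> * A \<kappa>\<bar>) \<le> C * Cl * (\<Sum>is\<in>{is. length is \<le> p + 5}. supn (pderivs is \<phi>))"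
proof -
  obtain Cl where Cl: "0 < Cl" "\<And>F. finite F \<Longrightarrow> F \<subseteq> Z4 \<Longrightarrow> (\<Sum>k\<in>F. bracket k powr - (4 + 1)) \<le> Cl"
    using lattice_sum[OF zero_less_one] by blast
  show ?thesis
  proof (rule that)
    show "0 < 2 * Cl" using Cl by simp
    fix A :: "(real^4) \<times> bool \<Rightarrow> real" and C p \<phi> F
    assume C: "0 \<le> C" and A: "\<And>\<kappa>. fst \<kappa> \<in> Z4 \<Longrightarrow> \<bar>A \<kappa>\<bar> \<le> C * bracket (fst \<kappa>) ^ p" and \<phi>: "\<phi> \<in> TestF"
      and F: "finite F" "F \<subseteq> Z4 \<times> (UNIV::bool set)"
    define Nn where "Nn = (\<Sum>is\<in>{is. length is \<le> p + 5}. supn (pderivs is \<phi>))"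
    have N0: "0 \<le> Nn" unfolding Nn_def by (intro sum_nonneg supn_pderivs_nonneg[OF \<phi>])
    have "\<bar>mode_coeff (fourier \<phi>) \<kappa> * A \<kappa>\<bar> \<le> C * Nn * bracket (fst \<kappa>) powr - (4 + 1)" if "\<kappa> \<in> F" for \<kappa>
    proof -
      have k: "fst \<kappa> \<in> Z4" using that F by auto
      let ?b = "bracket (fst \<kappa>)"
      have "norm (fourier \<phi> (fst \<kappa>)) * ?b ^ (p + 5) \<le> Nn" unfolding Nn_def by (rule fourier_decay[OF \<phi> k])
      then have f: "norm (fourier \<phi> (fst \<kappa>)) * ?b ^ p \<le> Nn / ?b ^ 5"
        by (simp add: power_add field_simps)
      have "\<bar>mode_coeff (fourier \<phi>) \<kappa> * A \<kappa>\<bar> \<le> norm (fourier \<phi> (fst \<kappa>)) * (C * ?b ^ p)"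
        unfolding abs_mult by (intro mult_mono abs_mode_coeff_le A k) auto
      also have "\<dots> = C * (norm (fourier \<phi> (fst \<kappa>)) * ?b ^ p)" by simp
      also have "\<dots> \<le> C * (Nn / ?b ^ 5)" by (intro mult_left_mono f C)
      also have "Nn / ?b ^ 5 = Nn * ?b powr - (4 + 1)"
        using powr_realpow[of ?b 5] by (simp add: powr_minus_divide)
      finally show ?thesis by (simp only: mult.assoc)
    qed
    then have "(\<Sum>\<kappa>\<in>F. \<bar>mode_coeff (fourier \<phi>) \<kappa> * A \<kappa>\<bar>) \<le> (\<Sum>\<kappa>\<in>F. C * Nn * bracket (fst \<kappa>) powr - (4 + 1))" by (rule sum_mono)
    also have "\<dots> \<le> (\<Sum>\<kappa>\<in>fst ` F \<times> (UNIV::bool set). C * Nn * bracket (fst \<kappa>) powr - (4 + 1))"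
      using F C N0 by (intro sum_mono2) (auto simp: image_iff, force)
    also have "\<dots> = (\<Sum>k\<in>fst ` F. \<Sum>j\<in>(UNIV::bool set). C * Nn * bracket k powr - (4 + 1))"
      by (subst sum.cartesian_product) (simp add: case_prod_unfold)
    also have "\<dots> = C * Nn * (2 * (\<Sum>k\<in>fst ` F. bracket k powr - (4 + 1)))" by (simp add: sum_distrib_left mult_ac)
    also have "\<dots> \<le> C * Nn * (2 * Cl)"
      using F C N0 by (intro mult_left_mono Cl) auto
    finally show "(\<Sum>\<kappa>\<in>F. \<bar>mode_coeff (fourier \<phi>) \<kappa> * A \<kappa>\<bar>) \<le> C * (2 * Cl) * (\<Sum>is\<in>{is. length is \<le> p + 5}. supn (pderivs is \<phi>))"
      unfolding Nn_def[symmetric] by (simp only: mult_ac)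
  qed
qed

lemma fourier_lincomb:
  assumes "\<phi> \<in> TestF" "\<psi> \<in> TestF"
  shows "fourier (\<lambda>x. a * \<phi> x + b * \<psi> x) k = a * fourier \<phi> k + b * fourier \<psi> k"
proof -
  have int: "integrable cubeM (\<lambda>x. complex_of_real (\<phi> x) * ek k x)" if "\<phi> \<in> TestF" for \<phi>
    by (rule integrable_cubeM_bounded[where B="supn \<phi>"])
      (use borel_testf[OF that] pderivs_le_supn[OF that, of "[]"] in \<open>auto simp: norm_mult\<close>)
  have "fourier (\<lambda>x. a * \<phi> x + b * \<psi> x) k = (LINT x|cubeM. a * (complex_of_real (\<phi> x) * ek k x) + b * (complex_of_real (\<psi> x) * ek k x))"
    unfolding fourier_def by (intro Bochner_Integration.integral_cong refl) (simp add: algebra_simps)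
  also have "\<dots> = a * fourier \<phi> k + b * fourier \<psi> k"
    unfolding fourier_def by (subst Bochner_Integration.integral_add) (auto intro!: integrable_mult_right int assms)
  finally show ?thesis .
qed

lemma dist_of_test:
  assumes "growth A" "\<phi> \<in> TestF"
  shows "summable (\<lambda>N. \<Sum>\<kappa>\<in>shell N. mode_coeff (fourier \<phi>) \<kappa> * A \<kappa>)"
    "(\<lambda>N. \<Sum>\<kappa>\<in>modes N. mode_coeff (fourier \<phi>) \<kappa> * A \<kappa>) \<longlonglongrightarrow> dist_of A \<phi>"
proof -
  obtain C p where C: "0 \<le> C" "\<And>\<kappa>. fst \<kappa> \<in> Z4 \<Longrightarrow> \<bar>A \<kappa>\<bar> \<le> C * bracket (fst \<kappa>) ^ p" using assms(1) unfolding growth_def by blast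
  obtain Cl where Cl: "0 < Cl" "\<And>A C p \<phi> F. 0 \<le> C \<Longrightarrow> (\<And>\<kappa>. fst \<kappa> \<in> Z4 \<Longrightarrow> \<bar>A \<kappa>\<bar> \<le> C * bracket (fst \<kappa>) ^ p) \<Longrightarrow> \<phi> \<in> TestF \<Longrightarrow>
     finite F \<Longrightarrow> F \<subseteq> Z4 \<times> UNIV \<Longrightarrow>
     (\<Sum>\<kappa>\<in>F. \<bar>mode_coeff (fourier \<phi>) \<kappa> * A \<kappa>\<bar>) \<le> C * Cl * (\<Sum>is\<in>{is. length is \<le> p + 5}. supn (pderivs is \<phi>))"
    by (rule mode_sum_bound) blast
  show s: "summable (\<lambda>N. \<Sum>\<kappa>\<in>shell N. mode_coeff (fourier \<phi>) \<kappa> * A \<kappa>)"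
    by (rule dist_summable(1)[OF Cl(2)[OF C assms(2)]])
  have "(\<lambda>N. \<Sum>i<Suc N. \<Sum>\<kappa>\<in>shell i. mode_coeff (fourier \<phi>) \<kappa> * A \<kappa>) \<longlonglongrightarrow> dist_of A \<phi>"
    unfolding dist_of_def by (rule LIMSEQ_Suc[OF summable_LIMSEQ[OF s]])
  then show "(\<lambda>N. \<Sum>\<kappa>\<in>modes N. mode_coeff (fourier \<phi>) \<kappa> * A \<kappa>) \<longlonglongrightarrow> dist_of A \<phi>" unfolding sum_shell .
qed

lemma Distrib_dist_of:
  assumes "growth A" shows "Distrib (dist_of A)"
  unfolding Distrib_def
proof (intro conjI allI impI)
  fix \<phi> \<psi> a b assume t: "\<phi> \<in> TestF" "\<psi> \<in> TestF"
  have "dist_of A (\<lambda>x. a * \<phi> x + b * \<psi> x) = (\<Sum>N. a * (\<Sum>\<kappa>\<in>shell N. mode_coeff (fourier \<phi>) \<kappa> * A \<kappa>) + b * (\<Sum>\<kappa>\<in>shell N. mode_coeff (fourier \<psi>) \<kappa> * A \<kappa>))"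
    unfolding dist_of_def
  proof (intro arg_cong[where f=suminf] ext)
    fix N
    have "mode_coeff (fourier (\<lambda>x. a * \<phi> x + b * \<psi> x)) \<kappa> = a * mode_coeff (fourier \<phi>) \<kappa> + b * mode_coeff (fourier \<psi>) \<kappa>" for \<kappa>
      unfolding mode_coeff_def fourier_lincomb[OF t] by simp
    then show "(\<Sum>\<kappa>\<in>shell N. mode_coeff (fourier (\<lambda>x. a * \<phi> x + b * \<psi> x)) \<kappa> * A \<kappa>) = a * (\<Sum>\<kappa>\<in>shell N. mode_coeff (fourier \<phi>) \<kappa> * A \<kappa>) + b * (\<Sum>\<kappa>\<in>shell N. mode_coeff (fourier \<psi>) \<kappa> * A \<kappa>)"
      by (simp add: sum_distrib_left sum.distrib[symmetric] algebra_simps)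
  qed
  also have "\<dots> = a * dist_of A \<phi> + b * dist_of A \<psi>"
    unfolding dist_of_def
    using dist_of_test(1)[OF assms t(1)] dist_of_test(1)[OF assms t(2)]
    by (simp add: suminf_add[symmetric] suminf_mult summable_mult)
  finally show "dist_of A (\<lambda>x. a * \<phi> x + b * \<psi> x) = a * dist_of A \<phi> + b * dist_of A \<psi>" .
next
  obtain C p where C: "0 \<le> C" "\<And>\<kappa>. fst \<kappa> \<in> Z4 \<Longrightarrow> \<bar>A \<kappa>\<bar> \<le> C * bracket (fst \<kappa>) ^ p" using assms(1) unfolding growth_def by blast
  obtain Cl where Cl: "0 < Cl" "\<And>A C p \<phi> F. 0 \<le> C \<Longrightarrow> (\<And>\<kappa>. fst \<kappa> \<in> Z4 \<Longrightarrow> \<bar>A \<kappa>\<bar> \<le> C * bracket (fst \<kappa>) ^ p) \<Longrightarrow> \<phi> \<in> TestF \<Longrightarrow>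
     finite F \<Longrightarrow> F \<subseteq> Z4 \<times> UNIV \<Longrightarrow>
     (\<Sum>\<kappa>\<in>F. \<bar>mode_coeff (fourier \<phi>) \<kappa> * A \<kappa>\<bar>) \<le> C * Cl * (\<Sum>is\<in>{is. length is \<le> p + 5}. supn (pderivs is \<phi>))"
    by (rule mode_sum_bound) blast
  have "\<bar>dist_of A \<phi>\<bar> \<le> C * Cl * (\<Sum>is\<in>{is. length is \<le> p + 5}. supn (pderivs is \<phi>))" if "\<phi> \<in> TestF" for \<phi>
    unfolding dist_of_def by (rule dist_summable(2)[OF Cl(2)[OF C that]])
  then show "\<exists>C N. \<forall>\<phi>\<in>TestF. \<bar>dist_of A \<phi>\<bar> \<le> C * (\<Sum>is\<in>{is. length is \<le> N}. supn (pderivs is \<phi>))" by blast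
qed

text \<open>Orthogonality leaves only the frequencies in the cube, so the series terminates, for
  arbitrary A.\<close>

lemma dist_of_tpoly:
  assumes "herm d"
  shows "dist_of A (tpoly d N) = (\<Sum>\<kappa>\<in>modes N. mode_coeff d \<kappa> * A \<kappa>)"
proof -
  let ?f = "\<lambda>\<kappa>. mode_coeff (fourier (tpoly d N)) \<kappa> * A \<kappa>"
  have v: "mode_coeff (fourier (tpoly d N)) \<kappa> = (if \<kappa> \<in> modes N then mode_coeff d \<kappa> else 0)" if "fst \<kappa> \<in> Z4" for \<kappa>
    using fourier_tpoly[OF assms that] by (cases \<kappa>) (auto simp: mode_coeff_def modes_def)
  have "(\<Sum>\<kappa>\<in>shell i. ?f \<kappa>) = 0" if out: "i \<notin> {..<Suc N}" for i
  proof (rule sum.neutral, rule ballI)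
    fix \<kappa> assume k: "\<kappa> \<in> shell i"
    obtain i' where "i = Suc i'" "N \<le> i'" using out by (cases i) auto
    then have "\<kappa> \<notin> modes N" using k modes_mono[of N i'] by (auto simp: shell_def)
    then show "?f \<kappa> = 0" using v[OF shell_Z4[OF k]] by simp
  qed
  then have "dist_of A (tpoly d N) = (\<Sum>i<Suc N. \<Sum>\<kappa>\<in>shell i. ?f \<kappa>)"
    unfolding dist_of_def by (intro suminf_finite) auto
  also have "\<dots> = (\<Sum>\<kappa>\<in>modes N. ?f \<kappa>)" by (rule sum_shell)
  also have "\<dots> = (\<Sum>\<kappa>\<in>modes N. mode_coeff d \<kappa> * A \<kappa>)"
    by (intro sum.cong refl) (subst v, auto simp: modes_def dest: subsetD[OF ZB_Z4])
  finally show ?thesis .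
qed

lemma smooth4_bounded:
  fixes f :: "real^4 \<Rightarrow> real"
  assumes "smooth4 f" "\<And>y. f y \<noteq> 0 \<Longrightarrow> norm y \<le> R"
  shows "\<exists>B. \<forall>y. \<bar>f y\<bar> \<le> B"
proof -
  have "continuous_on UNIV (pderivs [] f)" using assms(1) unfolding smooth4_def by blast
  then have "compact (f ` cball 0 R)"
    by (intro compact_continuous_image) (auto intro: continuous_on_subset)
  then obtain B where B: "\<And>y. y \<in> cball 0 R \<Longrightarrow> \<bar>f y\<bar> \<le> B"
    by (metis bounded_iff compact_imp_bounded imageI real_norm_def)
  have "\<bar>f y\<bar> \<le> max B 0" for y
  proof (cases "f y = 0")
    case False
    then show ?thesis using B[of y] assms(2)[of y] by simp
  qed simp
  then show ?thesis by blast
qed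

section \<open>Littlewood-Paley blocks\<close>

locale dyadic =
  fixes \<rho>m \<rho>0 :: "real^4 \<Rightarrow> real"
  assumes part: "dyadic_partition \<rho>m \<rho>0"
begin

text \<open>Indices are shifted by one, so that $q = 0$ belongs to the block $\Delta_{-1}$.\<close>

definition rq :: "nat \<Rightarrow> real^4 \<Rightarrow> real" where
  "rq q = rhoq \<rho>m \<rho>0 (int q - 1)"

text \<open>Radius of a ball holding the frequencies of block q: with the shifted index the annulus
  ends at (8/3) 2^(q - 1), below 2^(q + 1), and the initial ball of radius 4/3 fits into radius
  2.\<close>

definition RQ :: "nat \<Rightarrow> nat" where "RQ q = 2 ^ (q + 1)"

definition dq :: "nat \<Rightarrow> real^4 \<Rightarrow> real^4 \<Rightarrow> complex" where
  "dq q x k = complex_of_real (rq q k) * ek k x"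

definition block :: "nat \<Rightarrow> ((real^4) \<times> bool \<Rightarrow> real) \<Rightarrow> real^4 \<Rightarrow> real" where
  "block q A x = (\<Sum>\<kappa>\<in>modes (RQ q). mode_coeff (dq q x) \<kappa> * A \<kappa>)"

lemma RQ_pos: "1 \<le> RQ q" by (simp add: RQ_def)

lemma rq_support: assumes "rq q k \<noteq> 0" shows "norm k \<le> real (RQ q)"
proof (cases q)
  case 0
  then have "\<rho>m k \<noteq> 0" using assms by (simp add: rq_def rhoq_def)
  then have "norm k \<le> 4/3" using part unfolding dyadic_partition_def by blast
  then show ?thesis using 0 by (simp add: RQ_def)
next
  case (Suc p)
  let ?c = "2 powr (- real p)"
  have "\<rho>0 (?c *\<^sub>R k) \<noteq> 0" using assms Suc by (simp add: rq_def rhoq_def)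
  then have "norm (?c *\<^sub>R k) \<le> 8/3" using part unfolding dyadic_partition_def by blast
  then have "?c * norm k \<le> 8/3" by simp
  then have "2 ^ p * (?c * norm k) \<le> 2 ^ p * (8/3)" by (intro mult_left_mono) auto
  moreover have "2 ^ p * ?c = (1::real)" by (simp add: powr_minus powr_realpow)
  ultimately have "norm k \<le> 2 ^ p * (8/3)" by (simp add: mult.assoc[symmetric])
  also have "\<dots> \<le> 2 ^ p * 4" by simp
  finally show ?thesis using Suc by (simp add: RQ_def)
qed

lemma rq_even: "rq q (- k) = rq q k"
proof -
  have "\<rho>m (- y) = \<rho>m y" "\<rho>0 (- y) = \<rho>0 y" for y
    using part unfolding dyadic_partition_def radial_def by (metis norm_minus_cancel)+
  from this(1)[of k] this(2)[of "2 powr (- real_of_int (int q - 1)) *\<^sub>R k"] show ?thesis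
    by (simp add: rq_def rhoq_def)
qed

lemma herm_dq: "herm (dq q x)"
  by (simp add: herm_def dq_def rq_even cnj_ek)

lemma rq_bounded: "\<exists>B\<ge>1. \<forall>q k. \<bar>rq q k\<bar> \<le> B"
proof -
  have "\<exists>B. \<forall>y. \<bar>\<rho>m y\<bar> \<le> B"
  proof (rule smooth4_bounded[where R=3])
    show "smooth4 \<rho>m" using part by (simp add: dyadic_partition_def)
    show "norm y \<le> 3" if "\<rho>m y \<noteq> 0" for y
    proof -
      have "norm y \<le> 4/3" using part that unfolding dyadic_partition_def by blast
      then show ?thesis by simp
    qed
  qed
  then obtain B1 where B1: "\<And>y. \<bar>\<rho>m y\<bar> \<le> B1" by blast
  have "\<exists>B. \<forall>y. \<bar>\<rho>0 y\<bar> \<le> B"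
  proof (rule smooth4_bounded[where R=3])
    show "smooth4 \<rho>0" using part by (simp add: dyadic_partition_def)
    show "norm y \<le> 3" if "\<rho>0 y \<noteq> 0" for y
    proof -
      have "norm y \<le> 8/3" using part that unfolding dyadic_partition_def by blast
      then show ?thesis by simp
    qed
  qed
  then obtain B2 where B2: "\<And>y. \<bar>\<rho>0 y\<bar> \<le> B2" by blast
  have "\<bar>rq q k\<bar> \<le> max 1 (max B1 B2)" for q k
    unfolding rq_def rhoq_def using B1 B2 by (auto simp: le_max_iff_disj)
  then show ?thesis by (intro exI[of _ "max 1 (max B1 B2)"]) auto
qed

text \<open>The bounded support of \<open>rq\<close> reduces the lattice sum to a cube, and the
  addition formula for the cosine of a difference gives the coefficients \<open>dq\<close>. Blocks
  therefore test a distribution against trigonometric polynomials only.\<close>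

lemma Kq_tpoly: "(\<lambda>y. Kq \<rho>m \<rho>0 (int q - 1) (x - y)) = tpoly (dq q x) (RQ q)"
proof
  fix y
  have sub: "k \<in> ZB (RQ q)" if "k \<in> Z4" "rq q k \<noteq> 0" for k
    using rq_support[OF that(2)] that(1) component_le_norm_cart[of k] unfolding ZB_def by (auto intro: order_trans)
  have "Kq \<rho>m \<rho>0 (int q - 1) (x - y) = infsum (\<lambda>k. rq q k * cos (2 * pi * ((x - y) \<bullet> k))) (ZB (RQ q))"
    unfolding Kq_def rq_def[symmetric] using sub ZB_Z4 by (intro infsum_cong_neutral) auto
  also have "\<dots> = (\<Sum>k\<in>ZB (RQ q). rq q k * cos (2 * pi * ((x - y) \<bullet> k)))" by simp
  also have "\<dots> = tpoly (dq q x) (RQ q) y"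
    unfolding tpoly_def sum_modes
  proof (intro sum.cong refl)
    fix k
    have "cos (2 * pi * ((x - y) \<bullet> k)) = cos (2 * pi * (k \<bullet> x) - 2 * pi * (k \<bullet> y))"
      unfolding inner_commute[of "x - y"] by (simp add: inner_diff_right right_diff_distrib)
    then show "rq q k * cos (2 * pi * ((x - y) \<bullet> k)) = mode_coeff (dq q x) (k, False) * mode (k, False) y + mode_coeff (dq q x) (k, True) * mode (k, True) y"
      by (simp add: mode_coeff_def dq_def mode_def ek_def cos_diff algebra_simps)
  qed
  finally show "Kq \<rho>m \<rho>0 (int q - 1) (x - y) = tpoly (dq q x) (RQ q) y" .
qed

lemma Deltaq_dist_of: "Deltaq \<rho>m \<rho>0 (int q - 1) (dist_of A) x = block q A x"
  unfolding Deltaq_def Kq_tpoly block_def by (rule dist_of_tpoly[OF herm_dq])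

text \<open>A block is a sum of $O(R^4)$ modes with gradient $O(R)$, so its values on a grid of mesh $R^{-5}$ and its modes control its supremum.\<close>

definition Grid :: "nat \<Rightarrow> (real^4) set" where
  "Grid q = (\<lambda>f. \<chi> i. real (f i) / real (RQ q ^ 5)) ` Pi\<^sub>E (UNIV::4 set) (\<lambda>_. {..<RQ q ^ 5})"

lemma finite_Grid [simp]: "finite (Grid q)"
  unfolding Grid_def by (intro finite_imageI finite_PiE) auto

lemma card_Grid: "card (Grid q) \<le> RQ q ^ 20"
proof -
  have "card (Grid q) \<le> card (Pi\<^sub>E (UNIV::4 set) (\<lambda>_. {..<RQ q ^ 5}))"
    unfolding Grid_def by (intro card_image_le finite_PiE) auto
  also have "\<dots> = RQ q ^ 20" by (simp add: card_PiE power_mult[symmetric])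
  finally show ?thesis .
qed

lemma Grid_near:
  assumes "x \<in> cube" shows "\<exists>g\<in>Grid q. norm (x - g) \<le> 4 / real (RQ q ^ 5)"
proof -
  let ?M = "RQ q ^ 5"
  have M: "0 < real ?M" using RQ_pos[of q] by simp
  define f where "f i = nat \<lfloor>x $ i * real ?M\<rfloor>" for i
  have f: "real (f i) \<le> x $ i * real ?M" "x $ i * real ?M < real (f i) + 1" "f i < ?M" for i
  proof -
    have x: "0 \<le> x $ i" "x $ i < 1" using assms by (auto simp: cube_def)
    then have "0 \<le> x $ i * real ?M" by simp
    then show 1: "real (f i) \<le> x $ i * real ?M" "x $ i * real ?M < real (f i) + 1" unfolding f_def by linarith+
    have "x $ i * real ?M < 1 * real ?M" using x M by (intro mult_strict_right_mono) auto
    then have "real (f i) < real ?M" using 1 by linarith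
    then show "f i < ?M" by (simp only: of_nat_less_iff)
  qed
  let ?g = "(\<chi> i. real (f i) / real ?M) :: real^4"
  have "norm (x - ?g) \<le> (\<Sum>i\<in>UNIV. \<bar>(x - ?g) $ i\<bar>)" by (rule norm_le_l1_cart)
  also have "\<dots> \<le> (\<Sum>i\<in>(UNIV::4 set). 1 / real ?M)"
  proof (rule sum_mono)
    fix i
    have "\<bar>x $ i * real ?M - real (f i)\<bar> \<le> 1" using f[of i] by linarith
    moreover have "(x - ?g) $ i = (x $ i * real ?M - real (f i)) / real ?M" using M by (simp add: field_simps)
    ultimately show "\<bar>(x - ?g) $ i\<bar> \<le> 1 / real ?M" using M by (simp only: abs_divide abs_of_pos divide_right_mono less_imp_le)
  qed
  also have "\<dots> = 4 / real ?M" by simp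
  finally have "norm (x - ?g) \<le> 4 / real ?M" .
  moreover have "?g \<in> Grid q"
    unfolding Grid_def by (rule rev_image_eqI[of f]) (use f(3) in auto)
  ultimately show ?thesis by blast
qed

lemma card_ZB_le: "real (card (ZB N)) \<le> (2 * real N + 1) ^ 4"
proof -
  have "ZB N \<subseteq> (\<lambda>b. \<chi> i. of_int (b i)) ` Pi\<^sub>E (UNIV::4 set) (\<lambda>_. {- int N..int N})"
  proof
    fix k assume k: "k \<in> ZB N"
    have "\<lfloor>k $ i\<rfloor> \<in> {- int N..int N}" for i
    proof -
      obtain a where a: "k $ i = of_int a" using k unfolding ZB_def Z4_def by (metis (no_types, lifting) Ints_cases mem_Collect_eq)
      have "\<bar>k $ i\<bar> \<le> real N" using k by (simp add: ZB_def)
      then have "\<bar>a\<bar> \<le> int N" unfolding a by linarith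
      then show ?thesis using a by auto
    qed
    moreover have "k = (\<chi> i. of_int \<lfloor>k $ i\<rfloor>)" using k by (auto simp: ZB_def Z4_def vec_eq_iff)
    ultimately show "k \<in> (\<lambda>b. \<chi> i. of_int (b i)) ` Pi\<^sub>E (UNIV::4 set) (\<lambda>_. {- int N..int N})"
      by (intro rev_image_eqI[of "\<lambda>i. \<lfloor>k $ i\<rfloor>"]) auto
  qed
  then have "card (ZB N) \<le> card (Pi\<^sub>E (UNIV::4 set) (\<lambda>_. {- int N..int N}))"
    by (intro surj_card_le finite_PiE) auto
  also have "\<dots> = (2 * N + 1) ^ 4"
  proof -
    have "card {- int N..int N} = 2 * N + 1" by (simp add: nat_add_distrib nat_mult_distrib)
    then show ?thesis by (simp only: card_PiE finite prod_constant) simp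
  qed
  finally have "real (card (ZB N)) \<le> real ((2 * N + 1) ^ 4)" by (simp only: of_nat_le_iff)
  then show ?thesis by (simp add: add.commute)
qed

lemma norm_ZB_le: "k \<in> ZB N \<Longrightarrow> norm k \<le> 4 * real N"
proof -
  assume k: "k \<in> ZB N"
  have "norm k \<le> (\<Sum>i\<in>UNIV. \<bar>k $ i\<bar>)" by (rule norm_le_l1_cart)
  also have "\<dots> \<le> (\<Sum>i\<in>(UNIV::4 set). real N)" using k by (intro sum_mono) (auto simp: ZB_def)
  finally show ?thesis by simp
qed

lemma block_periodic: "l \<in> Z4 \<Longrightarrow> block q A (x + l) = block q A x"
proof -
  assume l: "l \<in> Z4"
  have "mode_coeff (dq q (x + l)) \<kappa> = mode_coeff (dq q x) \<kappa>" if "\<kappa> \<in> modes (RQ q)" for \<kappa>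
    using that l ZB_Z4 ek_periodic[of "fst \<kappa>" l x] by (auto simp: mode_coeff_def dq_def modes_def subset_iff)
  then show ?thesis unfolding block_def by (intro sum.cong) auto
qed

lemma norm_ek_diff: "norm (ek k x - ek k y) \<le> 4 * pi * norm k * norm (x - y)"
proof -
  let ?a = "2 * pi * (k \<bullet> x)" and ?b = "2 * pi * (k \<bullet> y)"
  have c: "\<bar>cos ?a - cos ?b\<bar> \<le> \<bar>?a - ?b\<bar>" "\<bar>sin ?a - sin ?b\<bar> \<le> \<bar>?a - ?b\<bar>"
  proof -
    have "\<bar>cos a - cos b\<bar> \<le> \<bar>a - b\<bar>" for a b :: real
    proof -
      have "\<bar>cos a - cos b\<bar> = 2 * (\<bar>sin ((a + b) / 2)\<bar> * \<bar>sin ((b - a) / 2)\<bar>)"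
        by (simp add: cos_diff_cos abs_mult)
      also have "\<dots> \<le> 2 * (1 * \<bar>(b - a) / 2\<bar>)"
        by (intro mult_left_mono mult_mono abs_sin_x_le_abs_x) auto
      finally show ?thesis by simp
    qed
    then show "\<bar>cos ?a - cos ?b\<bar> \<le> \<bar>?a - ?b\<bar>" .
    have "\<bar>sin a - sin b\<bar> \<le> \<bar>a - b\<bar>" for a b :: real
    proof -
      have "\<bar>sin a - sin b\<bar> = 2 * (\<bar>sin ((a - b) / 2)\<bar> * \<bar>cos ((a + b) / 2)\<bar>)"
        by (simp add: sin_diff_sin abs_mult)
      also have "\<dots> \<le> 2 * (\<bar>(a - b) / 2\<bar> * 1)"
        by (intro mult_left_mono mult_mono abs_sin_x_le_abs_x) auto
      finally show ?thesis by simp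
    qed
    then show "\<bar>sin ?a - sin ?b\<bar> \<le> \<bar>?a - ?b\<bar>" .
  qed
  have "norm (ek k x - ek k y) \<le> \<bar>cos ?a - cos ?b\<bar> + \<bar>sin ?a - sin ?b\<bar>"
    using cmod_le[of "ek k x - ek k y"] by (simp add: ek_def)
  also have "\<dots> \<le> 2 * \<bar>?a - ?b\<bar>" using add_mono[OF c] by simp
  also have "?a - ?b = 2 * pi * (k \<bullet> (x - y))" by (simp add: inner_diff_right right_diff_distrib)
  also have "2 * \<bar>2 * pi * (k \<bullet> (x - y))\<bar> = 4 * pi * \<bar>k \<bullet> (x - y)\<bar>" by (simp add: abs_mult)
  also have "\<dots> \<le> 4 * pi * (norm k * norm (x - y))" by (intro mult_left_mono Cauchy_Schwarz_ineq2) auto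
  finally show ?thesis by simp
qed

lemma block_sup:
  obtains C where "1 \<le> C" "\<And>q A K x. 0 \<le> K \<Longrightarrow> (\<And>\<kappa>. \<kappa> \<in> modes (RQ q) \<Longrightarrow> \<bar>A \<kappa>\<bar> \<le> K) \<Longrightarrow> (\<And>g. g \<in> Grid q \<Longrightarrow> \<bar>block q A g\<bar> \<le> K) \<Longrightarrow> \<bar>block q A x\<bar> \<le> C * K"
proof -
  obtain B where B: "1 \<le> B" "\<And>q k. \<bar>rq q k\<bar> \<le> B" using rq_bounded by blast
  \<comment> \<open>The 1 stands for the value at the nearest grid point, 2 * 81 R^4 bounds the
    number of modes, and the last factor is R^4 times the increment of one coefficient, so the
    powers of R cancel.\<close>
  let ?C = "1 + 2 * 81 * (B * (4 * pi * 4 * 4))"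
  show ?thesis
  proof (rule that)
    show "1 \<le> ?C" using B by simp
    fix q A K x assume K: "0 \<le> K" and A: "\<And>\<kappa>. \<kappa> \<in> modes (RQ q) \<Longrightarrow> \<bar>A \<kappa>\<bar> \<le> K" and G: "\<And>g. g \<in> Grid q \<Longrightarrow> \<bar>block q A g\<bar> \<le> K"
    obtain l where l: "l \<in> Z4" "x - l \<in> cube" using cube_reduce by blast
    obtain g where g: "g \<in> Grid q" "norm (x - l - g) \<le> 4 / real (RQ q ^ 5)" using Grid_near[OF l(2)] by blast
    define R where "R = real (RQ q)"
    have R: "1 \<le> R" using RQ_pos[of q] by (simp add: R_def)
    have t: "\<bar>mode_coeff (dq q (x - l)) \<kappa> - mode_coeff (dq q g) \<kappa>\<bar> \<le> B * (4 * pi * 4 * 4) / R ^ 4" if "\<kappa> \<in> modes (RQ q)" for \<kappa>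
    proof -
      have k: "fst \<kappa> \<in> ZB (RQ q)" using that by (auto simp: modes_def)
      have "mode_coeff (dq q (x - l)) \<kappa> - mode_coeff (dq q g) \<kappa> = mode_coeff (\<lambda>k. dq q (x - l) k - dq q g k) \<kappa>" by (simp add: mode_coeff_def)
      then have "\<bar>mode_coeff (dq q (x - l)) \<kappa> - mode_coeff (dq q g) \<kappa>\<bar> \<le> norm (dq q (x - l) (fst \<kappa>) - dq q g (fst \<kappa>))"
        using abs_mode_coeff_le[of "\<lambda>k. dq q (x - l) k - dq q g k" \<kappa>] by simp
      also have "\<dots> = \<bar>rq q (fst \<kappa>)\<bar> * norm (ek (fst \<kappa>) (x - l) - ek (fst \<kappa>) g)"
        unfolding dq_def right_diff_distrib[symmetric] norm_mult by simp
      also have "\<dots> \<le> B * (4 * pi * (4 * R) * (4 / R ^ 5))"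
      proof (intro mult_mono B order_trans[OF norm_ek_diff])
        show "norm (x - l - g) \<le> 4 / R ^ 5" using g(2) by (simp add: R_def)
        show "norm (fst \<kappa>) \<le> 4 * R" using norm_ZB_le[OF k] by (simp add: R_def)
      qed (use R B in auto)
      also have "\<dots> = B * (4 * pi * 4 * 4) / R ^ 4" using R by (simp add: field_simps eval_nat_numeral)
      finally show ?thesis .
    qed
    have "block q A (x - l) - block q A g = (\<Sum>\<kappa>\<in>modes (RQ q). (mode_coeff (dq q (x - l)) \<kappa> - mode_coeff (dq q g) \<kappa>) * A \<kappa>)"
      unfolding block_def by (simp add: sum_subtractf left_diff_distrib)
    also have "\<bar>\<dots>\<bar> \<le> (\<Sum>\<kappa>\<in>modes (RQ q). B * (4 * pi * 4 * 4) / R ^ 4 * K)"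
      by (rule order_trans[OF sum_abs sum_mono]) (unfold abs_mult, intro mult_mono t A, use R B in auto)
    also have "\<dots> = real (card (modes (RQ q))) * (B * (4 * pi * 4 * 4) / R ^ 4 * K)" by simp
    also have "\<dots> \<le> (2 * (81 * R ^ 4)) * (B * (4 * pi * 4 * 4) / R ^ 4 * K)"
    proof (intro mult_right_mono)
      have "real (card (modes (RQ q))) = 2 * real (card (ZB (RQ q)))" by (simp add: modes_def card_cartesian_product)
      also have "\<dots> \<le> 2 * (2 * R + 1) ^ 4" using card_ZB_le[of "RQ q"] by (simp add: R_def)
      also have "\<dots> \<le> 2 * (3 * R) ^ 4" using R by (intro mult_left_mono power_mono) auto
      finally show "real (card (modes (RQ q))) \<le> 2 * (81 * R ^ 4)" by (simp add: power_mult_distrib)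
    qed (use R B K in auto)
    also have "\<dots> = 2 * 81 * (B * (4 * pi * 4 * 4)) * K" using R by simp
    finally have "\<bar>block q A (x - l) - block q A g\<bar> \<le> 2 * 81 * (B * (4 * pi * 4 * 4)) * K" .
    moreover have "block q A x = block q A (x - l)" using block_periodic[OF l(1), of q A "x - l"] by simp
    ultimately show "\<bar>block q A x\<bar> \<le> ?C * K" using G[OF g(1)] unfolding distrib_right by linarith
  qed
qed

text \<open>Half of the exponent is held in reserve: a block bound of order R^(-\<theta>/2) against
  the weight 2^(\<theta> i) leaves 2^(\<theta> q / 2 - 3 \<theta> / 2), and \<theta> < 0 makes q = 0
  the worst case.\<close>

lemma Cnorm_le:
  assumes \<theta>: "\<theta> < 0" and K: "0 \<le> K"
    and D: "\<And>q x. \<bar>Deltaq \<rho>m \<rho>0 (int q - 1) f x\<bar> \<le> K * real (RQ q) powr (- \<theta> / 2)"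
  shows "Cnorm \<rho>m \<rho>0 \<theta> f \<le> K * 2 powr (- 3 * \<theta> / 2)"
  unfolding Cnorm_def
proof (rule cSUP_least)
  fix i :: int assume "i \<in> {-1..}"
  then obtain q :: nat where i: "i = int q - 1" by (metis add_diff_cancel_right' atLeast_iff diff_add_cancel diff_ge_0_iff_ge diff_minus_eq_add nonneg_int_cases)
  have "supn (Deltaq \<rho>m \<rho>0 i f) \<le> K * real (RQ q) powr (- \<theta> / 2)"
    unfolding supn_def i by (rule cSUP_least) (use D in auto)
  then have "2 powr (\<theta> * real_of_int i) * supn (Deltaq \<rho>m \<rho>0 i f) \<le> 2 powr (\<theta> * real_of_int i) * (K * real (RQ q) powr (- \<theta> / 2))"
    by (intro mult_left_mono) auto
  also have "real (RQ q) = 2 powr (real q + 1)" by (simp add: RQ_def powr_add powr_realpow)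
  also have "2 powr (\<theta> * real_of_int i) * (K * (2 powr (real q + 1)) powr (- \<theta> / 2)) = K * 2 powr (\<theta> * real_of_int i + (real q + 1) * (- \<theta> / 2))"
    by (subst powr_powr, subst powr_add, rule mult.left_commute)
  also have "\<dots> \<le> K * 2 powr (- 3 * \<theta> / 2)"
  proof (intro mult_left_mono powr_mono K)
    have "\<theta> * real q \<le> 0" using \<theta> by (simp add: mult_nonpos_nonneg)
    then show "\<theta> * real_of_int i + (real q + 1) * (- \<theta> / 2) \<le> - 3 * \<theta> / 2"
      unfolding i by (simp add: field_simps)
  qed simp
  finally show "2 powr (\<theta> * real_of_int i) * supn (Deltaq \<rho>m \<rho>0 i f) \<le> K * 2 powr (- 3 * \<theta> / 2)" .
qed auto

text \<open>The reserve in the exponent makes the weighted block norms decay geometrically with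
  ratio 2^(\<theta>/2); \<open>Calpha\<close> demands this limit zero and not just
  boundedness.\<close>

lemma Calpha_I:
  assumes \<theta>: "\<theta> < 0" and K: "0 \<le> K" and A: "growth A"
    and D: "\<And>q x. \<bar>block q A x\<bar> \<le> K * real (RQ q) powr (- \<theta> / 2)"
  shows "dist_of A \<in> Calpha \<rho>m \<rho>0 \<theta>"
proof -
  have "(\<lambda>q::nat. 2 powr (\<theta> * real q) * supn (Deltaq \<rho>m \<rho>0 (int q) (dist_of A))) \<longlonglongrightarrow> 0"
  proof (rule tendsto_sandwich[OF _ _ tendsto_const])
    have up: "supn (Deltaq \<rho>m \<rho>0 (int q) (dist_of A)) \<le> K * real (RQ (Suc q)) powr (- \<theta> / 2)" for q
      unfolding supn_def using Deltaq_dist_of[of "Suc q" A] D[of "Suc q"] by (intro cSUP_least) auto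
    have lo: "0 \<le> supn (Deltaq \<rho>m \<rho>0 (int q) (dist_of A))" for q
    proof -
      have "bdd_above (range (\<lambda>x. \<bar>Deltaq \<rho>m \<rho>0 (int q) (dist_of A) x\<bar>))"
        by (rule bdd_aboveI[of _ "K * real (RQ (Suc q)) powr (- \<theta> / 2)"]) (use Deltaq_dist_of[of "Suc q" A] D[of "Suc q"] in auto)
      from le_supn[OF this, of 0] show ?thesis by linarith
    qed
    show "eventually (\<lambda>q. 0 \<le> 2 powr (\<theta> * real q) * supn (Deltaq \<rho>m \<rho>0 (int q) (dist_of A))) sequentially"
      using lo by simp
    show "eventually (\<lambda>q. 2 powr (\<theta> * real q) * supn (Deltaq \<rho>m \<rho>0 (int q) (dist_of A)) \<le> K * 2 powr (- \<theta>) * (2 powr (\<theta> / 2)) ^ q) sequentially"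
    proof (intro always_eventually allI)
      fix q
      have "2 powr (\<theta> * real q) * supn (Deltaq \<rho>m \<rho>0 (int q) (dist_of A)) \<le> 2 powr (\<theta> * real q) * (K * real (RQ (Suc q)) powr (- \<theta> / 2))"
        by (intro mult_left_mono up) auto
      also have "real (RQ (Suc q)) = 2 powr (real q + 2)" by (simp add: RQ_def powr_add powr_realpow)
      also have "2 powr (\<theta> * real q) * (K * (2 powr (real q + 2)) powr (- \<theta> / 2)) = K * 2 powr (\<theta> * real q + (real q + 2) * (- \<theta> / 2))"
        by (subst powr_powr, subst powr_add, rule mult.left_commute)
      also have "\<theta> * real q + (real q + 2) * (- \<theta> / 2) = - \<theta> + \<theta> / 2 * real q" by (simp add: field_simps)
      also have "K * 2 powr (- \<theta> + \<theta> / 2 * real q) = K * 2 powr (- \<theta>) * (2 powr (\<theta> / 2)) ^ q"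
      proof -
        have p: "(2 powr (\<theta> / 2)) ^ q = 2 powr (\<theta> / 2 * real q)" by (subst powr_power) (auto simp: mult_ac)
        show ?thesis unfolding p powr_add by (simp only: mult.assoc)
      qed
      finally show "2 powr (\<theta> * real q) * supn (Deltaq \<rho>m \<rho>0 (int q) (dist_of A)) \<le> K * 2 powr (- \<theta>) * (2 powr (\<theta> / 2)) ^ q" .
    qed
    have "2 powr (\<theta> / 2) < 2 powr (0::real)" using \<theta> by (intro powr_less_mono) auto
    then have "(\<lambda>q. (2 powr (\<theta> / 2)) ^ q) \<longlonglongrightarrow> 0" by (intro LIMSEQ_power_zero) auto
    from tendsto_mult_left[OF this, of "K * 2 powr (- \<theta>)"]
    show "(\<lambda>q. K * 2 powr (- \<theta>) * (2 powr (\<theta> / 2)) ^ q) \<longlonglongrightarrow> 0" by simp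
  qed
  then show ?thesis using Distrib_dist_of[OF A] by (simp add: Calpha_def)
qed

end

section \<open>The kernels of the theorem\<close>

lemma eta_summable:
  assumes "0 < r" shows "(\<lambda>k. cos (2 * pi * (x \<bullet> k)) * exp (- r * (2 * pi * norm k) ^ 4)) summable_on Z4"
proof -
  obtain C where C: "\<And>F. finite F \<Longrightarrow> F \<subseteq> Z4 \<Longrightarrow> (\<Sum>k\<in>F. bracket k powr - (4 + 1)) \<le> C"
    using lattice_sum[OF zero_less_one] by blast
  let ?f = "\<lambda>k. cos (2 * pi * (x \<bullet> k)) * exp (- r * aK k)"
  have "(\<lambda>k. norm (?f k)) summable_on Z4"
  proof (rule nonneg_bdd_above_summable_on)
    have "sum (\<lambda>k. norm (?f k)) F \<le> (1 + 2 / r^2) * C" if F: "F \<subseteq> Z4" "finite F" for F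
    proof -
      have "sum (\<lambda>k. norm (?f k)) F \<le> (\<Sum>k\<in>F. (1 + 2 / r^2) * bracket k powr - (4 + 1))"
      proof (rule sum_mono)
        fix k assume "k \<in> F"
        then have "exp (- r * aK k) \<le> (1 + 2 / r^2) * bracket k powr - (4 + 1)" using F by (intro exp_aK_le assms) auto
        moreover have "norm (?f k) \<le> 1 * exp (- r * aK k)"
          unfolding norm_mult by (intro mult_mono) auto
        ultimately show "norm (?f k) \<le> (1 + 2 / r^2) * bracket k powr - (4 + 1)" by linarith
      qed
      also have "\<dots> = (1 + 2 / r^2) * (\<Sum>k\<in>F. bracket k powr - (4 + 1))" by (rule sum_distrib_left[symmetric])
      also have "\<dots> \<le> (1 + 2 / r^2) * C" by (intro mult_left_mono C F) auto
      finally show ?thesis .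
    qed
    then show "bdd_above (sum (\<lambda>k. norm (?f k)) ` {F. F \<subseteq> Z4 \<and> finite F})"
      by (intro bdd_aboveI[of _ "(1 + 2 / r^2) * C"]) auto
  qed simp
  then have "?f summable_on Z4" by (rule abs_summable_summable)
  then show ?thesis by (simp add: aK_def)
qed

lemma etat_one_tendsto:
  assumes "0 < r" shows "(\<lambda>j. etat (\<lambda>_. 1) j r x) \<longlonglongrightarrow> eta r x"
proof -
  let ?f = "\<lambda>k. cos (2 * pi * (x \<bullet> k)) * exp (- r * (2 * pi * norm k) ^ 4)"
  have "(?f has_sum eta r x) Z4"
    unfolding eta_def by (rule has_sum_infsum[OF eta_summable[OF assms]])
  then have "(sum ?f \<longlongrightarrow> eta r x) (finite_subsets_at_top Z4)" by (simp add: has_sum_def)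
  from filterlim_compose[OF this ZB_filterlim]
  show ?thesis by (simp add: etat_def aK_def mult.commute)
qed

text \<open>At time zero the series is not summable: along a coordinate axis its terms would have to
  tend to zero, which the double angle formula cos(2 t) = 2 cos(t)^2 - 1 excludes. The value 0 is
  then the default of \<open>infsum\<close>.\<close>

lemma eta_0: "eta 0 x = 0"
proof -
  let ?f = "\<lambda>k. cos (2 * pi * (x \<bullet> k)) * exp (- 0 * (2 * pi * norm k) ^ 4)"
  have "\<not> ?f summable_on Z4"
  proof
    assume s: "?f summable_on Z4"
    define g where "g n = real n *\<^sub>R (axis undefined 1 :: real^4)" for n
    have g: "range g \<subseteq> Z4" "inj g" by (auto simp: g_def Z4_def axis_def inj_on_def vec_eq_iff)
    have "?f summable_on range g" by (rule summable_on_subset_banach[OF s g(1)])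
    then have "(?f \<circ> g) summable_on UNIV" using g(2) by (subst (asm) summable_on_reindex) auto
    then have "summable (?f \<circ> g)" by (rule summable_on_imp_summable)
    then have "(?f \<circ> g) \<longlonglongrightarrow> 0" by (rule summable_LIMSEQ_zero)
    then have c: "(\<lambda>n. cos (2 * pi * (real n * (x \<bullet> axis undefined 1)))) \<longlonglongrightarrow> 0" by (simp add: g_def o_def)
    define y where "y = x \<bullet> axis undefined 1"
    have dbl: "cos (2 * pi * (real (2 * n) * y)) = 2 * (cos (2 * pi * (real n * y)))^2 - 1" for n
      using cos_double_cos[of "2 * pi * (real n * y)"] by (simp add: mult_ac)
    have "(\<lambda>n. cos (2 * pi * (real (2 * n) * y))) \<longlonglongrightarrow> 0"
      using LIMSEQ_subseq_LIMSEQ[OF c, of "\<lambda>n. 2 * n"] unfolding y_def by (simp add: strict_mono_def o_def)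
    moreover have "(\<lambda>n. cos (2 * pi * (real (2 * n) * y))) \<longlonglongrightarrow> 2 * 0^2 - 1"
      unfolding dbl unfolding y_def by (intro tendsto_intros c)
    ultimately have "(0::real) = 2 * 0^2 - 1" by (rule LIMSEQ_unique)
    then show False by simp
  qed
  then show ?thesis unfolding eta_def by (rule infsum_not_exists)
qed

lemma fourier_symbol_eta: "fourier_symbol (\<lambda>_. 1) eta"
  unfolding fourier_symbol_def using etat_one_tendsto eta_0 by (auto intro!: exI[of _ 1])

lemma fourier_symbol_zero: "fourier_symbol (\<lambda>_. 0) (\<lambda>_ _. 0)"
  unfolding fourier_symbol_def by (auto simp: etat_def)

text \<open>Convolution multiplies Fourier coefficients. Since i \<le> j, every frequency of the
  first factor occurs in the second, so nothing is lost on the diagonal.\<close>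

lemma etat_conv:
  assumes b: "\<And>k. b (- k) = b k" and j: "i \<le> j"
  shows "(LINT y|cubeM. etat b i 0 (x - y) * etat (\<lambda>_. 1) j r y) = etat b i r x"
proof -
  let ?e = "\<lambda>l. complex_of_real (1 * exp (- r * aK l))"
  have "complex_of_real (LINT y|cubeM. etat b i 0 (x - y) * etat (\<lambda>_. 1) j r y)
    = (LINT y|cubeM. complex_of_real (etat b i 0 (x - y)) * complex_of_real (etat (\<lambda>_. 1) j r y))"
    unfolding of_real_mult[symmetric] integral_complex_of_real ..
  also have "\<dots> = (LINT y|cubeM. (\<Sum>k\<in>ZB i. \<Sum>l\<in>ZB j. (complex_of_real (b k) * ek k x * ?e l) * ek (l - k) y))"
  proof (intro Bochner_Integration.integral_cong refl)
    fix y
    have "ek k (x - y) = ek k x * ek (- k) y" for k using ek_add[of k x "- y"] by (simp add: ek_minus_right)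
    moreover have "ek (- k) y * ek l y = ek (l - k) y" for k l using ek_add_left[of "- k" l y] by simp
    ultimately show "complex_of_real (etat b i 0 (x - y)) * complex_of_real (etat (\<lambda>_. 1) j r y)
      = (\<Sum>k\<in>ZB i. \<Sum>l\<in>ZB j. (complex_of_real (b k) * ek k x * ?e l) * ek (l - k) y)"
      unfolding etat_ek[of b, OF b] etat_ek[of "\<lambda>_. 1", OF refl] sum_product
      by (intro sum.cong refl) (simp add: mult_ac)
  qed
  also have "\<dots> = (\<Sum>k\<in>ZB i. \<Sum>l\<in>ZB j. LINT y|cubeM. (complex_of_real (b k) * ek k x * ?e l) * ek (l - k) y)"
  proof -
    have int: "integrable cubeM (\<lambda>y. c * ek k y)" for c k
      by (intro integrable_mult_right integrable_cubeM_bounded[where B=1]) auto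
    show ?thesis
      by (subst Bochner_Integration.integral_sum, intro Bochner_Integration.integrable_sum int)
        (intro sum.cong refl Bochner_Integration.integral_sum int)
  qed
  also have "\<dots> = (\<Sum>k\<in>ZB i. \<Sum>l\<in>ZB j. if l = k then complex_of_real (b k) * ek k x * ?e l else 0)"
    using cubeM.prob_space by (intro sum.cong refl) (auto simp: integral_ek dest!: subsetD[OF ZB_Z4])
  also have "\<dots> = (\<Sum>k\<in>ZB i. complex_of_real (b k) * ek k x * ?e k)"
    using ZB_mono[OF j] by (intro sum.cong refl) (auto simp: subset_iff)
  also have "\<dots> = complex_of_real (etat b i r x)"
    unfolding etat_ek[of b, OF b] by (intro sum.cong refl) simp
  finally show ?thesis by (simp only: of_real_eq_iff)
qed

lemma cutoffD:
  assumes "cutoff \<zeta>"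
  shows "\<zeta> (- x) = \<zeta> x" "\<zeta> 0 = 1" "continuous_on UNIV \<zeta>" "\<exists>Z\<ge>1. \<forall>x. \<bar>\<zeta> x\<bar> \<le> Z"
    "\<exists>R. \<forall>x. \<zeta> x \<noteq> 0 \<longrightarrow> norm x \<le> R"
proof -
  show "\<zeta> (- x) = \<zeta> x" "\<zeta> 0 = 1" "\<exists>R. \<forall>x. \<zeta> x \<noteq> 0 \<longrightarrow> norm x \<le> R"
    using assms unfolding cutoff_def by blast+
  then obtain R where R: "\<And>x. \<zeta> x \<noteq> 0 \<Longrightarrow> norm x \<le> R" by blast
  have sm: "smooth4 \<zeta>" using assms unfolding cutoff_def by blast
  then have "continuous_on UNIV (pderivs [] \<zeta>)" unfolding smooth4_def by blast
  then show "continuous_on UNIV \<zeta>" by simp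
  obtain B where "\<And>x. \<bar>\<zeta> x\<bar> \<le> B" using smooth4_bounded[OF sm R] by blast
  then show "\<exists>Z\<ge>1. \<forall>x. \<bar>\<zeta> x\<bar> \<le> Z" by (intro exI[of _ "max 1 B"]) (auto simp: le_max_iff_disj)
qed

text \<open>The multiplier is nonzero at finitely many lattice points only, so truncations are
  constant from some index on. The convolution with \<open>eta\<close> is computed for truncations
  of \<open>eta\<close> and passed to the limit by dominated convergence.\<close>

lemma fourier_symbol_eta_eps:
  assumes \<zeta>: "cutoff \<zeta>" and \<epsilon>: "0 < \<epsilon>"
  shows "fourier_symbol (\<lambda>k. \<zeta> (\<epsilon> *\<^sub>R k)) (eta_eps \<zeta> \<epsilon>)"
proof -
  let ?b = "\<lambda>k. \<zeta> (\<epsilon> *\<^sub>R k)"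
  obtain R where R: "\<And>x. \<zeta> x \<noteq> 0 \<Longrightarrow> norm x \<le> R" using cutoffD(5)[OF \<zeta>] by blast
  obtain Z where Z: "\<And>x. \<bar>\<zeta> x\<bar> \<le> Z" using cutoffD(4)[OF \<zeta>] by blast
  \<comment> \<open>Outside the cube of this size the multiplier vanishes.\<close>
  define i where "i = nat \<lceil>R / \<epsilon>\<rceil>"
  have sub: "k \<in> ZB i" if "k \<in> Z4" "?b k \<noteq> 0" for k
  proof -
    have "norm (\<epsilon> *\<^sub>R k) \<le> R" by (rule R[OF that(2)])
    then have "norm k \<le> R / \<epsilon>" using \<epsilon> by (simp add: field_simps)
    then have "norm k \<le> real i" unfolding i_def by linarith
    then show ?thesis using that(1) component_le_norm_cart[of k] unfolding ZB_def by (auto intro: order_trans)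
  qed
  have bm: "?b (- k) = ?b k" for k using cutoffD(1)[OF \<zeta>, of "\<epsilon> *\<^sub>R k"] by simp
  have et: "etat ?b j r x = etat ?b i r x" if "i \<le> j" for j r x
    unfolding etat_def
  proof (rule sum.mono_neutral_right)
    show "\<forall>k\<in>ZB j - ZB i. ?b k * exp (- r * aK k) * cos (2 * pi * (x \<bullet> k)) = 0"
    proof
      fix k assume "k \<in> ZB j - ZB i"
      then have "?b k = 0" using sub[of k] ZB_Z4 by blast
      then show "?b k * exp (- r * aK k) * cos (2 * pi * (x \<bullet> k)) = 0" by simp
    qed
  qed (use ZB_mono[OF that] in auto)
  have ze: "zeta_eps \<zeta> \<epsilon> x = etat ?b i 0 x" for x
  proof -
    have "zeta_eps \<zeta> \<epsilon> x = infsum (\<lambda>k. ?b k * cos (2 * pi * (x \<bullet> k))) (ZB i)"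
      unfolding zeta_eps_def using sub ZB_Z4 by (intro infsum_cong_neutral) auto
    then show ?thesis by (simp add: etat_def)
  qed
  have main: "eta_eps \<zeta> \<epsilon> r x = etat ?b i r x" if r: "0 < r" for r x
  proof -
    have "\<exists>M. \<forall>j y. \<bar>etat (\<lambda>_. 1) j r y\<bar> \<le> M" by (rule etat_bounded[OF _ r, of _ 1]) simp
    then obtain M where M: "\<And>j y. \<bar>etat (\<lambda>_. 1) j r y\<bar> \<le> M" by blast
    define N where "N = (\<Sum>k\<in>ZB i. \<bar>?b k\<bar> * exp (- 0 * aK k))"
    have N: "\<bar>etat ?b i 0 y\<bar> \<le> N" for y unfolding N_def by (rule etat_bound)
    have mode: "eta r \<in> borel_measurable borel"
      by (rule borel_measurable_LIMSEQ_real[OF etat_one_tendsto[OF r] etat_borel])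
    have bm0: "(\<lambda>y. etat ?b i 0 (x - y)) \<in> borel_measurable borel" by measurable
    have "(\<lambda>j. LINT y|cubeM. etat ?b i 0 (x - y) * etat (\<lambda>_. 1) j r y) \<longlonglongrightarrow> (LINT y|cubeM. etat ?b i 0 (x - y) * eta r y)"
    proof (rule integral_dominated_convergence[where w="\<lambda>_. N * M"])
      show "AE y in cubeM. (\<lambda>j. etat ?b i 0 (x - y) * etat (\<lambda>_. 1) j r y) \<longlonglongrightarrow> etat ?b i 0 (x - y) * eta r y"
        by (intro AE_I2 tendsto_mult tendsto_const etat_one_tendsto r)
      show "AE y in cubeM. norm (etat ?b i 0 (x - y) * etat (\<lambda>_. 1) j r y) \<le> N * M" for j
      proof (rule AE_I2)
        fix y
        have "0 \<le> N" using N[of 0] by linarith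
        then show "norm (etat ?b i 0 (x - y) * etat (\<lambda>_. 1) j r y) \<le> N * M"
          unfolding real_norm_def abs_mult by (intro mult_mono N M) auto
      qed
      show "(\<lambda>y. etat ?b i 0 (x - y) * eta r y) \<in> borel_measurable cubeM"
        by (intro measurable_cubeM borel_measurable_times bm0 mode)
      have "(\<lambda>y. etat ?b i 0 (x - y) * etat (\<lambda>_. 1) j r y) \<in> borel_measurable borel" for j
        by (intro borel_measurable_times bm0 etat_borel)
      then show "(\<lambda>y. etat ?b i 0 (x - y) * etat (\<lambda>_. 1) j r y) \<in> borel_measurable cubeM" for j by (rule measurable_cubeM)
    qed simp
    moreover have "eventually (\<lambda>j. (LINT y|cubeM. etat ?b i 0 (x - y) * etat (\<lambda>_. 1) j r y) = etat ?b i r x) sequentially"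
      using eventually_ge_at_top[of i] by eventually_elim (rule etat_conv[of ?b, OF bm])
    ultimately have "(\<lambda>j::nat. etat ?b i r x) \<longlonglongrightarrow> (LINT y|cubeM. etat ?b i 0 (x - y) * eta r y)"
      by (rule Lim_transform_eventually)
    then have "etat ?b i r x = (LINT y|cubeM. etat ?b i 0 (x - y) * eta r y)" by (rule LIMSEQ_unique[OF tendsto_const])
    then show ?thesis unfolding eta_eps_def convT_def set_integral_cube ze by (rule sym)
  qed
  show ?thesis
    unfolding fourier_symbol_def
  proof (intro conjI allI impI)
    show "?b (- k) = ?b k" for k by (rule bm)
    show "\<exists>B. \<forall>k. \<bar>?b k\<bar> \<le> B" using Z by blast
    show "(\<lambda>j. etat ?b j r x) \<longlonglongrightarrow> eta_eps \<zeta> \<epsilon> r x" if "0 < r" for r x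
    proof (rule tendsto_eventually)
      show "eventually (\<lambda>j. etat ?b j r x = eta_eps \<zeta> \<epsilon> r x) sequentially"
        using eventually_ge_at_top[of i] by eventually_elim (rule trans[OF et main[OF that, symmetric]])
    qed
    \<comment> \<open>At time zero the mollifier is convolved with the zero function, by
      \<open>eta_0\<close>.\<close>
    show "eta_eps \<zeta> \<epsilon> 0 x = 0" for x
      unfolding eta_eps_def convT_def by (simp add: eta_0 set_lebesgue_integral_def)
  qed
qed

lemma bracket_powr_ge_1: "0 \<le> \<beta> \<Longrightarrow> 1 \<le> bracket k powr \<beta>"
  by (rule ge_one_powr_ge_zero) auto

lemma prod_bracket_ge_1: "0 \<le> \<beta> \<Longrightarrow> 1 \<le> (\<Prod>m<n. bracket (\<kappa> m) powr \<beta>)"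
  by (rule prod_ge_1) (simp add: bracket_powr_ge_1)

text \<open>The multiplier bound for a single kernel, written as a difference from the zero symbol;
  n \<ge> 1 makes the product of zeros vanish.\<close>

lemma mult_bound:
  assumes Z: "1 \<le> Z" "\<And>k. \<bar>b k\<bar> \<le> Z" and n: "1 \<le> n" and \<beta>: "0 \<le> \<beta>"
  shows "\<bar>(\<Prod>m<n. b (\<kappa> m)) - (\<Prod>m<n. 0)\<bar> \<le> Z ^ n * (\<Prod>m<n. bracket (\<kappa> m) powr \<beta>)"
proof -
  have zero: "(\<Prod>m<n. 0::real) = 0" using n by simp
  have "\<bar>\<Prod>m<n. b (\<kappa> m)\<bar> \<le> (\<Prod>m<n. Z)" unfolding abs_prod by (intro prod_mono conjI Z) auto
  moreover have "Z ^ n * 1 \<le> Z ^ n * (\<Prod>m<n. bracket (\<kappa> m) powr \<beta>)"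
    using Z by (intro mult_left_mono prod_bracket_ge_1 \<beta>) auto
  ultimately show ?thesis unfolding zero by simp
qed

text \<open>Telescoping: factors are replaced by 1 one at a time, the others being at most Z in
  absolute value; the weights are at least 1 and absorb the missing factors.\<close>

lemma prod_minus_one_le:
  fixes x w :: "nat \<Rightarrow> real"
  assumes "1 \<le> Z" "0 \<le> \<eta>" "\<And>m. \<bar>x m\<bar> \<le> Z" "\<And>m. \<bar>x m - 1\<bar> \<le> \<eta> * w m" "\<And>m. 1 \<le> w m"
  shows "\<bar>(\<Prod>m<n. x m) - 1\<bar> \<le> real n * \<eta> * Z ^ n * (\<Prod>m<n. w m)"
proof (induction n)
  case (Suc n)
  let ?X = "\<Prod>m<n. x m" and ?W = "\<Prod>m<n. w m"
  have W: "1 \<le> ?W" by (rule prod_ge_1) (use assms in auto)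
  have w0: "0 \<le> w n" "1 \<le> w n" using assms(5)[of n] by auto
  have X: "\<bar>?X\<bar> \<le> Z ^ n"
  proof -
    have "\<bar>?X\<bar> \<le> (\<Prod>m<n. Z)" unfolding abs_prod by (intro prod_mono conjI assms) auto
    then show ?thesis by simp
  qed
  have Zn: "1 \<le> Z ^ n" "Z ^ n \<le> Z ^ Suc n" using assms(1) by (auto intro: one_le_power)
  have "(\<Prod>m<Suc n. x m) - 1 = ?X * (x n - 1) + (?X - 1)" by (simp add: algebra_simps)
  also have "\<bar>\<dots>\<bar> \<le> \<bar>?X\<bar> * \<bar>x n - 1\<bar> + \<bar>?X - 1\<bar>" by (rule order_trans[OF abs_triangle_ineq]) (simp add: abs_mult)
  also have "\<dots> \<le> Z ^ n * (\<eta> * w n) + real n * \<eta> * Z ^ n * ?W"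
    using assms(1) by (intro add_mono mult_mono X assms Suc) auto
  also have "\<dots> \<le> Z ^ Suc n * \<eta> * (?W * w n) + real n * \<eta> * Z ^ Suc n * (?W * w n)"
  proof (rule add_mono)
    have "Z ^ n * (\<eta> * w n) \<le> Z ^ Suc n * (\<eta> * (?W * w n))"
      using Zn assms(1,2) W w0 mult_right_mono[OF W w0(1)] by (intro mult_mono mult_left_mono) auto
    then show "Z ^ n * (\<eta> * w n) \<le> Z ^ Suc n * \<eta> * (?W * w n)" by (simp only: mult.assoc)
    show "real n * \<eta> * Z ^ n * ?W \<le> real n * \<eta> * Z ^ Suc n * (?W * w n)"
      using Zn assms(1,2) W w0 mult_left_mono[OF w0(2), of ?W] by (intro mult_mono mult_left_mono) auto
  qed
  also have "\<dots> = real (Suc n) * \<eta> * Z ^ Suc n * (\<Prod>m<Suc n. w m)" by (simp add: algebra_simps)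
  finally show ?case .
qed simp

text \<open>Low frequencies have multiplier close to 1 by continuity of \<zeta> at 0. High
  frequencies are merely bounded, but there \<open>bracket\<close> to the power \<beta> is so large
  that it pays for the small constant \<eta>.\<close>

lemma zeta_multiplier:
  fixes n :: nat and \<beta> \<eta> :: real
  assumes \<zeta>: "cutoff \<zeta>" and \<beta>: "0 < \<beta>" and \<eta>: "0 < \<eta>" and n: "1 \<le> n"
  shows "eventually (\<lambda>\<epsilon>. 0 < \<epsilon> \<and> (\<forall>\<kappa>. \<bar>(\<Prod>m<n. \<zeta> (\<epsilon> *\<^sub>R \<kappa> m)) - (\<Prod>m<n. 1)\<bar> \<le> \<eta> * (\<Prod>m<n. bracket (\<kappa> m) powr \<beta>))) (at_right 0)"
proof -
  obtain Z where Z: "1 \<le> Z" "\<And>x. \<bar>\<zeta> x\<bar> \<le> Z" using cutoffD(4)[OF \<zeta>] by blast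
  \<comment> \<open>Divides out the factor by which \<open>prod_minus_one_le\<close> enlarges the
    error of one frequency.\<close>
  define \<eta>' where "\<eta>' = \<eta> / (real n * Z ^ n)"
  have Zn: "0 < real n * Z ^ n" using Z n by simp
  have e': "0 < \<eta>'" using \<eta> Zn by (simp add: \<eta>'_def)
  have "isCont \<zeta> 0" using cutoffD(3)[OF \<zeta>] by (simp add: continuous_on_eq_continuous_at)
  then obtain \<rho> where \<rho>: "0 < \<rho>" "\<And>x. norm x < \<rho> \<Longrightarrow> \<bar>\<zeta> x - 1\<bar> < \<eta>'"
    using e' cutoffD(2)[OF \<zeta>] unfolding continuous_at_eps_delta by (auto simp: dist_norm)
  \<comment> \<open>The frequency beyond which \<eta>' |k|^\<beta> exceeds the trivial bound Z + 1
    for the error.\<close>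
  define c where "c = ((Z + 1) / \<eta>') powr (1 / \<beta>)"
  have c: "0 < c" "c powr \<beta> = (Z + 1) / \<eta>'" using Z e' \<beta> by (auto simp: c_def powr_powr)
  have one: "\<bar>\<zeta> (\<epsilon> *\<^sub>R k) - 1\<bar> \<le> \<eta>' * bracket k powr \<beta>" if \<epsilon>: "0 < \<epsilon>" "\<epsilon> < \<rho> / c" for \<epsilon> k
  proof (cases "norm (\<epsilon> *\<^sub>R k) < \<rho>")
    case True
    then have "\<bar>\<zeta> (\<epsilon> *\<^sub>R k) - 1\<bar> \<le> \<eta>' * 1" using \<rho>(2)[OF True] by simp
    also have "\<dots> \<le> \<eta>' * bracket k powr \<beta>" using e' \<beta> by (intro mult_left_mono bracket_powr_ge_1) auto
    finally show ?thesis .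
  next
    case False
    then have "\<rho> \<le> \<epsilon> * norm k" using \<epsilon> by simp
    then have "\<rho> / \<epsilon> \<le> norm k" using \<epsilon> by (simp add: field_simps)
    moreover have "c \<le> \<rho> / \<epsilon>" using \<epsilon> c by (simp add: field_simps)
    ultimately have "c \<le> bracket k" by (simp add: bracket_def)
    then have "c powr \<beta> \<le> bracket k powr \<beta>" using c \<beta> by (intro powr_mono2) auto
    then have "\<eta>' * ((Z + 1) / \<eta>') \<le> \<eta>' * bracket k powr \<beta>" unfolding c(2) using e' by (intro mult_left_mono) auto
    then have "Z + 1 \<le> \<eta>' * bracket k powr \<beta>" using e' by simp
    moreover have "\<bar>\<zeta> (\<epsilon> *\<^sub>R k) - 1\<bar> \<le> Z + 1" using Z(2)[of "\<epsilon> *\<^sub>R k"] by linarith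
    ultimately show ?thesis by linarith
  qed
  have "eventually (\<lambda>\<epsilon>. \<epsilon> \<in> {0<..<\<rho> / c}) (at_right 0)"
    using \<rho> c by (intro eventually_at_right_real) auto
  then show ?thesis
  proof eventually_elim
    case (elim \<epsilon>)
    then have \<epsilon>: "0 < \<epsilon>" "\<epsilon> < \<rho> / c" by auto
    have "\<bar>(\<Prod>m<n. \<zeta> (\<epsilon> *\<^sub>R \<kappa> m)) - (\<Prod>m<n. 1)\<bar> \<le> \<eta> * (\<Prod>m<n. bracket (\<kappa> m) powr \<beta>)" for \<kappa>
    proof -
      have "\<bar>(\<Prod>m<n. \<zeta> (\<epsilon> *\<^sub>R \<kappa> m)) - 1\<bar> \<le> real n * \<eta>' * Z ^ n * (\<Prod>m<n. bracket (\<kappa> m) powr \<beta>)"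
        by (rule prod_minus_one_le) (use Z e' \<beta> one[OF \<epsilon>] in \<open>auto simp: bracket_powr_ge_1\<close>)
      also have "real n * \<eta>' * Z ^ n = (real n * Z ^ n) * \<eta>'" by simp
      also have "\<dots> = \<eta>" using less_imp_neq[OF Zn] unfolding \<eta>'_def by (simp only: times_divide_eq_right nonzero_mult_div_cancel_left not_False_eq_True)
      finally show ?thesis by simp
    qed
    then show ?case using \<epsilon> by blast
  qed
qed

section \<open>Moments of the increments\<close>

lemma fourier_symbol_bound:
  assumes "fourier_symbol b E"
  obtains Z where "1 \<le> Z" "\<And>k. \<bar>b k\<bar> \<le> Z"
proof -
  obtain B where "\<And>k. \<bar>b k\<bar> \<le> B" using reprD(2)[OF assms] by blast
  then show ?thesis by (intro that[of "max 1 B"]) (auto simp: le_max_iff_disj)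
qed

lemma kern_diff:
  assumes R: "fourier_symbol b E" and f: "f \<in> borel_measurable borel" "\<And>x. \<bar>f x\<bar> \<le> B1"
    and g: "g \<in> borel_measurable borel" "\<And>x. \<bar>g x\<bar> \<le> B2"
  shows "kern n E r (\<lambda>x. f x - g x) z = kern n E r f z - kern n E r g z"
  using kern_sum[OF R, of "UNIV::bool set" "\<lambda>i. if i then f else g" "\<lambda>i. if i then B1 else B2" n r "\<lambda>i. if i then 1 else -1" z] f g
  by (simp add: UNIV_bool)

text \<open>The parameter budget. The third condition on \<beta> is that of
  \<open>lattice_conv\<close> with \<delta> = 6 \<beta>; the fourth keeps the block variance R^(12 n
  \<beta>) below R^(-\<theta>/2). After weighting, 4 \<le> \<beta> m leaves a factor 2^-l once the
  2^l increments per unit time are summed, and 21 \<le> m (-\<theta>/2) leaves R^-1 once some R^20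
  grid points are summed.\<close>

locale wick_power = wiener_chaos M W n I + dyadic \<rho>m \<rho>0
  for M :: "'w measure" and W n I \<rho>m \<rho>0 +
  fixes \<theta> \<beta> :: real and m :: nat
  assumes n1: "1 \<le> n" and \<theta>: "\<theta> < 0" and \<beta>: "0 < \<beta>" "\<beta> \<le> 1" "(2 * real n - 1) * (6 * \<beta>) \<le> 4" "12 * real n * \<beta> \<le> - \<theta> / 2"
    and m0: "0 < m" and m1: "4 \<le> \<beta> * real m" and m2: "21 \<le> real m * (- \<theta> / 2)"
begin

abbreviation "wt \<equiv> 4 - (2 * real n - 1) * (6 * \<beta>)"

text \<open>The exponent \<open>wt\<close> equals 4 + 6 \<beta> - 12 n \<beta>: decay with exponent
  4 + 6 \<beta> is summable over the lattice, and the surplus 12 n \<beta> is paid at the largest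
  frequency of the polynomial.\<close>

lemma tpoly_G:
  obtains Cl where "0 < Cl" "\<And>d N Bd F. herm d \<Longrightarrow> 1 \<le> N \<Longrightarrow> 0 \<le> Bd \<Longrightarrow> (\<And>K. K \<in> ZB N \<Longrightarrow> norm (d K) \<le> Bd) \<Longrightarrow>
     finite F \<Longrightarrow> F \<subseteq> Z4 \<Longrightarrow> (\<Sum>K\<in>F. (norm (fourier (tpoly d N) K))^2 * bracket K powr - wt) \<le> Bd^2 * Cl * real N powr (12 * real n * \<beta>)"
proof -
  obtain C where C: "0 < C" "\<And>F. finite F \<Longrightarrow> F \<subseteq> Z4 \<Longrightarrow> (\<Sum>k\<in>F. bracket k powr - (4 + 6 * \<beta>)) \<le> C"
    using lattice_sum[of "6 * \<beta>"] \<beta>(1) by (metis mult_pos_pos zero_less_numeral)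
  let ?a = "12 * real n * \<beta>"
  have a0: "0 \<le> ?a" using \<beta>(1) by simp
  show ?thesis
  proof (rule that)
    show "0 < C * 4 powr ?a" using C by simp
    fix d N Bd and F :: "(real^4) set"
    assume d: "herm d" "1 \<le> N" "0 \<le> Bd" "\<And>K. K \<in> ZB N \<Longrightarrow> norm (d K) \<le> Bd" and F: "finite F" "F \<subseteq> Z4"
    have "(norm (fourier (tpoly d N) K))^2 * bracket K powr - wt \<le> Bd^2 * (4 * real N) powr ?a * bracket K powr - (4 + 6 * \<beta>)" if K: "K \<in> F" for K
    proof (cases "K \<in> ZB N")
      case False
      then show ?thesis using fourier_tpoly[OF d(1), of K N] K F by (simp add: subset_iff)
    next
      case True
      have "norm (fourier (tpoly d N) K) \<le> Bd" using fourier_tpoly[OF d(1), of K N] K F True d(4)[OF True] by (simp add: subset_iff)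
      then have 1: "(norm (fourier (tpoly d N) K))^2 \<le> Bd^2" by (intro power_mono) auto
      have "bracket K \<le> 4 * real N" using norm_ZB_le[OF True] d(2) by (simp add: bracket_def)
      then have 2: "bracket K powr ?a \<le> (4 * real N) powr ?a" using a0 by (intro powr_mono2) auto
      have "bracket K powr - wt = bracket K powr ?a * bracket K powr - (4 + 6 * \<beta>)"
        unfolding powr_add[symmetric] by (simp add: algebra_simps)
      also have "\<dots> \<le> (4 * real N) powr ?a * bracket K powr - (4 + 6 * \<beta>)" by (intro mult_right_mono 2) auto
      finally have "(norm (fourier (tpoly d N) K))^2 * bracket K powr - wt \<le> Bd^2 * ((4 * real N) powr ?a * bracket K powr - (4 + 6 * \<beta>))"
        by (intro mult_mono 1) auto
      then show ?thesis by (simp only: mult.assoc)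
    qed
    then have "(\<Sum>K\<in>F. (norm (fourier (tpoly d N) K))^2 * bracket K powr - wt) \<le> (\<Sum>K\<in>F. Bd^2 * (4 * real N) powr ?a * bracket K powr - (4 + 6 * \<beta>))"
      by (rule sum_mono)
    also have "\<dots> = Bd^2 * (4 * real N) powr ?a * (\<Sum>K\<in>F. bracket K powr - (4 + 6 * \<beta>))" by (rule sum_distrib_left[symmetric])
    also have "\<dots> \<le> Bd^2 * (4 * real N) powr ?a * C" by (intro mult_left_mono C F) auto
    also have "\<dots> = Bd^2 * (C * 4 powr ?a) * real N powr ?a" by (simp add: powr_mult)
    finally show "(\<Sum>K\<in>F. (norm (fourier (tpoly d N) K))^2 * bracket K powr - wt) \<le> Bd^2 * (C * 4 powr ?a) * real N powr ?a" .
  qed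
qed

lemma kern_sq:
  assumes R: "fourier_symbol b E" and U: "1 \<le> U"
  obtains C where "0 \<le> C" "\<And>\<phi> Bp G r. \<phi> \<in> borel_measurable borel \<Longrightarrow> (\<And>x. \<bar>\<phi> x\<bar> \<le> Bp) \<Longrightarrow>
     (\<And>F. finite F \<Longrightarrow> F \<subseteq> Z4 \<Longrightarrow> (\<Sum>K\<in>F. (norm (fourier \<phi> K))^2 * bracket K powr - wt) \<le> G) \<Longrightarrow> 0 \<le> r \<Longrightarrow> r \<le> U \<Longrightarrow>
     hypercontr (kern n E r \<phi>) \<and> (\<integral>z. (kern n E r \<phi> z)^2 \<partial>STn n) \<le> C * G"
proof -
  obtain Z where Z: "1 \<le> Z" "\<And>k. \<bar>b k\<bar> \<le> Z" by (rule fourier_symbol_bound[OF R]) blast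
  obtain C where C0: "0 < C" and C: "\<And>b b' E E' B \<phi> Bp r s G. fourier_symbol b E \<Longrightarrow> fourier_symbol b' E' \<Longrightarrow> \<phi> \<in> borel_measurable borel \<Longrightarrow> (\<And>x. \<bar>\<phi> x\<bar> \<le> Bp) \<Longrightarrow>
       (\<And>\<kappa>. \<kappa> \<in> Pi\<^sub>E {..<n} (\<lambda>_. Z4) \<Longrightarrow> \<bar>(\<Prod>m<n. b (\<kappa> m)) - (\<Prod>m<n. b' (\<kappa> m))\<bar> \<le> B * (\<Prod>m<n. bracket (\<kappa> m) powr \<beta>)) \<Longrightarrow>
       (\<And>F. finite F \<Longrightarrow> F \<subseteq> Z4 \<Longrightarrow> (\<Sum>K\<in>F. (norm (fourier \<phi> K))^2 * bracket K powr - wt) \<le> G) \<Longrightarrow>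
       0 \<le> s \<Longrightarrow> s \<le> r \<Longrightarrow> r \<le> U \<Longrightarrow>
       hypercontr (kern_incr n E E' r s \<phi>) \<and> (\<integral>z. (kern_incr n E E' r s \<phi> z)^2 \<partial>STn n) \<le> C * B^2 * (r - s) powr \<beta> * G"
    by (rule kern_incr_bound[OF n1 \<beta>(1-3) U]) blast
  show ?thesis
  proof (rule that)
    show "0 \<le> C * (Z ^ n)^2 * U powr \<beta>" using C0 by simp
    fix \<phi> Bp G r
    assume \<phi>: "\<phi> \<in> borel_measurable borel" "\<And>x. \<bar>\<phi> x\<bar> \<le> Bp"
      and G: "\<And>F. finite F \<Longrightarrow> F \<subseteq> Z4 \<Longrightarrow> (\<Sum>K\<in>F. (norm (fourier \<phi> K))^2 * bracket K powr - wt) \<le> G" and r: "0 \<le> r" "r \<le> U"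
    have eq: "kern_incr n E (\<lambda>_ _. 0) r 0 \<phi> = kern n E r \<phi>"
      using kern_zero[OF n1] kern_time_0[OF R n1] by (auto simp: kern_incr_def)
    have "hypercontr (kern_incr n E (\<lambda>_ _. 0) r 0 \<phi>) \<and> (\<integral>z. (kern_incr n E (\<lambda>_ _. 0) r 0 \<phi> z)^2 \<partial>STn n) \<le> C * (Z ^ n)^2 * (r - 0) powr \<beta> * G"
      by (rule C[OF R fourier_symbol_zero \<phi> mult_bound[of Z b n \<beta>, OF Z n1] G]) (use r \<beta> in auto)
    moreover have "C * (Z ^ n)^2 * (r - 0) powr \<beta> * G \<le> C * (Z ^ n)^2 * U powr \<beta> * G"
      using r \<beta> C0 G[of "{}"] by (intro mult_right_mono mult_left_mono powr_mono2) auto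
    ultimately show "hypercontr (kern n E r \<phi>) \<and> (\<integral>z. (kern n E r \<phi> z)^2 \<partial>STn n) \<le> C * (Z ^ n)^2 * U powr \<beta> * G"
      unfolding eq by auto
  qed
qed

lemma kern_hyp:
  assumes R: "fourier_symbol b E" and \<phi>: "\<phi> \<in> borel_measurable borel" "\<And>x. \<bar>\<phi> x\<bar> \<le> Bp"
    and G: "\<And>F. finite F \<Longrightarrow> F \<subseteq> Z4 \<Longrightarrow> (\<Sum>K\<in>F. (norm (fourier \<phi> K))^2 * bracket K powr - wt) \<le> G" and t: "0 \<le> t"
  shows "hypercontr (kern n E t \<phi>)"
proof -
  obtain C where "\<And>\<phi> Bp G r. \<phi> \<in> borel_measurable borel \<Longrightarrow> (\<And>x. \<bar>\<phi> x\<bar> \<le> Bp) \<Longrightarrow>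
     (\<And>F. finite F \<Longrightarrow> F \<subseteq> Z4 \<Longrightarrow> (\<Sum>K\<in>F. (norm (fourier \<phi> K))^2 * bracket K powr - wt) \<le> G) \<Longrightarrow> 0 \<le> r \<Longrightarrow> r \<le> max 1 t \<Longrightarrow>
     hypercontr (kern n E r \<phi>) \<and> (\<integral>z. (kern n E r \<phi> z)^2 \<partial>STn n) \<le> C * G"
    by (rule kern_sq[OF R, of "max 1 t"]) (simp, blast)
  note * = this[OF \<phi> G t]
  show ?thesis by (rule conjunct1[OF *]) auto
qed

lemma tpoly_hyp:
  assumes "fourier_symbol b E" "herm d" "0 \<le> t" shows "hypercontr (kern n E t (tpoly d N))"
proof -
  obtain Cl where Cl: "0 < Cl" "\<And>d N Bd F. herm d \<Longrightarrow> 1 \<le> N \<Longrightarrow> 0 \<le> Bd \<Longrightarrow> (\<And>K. K \<in> ZB N \<Longrightarrow> norm (d K) \<le> Bd) \<Longrightarrow>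
     finite F \<Longrightarrow> F \<subseteq> Z4 \<Longrightarrow> (\<Sum>K\<in>F. (norm (fourier (tpoly d N) K))^2 * bracket K powr - wt) \<le> Bd^2 * Cl * real N powr (12 * real n * \<beta>)"
    by (rule tpoly_G) blast
  \<comment> \<open>Values of d outside the cube do not enter \<open>tpoly d N\<close>; cutting them
    off gives one bound for all coefficients, and passing to a size of at least 1 meets the
    hypothesis of \<open>tpoly_G\<close>.\<close>
  define d' where "d' k = (if k \<in> ZB N then d k else 0)" for k
  have h: "herm d'" using assms(2) by (simp add: herm_def d'_def)
  have dk: "norm (d' K) \<le> (\<Sum>k\<in>ZB N. norm (d k))" for K
    by (cases "K \<in> ZB N") (auto simp: d'_def intro!: member_le_sum[where f="\<lambda>k. norm (d k)"] sum_nonneg)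
  have eq: "tpoly d N = tpoly d' (max 1 N)"
  proof
    fix x
    have "tpoly d N x = (\<Sum>\<kappa>\<in>modes N. mode_coeff d' \<kappa> * mode \<kappa> x)"
      unfolding tpoly_def by (intro sum.cong refl) (auto simp: mode_coeff_def d'_def modes_def)
    also have "\<dots> = tpoly d' (max 1 N) x"
      unfolding tpoly_def using modes_mono[of N "max 1 N"]
      by (intro sum.mono_neutral_left) (auto simp: mode_coeff_def d'_def modes_def)
    finally show "tpoly d N x = tpoly d' (max 1 N) x" .
  qed
  show ?thesis unfolding eq
    by (rule kern_hyp[OF assms(1) tpoly_borel tpoly_bound Cl(2)[OF h _ _ dk] assms(3)]) (auto intro: sum_nonneg)
qed

lemma mode_eq_tpoly: "\<kappa> \<in> modes N \<Longrightarrow> mode \<kappa> = tpoly (dmode \<kappa>) N"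
  using tpoly_dmode by (intro ext) simp

lemma modes_Z4: "\<kappa> \<in> modes N \<Longrightarrow> fst \<kappa> \<in> Z4" by (auto simp: modes_def dest: subsetD[OF ZB_Z4])

lemma mode_in_modes: "fst \<kappa> \<in> Z4 \<Longrightarrow> \<exists>N. \<kappa> \<in> modes N"
  using ZB_exhaust[of "fst \<kappa>"] by (cases \<kappa>) (auto simp: modes_def)

lemma mode_hyp: assumes "fourier_symbol b E" "fst \<kappa> \<in> Z4" "0 \<le> t" shows "hypercontr (kern n E t (mode \<kappa>))"
proof -
  obtain N where "\<kappa> \<in> modes N" using mode_in_modes[OF assms(2)] by blast
  then show ?thesis using tpoly_hyp[OF assms(1) herm_dmode assms(3)] by (simp add: mode_eq_tpoly)
qed

lemma hypercontr_L2: "hypercontr f \<Longrightarrow> L2 (STn n) f" by (simp add: hypercontr_def)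

text \<open>With E' = 0 this is almost surely the mode of the process itself, otherwise that of an
  approximation error. The chaining argument is carried out once, for this difference.\<close>

definition mode_diff :: "(real \<Rightarrow> real^4 \<Rightarrow> real) \<Rightarrow> (real \<Rightarrow> real^4 \<Rightarrow> real) \<Rightarrow> 'w \<Rightarrow> real \<Rightarrow> (real^4) \<times> bool \<Rightarrow> real" where
  "mode_diff E E' \<omega> t \<kappa> = I (kern n E t (mode \<kappa>)) \<omega> - I (kern n E' t (mode \<kappa>)) \<omega>"

lemma mode_diff_measurable:
  assumes "fourier_symbol b E" "fourier_symbol b' E'" "fst \<kappa> \<in> Z4" "0 \<le> t"
  shows "(\<lambda>\<omega>. mode_diff E E' \<omega> t \<kappa>) \<in> borel_measurable M"
  unfolding mode_diff_def
  by (intro borel_measurable_diff I_measurable hypercontr_L2 mode_hyp[OF assms(1,3,4)] mode_hyp[OF assms(2,3,4)])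

lemma mode_diff_time_0:
  assumes "fourier_symbol b E" "fourier_symbol b' E'" shows "mode_diff E E' \<omega> 0 \<kappa> = 0"
proof -
  have "kern n E 0 (mode \<kappa>) = (\<lambda>_. 0)" "kern n E' 0 (mode \<kappa>) = (\<lambda>_. 0)"
    using kern_time_0[OF assms(1) n1] kern_time_0[OF assms(2) n1] by auto
  then show ?thesis by (simp add: mode_diff_def)
qed

lemma kern_incr_mode_AE:
  assumes R: "fourier_symbol b E" "fourier_symbol b' E'" and \<kappa>: "fst \<kappa> \<in> Z4" and t: "0 \<le> r" "0 \<le> s"
  shows "L2 (STn n) (kern_incr n E E' r s (mode \<kappa>))"
    "AE \<omega> in M. I (kern_incr n E E' r s (mode \<kappa>)) \<omega> = mode_diff E E' \<omega> r \<kappa> - mode_diff E E' \<omega> s \<kappa>"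
proof -
  note L = mode_hyp[OF R(1) \<kappa> t(1), THEN hypercontr_L2] mode_hyp[OF R(2) \<kappa> t(1), THEN hypercontr_L2]
    mode_hyp[OF R(1) \<kappa> t(2), THEN hypercontr_L2] mode_hyp[OF R(2) \<kappa> t(2), THEN hypercontr_L2]
  note D = L2_diff[OF L(1,2)] L2_diff[OF L(3,4)]
  show "L2 (STn n) (kern_incr n E E' r s (mode \<kappa>))" unfolding kern_incr_def[abs_def] by (rule L2_diff[OF D])
  show "AE \<omega> in M. I (kern_incr n E E' r s (mode \<kappa>)) \<omega> = mode_diff E E' \<omega> r \<kappa> - mode_diff E E' \<omega> s \<kappa>"
    using I_diff[OF L(1,2)] I_diff[OF L(3,4)] I_diff[OF D] unfolding kern_incr_def[abs_def] mode_diff_def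
    by eventually_elim simp
qed

lemma kern_incr_tpoly:
  assumes "fourier_symbol b E" "fourier_symbol b' E'"
  shows "kern_incr n E E' r s (tpoly d N) = (\<lambda>z. \<Sum>\<kappa>\<in>modes N. mode_coeff d \<kappa> * kern_incr n E E' r s (mode \<kappa>) z)"
  unfolding kern_incr_def[abs_def] kern_tpoly[OF assms(1)] kern_tpoly[OF assms(2)]
  by (simp add: sum_subtractf[symmetric] right_diff_distrib)

lemma kern_incr_tpoly_AE:
  assumes R: "fourier_symbol b E" "fourier_symbol b' E'" and t: "0 \<le> r" "0 \<le> s"
  shows "AE \<omega> in M. I (kern_incr n E E' r s (tpoly d N)) \<omega> = (\<Sum>\<kappa>\<in>modes N. mode_coeff d \<kappa> * (mode_diff E E' \<omega> r \<kappa> - mode_diff E E' \<omega> s \<kappa>))"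
proof -
  have "AE \<omega> in M. I (\<lambda>z. \<Sum>\<kappa>\<in>modes N. mode_coeff d \<kappa> * kern_incr n E E' r s (mode \<kappa>) z) \<omega> = (\<Sum>\<kappa>\<in>modes N. mode_coeff d \<kappa> * I (kern_incr n E E' r s (mode \<kappa>)) \<omega>)"
    by (rule I_sum) (auto intro: kern_incr_mode_AE(1)[OF R modes_Z4 t])
  moreover have "AE \<omega> in M. \<forall>\<kappa>\<in>modes N. I (kern_incr n E E' r s (mode \<kappa>)) \<omega> = mode_diff E E' \<omega> r \<kappa> - mode_diff E E' \<omega> s \<kappa>"
    by (rule AE_finite_allI) (auto intro: kern_incr_mode_AE(2)[OF R modes_Z4 t])
  ultimately show ?thesis unfolding kern_incr_tpoly[OF R] by eventually_elim simp
qed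

text \<open>Hypercontractivity of order 2 m applied to the L^2 bound of
  \<open>kern_incr_bound\<close>. The constant is uniform over polynomials and times because the
  bound is going to be summed over all of them.\<close>

lemma incr_moment:
  assumes U: "1 \<le> U"
  obtains A where "0 < A"
   "\<And>b E b' E' B d N Bd r s. fourier_symbol b E \<Longrightarrow> fourier_symbol b' E' \<Longrightarrow> 0 < B \<Longrightarrow>
     (\<And>\<kappa>. \<kappa> \<in> Pi\<^sub>E {..<n} (\<lambda>_. Z4) \<Longrightarrow> \<bar>(\<Prod>m<n. b (\<kappa> m)) - (\<Prod>m<n. b' (\<kappa> m))\<bar> \<le> B * (\<Prod>m<n. bracket (\<kappa> m) powr \<beta>)) \<Longrightarrow>
     herm d \<Longrightarrow> 1 \<le> N \<Longrightarrow> 0 < Bd \<Longrightarrow> (\<And>K. K \<in> ZB N \<Longrightarrow> norm (d K) \<le> Bd) \<Longrightarrow> 0 \<le> s \<Longrightarrow> s < r \<Longrightarrow> r \<le> U \<Longrightarrow>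
     (\<integral>\<^sup>+\<omega>. ennreal ((I (kern_incr n E E' r s (tpoly d N)) \<omega>) ^ (2 * m)) \<partial>M) \<le> ennreal ((A * B^2 * (r - s) powr \<beta> * Bd^2 * real N powr (12 * real n * \<beta>)) ^ m)"
proof -
  obtain Cl where Cl: "0 < Cl" "\<And>d N Bd F. herm d \<Longrightarrow> 1 \<le> N \<Longrightarrow> 0 \<le> Bd \<Longrightarrow> (\<And>K. K \<in> ZB N \<Longrightarrow> norm (d K) \<le> Bd) \<Longrightarrow>
     finite F \<Longrightarrow> F \<subseteq> Z4 \<Longrightarrow> (\<Sum>K\<in>F. (norm (fourier (tpoly d N) K))^2 * bracket K powr - wt) \<le> Bd^2 * Cl * real N powr (12 * real n * \<beta>)"
    by (rule tpoly_G) blast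
  obtain C where C: "0 < C" "\<And>b b' E E' B \<phi> Bp r s G. fourier_symbol b E \<Longrightarrow> fourier_symbol b' E' \<Longrightarrow> \<phi> \<in> borel_measurable borel \<Longrightarrow> (\<And>x. \<bar>\<phi> x\<bar> \<le> Bp) \<Longrightarrow>
       (\<And>\<kappa>. \<kappa> \<in> Pi\<^sub>E {..<n} (\<lambda>_. Z4) \<Longrightarrow> \<bar>(\<Prod>m<n. b (\<kappa> m)) - (\<Prod>m<n. b' (\<kappa> m))\<bar> \<le> B * (\<Prod>m<n. bracket (\<kappa> m) powr \<beta>)) \<Longrightarrow>
       (\<And>F. finite F \<Longrightarrow> F \<subseteq> Z4 \<Longrightarrow> (\<Sum>K\<in>F. (norm (fourier \<phi> K))^2 * bracket K powr - wt) \<le> G) \<Longrightarrow>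
       0 \<le> s \<Longrightarrow> s \<le> r \<Longrightarrow> r \<le> U \<Longrightarrow>
       hypercontr (kern_incr n E E' r s \<phi>) \<and> (\<integral>z. (kern_incr n E E' r s \<phi> z)^2 \<partial>STn n) \<le> C * B^2 * (r - s) powr \<beta> * G"
    by (rule kern_incr_bound[OF n1 \<beta>(1-3) U]) blast
  let ?f = "fact n :: real"
  \<comment> \<open>The factor 2 provides the strict inequality that \<open>hypercontr\<close> asks
    for.\<close>
  let ?A = "Kbon m ^ n * (2 * ?f * C * Cl)"
  have Kb: "0 < Kbon m ^ n" using Kbon_ge_1[of m] by (intro zero_less_power) linarith
  show ?thesis
  proof (rule that)
    show "0 < ?A" using Kb C Cl by simp
    fix b E b' E' B d N Bd r s
    assume R: "fourier_symbol b E" "fourier_symbol b' E'" and B: "0 < B" "\<And>\<kappa>. \<kappa> \<in> Pi\<^sub>E {..<n} (\<lambda>_. Z4) \<Longrightarrow> \<bar>(\<Prod>m<n. b (\<kappa> m)) - (\<Prod>m<n. b' (\<kappa> m))\<bar> \<le> B * (\<Prod>m<n. bracket (\<kappa> m) powr \<beta>)"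
      and d: "herm d" "1 \<le> N" "0 < Bd" "\<And>K. K \<in> ZB N \<Longrightarrow> norm (d K) \<le> Bd" and s: "0 \<le> s" "s < r" "r \<le> U"
    define G where "G = Bd^2 * Cl * real N powr (12 * real n * \<beta>)"
    have G0: "0 < G" using Cl d by (simp add: G_def)
    define q where "q = C * B^2 * (r - s) powr \<beta> * G"
    have q0: "0 < q" using C B s G0 by (simp add: q_def)
    have "hypercontr (kern_incr n E E' r s (tpoly d N)) \<and> (\<integral>z. (kern_incr n E E' r s (tpoly d N) z)^2 \<partial>STn n) \<le> q"
      unfolding q_def by (rule C(2)[OF R tpoly_borel tpoly_bound B(2)]) (use Cl(2)[OF d(1,2) _ d(4)] d(3) s in \<open>auto simp: G_def\<close>)
    then have h: "hypercontr (kern_incr n E E' r s (tpoly d N))" "(\<integral>z. (kern_incr n E E' r s (tpoly d N) z)^2 \<partial>STn n) \<le> q" by auto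
    have "?f * (\<integral>z. (kern_incr n E E' r s (tpoly d N) z)^2 \<partial>STn n) \<le> ?f * q" by (intro mult_left_mono h(2)) auto
    also have "\<dots> < 2 * (?f * q)" using q0 by simp
    finally have "fact n * (\<integral>z. (kern_incr n E E' r s (tpoly d N) z)^2 \<partial>STn n) < 2 * (?f * q)" .
    then have "(\<integral>\<^sup>+\<omega>. ennreal ((I (kern_incr n E E' r s (tpoly d N)) \<omega>) ^ (2 * m)) \<partial>M) \<le> ennreal ((Kbon m ^ n * (2 * (?f * q))) ^ m)"
      using h(1) m0 unfolding hypercontr_def by blast
    also have "Kbon m ^ n * (2 * (?f * q)) = ?A * B^2 * (r - s) powr \<beta> * Bd^2 * real N powr (12 * real n * \<beta>)"
      by (simp add: q_def G_def mult_ac)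
    finally show "(\<integral>\<^sup>+\<omega>. ennreal ((I (kern_incr n E E' r s (tpoly d N)) \<omega>) ^ (2 * m)) \<partial>M) \<le> ennreal ((?A * B^2 * (r - s) powr \<beta> * Bd^2 * real N powr (12 * real n * \<beta>)) ^ m)" .
  qed
qed

text \<open>The weight asks for time regularity $\beta/4$ and for a growth of the blocks of order $R^{-\theta/2}$.\<close>

definition wgt :: "nat \<Rightarrow> nat \<Rightarrow> real" where
  "wgt l q = 2 powr (2 * real m * (\<beta> / 4) * real l) * real (RQ q) powr (- (2 * real m * (- \<theta> / 2)))"

definition chain_term :: "(real \<Rightarrow> (real^4) \<times> bool \<Rightarrow> real) \<Rightarrow> nat \<Rightarrow> nat \<Rightarrow> nat \<Rightarrow> ennreal" where
  "chain_term z l q j = (\<Sum>\<kappa>\<in>modes (RQ q). ennreal ((z (real (Suc j) / 2 ^ l) \<kappa> - z (real j / 2 ^ l) \<kappa>) ^ (2 * m)))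
     + (\<Sum>g\<in>Grid q. ennreal ((block q (\<lambda>\<kappa>. z (real (Suc j) / 2 ^ l) \<kappa> - z (real j / 2 ^ l) \<kappa>) g) ^ (2 * m)))"

definition chain_sum :: "nat \<Rightarrow> (real \<Rightarrow> (real^4) \<times> bool \<Rightarrow> real) \<Rightarrow> ennreal" where
  "chain_sum U z = (\<Sum>l. \<Sum>q. \<Sum>j<U * 2 ^ l. ennreal (wgt l q) * chain_term z l q j)"

lemma wgt_pos: "0 < wgt l q" using RQ_pos[of q] by (simp add: wgt_def)

lemma block_measurable:
  assumes "\<And>\<kappa>. \<kappa> \<in> modes (RQ q) \<Longrightarrow> (\<lambda>\<omega>. f \<omega> \<kappa>) \<in> borel_measurable M"
  shows "(\<lambda>\<omega>. block q (f \<omega>) g) \<in> borel_measurable M"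
  unfolding block_def by (intro borel_measurable_sum borel_measurable_times borel_measurable_const assms)

lemma chain_term_measurable:
  assumes "fourier_symbol b E" "fourier_symbol b' E'"
  shows "(\<lambda>\<omega>. chain_term (mode_diff E E' \<omega>) l q j) \<in> borel_measurable M"
  unfolding chain_term_def
  by (intro borel_measurable_add borel_measurable_sum measurable_compose[OF _ measurable_ennreal] borel_measurable_power
    borel_measurable_diff block_measurable mode_diff_measurable[OF assms] modes_Z4) auto

lemma chain_sum_measurable:
  assumes "fourier_symbol b E" "fourier_symbol b' E'"
  shows "(\<lambda>\<omega>. chain_sum U (mode_diff E E' \<omega>)) \<in> borel_measurable M"
  unfolding chain_sum_def
  by (intro borel_measurable_suminf_order borel_measurable_sum borel_measurable_times_ennreal borel_measurable_const chain_term_measurable[OF assms])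

text \<open>Expectations are taken term by term; moments, weights and numbers of terms combine to
  geometric series in l and q. The multiplier size B survives as the factor (B^2)^m, which later
  makes the sum small.\<close>

lemma chain_sum_expectation:
  assumes U: "1 \<le> U"
  obtains Q where "0 < Q"
   "\<And>b E b' E' B. fourier_symbol b E \<Longrightarrow> fourier_symbol b' E' \<Longrightarrow> 0 < B \<Longrightarrow>
     (\<And>\<kappa>. \<kappa> \<in> Pi\<^sub>E {..<n} (\<lambda>_. Z4) \<Longrightarrow> \<bar>(\<Prod>m<n. b (\<kappa> m)) - (\<Prod>m<n. b' (\<kappa> m))\<bar> \<le> B * (\<Prod>m<n. bracket (\<kappa> m) powr \<beta>)) \<Longrightarrow>
     (\<integral>\<^sup>+\<omega>. chain_sum U (mode_diff E E' \<omega>) \<partial>M) \<le> ennreal (Q * (B^2) ^ m)"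
proof -
  have U1: "1 \<le> real U" using U by simp
  obtain A where A: "0 < A"
   "\<And>b E b' E' B d N Bd r s. fourier_symbol b E \<Longrightarrow> fourier_symbol b' E' \<Longrightarrow> 0 < B \<Longrightarrow>
     (\<And>\<kappa>. \<kappa> \<in> Pi\<^sub>E {..<n} (\<lambda>_. Z4) \<Longrightarrow> \<bar>(\<Prod>m<n. b (\<kappa> m)) - (\<Prod>m<n. b' (\<kappa> m))\<bar> \<le> B * (\<Prod>m<n. bracket (\<kappa> m) powr \<beta>)) \<Longrightarrow>
     herm d \<Longrightarrow> 1 \<le> N \<Longrightarrow> 0 < Bd \<Longrightarrow> (\<And>K. K \<in> ZB N \<Longrightarrow> norm (d K) \<le> Bd) \<Longrightarrow> 0 \<le> s \<Longrightarrow> s < r \<Longrightarrow> r \<le> real U \<Longrightarrow>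
     (\<integral>\<^sup>+\<omega>. ennreal ((I (kern_incr n E E' r s (tpoly d N)) \<omega>) ^ (2 * m)) \<partial>M) \<le> ennreal ((A * B^2 * (r - s) powr \<beta> * Bd^2 * real N powr (12 * real n * \<beta>)) ^ m)"
    by (rule incr_moment[OF U1]) blast
  obtain Br where Br: "1 \<le> Br" "\<And>q k. \<bar>rq q k\<bar> \<le> Br" using rq_bounded by blast
  let ?Q0 = "A * Br^2"
  have Q0: "0 < ?Q0" using A Br by simp
  show ?thesis
  proof (rule that)
    \<comment> \<open>163 = 2 * 81 + 1 counts modes and grid points in units of R^20; the 2 is the
      sum of the geometric series in l, that in q summing to 1.\<close>
    show "0 < real U * 163 * 2 * ?Q0 ^ m" using Q0 U by simp
    fix b E b' E' B
    assume R: "fourier_symbol b E" "fourier_symbol b' E'" and B: "0 < B" "\<And>\<kappa>. \<kappa> \<in> Pi\<^sub>E {..<n} (\<lambda>_. Z4) \<Longrightarrow> \<bar>(\<Prod>m<n. b (\<kappa> m)) - (\<Prod>m<n. b' (\<kappa> m))\<bar> \<le> B * (\<Prod>m<n. bracket (\<kappa> m) powr \<beta>)"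
    let ?z = "\<lambda>\<omega>. mode_diff E E' \<omega>"
    let ?R = "\<lambda>q. real (RQ q)"
    define X where "X l q = (A * B^2 * (1 / 2 ^ l) powr \<beta> * Br^2 * ?R q powr (12 * real n * \<beta>)) ^ m" for l q :: nat
    have X0: "0 \<le> X l q" for l q unfolding X_def using A by simp
    have R1: "1 \<le> ?R q" for q using RQ_pos[of q] by simp
    have tm: "(\<integral>\<^sup>+\<omega>. chain_term (?z \<omega>) l q j \<partial>M) \<le> ennreal (163 * ?R q ^ 20 * X l q)" if j: "j < U * 2 ^ l" for l q j
    proof -
      let ?r = "real (Suc j) / 2 ^ l" and ?s = "real j / 2 ^ l"
      have "real (Suc j) \<le> real (U * 2 ^ l)" using j by linarith
      then have rs: "0 \<le> ?s" "?s < ?r" "?r \<le> real U" "?r - ?s = 1 / 2 ^ l"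
        by (auto simp: divide_simps diff_divide_distrib[symmetric])
      have r0: "0 \<le> ?r" by simp
      have mom: "(\<integral>\<^sup>+\<omega>. ennreal ((I (kern_incr n E E' ?r ?s (tpoly d (RQ q))) \<omega>) ^ (2 * m)) \<partial>M) \<le> ennreal (X l q)"
        if "herm d" "\<And>K. norm (d K) \<le> Br" for d
        using A(2)[OF R B that(1) RQ_pos, of Br q ?s ?r] that Br(1) rs unfolding X_def rs(4) by simp
      have k1: "(\<integral>\<^sup>+\<omega>. ennreal ((?z \<omega> ?r \<kappa> - ?z \<omega> ?s \<kappa>) ^ (2 * m)) \<partial>M) \<le> ennreal (X l q)" if \<kappa>: "\<kappa> \<in> modes (RQ q)" for \<kappa>
      proof -
        have "(\<integral>\<^sup>+\<omega>. ennreal ((?z \<omega> ?r \<kappa> - ?z \<omega> ?s \<kappa>) ^ (2 * m)) \<partial>M) = (\<integral>\<^sup>+\<omega>. ennreal ((I (kern_incr n E E' ?r ?s (mode \<kappa>)) \<omega>) ^ (2 * m)) \<partial>M)"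
          by (rule nn_integral_cong_AE, rule eventually_mono[OF kern_incr_mode_AE(2)[OF R modes_Z4[OF \<kappa>] r0 rs(1)]]) simp
        also have "\<dots> \<le> ennreal (X l q)"
          unfolding mode_eq_tpoly[OF \<kappa>] using norm_dmode_le Br(1) by (intro mom herm_dmode) (metis order_trans)
        finally show ?thesis .
      qed
      have k2: "(\<integral>\<^sup>+\<omega>. ennreal ((block q (\<lambda>\<kappa>. ?z \<omega> ?r \<kappa> - ?z \<omega> ?s \<kappa>) g) ^ (2 * m)) \<partial>M) \<le> ennreal (X l q)" for g
      proof -
        have "(\<integral>\<^sup>+\<omega>. ennreal ((block q (\<lambda>\<kappa>. ?z \<omega> ?r \<kappa> - ?z \<omega> ?s \<kappa>) g) ^ (2 * m)) \<partial>M) = (\<integral>\<^sup>+\<omega>. ennreal ((I (kern_incr n E E' ?r ?s (tpoly (dq q g) (RQ q))) \<omega>) ^ (2 * m)) \<partial>M)"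
          by (rule nn_integral_cong_AE, rule eventually_mono[OF kern_incr_tpoly_AE[OF R r0 rs(1), of "dq q g" "RQ q"]]) (simp add: block_def)
        also have "\<dots> \<le> ennreal (X l q)"
          using Br(2) by (intro mom herm_dq) (simp add: dq_def norm_mult)
        finally show ?thesis .
      qed
      have zm: "(\<lambda>\<omega>. ?z \<omega> t \<kappa>) \<in> borel_measurable M" if "\<kappa> \<in> modes (RQ q)" "0 \<le> t" for \<kappa> t
        by (rule mode_diff_measurable[OF R modes_Z4[OF that(1)] that(2)])
      have mz: "(\<lambda>\<omega>. ennreal ((?z \<omega> ?r \<kappa> - ?z \<omega> ?s \<kappa>) ^ (2 * m))) \<in> borel_measurable M" if "\<kappa> \<in> modes (RQ q)" for \<kappa>
        by (intro measurable_compose[OF _ measurable_ennreal] borel_measurable_power borel_measurable_diff zm that r0 rs(1))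
      have mD: "(\<lambda>\<omega>. ennreal ((block q (\<lambda>\<kappa>. ?z \<omega> ?r \<kappa> - ?z \<omega> ?s \<kappa>) g) ^ (2 * m))) \<in> borel_measurable M" for g
        by (intro measurable_compose[OF _ measurable_ennreal] borel_measurable_power block_measurable borel_measurable_diff zm r0 rs(1))
      have "(\<integral>\<^sup>+\<omega>. chain_term (?z \<omega>) l q j \<partial>M) = (\<Sum>\<kappa>\<in>modes (RQ q). \<integral>\<^sup>+\<omega>. ennreal ((?z \<omega> ?r \<kappa> - ?z \<omega> ?s \<kappa>) ^ (2 * m)) \<partial>M)
        + (\<Sum>g\<in>Grid q. \<integral>\<^sup>+\<omega>. ennreal ((block q (\<lambda>\<kappa>. ?z \<omega> ?r \<kappa> - ?z \<omega> ?s \<kappa>) g) ^ (2 * m)) \<partial>M)"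
        unfolding chain_term_def
        by (simp only: nn_integral_add[OF borel_measurable_sum[OF mz] borel_measurable_sum[OF mD]] nn_integral_sum[OF mz] nn_integral_sum[OF mD])
      also have "\<dots> \<le> (\<Sum>\<kappa>\<in>modes (RQ q). ennreal (X l q)) + (\<Sum>g\<in>Grid q. ennreal (X l q))"
        by (intro add_mono sum_mono k1 k2)
      also have "\<dots> = ennreal ((real (card (modes (RQ q))) + real (card (Grid q))) * X l q)"
        using X0[of l q] by (simp add: ennreal_of_nat_eq_real_of_nat ennreal_mult[symmetric] ennreal_plus[symmetric] distrib_right del: ennreal_plus)
      also have "\<dots> \<le> ennreal (163 * ?R q ^ 20 * X l q)"
      proof (intro ennreal_leI mult_right_mono X0)
        have "real (card (modes (RQ q))) = 2 * real (card (ZB (RQ q)))" by (simp add: modes_def card_cartesian_product)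
        also have "\<dots> \<le> 2 * (2 * ?R q + 1) ^ 4" using card_ZB_le[of "RQ q"] by simp
        also have "\<dots> \<le> 2 * (3 * ?R q) ^ 4" using R1[of q] by (intro mult_left_mono power_mono) auto
        also have "\<dots> = 162 * ?R q ^ 4" by (simp add: power_mult_distrib)
        also have "\<dots> \<le> 162 * ?R q ^ 20" using R1[of q] by (intro mult_left_mono power_increasing) auto
        finally have "real (card (modes (RQ q))) \<le> 162 * ?R q ^ 20" .
        moreover have "real (card (Grid q)) \<le> ?R q ^ 20" using card_Grid[of q] by (metis of_nat_le_iff of_nat_power)
        ultimately show "real (card (modes (RQ q))) + real (card (Grid q)) \<le> 163 * ?R q ^ 20" by linarith
      qed
      finally show ?thesis .
    qed
    let ?P = "real U * 163 * (?Q0 * B^2) ^ m"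
    have P0: "0 \<le> ?P" using A(1) by simp
    have arith: "real (U * 2 ^ l) * (wgt l q * (163 * ?R q ^ 20 * X l q)) \<le> ?P * (1 / 2) ^ l * (1 / 2) ^ Suc q" for l q
    proof -
      have Xe: "X l q = (?Q0 * B^2) ^ m * (2 powr (- \<beta> * real m * real l) * ?R q powr (12 * real n * \<beta> * real m))"
      proof -
        have a1: "((1 / 2 ^ l) powr \<beta>) ^ m = 2 powr (- \<beta> * real m * real l)"
        proof -
          have "(1 / 2 ^ l :: real) = 2 powr (- real l)" by (simp add: powr_minus powr_realpow divide_inverse)
          then have "((1 / 2 ^ l :: real) powr \<beta>) ^ m = (2 powr (- real l * \<beta>)) ^ m" by (simp only: powr_powr)
          also have "\<dots> = 2 powr (- real l * \<beta> * real m)" by (subst powr_power) (auto simp: mult_ac)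
          also have "- real l * \<beta> * real m = - \<beta> * real m * real l" by simp
          finally show ?thesis .
        qed
        have a2: "(?R q powr (12 * real n * \<beta>)) ^ m = ?R q powr (12 * real n * \<beta> * real m)"
          using R1[of q] by (subst powr_power) (auto simp: mult_ac)
        show ?thesis unfolding X_def power_mult_distrib a1 a2 by (simp only: mult_ac)
      qed
      \<comment> \<open>Number of increments, weight and moment together have exponent l (1 -
        \<beta> m / 2), at most -l by \<open>m1\<close>.\<close>
      have e1: "2 ^ l * (2 powr (2 * real m * (\<beta> / 4) * real l) * 2 powr (- \<beta> * real m * real l)) \<le> (1 / 2) ^ l"
      proof -
        have "2 ^ l * (2 powr (2 * real m * (\<beta> / 4) * real l) * 2 powr (- \<beta> * real m * real l)) = 2 powr (real l + (2 * real m * (\<beta> / 4) * real l + - \<beta> * real m * real l))"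
          by (simp only: powr_add powr_realpow zero_less_numeral)
        also have "\<dots> \<le> 2 powr (- real l)"
        proof (rule powr_mono)
          have "4 * real l \<le> \<beta> * real m * real l" using m1 by (intro mult_right_mono) auto
          then show "real l + (2 * real m * (\<beta> / 4) * real l + - \<beta> * real m * real l) \<le> - real l" by (simp add: algebra_simps)
        qed simp
        also have "\<dots> = (1 / 2) ^ l" by (simp add: powr_minus_divide powr_realpow power_one_over)
        finally show ?thesis .
      qed
      \<comment> \<open>The variance uses up at most half of the weight exponent 2 m (-\<theta>/2);
        by \<open>m2\<close> the other half exceeds the 20 from the grid by at least one.\<close>
      have e2: "?R q ^ 20 * (?R q powr (- (2 * real m * (- \<theta> / 2))) * ?R q powr (12 * real n * \<beta> * real m)) \<le> (1 / 2) ^ Suc q"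
      proof -
        have "?R q ^ 20 = ?R q powr 20" using R1[of q] powr_realpow[of "?R q" 20] by simp
        then have "?R q ^ 20 * (?R q powr (- (2 * real m * (- \<theta> / 2))) * ?R q powr (12 * real n * \<beta> * real m)) = ?R q powr (20 + (- (2 * real m * (- \<theta> / 2)) + 12 * real n * \<beta> * real m))"
          by (simp only: powr_add)
        also have "\<dots> \<le> ?R q powr (- 1)"
        proof (rule powr_mono)
          have "12 * real n * \<beta> * real m \<le> (- \<theta> / 2) * real m" using \<beta>(4) by (intro mult_right_mono) auto
          then show "20 + (- (2 * real m * (- \<theta> / 2)) + 12 * real n * \<beta> * real m) \<le> - 1"
            using m2 by (simp add: algebra_simps)
        qed (rule R1)
        also have "\<dots> = (1 / 2) ^ Suc q" by (simp add: powr_minus_divide RQ_def power_one_over)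
        finally show ?thesis .
      qed
      have "real (U * 2 ^ l) * (wgt l q * (163 * ?R q ^ 20 * X l q))
        = ?P * (2 ^ l * (2 powr (2 * real m * (\<beta> / 4) * real l) * 2 powr (- \<beta> * real m * real l)))
           * (?R q ^ 20 * (?R q powr (- (2 * real m * (- \<theta> / 2))) * ?R q powr (12 * real n * \<beta> * real m)))"
        unfolding wgt_def Xe of_nat_mult of_nat_power of_nat_numeral by (simp only: mult_ac)
      also have "\<dots> \<le> ?P * (1 / 2) ^ l * (1 / 2) ^ Suc q"
        by (rule mult_mono[OF mult_left_mono[OF e1 P0] e2 mult_nonneg_nonneg[OF P0]]) (rule zero_le_power, simp, intro mult_nonneg_nonneg, simp_all)
      finally show ?thesis .
    qed
    have SSm: "(\<lambda>\<omega>. chain_term (?z \<omega>) l q j) \<in> borel_measurable M" for l q j by (rule chain_term_measurable[OF R])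
    have M0: "(\<lambda>\<omega>. ennreal (wgt l q) * chain_term (?z \<omega>) l q j) \<in> borel_measurable M" for l q j
      by (intro borel_measurable_times_ennreal borel_measurable_const SSm)
    have M1: "(\<lambda>\<omega>. \<Sum>j<U * 2 ^ l. ennreal (wgt l q) * chain_term (?z \<omega>) l q j) \<in> borel_measurable M" for l q
      by (intro borel_measurable_sum M0)
    have "(\<integral>\<^sup>+\<omega>. chain_sum U (?z \<omega>) \<partial>M) = (\<Sum>l. \<Sum>q. \<Sum>j<U * 2 ^ l. ennreal (wgt l q) * (\<integral>\<^sup>+\<omega>. chain_term (?z \<omega>) l q j \<partial>M))"
      unfolding chain_sum_def
      by (simp only: nn_integral_suminf[OF borel_measurable_suminf_order[OF M1]] nn_integral_suminf[OF M1] nn_integral_sum[OF M0] nn_integral_cmult[OF SSm])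
    also have "\<dots> \<le> (\<Sum>l. \<Sum>q. ennreal (?P * (1 / 2) ^ l * (1 / 2) ^ Suc q))"
    proof (intro suminf_le allI summableI)
      fix l q
      have "(\<Sum>j<U * 2 ^ l. ennreal (wgt l q) * (\<integral>\<^sup>+\<omega>. chain_term (?z \<omega>) l q j \<partial>M)) \<le> (\<Sum>j<U * 2 ^ l. ennreal (wgt l q) * ennreal (163 * ?R q ^ 20 * X l q))"
        by (intro sum_mono mult_left_mono tm) auto
      also have "\<dots> = ennreal (real (U * 2 ^ l) * (wgt l q * (163 * ?R q ^ 20 * X l q)))"
      proof -
        have nn: "0 \<le> wgt l q" "0 \<le> 163 * ?R q ^ 20 * X l q" using wgt_pos[of l q] X0[of l q] by auto
        have "(\<Sum>j<U * 2 ^ l. ennreal (wgt l q) * ennreal (163 * ?R q ^ 20 * X l q)) = ennreal (real (U * 2 ^ l)) * ennreal (wgt l q * (163 * ?R q ^ 20 * X l q))"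
          unfolding ennreal_mult[OF nn, symmetric] sum_constant card_lessThan by (simp add: ennreal_of_nat_eq_real_of_nat)
        also have "\<dots> = ennreal (real (U * 2 ^ l) * (wgt l q * (163 * ?R q ^ 20 * X l q)))"
          by (rule ennreal_mult[symmetric]) (use nn in auto)
        finally show ?thesis .
      qed
      also have "\<dots> \<le> ennreal (?P * (1 / 2) ^ l * (1 / 2) ^ Suc q)" by (rule ennreal_leI[OF arith])
      finally show "(\<Sum>j<U * 2 ^ l. ennreal (wgt l q) * (\<integral>\<^sup>+\<omega>. chain_term (?z \<omega>) l q j \<partial>M)) \<le> ennreal (?P * (1 / 2) ^ l * (1 / 2) ^ Suc q)" .
    qed
    also have "\<dots> = (\<Sum>l. ennreal (?P * (1 / 2) ^ l))"
    proof (intro arg_cong[where f=suminf] ext)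
      fix l
      have "(\<lambda>q. ?P * (1 / 2) ^ l * (1 / 2) ^ Suc q) sums (?P * (1 / 2) ^ l * 1)" by (intro sums_mult power_half_series)
      then show "(\<Sum>q. ennreal (?P * (1 / 2) ^ l * (1 / 2) ^ Suc q)) = ennreal (?P * (1 / 2) ^ l)"
        using P0 by (subst suminf_ennreal_eq[where x="?P * (1 / 2) ^ l"]) auto
    qed
    also have "\<dots> = ennreal (?P * 2)"
    proof (rule suminf_ennreal_eq)
      show "(\<lambda>l. ?P * (1 / 2) ^ l) sums (?P * 2)" using geometric_sums[of "1 / 2 :: real"] by (intro sums_mult) simp
    qed (use P0 in auto)
    also have "?P * 2 = real U * 163 * 2 * ?Q0 ^ m * (B^2) ^ m" by (simp add: power_mult_distrib)
    finally show "(\<integral>\<^sup>+\<omega>. chain_sum U (?z \<omega>) \<partial>M) \<le> ennreal (real U * 163 * 2 * ?Q0 ^ m * (B^2) ^ m)" .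
  qed
qed

end

context wick_power
begin

section \<open>Paths\<close>

text \<open>A single term never exceeds the whole sum. Its weight is a 2 m-th power, so taking roots
  yields a Hoelder bound for this one increment.\<close>

lemma chain_term_coord:
  assumes S: "chain_sum U z \<le> ennreal (K ^ (2 * m))" and K: "0 \<le> K" and j: "j < U * 2 ^ l"
    and d: "ennreal (d ^ (2 * m)) \<le> chain_term z l q j"
  shows "\<bar>d\<bar> \<le> K * real (RQ q) powr (- \<theta> / 2) * 2 powr (- (\<beta> / 4) * real l)"
proof -
  let ?R = "real (RQ q)"
  let ?w = "2 powr ((\<beta> / 4) * real l) * ?R powr (- (- \<theta> / 2))"
  have R: "0 < ?R" using RQ_pos[of q] by simp
  have w: "0 < ?w" using R by simp
  have we: "wgt l q = ?w ^ (2 * m)"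
  proof -
    have "(2 powr ((\<beta> / 4) * real l)) ^ (2 * m) = 2 powr (((\<beta> / 4) * real l) * real (2 * m))" by (subst powr_power) (auto simp: mult_ac)
    moreover have "(?R powr (- (- \<theta> / 2))) ^ (2 * m) = ?R powr ((- (- \<theta> / 2)) * real (2 * m))" by (subst powr_power) (use R in \<open>auto simp: mult_ac\<close>)
    moreover have "((\<beta> / 4) * real l) * real (2 * m) = 2 * real m * (\<beta> / 4) * real l" "(- (- \<theta> / 2)) * real (2 * m) = - (2 * real m * (- \<theta> / 2))" by auto
    ultimately show ?thesis unfolding wgt_def power_mult_distrib by (simp only:)
  qed
  let ?g = "\<lambda>l q. \<Sum>j<U * 2 ^ l. ennreal (wgt l q) * chain_term z l q j"
  have "ennreal (wgt l q * d ^ (2 * m)) = ennreal (wgt l q) * ennreal (d ^ (2 * m))"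
    by (rule ennreal_mult) (use wgt_pos[of l q] in auto)
  also have "\<dots> \<le> ennreal (wgt l q) * chain_term z l q j" by (intro mult_left_mono d) auto
  also have "\<dots> \<le> ?g l q" using j by (intro member_le_sum) auto
  also have "\<dots> \<le> (\<Sum>q. ?g l q)" using sum_le_suminf[OF summableI, of "{q}" "?g l"] by simp
  also have "\<dots> \<le> chain_sum U z" unfolding chain_sum_def using sum_le_suminf[OF summableI, of "{l}" "\<lambda>l. \<Sum>q. ?g l q"] by simp
  also have "\<dots> \<le> ennreal (K ^ (2 * m))" by (rule S)
  finally have "(?w * \<bar>d\<bar>) ^ (2 * m) \<le> K ^ (2 * m)"
    using K by (simp add: we power_mult_distrib power_even_abs)
  then have "?w * \<bar>d\<bar> \<le> K" using K w m0 by (subst (asm) power_mono_iff) auto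
  then have "\<bar>d\<bar> \<le> K / ?w" using w by (simp add: pos_le_divide_eq mult.commute)
  also have "\<dots> = K * ?R powr (- \<theta> / 2) * 2 powr (- (\<beta> / 4) * real l)"
    by (simp add: powr_minus_divide)
  finally show ?thesis .
qed

lemma block_diff: "block q (\<lambda>\<kappa>. a \<kappa> - b \<kappa>) x = block q a x - block q b x"
  by (simp add: block_def right_diff_distrib sum_subtractf)

text \<open>\<open>lim\<close> is total, so this is defined for every path and measurable in
  \<omega> whenever the dyadic values are.\<close>

definition dyad_lim :: "(real \<Rightarrow> (real^4) \<times> bool \<Rightarrow> real) \<Rightarrow> real \<Rightarrow> (real^4) \<times> bool \<Rightarrow> real" where
  "dyad_lim z t \<kappa> = lim (\<lambda>l. z (dyad l t) \<kappa>)"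

text \<open>The first clause makes the modes grow polynomially, hence define a distribution; the
  second gives membership in \<open>Calpha\<close>; the third is Hoelder continuity in time, stated
  at dyadic scales as chaining delivers it.\<close>

definition mode_reg :: "nat \<Rightarrow> real \<Rightarrow> (real \<Rightarrow> (real^4) \<times> bool \<Rightarrow> real) \<Rightarrow> bool" where
  "mode_reg U L a \<longleftrightarrow>
    (\<forall>q t \<kappa>. \<kappa> \<in> modes (RQ q) \<longrightarrow> 0 \<le> t \<longrightarrow> t \<le> real U \<longrightarrow> \<bar>a t \<kappa>\<bar> \<le> L * real (RQ q) powr (- \<theta> / 2)) \<and>
    (\<forall>q t x. 0 \<le> t \<longrightarrow> t \<le> real U \<longrightarrow> \<bar>block q (a t) x\<bar> \<le> L * real (RQ q) powr (- \<theta> / 2)) \<and>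
    (\<forall>q s t l x. 0 \<le> s \<longrightarrow> s \<le> t \<longrightarrow> t \<le> real U \<longrightarrow> t - s \<le> 1 / 2 ^ l \<longrightarrow>
       \<bar>block q (a t) x - block q (a s) x\<bar> \<le> L * 2 powr (- (\<beta> / 4) * real l) * real (RQ q) powr (- \<theta> / 2))"

text \<open>Scalar chaining is applied to each mode and to each block at each grid point;
  \<open>block_sup\<close> passes from the grid to all x. Blocks of the limit are limits of blocks
  because a block is a finite sum of modes.\<close>

lemma chaining_path:
  obtains CC where "0 < CC"
    "\<And>z K. chain_sum U z \<le> ennreal (K ^ (2 * m)) \<Longrightarrow> 0 \<le> K \<Longrightarrow> (\<And>\<kappa>. z 0 \<kappa> = 0) \<Longrightarrow>
       (\<forall>t \<kappa>. fst \<kappa> \<in> Z4 \<longrightarrow> 0 \<le> t \<longrightarrow> t \<le> real U \<longrightarrow> (\<lambda>l. z (dyad l t) \<kappa>) \<longlonglongrightarrow> dyad_lim z t \<kappa>) \<and> mode_reg U (CC * K) (dyad_lim z)"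
proof -
  obtain C where C: "1 \<le> C" "\<And>q A K x. 0 \<le> K \<Longrightarrow> (\<And>\<kappa>. \<kappa> \<in> modes (RQ q) \<Longrightarrow> \<bar>A \<kappa>\<bar> \<le> K) \<Longrightarrow> (\<And>g. g \<in> Grid q \<Longrightarrow> \<bar>block q A g\<bar> \<le> K) \<Longrightarrow> \<bar>block q A x\<bar> \<le> C * K"
    by (rule block_sup) blast
  let ?\<gamma> = "\<beta> / 4"
  define cg where "cg = 1 / (1 - 2 powr - ?\<gamma>)"
  have \<gamma>: "0 < ?\<gamma>" using \<beta>(1) by simp
  then have "2 powr - ?\<gamma> < (1::real)" using powr_less_mono[of "- ?\<gamma>" 0 2] by simp
  then have cg: "0 < cg" by (simp add: cg_def)
  \<comment> \<open>One constant above both constants of \<open>chaining\<close>.\<close>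
  define H where "H = real U + 1 + 2 * cg"
  have H: "real U + cg \<le> H" "1 + 2 * cg \<le> H" "0 < H" using cg by (auto simp: H_def)
  show ?thesis
  proof (rule that)
    show "0 < C * H" using C(1) H(3) by simp
    fix z K assume S: "chain_sum U z \<le> ennreal (K ^ (2 * m))" and K: "0 \<le> K" and z0: "\<And>\<kappa>. z 0 \<kappa> = 0"
    let ?R = "\<lambda>q. real (RQ q) powr (- \<theta> / 2)"
    have R0: "0 \<le> K * ?R q" for q using K by simp
    have inc: "\<bar>z (real (Suc j) / 2 ^ l) \<kappa> - z (real j / 2 ^ l) \<kappa>\<bar> \<le> K * ?R q * 2 powr (- ?\<gamma> * real l)"
      if "\<kappa> \<in> modes (RQ q)" "j < U * 2 ^ l" for q \<kappa> l j
    proof (rule chain_term_coord[OF S K that(2)])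
      have "ennreal ((z (real (Suc j) / 2 ^ l) \<kappa> - z (real j / 2 ^ l) \<kappa>) ^ (2 * m)) \<le> (\<Sum>\<kappa>\<in>modes (RQ q). ennreal ((z (real (Suc j) / 2 ^ l) \<kappa> - z (real j / 2 ^ l) \<kappa>) ^ (2 * m)))"
        using that(1) by (intro member_le_sum[where f="\<lambda>\<kappa>. ennreal ((z (real (Suc j) / 2 ^ l) \<kappa> - z (real j / 2 ^ l) \<kappa>) ^ (2 * m))"]) auto
      then show "ennreal ((z (real (Suc j) / 2 ^ l) \<kappa> - z (real j / 2 ^ l) \<kappa>) ^ (2 * m)) \<le> chain_term z l q j"
        unfolding chain_term_def by (rule order_trans) simp
    qed
    have incD: "\<bar>block q (z (real (Suc j) / 2 ^ l)) g - block q (z (real j / 2 ^ l)) g\<bar> \<le> K * ?R q * 2 powr (- ?\<gamma> * real l)"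
      if "g \<in> Grid q" "j < U * 2 ^ l" for q g l j
    proof (rule chain_term_coord[OF S K that(2)])
      let ?D = "\<lambda>g. ennreal ((block q (\<lambda>\<kappa>. z (real (Suc j) / 2 ^ l) \<kappa> - z (real j / 2 ^ l) \<kappa>) g) ^ (2 * m))"
      have "?D g \<le> (\<Sum>g\<in>Grid q. ?D g)" using that(1) by (intro member_le_sum[where f="?D"]) auto
      also have "\<dots> \<le> chain_term z l q j" unfolding chain_term_def by simp
      finally show "ennreal ((block q (z (real (Suc j) / 2 ^ l)) g - block q (z (real j / 2 ^ l)) g) ^ (2 * m)) \<le> chain_term z l q j"
        unfolding block_diff .
    qed
    note ch = chaining[where \<gamma>="?\<gamma>" and U=U, OF \<gamma> R0, folded cg_def]
    have conv: "(\<lambda>l. z (dyad l t) \<kappa>) \<longlonglongrightarrow> dyad_lim z t \<kappa>" if "\<kappa> \<in> modes (RQ q)" "0 \<le> t" "t \<le> real U" for q t \<kappa>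
      unfolding dyad_lim_def by (rule ch(1)[where y="\<lambda>t. z t \<kappa>", OF z0 inc[OF that(1)] that(2,3)])
    have DL: "lim (\<lambda>l. block q (z (dyad l t)) g) = block q (dyad_lim z t) g" if "0 \<le> t" "t \<le> real U" for q t g
      unfolding block_def by (rule limI, rule tendsto_sum, rule tendsto_mult[OF tendsto_const conv[OF _ that]])
    have D0: "block q (z 0) g = 0" for q g by (simp add: block_def z0)
    have b1: "\<bar>dyad_lim z t \<kappa>\<bar> \<le> H * (K * ?R q)" if "\<kappa> \<in> modes (RQ q)" "0 \<le> t" "t \<le> real U" for q t \<kappa>
      using ch(2)[where y="\<lambda>t. z t \<kappa>", OF z0 inc[OF that(1)] that(2,3)] mult_right_mono[OF H(1) R0[of q]]
      unfolding dyad_lim_def by linarith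
    have b2: "\<bar>block q (dyad_lim z t) g\<bar> \<le> H * (K * ?R q)" if "g \<in> Grid q" "0 \<le> t" "t \<le> real U" for q t g
      using ch(2)[where y="\<lambda>t. block q (z t) g", OF D0 incD[OF that(1)] that(2,3)] mult_right_mono[OF H(1) R0[of q]]
      unfolding DL[OF that(2,3)] by linarith
    have le2: "(1 + 2 * cg) * (K * ?R q) * 2 powr (- ?\<gamma> * real l) \<le> H * (K * ?R q) * 2 powr (- ?\<gamma> * real l)" for q and l :: nat
      by (intro mult_right_mono H(2) R0) auto
    have c1: "\<bar>dyad_lim z t \<kappa> - dyad_lim z s \<kappa>\<bar> \<le> H * (K * ?R q) * 2 powr (- ?\<gamma> * real l)"
      if "\<kappa> \<in> modes (RQ q)" "0 \<le> s" "s \<le> t" "t \<le> real U" "t - s \<le> 1 / 2 ^ l" for q s t l \<kappa>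
      using ch(3)[where y="\<lambda>t. z t \<kappa>", OF z0 inc[OF that(1)] that(2-5)] le2[of q l]
      unfolding dyad_lim_def by linarith
    have c2: "\<bar>block q (\<lambda>\<kappa>. dyad_lim z t \<kappa> - dyad_lim z s \<kappa>) g\<bar> \<le> H * (K * ?R q) * 2 powr (- ?\<gamma> * real l)"
      if "g \<in> Grid q" "0 \<le> s" "s \<le> t" "t \<le> real U" "t - s \<le> 1 / 2 ^ l" for q s t l g
    proof -
      have ts: "0 \<le> t" "s \<le> real U" using that by auto
      show ?thesis
        using ch(3)[where y="\<lambda>t. block q (z t) g", OF D0 incD[OF that(1)] that(2-5)] le2[of q l]
        unfolding DL[OF ts(1) that(4)] DL[OF that(2) ts(2)] block_diff by linarith
    qed
    have CH: "H * (K * ?R q) \<le> C * H * K * ?R q" for q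
      using mult_right_mono[OF C(1), of "H * (K * ?R q)"] H(3) R0[of q] by (simp add: mult.assoc)
    have "(\<lambda>l. z (dyad l t) \<kappa>) \<longlonglongrightarrow> dyad_lim z t \<kappa>" if \<kappa>: "fst \<kappa> \<in> Z4" and t: "0 \<le> t" "t \<le> real U" for t \<kappa>
    proof -
      obtain N where N: "\<kappa> \<in> modes N" using mode_in_modes[OF \<kappa>] by blast
      \<comment> \<open>Every lattice mode lies within the radius of some block, since radii grow
        exponentially.\<close>
      have "N < 2 ^ N" by (rule less_exp)
      also have "\<dots> \<le> RQ N" by (simp add: RQ_def)
      finally have "N \<le> RQ N" by (rule less_imp_le)
      then show ?thesis using conv[OF subsetD[OF modes_mono N] t] by blast
    qed
    moreover have "mode_reg U (C * H * K) (dyad_lim z)"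
      unfolding mode_reg_def
    proof (intro conjI allI impI)
      fix q t \<kappa> assume "\<kappa> \<in> modes (RQ q)" "0 \<le> t" "t \<le> real U"
      then show "\<bar>dyad_lim z t \<kappa>\<bar> \<le> C * H * K * ?R q" by (rule order_trans[OF b1 CH])
    next
      fix q t x assume t: "0 \<le> t" "t \<le> real U"
      have "\<bar>block q (dyad_lim z t) x\<bar> \<le> C * (H * (K * ?R q))"
      proof (rule C(2))
        show "0 \<le> H * (K * ?R q)" using H(3) R0[of q] by simp
      qed (erule b1[OF _ t] b2[OF _ t])+
      then show "\<bar>block q (dyad_lim z t) x\<bar> \<le> C * H * K * ?R q" by (simp only: mult.assoc)
    next
      fix q s t x and l :: nat assume t: "0 \<le> s" "s \<le> t" "t \<le> real U" "t - s \<le> 1 / 2 ^ l"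
      have "\<bar>block q (\<lambda>\<kappa>. dyad_lim z t \<kappa> - dyad_lim z s \<kappa>) x\<bar> \<le> C * (H * (K * ?R q) * 2 powr (- ?\<gamma> * real l))"
      proof (rule C(2))
        show "0 \<le> H * (K * ?R q) * 2 powr (- ?\<gamma> * real l)" using H(3) R0[of q] by simp
      qed (erule c1[OF _ t] c2[OF _ t])+
      then show "\<bar>block q (dyad_lim z t) x - block q (dyad_lim z s) x\<bar> \<le> C * H * K * 2 powr (- ?\<gamma> * real l) * ?R q"
        unfolding block_diff by (simp only: mult_ac)
    qed
    ultimately show "(\<forall>t \<kappa>. fst \<kappa> \<in> Z4 \<longrightarrow> 0 \<le> t \<longrightarrow> t \<le> real U \<longrightarrow> (\<lambda>l. z (dyad l t) \<kappa>) \<longlonglongrightarrow> dyad_lim z t \<kappa>) \<and> mode_reg U (C * H * K) (dyad_lim z)"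
      by blast
  qed
qed

text \<open>A frequency lies in the range of a block whose radius is at most twice its
  \<open>bracket\<close>, so the block bound becomes a power of the bracket; the exponent is rounded
  up to a natural number.\<close>

lemma mode_reg_growth:
  assumes r: "mode_reg U L a" and L: "0 \<le> L" and t: "0 \<le> t" "t \<le> real U"
  shows "growth (a t)"
proof -
  let ?p = "nat \<lceil>- \<theta> / 2\<rceil>"
  have "\<bar>a t \<kappa>\<bar> \<le> (L * 2 ^ ?p) * bracket (fst \<kappa>) ^ ?p" if \<kappa>: "fst \<kappa> \<in> Z4" for \<kappa>
  proof -
    let ?b = "bracket (fst \<kappa>)"
    have b: "1 \<le> ?b" by (rule bracket_ge_1)
    define q where "q = nat \<lfloor>log 2 ?b\<rfloor>"
    have "0 \<le> log 2 ?b" using b by simp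
    then have q: "real q \<le> log 2 ?b" "log 2 ?b \<le> real (q + 1)" unfolding q_def by linarith+
    have e: "2 powr log 2 ?b = ?b" using b by simp
    have q1: "2 ^ q \<le> ?b" using powr_mono[OF q(1), of 2] unfolding e by (simp add: powr_realpow)
    have q2: "?b \<le> real (RQ q)" using powr_mono[OF q(2), of 2] unfolding e RQ_def powr_realpow[OF zero_less_numeral] by simp
    have "\<bar>fst \<kappa> $ i\<bar> \<le> real (RQ q)" for i
      using component_le_norm_cart[of "fst \<kappa>" i] q2 by (simp add: bracket_def)
    then have "\<kappa> \<in> modes (RQ q)" using \<kappa> by (cases \<kappa>) (auto simp: modes_def ZB_def)
    then have "\<bar>a t \<kappa>\<bar> \<le> L * real (RQ q) powr (- \<theta> / 2)" by (rule r[unfolded mode_reg_def, THEN conjunct1, rule_format, OF _ t])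
    also have "\<dots> \<le> L * (2 * ?b) ^ ?p"
    proof (intro mult_left_mono L)
      have "real (RQ q) powr (- \<theta> / 2) \<le> (2 * ?b) powr (- \<theta> / 2)"
        using q1 \<theta> by (intro powr_mono2) (auto simp: RQ_def)
      also have "\<dots> \<le> (2 * ?b) powr real ?p" using b by (intro powr_mono) linarith+
      also have "\<dots> = (2 * ?b) ^ ?p" using b by (intro powr_realpow) simp
      finally show "real (RQ q) powr (- \<theta> / 2) \<le> (2 * ?b) ^ ?p" .
    qed
    finally show ?thesis by (simp add: power_mult_distrib)
  qed
  then show ?thesis unfolding growth_def using L by (intro exI[of _ "L * 2 ^ ?p"] exI[of _ ?p]) auto
qed

lemma mode_reg_Calpha:
  assumes "mode_reg U L a" "0 \<le> L" "0 \<le> t" "t \<le> real U"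
  shows "dist_of (a t) \<in> Calpha \<rho>m \<rho>0 \<theta>"
proof (rule Calpha_I[OF \<theta> assms(2) mode_reg_growth[OF assms]])
  have "\<forall>q t x. 0 \<le> t \<longrightarrow> t \<le> real U \<longrightarrow> \<bar>block q (a t) x\<bar> \<le> L * real (RQ q) powr (- \<theta> / 2)"
    using assms(1) unfolding mode_reg_def by (elim conjE)
  with assms(3,4) show "\<bar>block q (a t) x\<bar> \<le> L * real (RQ q) powr (- \<theta> / 2)" for q x by simp
qed

lemma Deltaq_dist_of_diff:
  "Deltaq \<rho>m \<rho>0 (int q - 1) (\<lambda>\<phi>. dist_of A \<phi> - dist_of B \<phi>) x = block q A x - block q B x"
  using Deltaq_dist_of[of q A x] Deltaq_dist_of[of q B x] by (simp add: Deltaq_def)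

lemma mode_reg_cont:
  assumes r: "mode_reg U L a" and L: "0 \<le> L" and t: "0 \<le> s" "0 \<le> t" "s \<le> real U" "t \<le> real U" "\<bar>t - s\<bar> \<le> 1 / 2 ^ l"
  shows "Cnorm \<rho>m \<rho>0 \<theta> (\<lambda>\<phi>. dist_of (a t) \<phi> - dist_of (a s) \<phi>) \<le> L * 2 powr (- (\<beta> / 4) * real l) * 2 powr (- 3 * \<theta> / 2)"
proof (rule Cnorm_le[OF \<theta>])
  show "0 \<le> L * 2 powr (- (\<beta> / 4) * real l)" using L by simp
  fix q x
  have r3: "\<bar>block q (a t) x - block q (a s) x\<bar> \<le> L * 2 powr (- (\<beta> / 4) * real l) * real (RQ q) powr (- \<theta> / 2)"
    if "0 \<le> s" "s \<le> t" "t \<le> real U" "t - s \<le> 1 / 2 ^ l" for s t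
    using r[unfolded mode_reg_def, THEN conjunct2, THEN conjunct2] that by simp
  show "\<bar>Deltaq \<rho>m \<rho>0 (int q - 1) (\<lambda>\<phi>. dist_of (a t) \<phi> - dist_of (a s) \<phi>) x\<bar> \<le> L * 2 powr (- (\<beta> / 4) * real l) * real (RQ q) powr (- \<theta> / 2)"
    unfolding Deltaq_dist_of_diff
  proof (cases "s \<le> t")
    case True
    then show "\<bar>block q (a t) x - block q (a s) x\<bar> \<le> L * 2 powr (- (\<beta> / 4) * real l) * real (RQ q) powr (- \<theta> / 2)"
      using r3[of s t] t by simp
  next
    case False
    then show "\<bar>block q (a t) x - block q (a s) x\<bar> \<le> L * 2 powr (- (\<beta> / 4) * real l) * real (RQ q) powr (- \<theta> / 2)"
      using r3[of t s] t by (simp add: abs_minus_commute)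
  qed
qed

end

text \<open>An almost sure limit and an L^(2 p) limit of one sequence coincide, by Fatou. Used once
  along dyadic times and once along truncations of a test function.\<close>

lemma AE_eq_of_moments:
  fixes f h :: "'a \<Rightarrow> real" and g :: "nat \<Rightarrow> 'a \<Rightarrow> real"
  assumes [measurable]: "f \<in> borel_measurable M" "h \<in> borel_measurable M" "\<And>k. g k \<in> borel_measurable M"
    and lim: "AE x in M. (\<lambda>k. g k x) \<longlonglongrightarrow> h x"
    and le: "eventually (\<lambda>k. (\<integral>\<^sup>+x. ennreal ((f x - g k x) ^ (2 * p)) \<partial>M) \<le> ennreal (C k)) sequentially"
    and C: "C \<longlonglongrightarrow> 0" and p: "0 < p"
  shows "AE x in M. f x = h x"
proof -
  have "(\<integral>\<^sup>+x. ennreal ((f x - h x) ^ (2 * p)) \<partial>M) \<le> 0"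
  proof (rule nn_integral_fatou_le[OF _ _ le])
    show "(\<lambda>k. ennreal (C k)) \<longlonglongrightarrow> 0" using tendsto_ennrealI[OF C] by simp
    show "AE x in M. (\<lambda>k. ennreal ((f x - g k x) ^ (2 * p))) \<longlonglongrightarrow> ennreal ((f x - h x) ^ (2 * p))"
      using lim by eventually_elim (intro tendsto_ennrealI tendsto_power tendsto_diff tendsto_const)
  qed measurable
  then have "AE x in M. ennreal ((f x - h x) ^ (2 * p)) = 0" by (subst (asm) le_zero_eq, subst (asm) nn_integral_0_iff_AE) auto
  then show ?thesis
  proof eventually_elim
    fix x assume "ennreal ((f x - h x) ^ (2 * p)) = 0"
    then have "(f x - h x) ^ (2 * p) \<le> 0" by (simp add: ennreal_eq_0_iff)
    moreover have "0 \<le> (f x - h x) ^ (2 * p)" by (simp add: power_mult)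
    ultimately have "(f x - h x) ^ (2 * p) = 0" by linarith
    then show "f x = h x" using p by simp
  qed
qed

lemma dyad_bounds:
  assumes "0 \<le> t" shows "0 \<le> dyad l t" "dyad l t \<le> t" "t - dyad l t \<le> 1 / 2 ^ l"
proof -
  have a: "0 \<le> t * 2 ^ l" using assms by simp
  have b: "real (nat \<lfloor>t * 2 ^ l\<rfloor>) \<le> t * 2 ^ l" "t * 2 ^ l \<le> real (nat \<lfloor>t * 2 ^ l\<rfloor>) + 1" using a by linarith+
  show "0 \<le> dyad l t" by (simp add: dyad_def)
  show "dyad l t \<le> t" using b(1) by (simp add: dyad_def pos_divide_le_eq)
  have "t \<le> (real (nat \<lfloor>t * 2 ^ l\<rfloor>) + 1) / 2 ^ l" using b(2) by (simp add: pos_le_divide_eq)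
  then show "t - dyad l t \<le> 1 / 2 ^ l" by (simp add: dyad_def add_divide_distrib)
qed

lemma fourier_minus_tpoly:
  assumes \<phi>: "\<phi> \<in> TestF" and K: "K \<in> Z4"
  shows "fourier (\<lambda>x. \<phi> x - tpoly (fourier \<phi>) N x) K = (if K \<in> ZB N then 0 else fourier \<phi> K)"
proof -
  obtain B where B: "\<And>x. \<bar>\<phi> x\<bar> \<le> B"
    using periodic_bounded[OF continuous_testf[OF \<phi>]] \<phi> by (auto simp: TestF_def bdd_above_def)
  have i1: "integrable cubeM (\<lambda>x. complex_of_real (\<phi> x) * ek K x)"
    by (rule integrable_cubeM_bounded[where B=B]) (use B borel_testf[OF \<phi>] in \<open>auto simp: norm_mult\<close>)
  define T where "T = tpoly (fourier \<phi>) N"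
  have i2: "integrable cubeM (\<lambda>x. complex_of_real (T x) * ek K x)"
    unfolding T_def
    by (rule integrable_cubeM_bounded[where B="\<Sum>\<kappa>\<in>modes N. \<bar>mode_coeff (fourier \<phi>) \<kappa>\<bar>"]) (use tpoly_bound in \<open>auto simp: norm_mult\<close>)
  have "fourier (\<lambda>x. \<phi> x - T x) K = fourier \<phi> K - fourier T K"
    unfolding fourier_def using Bochner_Integration.integral_diff[OF i1 i2] by (simp add: left_diff_distrib)
  then show ?thesis unfolding T_def using fourier_tpoly[OF herm_fourier K] by simp
qed

context wick_power
begin

text \<open>Fourth-order decay gives |K|^-8 for the squared coefficient; outside the cube of size N
  five of these powers stay for the summation and the others yield 1/N. The weight is at most 1
  because \<open>wt\<close> is nonnegative.\<close>

lemma fourier_tail: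
  assumes \<phi>: "\<phi> \<in> TestF"
  obtains D where "0 \<le> D" "\<And>N F. 1 \<le> N \<Longrightarrow> finite F \<Longrightarrow> F \<subseteq> Z4 \<Longrightarrow>
     (\<Sum>K\<in>F. (norm (fourier (\<lambda>x. \<phi> x - tpoly (fourier \<phi>) N x) K))^2 * bracket K powr - wt) \<le> D / real N"
proof -
  obtain Cl where Cl: "0 < Cl" "\<And>F. finite F \<Longrightarrow> F \<subseteq> Z4 \<Longrightarrow> (\<Sum>k\<in>F. bracket k powr - (4 + 1)) \<le> Cl"
    using lattice_sum[of 1] by auto
  let ?S = "\<Sum>is\<in>{is. length is \<le> 4}. supn (pderivs is \<phi>)"
  show ?thesis
  proof (rule that)
    show "0 \<le> ?S^2 * Cl" using Cl by simp
    fix N :: nat and F :: "(real^4) set" assume N: "1 \<le> N" and F: "finite F" "F \<subseteq> Z4"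
    have "(norm (fourier (\<lambda>x. \<phi> x - tpoly (fourier \<phi>) N x) K))^2 * bracket K powr - wt \<le> ?S^2 / real N * bracket K powr - (4 + 1)" if "K \<in> F" for K
    proof (cases "K \<in> ZB N")
      case True
      then show ?thesis using fourier_minus_tpoly[OF \<phi>, of K N] that F by (simp add: subset_iff)
    next
      case False
      have KZ: "K \<in> Z4" using that F by auto
      then obtain i where "real N < \<bar>K $ i\<bar>" using False by (auto simp: ZB_def not_le)
      then have bN: "real N \<le> bracket K" using component_le_norm_cart[of K i] by (simp add: bracket_def)
      have b1: "bracket K ^ 8 * (norm (fourier \<phi> K))^2 \<le> ?S^2"
      proof -
        have "(norm (fourier \<phi> K) * bracket K ^ 4)^2 \<le> ?S^2" by (intro power_mono fourier_decay[OF \<phi> KZ]) auto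
        then show ?thesis by (simp add: power_mult_distrib power_mult[symmetric] mult.commute)
      qed
      have b2: "real N * bracket K ^ 5 \<le> bracket K ^ 8"
      proof -
        have "real N * bracket K ^ 5 \<le> bracket K ^ 3 * bracket K ^ 5"
        proof (intro mult_right_mono)
          have "bracket K ^ 1 \<le> bracket K ^ 3" by (intro power_increasing) auto
          then show "real N \<le> bracket K ^ 3" using bN by simp
        qed auto
        also have "\<dots> = bracket K ^ 8" by (simp add: power_add[symmetric])
        finally show ?thesis .
      qed
      have "real N * bracket K ^ 5 * (norm (fourier \<phi> K))^2 \<le> ?S^2"
        using mult_right_mono[OF b2, of "(norm (fourier \<phi> K))^2"] b1 by simp
      then have "(norm (fourier \<phi> K))^2 \<le> ?S^2 / (real N * bracket K ^ 5)"
        using N by (simp add: pos_le_divide_eq mult.commute)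
      also have "\<dots> = ?S^2 / real N * bracket K powr - (4 + 1)"
      proof -
        have "bracket K powr 5 = bracket K ^ 5" by simp
        then show ?thesis by (simp add: powr_minus_divide)
      qed
      finally have "(norm (fourier \<phi> K))^2 \<le> ?S^2 / real N * bracket K powr - (4 + 1)" .
      moreover have "bracket K powr - wt \<le> 1"
      proof -
        have "bracket K powr - wt \<le> bracket K powr 0" using \<beta>(3) by (intro powr_mono) auto
        also have "bracket K powr 0 = 1" by (subst powr_zero_eq_one) (use less_imp_neq[OF bracket_pos[of K]] in auto)
        finally show ?thesis .
      qed
      ultimately have "(norm (fourier \<phi> K))^2 * bracket K powr - wt \<le> (?S^2 / real N * bracket K powr - (4 + 1)) * 1"
        by (intro mult_mono) auto
      then show ?thesis using fourier_minus_tpoly[OF \<phi> KZ, of N] False by simp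
    qed
    then have "(\<Sum>K\<in>F. (norm (fourier (\<lambda>x. \<phi> x - tpoly (fourier \<phi>) N x) K))^2 * bracket K powr - wt) \<le> (\<Sum>K\<in>F. ?S^2 / real N * bracket K powr - (4 + 1))"
      by (rule sum_mono)
    also have "\<dots> = ?S^2 / real N * (\<Sum>K\<in>F. bracket K powr - (4 + 1))" by (rule sum_distrib_left[symmetric])
    also have "\<dots> \<le> ?S^2 / real N * Cl" by (intro mult_left_mono Cl(2) F) auto
    finally show "(\<Sum>K\<in>F. (norm (fourier (\<lambda>x. \<phi> x - tpoly (fourier \<phi>) N x) K))^2 * bracket K powr - wt) \<le> ?S^2 * Cl / real N" by simp
  qed
qed

lemma tpoly_I_AE:
  assumes R: "fourier_symbol b E" and r: "0 \<le> r"
  shows "AE \<omega> in M. I (kern n E r (tpoly d N)) \<omega> = (\<Sum>\<kappa>\<in>modes N. mode_coeff d \<kappa> * I (kern n E r (mode \<kappa>)) \<omega>)"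
proof -
  have "kern n E r (tpoly d N) = (\<lambda>z. \<Sum>\<kappa>\<in>modes N. mode_coeff d \<kappa> * kern n E r (mode \<kappa>) z)"
    by (rule ext) (rule kern_tpoly[OF R])
  then show ?thesis
    by (simp only:) (intro I_sum hypercontr_L2 mode_hyp[OF R modes_Z4 r] finite_modes)
qed

text \<open>The remainder of the Fourier series of \<phi> is itself admissible in
  \<open>kern_sq\<close>, with G of order 1/N by \<open>fourier_tail\<close>; almost sure linearity
  then resolves the polynomial part into modes.\<close>

lemma testf_approx:
  assumes R: "fourier_symbol b E" and \<phi>: "\<phi> \<in> TestF" and r: "0 \<le> r"
  obtains D where "\<And>N. 1 \<le> N \<Longrightarrow> (\<integral>\<^sup>+\<omega>. ennreal ((I (kern n E r \<phi>) \<omega> - (\<Sum>\<kappa>\<in>modes N. mode_coeff (fourier \<phi>) \<kappa> * I (kern n E r (mode \<kappa>)) \<omega>)) ^ (2 * 1)) \<partial>M) \<le> ennreal (D / real N)"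
    "L2 (STn n) (kern n E r \<phi>)"
proof -
  obtain B where B: "\<And>x. \<bar>\<phi> x\<bar> \<le> B"
    using periodic_bounded[OF continuous_testf[OF \<phi>]] \<phi> by (auto simp: TestF_def bdd_above_def)
  obtain D where D: "0 \<le> D" "\<And>N F. 1 \<le> N \<Longrightarrow> finite F \<Longrightarrow> F \<subseteq> Z4 \<Longrightarrow>
     (\<Sum>K\<in>F. (norm (fourier (\<lambda>x. \<phi> x - tpoly (fourier \<phi>) N x) K))^2 * bracket K powr - wt) \<le> D / real N"
    by (rule fourier_tail[OF \<phi>]) blast
  obtain C where C: "0 \<le> C" "\<And>\<phi> Bp G t. \<phi> \<in> borel_measurable borel \<Longrightarrow> (\<And>x. \<bar>\<phi> x\<bar> \<le> Bp) \<Longrightarrow>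
     (\<And>F. finite F \<Longrightarrow> F \<subseteq> Z4 \<Longrightarrow> (\<Sum>K\<in>F. (norm (fourier \<phi> K))^2 * bracket K powr - wt) \<le> G) \<Longrightarrow> 0 \<le> t \<Longrightarrow> t \<le> max 1 r \<Longrightarrow>
     hypercontr (kern n E t \<phi>) \<and> (\<integral>z. (kern n E t \<phi> z)^2 \<partial>STn n) \<le> C * G"
    by (rule kern_sq[OF R, of "max 1 r"]) (simp, blast)
  have L: "hypercontr (kern n E r (\<lambda>x. \<phi> x - tpoly (fourier \<phi>) N x)) \<and>
     (\<integral>z. (kern n E r (\<lambda>x. \<phi> x - tpoly (fourier \<phi>) N x) z)^2 \<partial>STn n) \<le> C * (D / real N)" if N: "1 \<le> N" for N
  proof (rule C(2))
    show "(\<lambda>x. \<phi> x - tpoly (fourier \<phi>) N x) \<in> borel_measurable borel" using borel_testf[OF \<phi>] by measurable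
    show "\<bar>\<phi> x - tpoly (fourier \<phi>) N x\<bar> \<le> B + (\<Sum>\<kappa>\<in>modes N. \<bar>mode_coeff (fourier \<phi>) \<kappa>\<bar>)" for x
      using B[of x] tpoly_bound[of "fourier \<phi>" N x] by linarith
    show "(\<Sum>K\<in>F. (norm (fourier (\<lambda>x. \<phi> x - tpoly (fourier \<phi>) N x) K))^2 * bracket K powr - wt) \<le> D / real N" if "finite F" "F \<subseteq> Z4" for F
      by (rule D(2)[OF N that])
  qed (use r in simp_all)
  have kd: "kern n E r (\<lambda>x. \<phi> x - tpoly (fourier \<phi>) N x) z = kern n E r \<phi> z - kern n E r (tpoly (fourier \<phi>) N) z" for N z
    by (rule kern_diff[OF R borel_testf[OF \<phi>] B tpoly_borel tpoly_bound])
  have Lt: "L2 (STn n) (kern n E r (tpoly (fourier \<phi>) N))" for N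
    by (rule hypercontr_L2[OF tpoly_hyp[OF R herm_fourier r]])
  have L2: "L2 (STn n) (kern n E r \<phi>)"
  proof -
    \<comment> \<open>The kernel of \<phi> is recovered as the kernel of the remainder plus that of
      the polynomial, both square integrable.\<close>
    have "L2 (STn n) (\<lambda>z. kern n E r (\<lambda>x. \<phi> x - tpoly (fourier \<phi>) 1 x) z - (0 - kern n E r (tpoly (fourier \<phi>) 1) z))"
      by (intro L2_diff L2_zero Lt hypercontr_L2[OF conjunct1[OF L]]) simp
    then show ?thesis unfolding kd by simp
  qed
  show ?thesis
  proof (rule that[OF _ L2])
    fix N :: nat assume N: "1 \<le> N"
    let ?\<psi> = "\<lambda>x. \<phi> x - tpoly (fourier \<phi>) N x"
    have LN: "L2 (STn n) (kern n E r ?\<psi>)" using L[OF N] hypercontr_L2 by blast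
    have e: "kern n E r ?\<psi> = (\<lambda>z. kern n E r \<phi> z - kern n E r (tpoly (fourier \<phi>) N) z)" using kd by auto
    have "AE \<omega> in M. I (kern n E r \<phi>) \<omega> - (\<Sum>\<kappa>\<in>modes N. mode_coeff (fourier \<phi>) \<kappa> * I (kern n E r (mode \<kappa>)) \<omega>) = I (kern n E r ?\<psi>) \<omega>"
      unfolding e using I_diff[OF L2 Lt[of N]] tpoly_I_AE[OF R r, of "fourier \<phi>" N] by eventually_elim simp
    then have "(\<integral>\<^sup>+\<omega>. ennreal ((I (kern n E r \<phi>) \<omega> - (\<Sum>\<kappa>\<in>modes N. mode_coeff (fourier \<phi>) \<kappa> * I (kern n E r (mode \<kappa>)) \<omega>)) ^ (2 * 1)) \<partial>M)
       = (\<integral>\<^sup>+\<omega>. ennreal ((I (kern n E r ?\<psi>) \<omega>)^2) \<partial>M)"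
      by (intro nn_integral_cong_AE) (auto elim!: eventually_mono)
    also have "\<dots> = ennreal (\<integral>\<omega>. (I (kern n E r ?\<psi>) \<omega>)^2 \<partial>M)"
      by (intro nn_integral_eq_integral I_sq_integrable LN) auto
    also have "\<dots> \<le> ennreal ((fact n * (C * D)) / real N)"
    proof (rule ennreal_leI)
      have "(\<integral>\<omega>. (I (kern n E r ?\<psi>) \<omega>)^2 \<partial>M) \<le> fact n * (\<integral>z. (kern n E r ?\<psi> z)^2 \<partial>STn n)" by (rule I_bound[OF LN])
      also have "\<dots> \<le> fact n * (C * (D / real N))" using L[OF N] by (intro mult_left_mono) auto
      finally show "(\<integral>\<omega>. (I (kern n E r ?\<psi>) \<omega>)^2 \<partial>M) \<le> fact n * (C * D) / real N" by simp
    qed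
    finally show "(\<integral>\<^sup>+\<omega>. ennreal ((I (kern n E r \<phi>) \<omega> - (\<Sum>\<kappa>\<in>modes N. mode_coeff (fourier \<phi>) \<kappa> * I (kern n E r (mode \<kappa>)) \<omega>)) ^ (2 * 1)) \<partial>M)
       \<le> ennreal (fact n * (C * D) / real N)" .
  qed
qed

end

section \<open>The process, its versions and their convergence\<close>

context wick_power
begin

abbreviation mode_proc :: "(real \<Rightarrow> real^4 \<Rightarrow> real) \<Rightarrow> 'w \<Rightarrow> real \<Rightarrow> (real^4) \<times> bool \<Rightarrow> real" where
  "mode_proc E \<equiv> mode_diff E (\<lambda>_ _. 0)"

text \<open>Integer horizons cover all times, and countably many conditions keep the event
  measurable. \<open>Suc U\<close> appears because the expectation bound asks for a horizon of at
  least one.\<close>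

definition good :: "(real \<Rightarrow> real^4 \<Rightarrow> real) \<Rightarrow> 'w \<Rightarrow> bool" where
  "good E \<omega> \<longleftrightarrow> (\<forall>U. chain_sum (Suc U) (mode_proc E \<omega>) < \<infinity>)"

definition proc_modes :: "(real \<Rightarrow> real^4 \<Rightarrow> real) \<Rightarrow> real \<Rightarrow> 'w \<Rightarrow> (real^4) \<times> bool \<Rightarrow> real" where
  "proc_modes E t \<omega> \<kappa> = (if good E \<omega> then dyad_lim (mode_proc E \<omega>) t \<kappa> else 0)"

definition proc :: "(real \<Rightarrow> real^4 \<Rightarrow> real) \<Rightarrow> real \<Rightarrow> 'w \<Rightarrow> (real^4 \<Rightarrow> real) \<Rightarrow> real" where
  "proc E t \<omega> = dist_of (proc_modes E t \<omega>)"

lemma good_measurable: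
  assumes "fourier_symbol b E" shows "{\<omega> \<in> space M. good E \<omega>} \<in> sets M"
proof -
  have [measurable]: "(\<lambda>\<omega>. chain_sum (Suc U) (mode_proc E \<omega>)) \<in> borel_measurable M" for U
    by (rule chain_sum_measurable[OF assms fourier_symbol_zero])
  show ?thesis unfolding good_def by measurable
qed

lemma AE_good:
  assumes R: "fourier_symbol b E" shows "AE \<omega> in M. good E \<omega>"
proof -
  obtain Z where Z: "1 \<le> Z" "\<And>k. \<bar>b k\<bar> \<le> Z" by (rule fourier_symbol_bound[OF R]) blast
  have Z0: "0 < Z ^ n" using Z(1) by simp
  have "AE \<omega> in M. chain_sum (Suc U) (mode_proc E \<omega>) < \<infinity>" for U
  proof -
    obtain Q where Q: "\<And>b E b' E' B. fourier_symbol b E \<Longrightarrow> fourier_symbol b' E' \<Longrightarrow> 0 < B \<Longrightarrow>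
     (\<And>\<kappa>. \<kappa> \<in> Pi\<^sub>E {..<n} (\<lambda>_. Z4) \<Longrightarrow> \<bar>(\<Prod>m<n. b (\<kappa> m)) - (\<Prod>m<n. b' (\<kappa> m))\<bar> \<le> B * (\<Prod>m<n. bracket (\<kappa> m) powr \<beta>)) \<Longrightarrow>
     (\<integral>\<^sup>+\<omega>. chain_sum (Suc U) (mode_diff E E' \<omega>) \<partial>M) \<le> ennreal (Q * (B^2) ^ m)"
      by (rule chain_sum_expectation[of "Suc U"]) (simp, blast)
    have "(\<integral>\<^sup>+\<omega>. chain_sum (Suc U) (mode_proc E \<omega>) \<partial>M) \<le> ennreal (Q * ((Z ^ n)^2) ^ m)"
      by (rule Q[OF R fourier_symbol_zero Z0 mult_bound[of Z b n \<beta>, OF Z n1]]) (use \<beta> in auto)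
    then have "(\<integral>\<^sup>+\<omega>. chain_sum (Suc U) (mode_proc E \<omega>) \<partial>M) \<noteq> \<infinity>" by (auto simp: top_unique)
    then have "AE \<omega> in M. chain_sum (Suc U) (mode_proc E \<omega>) \<noteq> \<infinity>"
      by (rule nn_integral_PInf_AE[OF chain_sum_measurable[OF R fourier_symbol_zero]])
    then show ?thesis by eventually_elim (simp add: less_top)
  qed
  then show ?thesis unfolding good_def by (simp add: AE_all_countable)
qed

lemma good_path:
  assumes R: "fourier_symbol b E" and g: "good E \<omega>"
  shows "\<exists>L\<ge>0. mode_reg (Suc U) L (dyad_lim (mode_proc E \<omega>))"
    "fst \<kappa> \<in> Z4 \<Longrightarrow> 0 \<le> t \<Longrightarrow> t \<le> real (Suc U) \<Longrightarrow> (\<lambda>l. mode_proc E \<omega> (dyad l t) \<kappa>) \<longlonglongrightarrow> dyad_lim (mode_proc E \<omega>) t \<kappa>"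
proof -
  obtain CC where CC: "0 < CC" and P: "\<And>z K. chain_sum (Suc U) z \<le> ennreal (K ^ (2 * m)) \<Longrightarrow> 0 \<le> K \<Longrightarrow> (\<And>\<kappa>. z 0 \<kappa> = 0) \<Longrightarrow>
       (\<forall>t \<kappa>. fst \<kappa> \<in> Z4 \<longrightarrow> 0 \<le> t \<longrightarrow> t \<le> real (Suc U) \<longrightarrow> (\<lambda>l. z (dyad l t) \<kappa>) \<longlonglongrightarrow> dyad_lim z t \<kappa>) \<and> mode_reg (Suc U) (CC * K) (dyad_lim z)"
    by (rule chaining_path) blast
  have "chain_sum (Suc U) (mode_proc E \<omega>) < \<infinity>" using g by (simp add: good_def)
  then obtain x where x: "chain_sum (Suc U) (mode_proc E \<omega>) = ennreal x" "0 \<le> x" by (cases "chain_sum (Suc U) (mode_proc E \<omega>)") auto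
  \<comment> \<open>The maximum with 1 gives x \<le> K \<le> K^(2 m); here only the existence of
    some finite K counts.\<close>
  define K where "K = max 1 x"
  have K1: "x \<le> K" "1 \<le> K" by (auto simp: K_def)
  then have "K ^ 1 \<le> K ^ (2 * m)" using m0 by (intro power_increasing) auto
  then have S: "chain_sum (Suc U) (mode_proc E \<omega>) \<le> ennreal (K ^ (2 * m))" unfolding x(1) using K1(1) by (intro ennreal_leI) simp
  have K0: "0 \<le> K" by (simp add: K_def)
  note P = P[OF S K0 mode_diff_time_0[OF R fourier_symbol_zero]]
  show "\<exists>L\<ge>0. mode_reg (Suc U) L (dyad_lim (mode_proc E \<omega>))" using P CC K0 by (intro exI[of _ "CC * K"]) simp
  show "fst \<kappa> \<in> Z4 \<Longrightarrow> 0 \<le> t \<Longrightarrow> t \<le> real (Suc U) \<Longrightarrow> (\<lambda>l. mode_proc E \<omega> (dyad l t) \<kappa>) \<longlonglongrightarrow> dyad_lim (mode_proc E \<omega>) t \<kappa>"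
    using P by blast
qed

text \<open>Off the good event all modes are zero, so the regularity holds for every \<omega> and
  not just almost surely, as \<open>cproc\<close> demands.\<close>

lemma proc_modes_reg:
  assumes R: "fourier_symbol b E" shows "\<exists>L\<ge>0. mode_reg (Suc U) L (\<lambda>t. proc_modes E t \<omega>)"
proof (cases "good E \<omega>")
  case True
  then have "(\<lambda>t. proc_modes E t \<omega>) = dyad_lim (mode_proc E \<omega>)" by (intro ext) (simp add: proc_modes_def)
  then show ?thesis using good_path(1)[OF R True] by simp
next
  case False
  then have "(\<lambda>t. proc_modes E t \<omega>) = (\<lambda>_ _. 0)" by (intro ext) (simp add: proc_modes_def)
  moreover have "mode_reg (Suc U) 0 (\<lambda>_ _. 0)" by (simp add: mode_reg_def block_def)
  ultimately show ?thesis by auto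
qed

lemma proc_modes_measurable:
  assumes R: "fourier_symbol b E" and \<kappa>: "fst \<kappa> \<in> Z4" and t: "0 \<le> t"
  shows "(\<lambda>\<omega>. proc_modes E t \<omega> \<kappa>) \<in> borel_measurable M"
  unfolding proc_modes_def dyad_lim_def
  by (intro measurable_If good_measurable[OF R] borel_measurable_lim_metric borel_measurable_const
    mode_diff_measurable[OF R fourier_symbol_zero \<kappa>] dyad_bounds(1)[OF t])

lemma proc_measurable:
  assumes "fourier_symbol b E" "0 \<le> t"
  shows "(\<lambda>\<omega>. proc E t \<omega> \<phi>) \<in> borel_measurable M"
  unfolding proc_def dist_of_def
  by (intro borel_measurable_suminf borel_measurable_sum borel_measurable_times borel_measurable_const proc_modes_measurable[OF assms(1) shell_Z4 assms(2)])

lemma cproc_proc: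
  assumes R: "fourier_symbol b E" shows "cproc M \<rho>m \<rho>0 \<theta> (proc E)"
  unfolding cproc_def
proof (intro conjI allI impI ballI)
  fix r :: real and \<omega> assume r: "0 \<le> r"
  obtain L where "0 \<le> L" "mode_reg (Suc (nat \<lceil>r\<rceil>)) L (\<lambda>t. proc_modes E t \<omega>)" using proc_modes_reg[OF R] by blast
  then show "proc E r \<omega> \<in> Calpha \<rho>m \<rho>0 \<theta>"
    unfolding proc_def using mode_reg_Calpha[of "Suc (nat \<lceil>r\<rceil>)" L "\<lambda>t. proc_modes E t \<omega>" r] r by simp linarith
next
  fix r :: real and \<phi> assume "0 \<le> r" then show "(\<lambda>\<omega>. proc E r \<omega> \<phi>) \<in> borel_measurable M" by (rule proc_measurable[OF R])
next
  fix \<omega> and r e :: real assume r: "0 \<le> r" and e: "0 < e"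
  let ?U = "Suc (nat \<lceil>r\<rceil>)"
  obtain L where L: "0 \<le> L" "mode_reg ?U L (\<lambda>t. proc_modes E t \<omega>)" using proc_modes_reg[OF R] by blast
  let ?g = "2 powr (- (\<beta> / 4)) :: real"
  let ?c = "2 powr (- 3 * \<theta> / 2) :: real"
  have g: "0 \<le> ?g" "?g < 1" using powr_less_mono[of "- (\<beta> / 4)" 0 2] \<beta>(1) by auto
  have "(\<lambda>l. L * ?g ^ l * ?c) \<longlonglongrightarrow> L * 0 * ?c" by (intro tendsto_mult tendsto_const LIMSEQ_realpow_zero g)
  then have "eventually (\<lambda>l. L * ?g ^ l * ?c < e) sequentially" using e by (intro order_tendstoD(2)[where y="L * 0 * ?c"]) auto
  then obtain l where l: "L * ?g ^ l * ?c < e" by (auto simp: eventually_sequentially)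
  have pw: "2 powr (- (\<beta> / 4) * real l) = ?g ^ l" by (subst powr_power) (auto simp: mult_ac)
  show "\<exists>\<delta>>0. \<forall>s\<ge>0. \<bar>s - r\<bar> < \<delta> \<longrightarrow> Cnorm \<rho>m \<rho>0 \<theta> (\<lambda>\<phi>. proc E s \<omega> \<phi> - proc E r \<omega> \<phi>) < e"
  \<comment> \<open>The 1 keeps s below the horizon chosen for r; the mesh 2^-l makes the Hoelder
    bound smaller than e.\<close>
  proof (intro exI[of _ "min 1 (1 / 2 ^ l)"] conjI allI impI)
    fix s :: real assume s: "0 \<le> s" "\<bar>s - r\<bar> < min 1 (1 / 2 ^ l)"
    have "r \<le> real (nat \<lceil>r\<rceil>)" by linarith
    then have u: "r \<le> real ?U" "s \<le> real ?U" "\<bar>s - r\<bar> \<le> 1 / 2 ^ l" using s unfolding min_less_iff_conj of_nat_Suc by linarith+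
    have "Cnorm \<rho>m \<rho>0 \<theta> (\<lambda>\<phi>. proc E s \<omega> \<phi> - proc E r \<omega> \<phi>) \<le> L * 2 powr (- (\<beta> / 4) * real l) * ?c"
      unfolding proc_def by (rule mode_reg_cont[OF L(2,1) r s(1) u])
    also have "\<dots> < e" using l unfolding pw .
    finally show "Cnorm \<rho>m \<rho>0 \<theta> (\<lambda>\<phi>. proc E s \<omega> \<phi> - proc E r \<omega> \<phi>) < e" .
  qed simp
qed

text \<open>For fixed r the integrals at the rounded times converge to the integral at r in L^(2 m),
  by the increment bound, and almost surely to the constructed mode, by chaining.\<close>

lemma AE_proc_modes:
  assumes R: "fourier_symbol b E" and \<kappa>: "fst \<kappa> \<in> Z4" and r: "0 \<le> r"
  shows "AE \<omega> in M. I (kern n E r (mode \<kappa>)) \<omega> = proc_modes E r \<omega> \<kappa>"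
proof -
  obtain Z where Z: "1 \<le> Z" "\<And>k. \<bar>b k\<bar> \<le> Z" by (rule fourier_symbol_bound[OF R]) blast
  obtain N where N: "\<kappa> \<in> modes N" "1 \<le> N"
  proof -
    obtain N where "\<kappa> \<in> modes N" using mode_in_modes[OF \<kappa>] by blast
    then have "\<kappa> \<in> modes (max 1 N)" using modes_mono[of N "max 1 N"] by auto
    then show ?thesis by (intro that[of "max 1 N"]) auto
  qed
  have Z0: "0 < Z ^ n" using Z(1) by simp
  obtain A where A0: "0 < A" and A:
   "\<And>b E b' E' B d N Bd r' s. fourier_symbol b E \<Longrightarrow> fourier_symbol b' E' \<Longrightarrow> 0 < B \<Longrightarrow>
     (\<And>\<kappa>. \<kappa> \<in> Pi\<^sub>E {..<n} (\<lambda>_. Z4) \<Longrightarrow> \<bar>(\<Prod>m<n. b (\<kappa> m)) - (\<Prod>m<n. b' (\<kappa> m))\<bar> \<le> B * (\<Prod>m<n. bracket (\<kappa> m) powr \<beta>)) \<Longrightarrow>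
     herm d \<Longrightarrow> 1 \<le> N \<Longrightarrow> 0 < Bd \<Longrightarrow> (\<And>K. K \<in> ZB N \<Longrightarrow> norm (d K) \<le> Bd) \<Longrightarrow> 0 \<le> s \<Longrightarrow> s < r' \<Longrightarrow> r' \<le> max 1 r \<Longrightarrow>
     (\<integral>\<^sup>+\<omega>. ennreal ((I (kern_incr n E E' r' s (tpoly d N)) \<omega>) ^ (2 * m)) \<partial>M) \<le> ennreal ((A * B^2 * (r' - s) powr \<beta> * Bd^2 * real N powr (12 * real n * \<beta>)) ^ m)"
    by (rule incr_moment[of "max 1 r"]) (simp, blast)
  let ?C = "\<lambda>l::nat. (A * (Z ^ n)^2 * (1 / 2 ^ l) powr \<beta> * 1^2 * real N powr (12 * real n * \<beta>)) ^ m"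
  have "AE \<omega> in M. mode_proc E \<omega> r \<kappa> = proc_modes E r \<omega> \<kappa>"
  proof (rule AE_eq_of_moments[where g="\<lambda>l \<omega>. mode_proc E \<omega> (dyad l r) \<kappa>" and C="?C" and p=m])
    show "(\<lambda>\<omega>. mode_proc E \<omega> r \<kappa>) \<in> borel_measurable M" by (rule mode_diff_measurable[OF R fourier_symbol_zero \<kappa> r])
    show "(\<lambda>\<omega>. proc_modes E r \<omega> \<kappa>) \<in> borel_measurable M" by (rule proc_modes_measurable[OF R \<kappa> r])
    show "(\<lambda>\<omega>. mode_proc E \<omega> (dyad l r) \<kappa>) \<in> borel_measurable M" for l by (rule mode_diff_measurable[OF R fourier_symbol_zero \<kappa> dyad_bounds(1)[OF r]])
    show "AE \<omega> in M. (\<lambda>l. mode_proc E \<omega> (dyad l r) \<kappa>) \<longlonglongrightarrow> proc_modes E r \<omega> \<kappa>"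
      using AE_good[OF R]
    proof eventually_elim
      fix \<omega> assume g: "good E \<omega>"
      have "r \<le> real (Suc (nat \<lceil>r\<rceil>))" by linarith
      from good_path(2)[OF R g \<kappa> r this] show "(\<lambda>l. mode_proc E \<omega> (dyad l r) \<kappa>) \<longlonglongrightarrow> proc_modes E r \<omega> \<kappa>" using g by (simp add: proc_modes_def)
    qed
    show "eventually (\<lambda>l. (\<integral>\<^sup>+\<omega>. ennreal ((mode_proc E \<omega> r \<kappa> - mode_proc E \<omega> (dyad l r) \<kappa>) ^ (2 * m)) \<partial>M) \<le> ennreal (?C l)) sequentially"
    proof (rule always_eventually, rule allI)
      fix l
      note d = dyad_bounds[OF r, of l]
      show "(\<integral>\<^sup>+\<omega>. ennreal ((mode_proc E \<omega> r \<kappa> - mode_proc E \<omega> (dyad l r) \<kappa>) ^ (2 * m)) \<partial>M) \<le> ennreal (?C l)"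
      \<comment> \<open>The increment bound is stated for s < r; if r is itself a grid point the
        difference is simply zero.\<close>
      proof (cases "dyad l r < r")
        case False
        then have e: "dyad l r = r" using d by simp
        have "2 * m \<noteq> 0" using m0 by simp
        then have z: "ennreal ((mode_proc E \<omega> r \<kappa> - mode_proc E \<omega> r \<kappa>) ^ (2 * m)) = 0" for \<omega> by (simp only: diff_self power_0_left if_False ennreal_0)
        show ?thesis unfolding e z by simp
      next
        case True
        have "(\<integral>\<^sup>+\<omega>. ennreal ((mode_proc E \<omega> r \<kappa> - mode_proc E \<omega> (dyad l r) \<kappa>) ^ (2 * m)) \<partial>M)
          = (\<integral>\<^sup>+\<omega>. ennreal ((I (kern_incr n E (\<lambda>_ _. 0) r (dyad l r) (tpoly (dmode \<kappa>) N)) \<omega>) ^ (2 * m)) \<partial>M)"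
          unfolding mode_eq_tpoly[OF N(1), symmetric]
          by (rule nn_integral_cong_AE, rule eventually_mono[OF kern_incr_mode_AE(2)[OF R fourier_symbol_zero \<kappa> r d(1)]]) simp
        also have "\<dots> \<le> ennreal ((A * (Z ^ n)^2 * (r - dyad l r) powr \<beta> * 1^2 * real N powr (12 * real n * \<beta>)) ^ m)"
          by (rule A[OF R fourier_symbol_zero Z0 mult_bound[of Z b n \<beta>, OF Z n1] herm_dmode N(2) _ norm_dmode_le d(1) True]) (use \<beta> in auto)
        also have "\<dots> \<le> ennreal (?C l)"
          using A0 d \<beta> by (intro ennreal_leI power_mono mult_right_mono mult_left_mono powr_mono2 mult_nonneg_nonneg) auto
        finally show ?thesis .
      qed
    qed
    have "(\<lambda>l::nat. (1 / 2) ^ l :: real) \<longlonglongrightarrow> 0" by (rule LIMSEQ_realpow_zero) auto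
    then have "(\<lambda>l::nat. (1 / 2 ^ l :: real)) \<longlonglongrightarrow> 0" by (simp add: power_one_over)
    then have "(\<lambda>l::nat. (1 / 2 ^ l :: real) powr \<beta>) \<longlonglongrightarrow> 0 powr \<beta>"
      by (rule tendsto_powr2[OF _ tendsto_const]) (use \<beta> in auto)
    then have "?C \<longlonglongrightarrow> (A * (Z ^ n)^2 * 0 powr \<beta> * 1^2 * real N powr (12 * real n * \<beta>)) ^ m"
      by (intro tendsto_power tendsto_mult tendsto_const)
    moreover have "(A * (Z ^ n)^2 * 0 powr \<beta> * 1^2 * real N powr (12 * real n * \<beta>)) ^ m = 0" using m0 by simp
    ultimately show "?C \<longlonglongrightarrow> 0" by (simp only:)
    show "0 < m" by (rule m0)
  qed
  moreover have "AE \<omega> in M. I (kern n (\<lambda>_ _. 0) r (mode \<kappa>)) \<omega> = 0"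
  proof -
    have "kern n (\<lambda>_ _. 0) r (mode \<kappa>) = (\<lambda>_. 0)" using kern_zero[OF n1] by auto
    then show ?thesis using I_diff[OF L2_zero L2_zero] by simp
  qed
  ultimately show ?thesis unfolding mode_diff_def by eventually_elim simp
qed

text \<open>Truncating the Fourier series of \<phi> converges in L^2 on the side of the integral and
  pathwise on the side of the distribution. Both limits belong to one sequence, since countably many
  modes agree outside a common null set.\<close>

lemma AE_proc:
  assumes R: "fourier_symbol b E" and \<phi>: "\<phi> \<in> TestF" and r: "0 \<le> r"
  shows "AE \<omega> in M. I (kern n E r \<phi>) \<omega> = proc E r \<omega> \<phi>" "I (kern n E r \<phi>) \<in> borel_measurable M"
proof -
  obtain D where D: "\<And>N. 1 \<le> N \<Longrightarrow> (\<integral>\<^sup>+\<omega>. ennreal ((I (kern n E r \<phi>) \<omega> - (\<Sum>\<kappa>\<in>modes N. mode_coeff (fourier \<phi>) \<kappa> * I (kern n E r (mode \<kappa>)) \<omega>)) ^ (2 * 1)) \<partial>M) \<le> ennreal (D / real N)"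
    and L: "L2 (STn n) (kern n E r \<phi>)"
    by (rule testf_approx[OF R \<phi> r]) blast
  show m: "I (kern n E r \<phi>) \<in> borel_measurable M" by (rule I_measurable[OF L])
  have ae: "AE \<omega> in M. \<forall>N. \<forall>\<kappa>\<in>modes N. I (kern n E r (mode \<kappa>)) \<omega> = proc_modes E r \<omega> \<kappa>"
    unfolding AE_all_countable by (intro allI AE_finite_allI finite_modes AE_proc_modes[OF R modes_Z4 r])
  show "AE \<omega> in M. I (kern n E r \<phi>) \<omega> = proc E r \<omega> \<phi>"
  proof (rule AE_eq_of_moments[where g="\<lambda>N \<omega>. \<Sum>\<kappa>\<in>modes N. mode_coeff (fourier \<phi>) \<kappa> * I (kern n E r (mode \<kappa>)) \<omega>" and p=1, OF m proc_measurable[OF R r]])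
    show "(\<lambda>\<omega>. \<Sum>\<kappa>\<in>modes N. mode_coeff (fourier \<phi>) \<kappa> * I (kern n E r (mode \<kappa>)) \<omega>) \<in> borel_measurable M" for N
      by (intro borel_measurable_sum borel_measurable_times borel_measurable_const I_measurable hypercontr_L2 mode_hyp[OF R modes_Z4 r])
    show "AE \<omega> in M. (\<lambda>N. \<Sum>\<kappa>\<in>modes N. mode_coeff (fourier \<phi>) \<kappa> * I (kern n E r (mode \<kappa>)) \<omega>) \<longlonglongrightarrow> proc E r \<omega> \<phi>"
      using ae
    proof eventually_elim
      fix \<omega> assume a: "\<forall>N. \<forall>\<kappa>\<in>modes N. I (kern n E r (mode \<kappa>)) \<omega> = proc_modes E r \<omega> \<kappa>"
      obtain K where K: "0 \<le> K" "mode_reg (Suc (nat \<lceil>r\<rceil>)) K (\<lambda>t. proc_modes E t \<omega>)" using proc_modes_reg[OF R] by blast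
      have ru: "r \<le> real (Suc (nat \<lceil>r\<rceil>))" by linarith
      have "(\<lambda>N. \<Sum>\<kappa>\<in>modes N. mode_coeff (fourier \<phi>) \<kappa> * proc_modes E r \<omega> \<kappa>) \<longlonglongrightarrow> proc E r \<omega> \<phi>"
        unfolding proc_def by (rule dist_of_test(2)[OF mode_reg_growth[OF K(2,1) r ru] \<phi>])
      then show "(\<lambda>N. \<Sum>\<kappa>\<in>modes N. mode_coeff (fourier \<phi>) \<kappa> * I (kern n E r (mode \<kappa>)) \<omega>) \<longlonglongrightarrow> proc E r \<omega> \<phi>"
        using a by simp
    qed
    show "eventually (\<lambda>N. (\<integral>\<^sup>+\<omega>. ennreal ((I (kern n E r \<phi>) \<omega> - (\<Sum>\<kappa>\<in>modes N. mode_coeff (fourier \<phi>) \<kappa> * I (kern n E r (mode \<kappa>)) \<omega>)) ^ (2 * 1)) \<partial>M) \<le> ennreal (D / real N)) sequentially"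
      using eventually_ge_at_top[of 1] by eventually_elim (rule D)
    show "(\<lambda>N. D / real N) \<longlonglongrightarrow> 0" by (rule lim_const_over_n)
  qed simp
qed

lemma proc_prob:
  assumes R: "fourier_symbol b E" and \<phi>: "\<phi> \<in> TestF" and r: "0 \<le> r"
  shows "measure M {\<omega> \<in> space M. proc E r \<omega> \<phi> = I (kern n E r \<phi>) \<omega>} = 1"
proof -
  note [measurable] = proc_measurable[OF R r, of \<phi>] AE_proc(2)[OF R \<phi> r]
  have s: "{\<omega> \<in> space M. proc E r \<omega> \<phi> = I (kern n E r \<phi>) \<omega>} \<in> sets M" by measurable
  show ?thesis unfolding prob_Collect_eq_1[OF s] using AE_proc(1)[OF R \<phi> r] by eventually_elim simp
qed

text \<open>On good paths limits along dyadic times commute with differences, so the modes of the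
  difference of the two versions are exactly those controlled by the chaining sum of
  \<open>mode_diff\<close>.\<close>

lemma proc_diff_bound:
  assumes R: "fourier_symbol b E" "fourier_symbol b' E'" and g: "good E \<omega>" "good E' \<omega>"
    and r: "mode_reg (Suc U) L (dyad_lim (mode_diff E E' \<omega>))" and L: "0 \<le> L" and t: "0 \<le> t" "t \<le> real (Suc U)"
  shows "Cnorm \<rho>m \<rho>0 \<theta> (\<lambda>\<phi>. proc E t \<omega> \<phi> - proc E' t \<omega> \<phi>) \<le> L * 2 powr (- 3 * \<theta> / 2)"
  unfolding proc_def
proof (rule Cnorm_le[OF \<theta> L])
  fix q x
  have "dyad_lim (mode_diff E E' \<omega>) t \<kappa> = proc_modes E t \<omega> \<kappa> - proc_modes E' t \<omega> \<kappa>" if "\<kappa> \<in> modes (RQ q)" for \<kappa>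
  proof -
    note Z = modes_Z4[OF that]
    have "(\<lambda>l. mode_proc E \<omega> (dyad l t) \<kappa> - mode_proc E' \<omega> (dyad l t) \<kappa>) \<longlonglongrightarrow> dyad_lim (mode_proc E \<omega>) t \<kappa> - dyad_lim (mode_proc E' \<omega>) t \<kappa>"
      by (intro tendsto_diff good_path(2)[OF R(1) g(1) Z t] good_path(2)[OF R(2) g(2) Z t])
    then have "(\<lambda>l. mode_diff E E' \<omega> (dyad l t) \<kappa>) \<longlonglongrightarrow> dyad_lim (mode_proc E \<omega>) t \<kappa> - dyad_lim (mode_proc E' \<omega>) t \<kappa>"
      by (simp add: mode_diff_def)
    then show ?thesis using g unfolding proc_modes_def dyad_lim_def[of "mode_diff E E' \<omega>"] by (simp add: limI)
  qed
  then have "block q (proc_modes E t \<omega>) x - block q (proc_modes E' t \<omega>) x = block q (dyad_lim (mode_diff E E' \<omega>) t) x"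
    unfolding block_diff[symmetric] by (simp add: block_def)
  then show "\<bar>Deltaq \<rho>m \<rho>0 (int q - 1) (\<lambda>\<phi>. dist_of (proc_modes E t \<omega>) \<phi> - dist_of (proc_modes E' t \<omega>) \<phi>) x\<bar> \<le> L * real (RQ q) powr (- \<theta> / 2)"
    unfolding Deltaq_dist_of_diff using r[unfolded mode_reg_def, THEN conjunct2, THEN conjunct1] t by simp
qed

text \<open>If both paths are good and the supremum exceeds \<sigma>, then the chaining sum of the
  difference exceeds x. Markov's inequality bounds that probability by the expectation, which
  carries the multiplier error \<eta> as a factor.\<close>

lemma proc_converges:
  assumes \<zeta>: "cutoff \<zeta>" and U: "0 \<le> U" and \<sigma>: "0 < \<sigma>"
  shows "((\<lambda>\<epsilon>. measure M {\<omega> \<in> space M. (SUP r\<in>{0..U}. Cnorm \<rho>m \<rho>0 \<theta> (\<lambda>\<phi>. proc (eta_eps \<zeta> \<epsilon>) r \<omega> \<phi> - proc eta r \<omega> \<phi>)) > \<sigma>}) \<longlongrightarrow> 0) (at_right 0)"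
proof -
  define V where "V = nat \<lceil>U\<rceil>"
  have V: "U \<le> real (Suc V)" unfolding V_def by linarith
  obtain CC where CC: "0 < CC" and P: "\<And>z K. chain_sum (Suc V) z \<le> ennreal (K ^ (2 * m)) \<Longrightarrow> 0 \<le> K \<Longrightarrow> (\<And>\<kappa>. z 0 \<kappa> = 0) \<Longrightarrow>
       (\<forall>t \<kappa>. fst \<kappa> \<in> Z4 \<longrightarrow> 0 \<le> t \<longrightarrow> t \<le> real (Suc V) \<longrightarrow> (\<lambda>l. z (dyad l t) \<kappa>) \<longlonglongrightarrow> dyad_lim z t \<kappa>) \<and> mode_reg (Suc V) (CC * K) (dyad_lim z)"
    by (rule chaining_path) blast
  obtain Q where Q0: "0 < Q" and Q: "\<And>b E b' E' B. fourier_symbol b E \<Longrightarrow> fourier_symbol b' E' \<Longrightarrow> 0 < B \<Longrightarrow>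
     (\<And>\<kappa>. \<kappa> \<in> Pi\<^sub>E {..<n} (\<lambda>_. Z4) \<Longrightarrow> \<bar>(\<Prod>m<n. b (\<kappa> m)) - (\<Prod>m<n. b' (\<kappa> m))\<bar> \<le> B * (\<Prod>m<n. bracket (\<kappa> m) powr \<beta>)) \<Longrightarrow>
     (\<integral>\<^sup>+\<omega>. chain_sum (Suc V) (mode_diff E E' \<omega>) \<partial>M) \<le> ennreal (Q * (B^2) ^ m)"
    by (rule chain_sum_expectation[of "Suc V"]) (simp, blast)
  let ?c = "2 powr (- 3 * \<theta> / 2) :: real"
  \<comment> \<open>Inverts the constants of \<open>chaining_path\<close> and
    \<open>proc_diff_bound\<close>, so that a chaining sum up to K^(2 m) forces the norm to be at
    most \<sigma>.\<close>
  define K where "K = \<sigma> / (CC * ?c)"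
  have K: "0 < K" "CC * K * ?c = \<sigma>" using CC \<sigma> by (auto simp: K_def)
  define x where "x = K ^ (2 * m)"
  have x: "0 < x" using K by (simp add: x_def)
  let ?S = "\<lambda>\<epsilon>. {\<omega> \<in> space M. (SUP r\<in>{0..U}. Cnorm \<rho>m \<rho>0 \<theta> (\<lambda>\<phi>. proc (eta_eps \<zeta> \<epsilon>) r \<omega> \<phi> - proc eta r \<omega> \<phi>)) > \<sigma>}"
  have bound: "measure M (?S \<epsilon>) \<le> Q * (\<eta>^2) ^ m / x"
    if \<epsilon>: "0 < \<epsilon>" and \<eta>: "0 < \<eta>" and mb: "\<And>\<kappa>. \<bar>(\<Prod>m<n. \<zeta> (\<epsilon> *\<^sub>R \<kappa> m)) - (\<Prod>m<n. 1)\<bar> \<le> \<eta> * (\<Prod>m<n. bracket (\<kappa> m) powr \<beta>)" for \<epsilon> \<eta>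
  proof -
    note R = fourier_symbol_eta_eps[OF \<zeta> \<epsilon>] fourier_symbol_eta
    let ?z = "mode_diff (eta_eps \<zeta> \<epsilon>) eta"
    let ?T = "{\<omega> \<in> space M. ennreal x < chain_sum (Suc V) (?z \<omega>)}"
    note [measurable] = chain_sum_measurable[OF R, of "Suc V"]
    have T: "?T \<in> sets M" by measurable
    have "measure M (?S \<epsilon>) \<le> measure M ?T"
    proof (rule finite_measure_mono_AE[OF _ T])
      show "AE \<omega> in M. \<omega> \<in> ?S \<epsilon> \<longrightarrow> \<omega> \<in> ?T"
        using AE_good[OF R(1)] AE_good[OF R(2)]
      proof eventually_elim
        fix \<omega> assume g: "good (eta_eps \<zeta> \<epsilon>) \<omega>" "good eta \<omega>"
        show "\<omega> \<in> ?S \<epsilon> \<longrightarrow> \<omega> \<in> ?T"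
        proof (rule impI, rule ccontr)
          assume s: "\<omega> \<in> ?S \<epsilon>" and nt: "\<omega> \<notin> ?T"
          then have le: "chain_sum (Suc V) (?z \<omega>) \<le> ennreal (K ^ (2 * m))" by (simp add: not_less x_def)
          have rg: "mode_reg (Suc V) (CC * K) (dyad_lim (?z \<omega>))"
            using P[OF le _ mode_diff_time_0[OF R]] K by simp
          have "(SUP r\<in>{0..U}. Cnorm \<rho>m \<rho>0 \<theta> (\<lambda>\<phi>. proc (eta_eps \<zeta> \<epsilon>) r \<omega> \<phi> - proc eta r \<omega> \<phi>)) \<le> \<sigma>"
          proof (rule cSUP_least)
            fix r assume "r \<in> {0..U}"
            then have r: "0 \<le> r" "r \<le> real (Suc V)" using V by auto
            have "0 \<le> CC * K" using CC K by simp
            from proc_diff_bound[OF R g rg this r] show "Cnorm \<rho>m \<rho>0 \<theta> (\<lambda>\<phi>. proc (eta_eps \<zeta> \<epsilon>) r \<omega> \<phi> - proc eta r \<omega> \<phi>) \<le> \<sigma>"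
              unfolding K(2) .
          qed (use U in simp)
          then show False using s by simp
        qed
      qed
    qed
    also have "measure M ?T \<le> Q * (\<eta>^2) ^ m / x"
    proof -
      have "ennreal x * emeasure M ?T = (\<integral>\<^sup>+\<omega>. ennreal x * indicator ?T \<omega> \<partial>M)"
        by (rule nn_integral_cmult_indicator[OF T, symmetric])
      also have "\<dots> \<le> (\<integral>\<^sup>+\<omega>. chain_sum (Suc V) (?z \<omega>) \<partial>M)"
        by (intro nn_integral_mono) (auto simp: indicator_def)
      also have "\<dots> \<le> ennreal (Q * (\<eta>^2) ^ m)" by (rule Q[OF R \<eta> mb])
      finally have "ennreal (x * measure M ?T) \<le> ennreal (Q * (\<eta>^2) ^ m)"
        using x by (simp add: emeasure_eq_measure ennreal_mult)
      then have "x * measure M ?T \<le> Q * (\<eta>^2) ^ m" using Q0 by (subst (asm) ennreal_le_iff) auto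
      then show ?thesis using x by (simp add: pos_le_divide_eq mult.commute)
    qed
    finally show ?thesis .
  qed
  show ?thesis
  proof (rule tendstoI)
    fix e :: real assume e: "0 < e"
    \<comment> \<open>\<eta> \<le> 1 allows \<eta>^(2 m) \<le> \<eta>, and the second entry makes
      the resulting bound e / 2.\<close>
    define \<eta> where "\<eta> = min 1 (e * x / (2 * Q))"
    have \<eta>: "0 < \<eta>" "\<eta> \<le> 1" "\<eta> \<le> e * x / (2 * Q)" using e x Q0 by (auto simp: \<eta>_def)
    have "Q * (\<eta>^2) ^ m / x \<le> Q * \<eta> / x"
    proof -
      have "\<eta> ^ (2 * m) \<le> \<eta> ^ 1" using \<eta> m0 by (intro power_decreasing) auto
      then show ?thesis using x Q0 by (intro divide_right_mono mult_left_mono) (auto simp: power_mult)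
    qed
    also have "\<dots> \<le> Q * (e * x / (2 * Q)) / x" using x Q0 \<eta> by (intro divide_right_mono mult_left_mono) auto
    also have "\<dots> < e" using x Q0 e by simp
    finally have small: "Q * (\<eta>^2) ^ m / x < e" .
    show "eventually (\<lambda>\<epsilon>. dist (measure M (?S \<epsilon>)) 0 < e) (at_right 0)"
      using zeta_multiplier[OF \<zeta> \<beta>(1) \<eta>(1) n1]
    proof eventually_elim
      fix \<epsilon> assume "0 < \<epsilon> \<and> (\<forall>\<kappa>. \<bar>(\<Prod>m<n. \<zeta> (\<epsilon> *\<^sub>R \<kappa> m)) - (\<Prod>m<n. 1)\<bar> \<le> \<eta> * (\<Prod>m<n. bracket (\<kappa> m) powr \<beta>))"
      then have "measure M (?S \<epsilon>) \<le> Q * (\<eta>^2) ^ m / x" by (intro bound \<eta>(1)) auto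
      then show "dist (measure M (?S \<epsilon>)) 0 < e" using small by (simp add: dist_real_def)
    qed
  qed
qed

end

text \<open>Both chaos orders of the theorem are instances of this; the order n enters through the
  choice of \<beta> and m.\<close>

lemma wick_power_process:
  fixes M :: "'w measure"
  assumes "prob_space M" "isonormal M W" "wiener_integral M W n I" "1 \<le> n" "dyadic_partition \<rho>m \<rho>0" "cutoff \<zeta>" "\<theta> < 0"
  shows "\<exists>Xt Xe. cproc M \<rho>m \<rho>0 \<theta> Xt \<and>
     (\<forall>r\<ge>0. \<forall>\<phi>\<in>TestF. measure M {\<omega>\<in>space M. Xt r \<omega> \<phi> = I (kern n eta r \<phi>) \<omega>} = 1) \<and>
     (\<forall>\<epsilon>>0. cproc M \<rho>m \<rho>0 \<theta> (Xe \<epsilon>) \<and>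
        (\<forall>r\<ge>0. \<forall>\<phi>\<in>TestF. measure M {\<omega>\<in>space M. Xe \<epsilon> r \<omega> \<phi> = I (kern n (eta_eps \<zeta> \<epsilon>) r \<phi>) \<omega>} = 1)) \<and>
     (\<forall>U\<ge>0. \<forall>\<sigma>>0. ((\<lambda>\<epsilon>. measure M {\<omega>\<in>space M.
            (SUP r\<in>{0..U}. Cnorm \<rho>m \<rho>0 \<theta> (\<lambda>\<phi>. Xe \<epsilon> r \<omega> \<phi> - Xt r \<omega> \<phi>)) > \<sigma>}) \<longlongrightarrow> 0) (at_right 0))"
proof -
  \<comment> \<open>The first entry gives (2 n - 1) 6 \<beta> \<le> 4 and \<beta> \<le> 1, the
    second the condition on block growth.\<close>
  define \<beta> where "\<beta> = min (1 / (3 * real n)) (- \<theta> / 2 / (12 * real n))"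
  have n: "1 \<le> real n" using assms(4) by simp
  have "0 < - \<theta> / 2 / (12 * real n)" using n assms(7) by (intro divide_pos_pos) auto
  then have \<beta>: "0 < \<beta>" "\<beta> \<le> 1 / (3 * real n)" "\<beta> \<le> - \<theta> / 2 / (12 * real n)" using n assms(7) by (auto simp: \<beta>_def)
  have \<beta>1: "\<beta> * (3 * real n) \<le> 1" "\<beta> * (12 * real n) \<le> - \<theta> / 2"
    by (subst pos_le_divide_eq[symmetric]; use \<beta>(2,3) n in simp)+
  \<comment> \<open>Large enough for the time condition and for the grid condition; the successor
    makes m positive.\<close>
  define m where "m = Suc (nat \<lceil>max (4 / \<beta>) (21 / (- \<theta> / 2))\<rceil>)"
  have m: "4 / \<beta> \<le> real m" "21 / (- \<theta> / 2) \<le> real m" unfolding m_def by linarith+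
  have "wick_power M W n I \<rho>m \<rho>0 \<theta> \<beta> m"
  proof (intro wick_power.intro wiener_chaos.intro wiener_chaos_axioms.intro dyadic.intro wick_power_axioms.intro assms)
    show "0 < \<beta>" by (rule \<beta>(1))
    have "\<beta> * 3 \<le> \<beta> * (3 * real n)" using n \<beta>(1) by simp
    then show "\<beta> \<le> 1" using \<beta>1(1) by linarith
    show "(2 * real n - 1) * (6 * \<beta>) \<le> 4" using \<beta>1(1) \<beta>(1) by (simp add: algebra_simps)
    show "12 * real n * \<beta> \<le> - \<theta> / 2" using \<beta>1(2) by (simp add: mult_ac)
    show "0 < m" by (simp add: m_def)
    show "4 \<le> \<beta> * real m" using m(1) \<beta>(1) by (simp add: pos_divide_le_eq mult.commute)
    show "21 \<le> real m * (- \<theta> / 2)" using m(2) assms(7) by (subst (asm) pos_divide_le_eq) auto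
  qed
  then interpret wick_power M W n I \<rho>m \<rho>0 \<theta> \<beta> m .
  show ?thesis
    by (intro exI[of _ "proc eta"] exI[of _ "\<lambda>\<epsilon>. proc (eta_eps \<zeta> \<epsilon>)"] conjI allI impI ballI
      cproc_proc[OF fourier_symbol_eta] cproc_proc[OF fourier_symbol_eta_eps] proc_prob[OF fourier_symbol_eta] proc_prob[OF fourier_symbol_eta_eps] proc_converges assms(6)) auto
qed

theorem theorem2:
  fixes M :: "'w measure"
    and W :: "(real \<times> (real^4) \<Rightarrow> real) \<Rightarrow> 'w \<Rightarrow> real"
    and I2 I3 :: "((nat \<Rightarrow> real \<times> (real^4)) \<Rightarrow> real) \<Rightarrow> 'w \<Rightarrow> real"
    and \<rho>m \<rho>0 \<zeta> :: "real^4 \<Rightarrow> real"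
    and \<theta> :: real
  assumes "prob_space M" and "complete_measure M"
    and "isonormal M W"
    and "wiener_integral M W 2 I2" and "wiener_integral M W 3 I3"
    and "dyadic_partition \<rho>m \<rho>0" and "cutoff \<zeta>"
    and "\<theta> < 0"
  shows "\<exists>Yt Gt Ye Ge.
     cproc M \<rho>m \<rho>0 \<theta> Yt \<and> cproc M \<rho>m \<rho>0 \<theta> Gt \<and>
     (\<forall>r\<ge>0. \<forall>\<phi>\<in>TestF.
        measure M {\<omega>\<in>space M. Yt r \<omega> \<phi> = I2 (kern 2 eta r \<phi>) \<omega>} = 1 \<and>
        measure M {\<omega>\<in>space M. Gt r \<omega> \<phi> = I3 (kern 3 eta r \<phi>) \<omega>} = 1) \<and>
     (\<forall>\<epsilon>>0. cproc M \<rho>m \<rho>0 \<theta> (Ye \<epsilon>) \<and> cproc M \<rho>m \<rho>0 \<theta> (Ge \<epsilon>) \<and>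
        (\<forall>r\<ge>0. \<forall>\<phi>\<in>TestF.
          measure M {\<omega>\<in>space M. Ye \<epsilon> r \<omega> \<phi> = I2 (kern 2 (eta_eps \<zeta> \<epsilon>) r \<phi>) \<omega>} = 1 \<and>
          measure M {\<omega>\<in>space M. Ge \<epsilon> r \<omega> \<phi> = I3 (kern 3 (eta_eps \<zeta> \<epsilon>) r \<phi>) \<omega>} = 1)) \<and>
     (\<forall>U\<ge>0. \<forall>\<sigma>>0.
        ((\<lambda>\<epsilon>. measure M {\<omega>\<in>space M.
            (SUP r\<in>{0..U}. Cnorm \<rho>m \<rho>0 \<theta> (\<lambda>\<phi>. Ye \<epsilon> r \<omega> \<phi> - Yt r \<omega> \<phi>)) > \<sigma>}) \<longlongrightarrow> 0) (at_right 0) \<and>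
        ((\<lambda>\<epsilon>. measure M {\<omega>\<in>space M.
            (SUP r\<in>{0..U}. Cnorm \<rho>m \<rho>0 \<theta> (\<lambda>\<phi>. Ge \<epsilon> r \<omega> \<phi> - Gt r \<omega> \<phi>)) > \<sigma>}) \<longlongrightarrow> 0) (at_right 0))"
proof -
  obtain Yt Ye where Y: "cproc M \<rho>m \<rho>0 \<theta> Yt"
    "\<forall>r\<ge>0. \<forall>\<phi>\<in>TestF. measure M {\<omega>\<in>space M. Yt r \<omega> \<phi> = I2 (kern 2 eta r \<phi>) \<omega>} = 1"
    "\<forall>\<epsilon>>0. cproc M \<rho>m \<rho>0 \<theta> (Ye \<epsilon>) \<and>
        (\<forall>r\<ge>0. \<forall>\<phi>\<in>TestF. measure M {\<omega>\<in>space M. Ye \<epsilon> r \<omega> \<phi> = I2 (kern 2 (eta_eps \<zeta> \<epsilon>) r \<phi>) \<omega>} = 1)"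
    "\<forall>U\<ge>0. \<forall>\<sigma>>0. ((\<lambda>\<epsilon>. measure M {\<omega>\<in>space M.
            (SUP r\<in>{0..U}. Cnorm \<rho>m \<rho>0 \<theta> (\<lambda>\<phi>. Ye \<epsilon> r \<omega> \<phi> - Yt r \<omega> \<phi>)) > \<sigma>}) \<longlongrightarrow> 0) (at_right 0)"
    using wick_power_process[OF assms(1,3,4) one_le_numeral assms(6-8)] by (elim exE conjE) (rule that)
  obtain Gt Ge where G: "cproc M \<rho>m \<rho>0 \<theta> Gt"
    "\<forall>r\<ge>0. \<forall>\<phi>\<in>TestF. measure M {\<omega>\<in>space M. Gt r \<omega> \<phi> = I3 (kern 3 eta r \<phi>) \<omega>} = 1"
    "\<forall>\<epsilon>>0. cproc M \<rho>m \<rho>0 \<theta> (Ge \<epsilon>) \<and>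
        (\<forall>r\<ge>0. \<forall>\<phi>\<in>TestF. measure M {\<omega>\<in>space M. Ge \<epsilon> r \<omega> \<phi> = I3 (kern 3 (eta_eps \<zeta> \<epsilon>) r \<phi>) \<omega>} = 1)"
    "\<forall>U\<ge>0. \<forall>\<sigma>>0. ((\<lambda>\<epsilon>. measure M {\<omega>\<in>space M.
            (SUP r\<in>{0..U}. Cnorm \<rho>m \<rho>0 \<theta> (\<lambda>\<phi>. Ge \<epsilon> r \<omega> \<phi> - Gt r \<omega> \<phi>)) > \<sigma>}) \<longlongrightarrow> 0) (at_right 0)"
    using wick_power_process[OF assms(1,3,5) one_le_numeral assms(6-8)] by (elim exE conjE) (rule that)
  show ?thesis
    by (intro exI[of _ Yt] exI[of _ Gt] exI[of _ Ye] exI[of _ Ge] conjI allI impI ballI Y(1) G(1))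
      (simp_all add: Y(2-4)[rule_format] G(2-4)[rule_format])
qed

end
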